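(* Let $n\geq 2$ be an integer. For each $\sigma>0$ let $r_\sigma(x)=\sigma x$, $r_\sigma:(0,\infty)\to\mathbb{R}^+$. Then there exists a unique smooth solution $u_\sigma:[0,\infty)\to\mathbb{R}^+$ of $$u''(x)=\Big[\frac{xu'(x)-u(x)}{2}+\frac{n-1}{u(x)}\Big]\big(1+(u'(x))^2\big)\qquad(\ast)$$ which is asymptotic to $r_\sigma$ as $x\to+\infty$. Moreover, for every $d>0$, any solution $u:(d,\infty)\to\mathbb{R}^+$ of $(\ast)$ is either the constant $u\equiv\sqrt{2(n-1)}$ or coincides on $(d,\infty)$ with $u_\sigma$ for some $\sigma=\sigma(u)>0$. Furthermore, for every $\sigma>0$: (i) $u_\sigma(x)>\sigma x$ for $x>0$, and $u_\sigma(0)<\sqrt{2(n-1)}$; (ii) $|u_\sigma(x)-\sigma x|=O(1/x)$ and $|u_\sigma'(x)-\sigma|=O(1/x^2)$ as $x\to+\infty$; (iii) the hypersurface $\Sigma_\sigma\subseteq\mathbb{R}^{n+1}$ obtained by rotating the graph of $u_\sigma$ about the $x_1$-axis has mean curvature $H(\Sigma_\sigma)>0$; (iv) $u_\sigma$ is strictly convex and $0<u_\sigma'<\sigma$ on $[0,\infty)$; (v) the maximal solution curve $\gamma_\sigma$ of the system below containing the graph of $u_\sigma$ is not embedded.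
   Context: Equation $(\ast)$ is the self-shrinker equation $H=\tfrac12\langle \vec X,\vec\nu\rangle$ for the hypersurface of revolution in $\mathbb{R}^{n+1}$ generated by rotating the graph $r=u(x)$ around the $x_1$-axis; for such a graph the mean curvature (with the convention $\vec H=-H\vec\nu$ and $\vec\nu$ the normal for which the self-shrinker equation holds in this form) equals $H=\frac{u-xu'}{2\sqrt{1+(u')^2}}$. In the upper half-plane $H^+=\{(x,r):r>0\}$, a curve $\gamma(t)=(x(t),r(t))$ parametrized by Euclidean arc length with tangent angle $\theta(t)$ to the $x$-axis is called a solution (geodesic) if $\dot x=\cos\theta$, $\dot r=\sin\theta$, $\dot\theta=\frac{x}{2}\sin\theta+\big(\frac{n-1}{r}-\frac{r}{2}\big)\cos\theta$; graphs of solutions of $(\ast)$ are such curves. A curve is embedded if it has no self-intersections. *)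

theory Defs
  imports "HOL-Analysis.Analysis" "HOL-Library.Landau_Symbols"
begin

definition ode_sol :: "nat \<Rightarrow> real set \<Rightarrow> (real \<Rightarrow> real) \<Rightarrow> (real \<Rightarrow> real) \<Rightarrow> (real \<Rightarrow> real) \<Rightarrow> bool" where
  "ode_sol n I u u' u'' \<longleftrightarrow>
     (\<forall>x\<in>I. u x > 0 \<and>
        (u has_real_derivative u' x) (at x within I) \<and>
        (u' has_real_derivative u'' x) (at x within I) \<and>
        u'' x = ((x * u' x - u x) / 2 + (real n - 1) / u x) * (1 + (u' x)\<^sup>2))"

definition is_sol :: "nat \<Rightarrow> real set \<Rightarrow> (real \<Rightarrow> real) \<Rightarrow> bool" where
  "is_sol n I u \<longleftrightarrow> (\<exists>u' u''. ode_sol n I u u' u'')"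

definition smooth_on :: "real set \<Rightarrow> (real \<Rightarrow> real) \<Rightarrow> bool" where
  "smooth_on I u \<longleftrightarrow> (\<exists>D :: nat \<Rightarrow> real \<Rightarrow> real. D 0 = u \<and>
      (\<forall>k. \<forall>x\<in>I. (D k has_real_derivative D (Suc k) x) (at x within I)))"

definition strictly_convex_on :: "real set \<Rightarrow> (real \<Rightarrow> real) \<Rightarrow> bool" where
  "strictly_convex_on S f \<longleftrightarrow>
     (\<forall>x\<in>S. \<forall>y\<in>S. x \<noteq> y \<longrightarrow> (\<forall>t::real. 0 < t \<and> t < 1 \<longrightarrow>
        f ((1 - t) * x + t * y) < (1 - t) * f x + t * f y))"

text \<open>Mean curvature of the rotation hypersurface generated by the graph r = u(x),
  at the point over x, in the form given in the paper: H = (u - x u') / (2 sqrt(1 + u'^2)).\<close>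
definition rot_mean_curv :: "real \<Rightarrow> real \<Rightarrow> real \<Rightarrow> real" where
  "rot_mean_curv x ux dux = (ux - x * dux) / (2 * sqrt (1 + dux\<^sup>2))"

text \<open>Arc-length parametrised solution curves (geodesics) in the upper half plane:
  x' = cos th, r' = sin th, th' = (x/2) sin th + ((n-1)/r - r/2) cos th, on an open interval J.\<close>
definition geo_sol :: "nat \<Rightarrow> real set \<Rightarrow> (real \<Rightarrow> real) \<Rightarrow> (real \<Rightarrow> real) \<Rightarrow> (real \<Rightarrow> real) \<Rightarrow> bool" where
  "geo_sol n J x r th \<longleftrightarrow> open J \<and> is_interval J \<and> J \<noteq> {} \<and>
     (\<forall>t\<in>J. r t > 0 \<and>
        (x has_real_derivative cos (th t)) (at t) \<and>
        (r has_real_derivative sin (th t)) (at t) \<and>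
        (th has_real_derivative
            (x t / 2 * sin (th t) + ((real n - 1) / r t - r t / 2) * cos (th t))) (at t))"

definition max_geo_sol :: "nat \<Rightarrow> real set \<Rightarrow> (real \<Rightarrow> real) \<Rightarrow> (real \<Rightarrow> real) \<Rightarrow> (real \<Rightarrow> real) \<Rightarrow> bool" where
  "max_geo_sol n J x r th \<longleftrightarrow> geo_sol n J x r th \<and>
     (\<forall>J' x' r' th'. geo_sol n J' x' r' th' \<and> J \<subseteq> J' \<and>
        (\<forall>t\<in>J. x' t = x t \<and> r' t = r t \<and> th' t = th t) \<longrightarrow> J' = J)"

definition embedded_curve :: "real set \<Rightarrow> (real \<Rightarrow> real) \<Rightarrow> (real \<Rightarrow> real) \<Rightarrow> bool" where
  "embedded_curve J x r \<longleftrightarrow> inj_on (\<lambda>t. (x t, r t)) J"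

end

theory Submission
  imports Defs
begin

text \<open>
  The graphs are pieces of arc-length solution curves. Along the arc leaving a point with horizontal
  tangent and positive curvature \<open>kap\<close>, on the side \<open>x \<ge> 0\<close>, the quantity \<open>r * kap / cos (th)\<close> is
  nondecreasing, which forces a vertical tangent in finite time. A graph over \<open>(d, \<infinity>)\<close> therefore has
  no critical point unless it is the constant solution, and a continuation argument shows that it is
  increasing and strictly convex; then \<open>w = u - x u'\<close> decreases to \<open>0\<close>, \<open>u'\<close> increases to some \<open>\<sigma>\<close>,
  and the estimates for \<open>u - \<sigma> x\<close> and \<open>u' - \<sigma>\<close> follow by integration. Conversely, for given \<open>\<sigma>\<close> the
  pair \<open>(u - \<sigma> x, w)\<close> solves a linear system with a bounded Lipschitz perturbation near \<open>x = \<infinity>\<close>, and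
  a contraction there yields existence and uniqueness. Continued towards \<open>x < 0\<close>, this curve has a valley
  at some \<open>x < 0\<close>, reaches a vertical tangent and turns back above its own graph. Were it embedded, it would
  stay above the graph while \<open>sin (th) - u' cos (th)\<close> can only vanish decreasingly; the tangent angle would
  then be forced around until the curve is enclosed between the graph and its own returning arc.
\<close>

section \<open>Ordinary differential equations\<close>

text \<open>A graph may acquire infinite slope while the curve goes on, so the qualitative analysis
  is done in arc length, where only an approach to \<open>r = 0\<close> can stop a continuation; the
  singular field is truncated to a bounded Lipschitz one to make a global existence theorem
  applicable. Reversing \<open>t\<close>, reflecting \<open>x\<close> and turning the angle by a
  matching multiple of \<open>pi\<close> preserve the system, so each kind of arc is analysed once.
  In particular the self-intersection argument uses the mirror image of the curve: its end comes
  from \<open>x = - \<infinity>\<close>, the continuation runs forward in time, and the valley lies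
  at positive \<open>x\<close>. The upper bound for \<open>r * kap / cos (th)\<close> comes from its
  second form \<open>c - r * hh / (2 * cos (th))\<close>. At infinity the linear equation for
  \<open>w\<close> is unstable: exactly one solution stays bounded, so boundedness replaces an
  initial condition. Finally, the last statement about the curve only says that its image contains
  the graph as a set of points, so a point of common tangency has to be found before uniqueness can
  be used.\<close>

lemma first_hit:
  fixes f :: "real \<Rightarrow> real"
  assumes "a \<le> b" "continuous_on {a..b} f" "f a < v" "v \<le> f b"
  obtains t where "a < t" "t \<le> b" "f t = v" "\<And>s. a \<le> s \<Longrightarrow> s < t \<Longrightarrow> f s < v"
proof -
  define S where "S = {t\<in>{a..b}. f t = v}"
  have "S = {a..b} \<inter> f -` {v}" unfolding S_def by auto
  then have "closed S" using continuous_closed_preimage[OF assms(2), of "{v}"] by simp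
  moreover have "bdd_below S" unfolding S_def by (auto intro: bdd_belowI[of _ a])
  moreover have "S \<noteq> {}" using IVT'[of f a v b] assms unfolding S_def by force
  ultimately have S: "Inf S \<in> S" by (intro closed_contains_Inf)
  show ?thesis
  proof (rule that[of "Inf S"])
    show "a < Inf S" "Inf S \<le> b" "f (Inf S) = v" using S assms(3) unfolding S_def
      by (auto simp: less_le)
    fix s assume s: "a \<le> s" "s < Inf S"
    show "f s < v"
    proof (rule ccontr)
      assume "\<not> f s < v"
      then obtain t where t: "a \<le> t" "t \<le> s" "f t = v"
        using IVT'[of f a v s] assms s S continuous_on_subset[OF assms(2), of "{a..s}"]
        unfolding S_def by force
      then have "t \<in> S" using s S unfolding S_def by auto
      then have "Inf S \<le> t" using \<open>bdd_below S\<close> by (simp add: cInf_lower)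
      then show False using t s by simp
    qed
  qed
qed

text \<open>Gronwall with an integrating factor: \<open>y * exp (- G)\<close> is nondecreasing. Only
  the sign of \<open>y\<close> is transported later, so the factor stays an unspecified positive
  \<open>k\<close>.\<close>

lemma linear_growth:
  fixes y :: "real \<Rightarrow> real"
  assumes ab: "a \<le> b" and A: "continuous_on {a..b} A"
    and y: "\<And>t. a \<le> t \<Longrightarrow> t \<le> b \<Longrightarrow> (y has_real_derivative y' t) (at t)"
    and ge: "\<And>t. a \<le> t \<Longrightarrow> t \<le> b \<Longrightarrow> y' t \<ge> A t * y t"
  shows "\<exists>k>0. y b \<ge> k * y a"
proof -
  define G where "G t = integral {a..t} A" for t
  have "y a * exp (- G a) \<le> y b * exp (- G b)"
  proof (rule DERIV_nonneg_imp_increasing_open[OF ab])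
    have dG: "(G has_real_derivative A t) (at t within {a..b})" if "t \<in> {a..b}" for t
      unfolding G_def by (rule integral_has_real_derivative[OF A that])
    then have "continuous_on {a..b} G" by (meson DERIV_continuous_on)
    moreover have "continuous_on {a..b} y"
      by (meson DERIV_atLeastAtMost_imp_continuous_on y)
    ultimately show "continuous_on {a..b} (\<lambda>t. y t * exp (- G t))" by (intro continuous_intros)
    fix t assume t: "a < t" "t < b"
    have "(G has_real_derivative A t) (at t)"
      using dG[of t] t by (simp add: at_within_Icc_at)
    then have "((\<lambda>t. y t * exp (- G t)) has_real_derivative
        y' t * exp (- G t) + exp (- G t) * (- A t) * y t) (at t)"
      using y[of t] t by (auto intro!: derivative_eq_intros)
    moreover have "y' t * exp (- G t) + exp (- G t) * (- A t) * y t = exp (- G t) * (y' t - A t * y t)"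
      by (simp add: algebra_simps)
    moreover have "\<dots> \<ge> 0" using ge[of t] t by simp
    ultimately show "\<exists>z. ((\<lambda>t. y t * exp (- G t)) has_real_derivative z) (at t) \<and> 0 \<le> z"
      by metis
  qed
  then have "y a * exp (G b) \<le> y b" by (simp add: G_def exp_minus field_simps)
  then show ?thesis by (intro exI[of _ "exp (G b)"]) (simp add: mult.commute)
qed

text \<open>The squared distance times \<open>exp (- 2 * L * t)\<close> is nonincreasing. The
  Lipschitz bound is required only along the two solutions, so it can be supplied for a field that
  is merely locally Lipschitz.\<close>

lemma ode_unique_right:
  fixes y z :: "real \<Rightarrow> 'a::real_inner"
  assumes ab: "a \<le> b"
    and y: "\<And>t. a \<le> t \<Longrightarrow> t \<le> b \<Longrightarrow> (y has_vector_derivative y' t) (at t)"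
    and z: "\<And>t. a \<le> t \<Longrightarrow> t \<le> b \<Longrightarrow> (z has_vector_derivative z' t) (at t)"
    and lip: "\<And>t. a \<le> t \<Longrightarrow> t \<le> b \<Longrightarrow> norm (y' t - z' t) \<le> L * norm (y t - z t)"
    and eq: "y a = z a"
  shows "y b = z b"
proof -
  define E where "E t = (y t - z t) \<bullet> (y t - z t)" for t
  have dE: "(E has_real_derivative 2 * ((y t - z t) \<bullet> (y' t - z' t))) (at t)"
    if "a \<le> t" "t \<le> b" for t
  proof -
    have d: "((\<lambda>t. y t - z t) has_vector_derivative (y' t - z' t)) (at t)"
      using y z that by (intro derivative_intros) auto
    from has_derivative_inner[OF d[unfolded has_vector_derivative_def] d[unfolded has_vector_derivative_def]]
    show ?thesis unfolding E_def has_field_derivative_def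
      by (rule has_derivative_eq_rhs) (auto simp: inner_commute algebra_simps fun_eq_iff)
  qed
  have "E b * exp (- (2 * L) * b) \<le> E a * exp (- (2 * L) * a)"
  proof (rule DERIV_nonpos_imp_nonincreasing[OF ab])
    fix t assume t: "a \<le> t" "t \<le> b"
    have "((\<lambda>t. E t * exp (- (2 * L) * t)) has_real_derivative
       (2 * ((y t - z t) \<bullet> (y' t - z' t)) - 2 * L * E t) * exp (- (2 * L) * t)) (at t)"
      using dE[OF t] by (auto intro!: derivative_eq_intros simp: algebra_simps)
    moreover have "(y t - z t) \<bullet> (y' t - z' t) \<le> norm (y t - z t) * norm (y' t - z' t)"
      by (rule norm_cauchy_schwarz)
    then have "(y t - z t) \<bullet> (y' t - z' t) \<le> norm (y t - z t) * (L * norm (y t - z t))"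
      using mult_left_mono[OF lip[OF t], of "norm (y t - z t)"] by simp
    then have "(y t - z t) \<bullet> (y' t - z' t) \<le> L * E t"
      unfolding E_def by (simp add: power2_norm_eq_inner[symmetric] power2_eq_square algebra_simps)
    then have "(2 * ((y t - z t) \<bullet> (y' t - z' t)) - 2 * L * E t) * exp (- (2 * L) * t) \<le> 0"
      by (intro mult_nonpos_nonneg) auto
    ultimately show "\<exists>w. ((\<lambda>t. E t * exp (- (2 * L) * t)) has_real_derivative w) (at t) \<and> w \<le> 0"
      by blast
  qed
  moreover have "E a = 0" using eq by (simp add: E_def)
  ultimately have "E b * exp (- (2 * L) * b) \<le> 0" by simp
  then have "E b \<le> 0" by (simp add: mult_le_0_iff)
  then show ?thesis unfolding E_def by (metis eq_iff_diff_eq_0 inner_eq_zero_iff inner_ge_zero order_antisym)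
qed

lemma ode_unique_left:
  fixes y z :: "real \<Rightarrow> 'a::real_inner"
  assumes ab: "a \<le> b"
    and y: "\<And>t. a \<le> t \<Longrightarrow> t \<le> b \<Longrightarrow> (y has_vector_derivative y' t) (at t)"
    and z: "\<And>t. a \<le> t \<Longrightarrow> t \<le> b \<Longrightarrow> (z has_vector_derivative z' t) (at t)"
    and lip: "\<And>t. a \<le> t \<Longrightarrow> t \<le> b \<Longrightarrow> norm (y' t - z' t) \<le> L * norm (y t - z t)"
    and eq: "y b = z b"
  shows "y a = z a"
proof -
  have rev: "((\<lambda>t. f (- t)) has_vector_derivative - f' (- t)) (at t)"
    if "(f has_vector_derivative f' (- t)) (at (- t))" for f f' :: "real \<Rightarrow> 'a" and t
  proof -
    have "(uminus has_vector_derivative (-1::real)) (at t)"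
      by (auto intro!: derivative_eq_intros)
    from vector_diff_chain_at[OF this that] show ?thesis by (simp add: o_def)
  qed
  have "y (- (- a)) = z (- (- a))"
  proof (rule ode_unique_right[where a = "- b" and b = "- a" and y = "\<lambda>t. y (- t)"
        and z = "\<lambda>t. z (- t)" and y' = "\<lambda>t. - y' (- t)" and z' = "\<lambda>t. - z' (- t)" and L = L])
    fix t assume t: "- b \<le> t" "t \<le> - a"
    show "norm (- y' (- t) - - z' (- t)) \<le> L * norm (y (- t) - z (- t))"
      using lip[of "- t"] t by (simp add: norm_minus_commute)
  qed (use ab eq in \<open>auto intro!: rev y z\<close>)
  then show ?thesis by simp
qed

lemma antiderivative_UNIV:
  fixes g :: "real \<Rightarrow> 'a::euclidean_space"
  assumes g: "continuous_on UNIV g"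
  obtains G where "G 0 = 0" "\<And>t. (G has_vector_derivative g t) (at t)"
proof -
  let ?G = "\<lambda>t. integral {0..t} g - integral {t..0} g"
  have "(?G has_vector_derivative g t) (at t)" for t :: real
  proof -
  define K where "K = \<bar>t\<bar> + 1"
  have int: "g integrable_on {a..b}" for a b :: real
    by (intro integrable_continuous_real continuous_on_subset[OF g]) auto
  have eq: "?G s = integral {- K..s} g - integral {- K..0} g" if "s \<in> {- K<..<K}" for s
  proof (cases "s \<ge> 0")
    case True
    have "integral {- K..0} g + integral {0..s} g = integral {- K..s} g"
      using True that int by (intro Henstock_Kurzweil_Integration.integral_combine) (auto simp: K_def)
    moreover have "integral {s..0} g = 0" using True by (cases "s = 0") auto
    ultimately show ?thesis by (simp add: algebra_simps)
  next
    case False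
    have "integral {- K..s} g + integral {s..0} g = integral {- K..0} g"
      using False that int by (intro Henstock_Kurzweil_Integration.integral_combine) (auto simp: K_def)
    moreover have "integral {0..s} g = 0" using False by auto
    ultimately show ?thesis by (simp add: algebra_simps)
  qed
  have t: "t \<in> {- K<..<K}" by (auto simp: K_def)
  have "((\<lambda>s. integral {- K..s} g) has_vector_derivative g t) (at t within {- K..K})"
    using t by (intro integral_has_vector_derivative continuous_on_subset[OF g]) auto
  then have "((\<lambda>s. integral {- K..s} g) has_vector_derivative g t) (at t)"
    using t by (simp add: at_within_Icc_at)
  then have "((\<lambda>s. integral {- K..s} g - integral {- K..0} g) has_vector_derivative g t) (at t)"
    by (auto intro!: derivative_eq_intros)
  then show ?thesis
    by (rule has_vector_derivative_transform_within_open[where S = "{- K<..<K}"]) (use t eq in auto)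
  qed
  then show ?thesis by (intro that[of ?G]) auto
qed

text \<open>The weight \<open>exp (2 * L * \<bar>t\<bar>)\<close> turns the Picard operator into a contraction on the whole line.\<close>

lemma global_picard:
  fixes f :: "'a::euclidean_space \<Rightarrow> 'a"
  assumes B: "\<And>z. norm (f z) \<le> B" and L: "L > 0"
    and lip: "\<And>z z'. norm (f z - f z') \<le> L * norm (z - z')"
  obtains y where "y 0 = y0" "\<And>t. (y has_vector_derivative f (y t)) (at t)"
proof -
  define W where "W t = exp (2 * L * \<bar>t\<bar>)" for t
  \<comment> \<open>The bounded function \<open>v\<close> encodes the candidate
    \<open>y0 + W * v\<close>; a solution grows at most linearly, so dividing by the weight makes it
    bounded.\<close>
  define Y where "Y v t = y0 + W t *\<^sub>R apply_bcontfun v t" for v :: "real \<Rightarrow>\<^sub>C 'a" and t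
  have Wpos: "W t > 0" for t by (simp add: W_def)
  have contf: "continuous_on UNIV f"
  proof (rule lipschitz_on_continuous_on)
    show "L-lipschitz_on UNIV f" using lip L by (auto simp: lipschitz_on_def dist_norm)
  qed
  have contY: "continuous_on UNIV (Y v)" for v
    unfolding Y_def W_def by (intro continuous_intros) auto
  have contfY: "continuous_on UNIV (\<lambda>t. f (Y v t))" for v
    by (rule continuous_on_compose2[OF contf contY]) auto
  have "\<exists>G. G 0 = 0 \<and> (\<forall>t. (G has_vector_derivative f (Y v t)) (at t))" for v
    by (rule antiderivative_UNIV[OF contfY[of v]]) blast
  then have "\<exists>G. \<forall>v. G v 0 = 0 \<and> (\<forall>t. (G v has_vector_derivative f (Y v t)) (at t))"
    by metis
  then obtain G where G0: "\<And>v. G v 0 = 0"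
    and dG: "\<And>v t. (G v has_vector_derivative f (Y v t)) (at t)" by blast
  have contG: "continuous_on S (G v)" for v S
    by (meson continuous_at_imp_continuous_on dG has_vector_derivative_continuous)
  \<comment> \<open>Integrating the weight from \<open>0\<close> gains a factor
    \<open>1 / m\<close>; with \<open>m = 2 * L\<close> this yields both the bound on the image and
    the contraction constant \<open>1/2\<close>.\<close>
  have bound: "norm (H t) \<le> K * (exp (m * \<bar>t\<bar>) - 1)"
    if H: "H 0 = 0" "\<And>s. (H has_vector_derivative H' s) (at s)"
      "\<And>s. norm (H' s) \<le> K * m * exp (m * \<bar>s\<bar>)" for H H' :: "real \<Rightarrow> 'a" and t K m
  proof -
    have cH: "continuous_on S H" for S
      by (meson continuous_at_imp_continuous_on H(2) has_vector_derivative_continuous)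
    consider "t = 0" | "t > 0" | "t < 0" by linarith
    then show ?thesis
    proof cases
      case 1 then show ?thesis using H by simp
    next
      case 2
      have "norm (H t - H 0) \<le> K * exp (m * t) - K * exp (m * 0)"
      proof (intro differentiable_bound_general[OF 2 cH, where \<phi> = "\<lambda>s. K * exp (m * s)"
              and f' = "H'" and \<phi>' = "\<lambda>s. K * m * exp (m * s)"])
        fix s assume "0 < s" "s < t"
        then show "norm (H' s) \<le> K * m * exp (m * s)" using H(3)[of s] by simp
      qed (auto intro!: continuous_intros H(2) derivative_eq_intros
            simp: has_real_derivative_iff_has_vector_derivative[symmetric])
      then show ?thesis using 2 H by (simp add: algebra_simps)
    next
      case 3
      have "norm (H 0 - H t) \<le> - K * exp (- m * 0) - (- K * exp (- m * t))"
      proof (intro differentiable_bound_general[OF 3 cH, where \<phi> = "\<lambda>s. - K * exp (- m * s)"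
              and f' = "H'" and \<phi>' = "\<lambda>s. K * m * exp (- m * s)"])
        fix s assume "t < s" "s < 0"
        then show "norm (H' s) \<le> K * m * exp (- m * s)" using H(3)[of s] by simp
      qed (auto intro!: continuous_intros H(2) derivative_eq_intros
            simp: has_real_derivative_iff_has_vector_derivative[symmetric])
      then show ?thesis using 3 H by (simp add: algebra_simps)
    qed
  qed
  define T where "T v = Bcontfun (\<lambda>t. (1 / W t) *\<^sub>R G v t)" for v
  have Bpos: "B \<ge> 0" using B[of undefined] norm_ge_zero order_trans by blast
  have Tin: "(\<lambda>t. (1 / W t) *\<^sub>R G v t) \<in> bcontfun" for v
  proof (rule bcontfun_normI)
    show "continuous_on UNIV (\<lambda>t. (1 / W t) *\<^sub>R G v t)"
      unfolding W_def by (intro continuous_intros contG) auto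
    fix t
    have "norm (G v t) \<le> B / (2 * L) * (W t - 1)" unfolding W_def
    proof (rule bound[OF G0 dG])
      fix s
      have "norm (f (Y v s)) \<le> B" by (rule B)
      also have "\<dots> \<le> B * exp (2 * L * \<bar>s\<bar>)" using Bpos L by (simp add: mult_le_cancel_left1)
      finally show "norm (f (Y v s)) \<le> B / (2 * L) * (2 * L) * exp (2 * L * \<bar>s\<bar>)" using L by simp
    qed
    also have "\<dots> \<le> B / (2 * L) * W t" using Bpos L by (intro mult_left_mono) auto
    finally show "norm ((1 / W t) *\<^sub>R G v t) \<le> B / (2 * L)"
      using Wpos[of t] by (simp add: field_simps)
  qed
  have T: "apply_bcontfun (T v) t = (1 / W t) *\<^sub>R G v t" for v t
    unfolding T_def using Bcontfun_inverse[OF Tin] by simp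
  have "\<exists>!v\<in>UNIV. T v = v"
  proof (rule Banach_fix[where c = "1/2"])
    fix v w :: "real \<Rightarrow>\<^sub>C 'a"
    show "dist (T v) (T w) \<le> 1/2 * dist v w"
    proof (rule dist_bound)
      fix t
      have "norm (G v t - G w t) \<le> dist v w / 2 * (W t - 1)" unfolding W_def
      proof (rule bound[where H = "\<lambda>t. G v t - G w t"])
        fix s
        show "((\<lambda>t. G v t - G w t) has_vector_derivative f (Y v s) - f (Y w s)) (at s)"
          using dG by (intro derivative_intros)
        have "norm (f (Y v s) - f (Y w s)) \<le> L * norm (Y v s - Y w s)" by (rule lip)
        also have "Y v s - Y w s = W s *\<^sub>R (apply_bcontfun v s - apply_bcontfun w s)"
          by (simp add: Y_def algebra_simps)
        also have "norm \<dots> = W s * dist (apply_bcontfun v s) (apply_bcontfun w s)"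
          using Wpos[of s] by (simp add: dist_norm)
        also have "L * \<dots> \<le> L * (W s * dist v w)"
          using L Wpos[of s] dist_bounded[of v s w] by (intro mult_left_mono) auto
        finally show "norm (f (Y v s) - f (Y w s)) \<le> dist v w / 2 * (2 * L) * exp (2 * L * \<bar>s\<bar>)"
          by (simp add: W_def algebra_simps)
      qed (simp add: G0)
      also have "\<dots> \<le> dist v w / 2 * W t" by (intro mult_left_mono) auto
      finally have "norm ((1 / W t) *\<^sub>R (G v t - G w t)) \<le> dist v w / 2"
        using Wpos[of t] unfolding norm_scaleR by (simp add: field_simps)
      then show "dist (apply_bcontfun (T v) t) (apply_bcontfun (T w) t) \<le> 1/2 * dist v w"
        by (simp add: T dist_norm scaleR_diff_right)
    qed
  qed (auto simp: complete_UNIV)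
  then obtain v where v: "T v = v" by blast
  have "Y v t = y0 + G v t" for t
  proof -
    have "apply_bcontfun v t = (1 / W t) *\<^sub>R G v t" using T[of v t] v by simp
    then show ?thesis using Wpos[of t] by (simp add: Y_def)
  qed
  then have Yeq: "Y v = (\<lambda>t. y0 + G v t)" by auto
  show ?thesis
  proof (rule that[of "Y v"])
    show "Y v 0 = y0" by (simp add: Yeq G0)
    show "(Y v has_vector_derivative f (Y v t)) (at t)" for t
      using dG[of v t] unfolding Yeq by (auto intro!: derivative_eq_intros)
  qed
qed

section \<open>Solution curves in the half-plane\<close>

definition curv :: "real \<Rightarrow> real \<Rightarrow> real \<Rightarrow> real \<Rightarrow> real" where
  "curv c x r \<theta> = x / 2 * sin \<theta> + (c / r - r / 2) * cos \<theta>"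

text \<open>Boundedness is carried along because products of Lipschitz functions are Lipschitz only
  when the factors are bounded. With sums, products and reciprocals available, compound fields are
  handled term by term.\<close>

definition bdd_lip :: "('a::real_normed_vector \<Rightarrow> real) \<Rightarrow> bool" where
  "bdd_lip f \<longleftrightarrow> (\<exists>B L. \<forall>z z'. \<bar>f z\<bar> \<le> B \<and> \<bar>f z - f z'\<bar> \<le> L * norm (z - z'))"

lemma bdd_lipI: "(\<And>z. \<bar>f z\<bar> \<le> B) \<Longrightarrow> (\<And>z z'. \<bar>f z - f z'\<bar> \<le> L * norm (z - z')) \<Longrightarrow> bdd_lip f"
  unfolding bdd_lip_def by blast

lemma bdd_lipE:
  assumes "bdd_lip f"
  obtains B L where "B > 0" "L > 0" "\<And>z. \<bar>f z\<bar> \<le> B" "\<And>z z'. \<bar>f z - f z'\<bar> \<le> L * norm (z - z')"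
proof -
  obtain B L where BL: "\<bar>f z\<bar> \<le> B" "\<bar>f z - f z'\<bar> \<le> L * norm (z - z')" for z z'
    using assms unfolding bdd_lip_def by blast
  show ?thesis
  proof (rule that[of "\<bar>B\<bar> + 1" "\<bar>L\<bar> + 1"])
    fix z z'
    show "\<bar>f z\<bar> \<le> \<bar>B\<bar> + 1" using BL(1)[of z] by linarith
    have "L * norm (z - z') \<le> (\<bar>L\<bar> + 1) * norm (z - z')" by (intro mult_right_mono) auto
    then show "\<bar>f z - f z'\<bar> \<le> (\<bar>L\<bar> + 1) * norm (z - z')" using BL(2)[of z z'] by linarith
  qed auto
qed

lemma bdd_lip_add: assumes "bdd_lip f" "bdd_lip g" shows "bdd_lip (\<lambda>z. f z + g z)"
proof -
  obtain B L where f: "\<And>z. \<bar>f z\<bar> \<le> B" "\<And>z z'. \<bar>f z - f z'\<bar> \<le> L * norm (z - z')"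
    using bdd_lipE[OF assms(1)] by metis
  obtain C M where g: "\<And>z. \<bar>g z\<bar> \<le> C" "\<And>z z'. \<bar>g z - g z'\<bar> \<le> M * norm (z - z')"
    using bdd_lipE[OF assms(2)] by metis
  show ?thesis
  proof (rule bdd_lipI[of _ "B + C" "L + M"])
    fix z z'
    show "\<bar>f z + g z\<bar> \<le> B + C" using f(1)[of z] g(1)[of z] by linarith
    show "\<bar>f z + g z - (f z' + g z')\<bar> \<le> (L + M) * norm (z - z')"
      using f(2)[of z z'] g(2)[of z z'] unfolding distrib_right by linarith
  qed
qed

lemma bdd_lip_mult: assumes "bdd_lip f" "bdd_lip g" shows "bdd_lip (\<lambda>z. f z * g z)"
proof -
  obtain B L where f: "B > 0" "\<And>z. \<bar>f z\<bar> \<le> B" "\<And>z z'. \<bar>f z - f z'\<bar> \<le> L * norm (z - z')"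
    using bdd_lipE[OF assms(1)] by metis
  obtain C M where g: "C > 0" "\<And>z. \<bar>g z\<bar> \<le> C" "\<And>z z'. \<bar>g z - g z'\<bar> \<le> M * norm (z - z')"
    using bdd_lipE[OF assms(2)] by metis
  show ?thesis
  proof (rule bdd_lipI[of _ "B * C" "L * C + B * M"])
    fix z z'
    show "\<bar>f z * g z\<bar> \<le> B * C" unfolding abs_mult using f g by (intro mult_mono) (auto intro: less_imp_le)
    have "f z * g z - f z' * g z' = (f z - f z') * g z + f z' * (g z - g z')" by (simp add: algebra_simps)
    also have "\<bar>\<dots>\<bar> \<le> \<bar>f z - f z'\<bar> * \<bar>g z\<bar> + \<bar>f z'\<bar> * \<bar>g z - g z'\<bar>"
      by (metis abs_mult abs_triangle_ineq)
    also have "\<dots> \<le> (L * norm (z - z')) * C + B * (M * norm (z - z'))"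
    proof (intro add_mono mult_mono)
      show "0 \<le> L * norm (z - z')" using f(3)[of z z'] abs_ge_zero order_trans by blast
    qed (use f g in \<open>auto intro: less_imp_le\<close>)
    finally show "\<bar>f z * g z - f z' * g z'\<bar> \<le> (L * C + B * M) * norm (z - z')"
      by (simp add: algebra_simps)
  qed
qed

lemma bdd_lip_const: "bdd_lip (\<lambda>z. k)"
  by (rule bdd_lipI[of _ "\<bar>k\<bar>" 0]) auto

lemma bdd_lip_Pair:
  assumes "bdd_lip f" "bdd_lip g" "bdd_lip h"
  obtains B L where "L > 0" "\<And>z. norm (f z, g z, h z) \<le> B"
    "\<And>z z'. norm ((f z, g z, h z) - (f z', g z', h z')) \<le> L * norm (z - z')"
proof -
  obtain B1 L1 where f: "L1 > 0" "\<And>z. \<bar>f z\<bar> \<le> B1" "\<And>z z'. \<bar>f z - f z'\<bar> \<le> L1 * norm (z - z')"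
    using bdd_lipE[OF assms(1)] by metis
  obtain B2 L2 where g: "L2 > 0" "\<And>z. \<bar>g z\<bar> \<le> B2" "\<And>z z'. \<bar>g z - g z'\<bar> \<le> L2 * norm (z - z')"
    using bdd_lipE[OF assms(2)] by metis
  obtain B3 L3 where h: "L3 > 0" "\<And>z. \<bar>h z\<bar> \<le> B3" "\<And>z z'. \<bar>h z - h z'\<bar> \<le> L3 * norm (z - z')"
    using bdd_lipE[OF assms(3)] by metis
  have n3: "norm (a, b, d) \<le> \<bar>a\<bar> + \<bar>b\<bar> + \<bar>d\<bar>" for a b d :: real
    using norm_Pair_le[of a "(b, d)"] norm_Pair_le[of b d] by simp
  show ?thesis
  proof (rule that[of "L1 + L2 + L3" "B1 + B2 + B3"])
    fix z z'
    show "norm (f z, g z, h z) \<le> B1 + B2 + B3"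
      using n3[of "f z" "g z" "h z"] f(2)[of z] g(2)[of z] h(2)[of z] by linarith
    show "norm ((f z, g z, h z) - (f z', g z', h z')) \<le> (L1 + L2 + L3) * norm (z - z')"
      using n3[of "f z - f z'" "g z - g z'" "h z - h z'"] f(3)[of z z'] g(3)[of z z'] h(3)[of z z']
      unfolding distrib_right by simp
  qed (use f g h in auto)
qed

definition clamp_to :: "real \<Rightarrow> real \<Rightarrow> real \<Rightarrow> real" where
  "clamp_to a b v = max a (min b v)"

text \<open>The field of the curve system with \<open>x\<close> clamped to \<open>[- M, M]\<close>
  and \<open>r\<close> to \<open>[1/M, M]\<close>: bounded, globally Lipschitz, and unchanged inside
  that box. It is written with factors such as \<open>1/2\<close> and \<open>-1/2\<close> to match
  the closure rules for \<open>bdd_lip\<close>.\<close>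

definition geo_field :: "real \<Rightarrow> real \<Rightarrow> real \<times> real \<times> real \<Rightarrow> real \<times> real \<times> real" where
  "geo_field c M z = (cos (snd (snd z)), sin (snd (snd z)),
     clamp_to (- M) M (fst z) * (1/2) * sin (snd (snd z)) +
     (c * (1 / clamp_to (1/M) M (fst (snd z))) + clamp_to (1/M) M (fst (snd z)) * (-1/2)) * cos (snd (snd z)))"

lemma abs_fst_le: "\<bar>fst z\<bar> \<le> norm z" for z :: "real \<times> 'a::real_normed_vector"
  by (metis norm_fst_le prod.collapse real_norm_def)

lemma norm_snd_le': "norm (snd z) \<le> norm z"
  by (metis norm_snd_le prod.collapse)

lemma abs_sin_diff_le: "\<bar>sin a - sin b\<bar> \<le> \<bar>a - b\<bar>" for a b :: real
proof -
  have "norm (sin a - sin b) \<le> 1 * norm (a - b)"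
    by (rule field_differentiable_bound[of UNIV sin cos]) (auto intro!: derivative_eq_intros)
  then show ?thesis by simp
qed

lemma abs_cos_diff_le: "\<bar>cos a - cos b\<bar> \<le> \<bar>a - b\<bar>" for a b :: real
proof -
  have "norm (cos a - cos b) \<le> 1 * norm (a - b)"
    by (rule field_differentiable_bound[of UNIV cos "\<lambda>x. - sin x"]) (auto intro!: derivative_eq_intros)
  then show ?thesis by simp
qed

lemma geo_field_bounds:
  assumes M: "M > 1"
  obtains B L where "L > 0" "\<And>z. norm (geo_field c M z) \<le> B"
    "\<And>z z'. norm (geo_field c M z - geo_field c M z') \<le> L * norm (z - z')"
proof -
  have n1: "\<bar>fst z - fst z'\<bar> \<le> norm (z - z')" for z z' :: "real \<times> real \<times> real"
    using abs_fst_le[of "z - z'"] by simp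
  have n2: "\<bar>fst (snd z) - fst (snd z')\<bar> \<le> norm (z - z')" for z z' :: "real \<times> real \<times> real"
    using abs_fst_le[of "snd (z - z')"] norm_snd_le'[of "z - z'"] by simp
  have n3: "\<bar>snd (snd z) - snd (snd z')\<bar> \<le> norm (z - z')" for z z' :: "real \<times> real \<times> real"
    using norm_snd_le'[of "snd (z - z')"] norm_snd_le'[of "z - z'"] by simp
  have s: "bdd_lip (\<lambda>z::real \<times> real \<times> real. sin (snd (snd z)))"
    by (rule bdd_lipI[of _ 1 1]) (simp, metis order_trans[OF abs_sin_diff_le n3] mult_1)
  have co: "bdd_lip (\<lambda>z::real \<times> real \<times> real. cos (snd (snd z)))"
    by (rule bdd_lipI[of _ 1 1]) (simp, metis order_trans[OF abs_cos_diff_le n3] mult_1)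
  have cl: "\<bar>clamp_to a b v - clamp_to a b w\<bar> \<le> \<bar>v - w\<bar>" for a b v w
    unfolding clamp_to_def by linarith
  have x: "bdd_lip (\<lambda>z::real \<times> real \<times> real. clamp_to (- M) M (fst z))"
  proof (intro bdd_lipI[of _ M 1])
    show "\<bar>clamp_to (- M) M (fst z) - clamp_to (- M) M (fst z')\<bar> \<le> 1 * norm (z - z')"
      for z z' :: "real \<times> real \<times> real"
      using cl[of "-M" M "fst z" "fst z'"] n1[of z z'] by linarith
  qed (use M in \<open>auto simp: clamp_to_def\<close>)
  have rr: "bdd_lip (\<lambda>z::real \<times> real \<times> real. clamp_to (1/M) M (fst (snd z)))"
  proof (intro bdd_lipI[of _ M 1])
    show "\<bar>clamp_to (1/M) M (fst (snd z)) - clamp_to (1/M) M (fst (snd z'))\<bar> \<le> 1 * norm (z - z')"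
      for z z' :: "real \<times> real \<times> real"
      using cl[of "1/M" M "fst (snd z)" "fst (snd z')"] n2[of z z'] by linarith
    have "1 / M < 1" "0 < 1 / M" using M by auto
    then show "\<bar>clamp_to (1 / M) M (fst (snd z))\<bar> \<le> M" for z :: "real \<times> real \<times> real"
      using M unfolding clamp_to_def by linarith
  qed
  have ge: "clamp_to (1/M) M v \<ge> 1 / M" for v by (simp add: clamp_to_def)
  have Mp: "1 / M > 0" using M by simp
  have ir: "bdd_lip (\<lambda>z::real \<times> real \<times> real. 1 / clamp_to (1/M) M (fst (snd z)))"
  proof (intro bdd_lipI[of _ M "M * M"])
    fix z z' :: "real \<times> real \<times> real"
    have inv: "0 < 1 / clamp_to (1/M) M v \<and> 1 / clamp_to (1/M) M v \<le> M" for v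
    proof -
      have "0 < clamp_to (1/M) M v" using ge[of v] Mp by linarith
      moreover have "1 \<le> clamp_to (1/M) M v * M" using ge[of v] M by (simp add: field_simps)
      ultimately show ?thesis by (simp add: field_simps)
    qed
    show "\<bar>1 / clamp_to (1/M) M (fst (snd z))\<bar> \<le> M" using inv[of "fst (snd z)"] by linarith
    let ?a = "clamp_to (1/M) M (fst (snd z))" and ?b = "clamp_to (1/M) M (fst (snd z'))"
    have pos: "?a > 0" "?b > 0" using ge Mp by (meson less_le_trans)+
    have "1 / ?a - 1 / ?b = (1 / ?a) * (1 / ?b) * (?b - ?a)" using pos by (simp add: field_simps)
    also have "\<bar>\<dots>\<bar> = (1 / ?a) * (1 / ?b) * \<bar>?b - ?a\<bar>"
      using pos by (simp add: abs_mult)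
    also have "\<dots> \<le> (M * M) * norm (z - z')"
    proof (rule mult_mono)
      show "1 / ?a * (1 / ?b) \<le> M * M"
        using inv[of "fst (snd z)"] inv[of "fst (snd z')"] M by (intro mult_mono) auto
      show "\<bar>?b - ?a\<bar> \<le> norm (z - z')"
        using cl[of "1/M" M "fst (snd z)" "fst (snd z')"] n2[of z z'] by linarith
    qed (use M in auto)
    finally show "\<bar>1 / ?a - 1 / ?b\<bar> \<le> (M * M) * norm (z - z')" .
  qed
  show ?thesis
    by (rule bdd_lip_Pair[OF co s bdd_lip_add[OF bdd_lip_mult[OF bdd_lip_mult[OF x bdd_lip_const[of "1/2"]] s]
            bdd_lip_mult[OF bdd_lip_add[OF bdd_lip_mult[OF bdd_lip_const[of c] ir]
              bdd_lip_mult[OF rr bdd_lip_const[of "-1/2"]]] co]]])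
      (rule that, simp_all add: geo_field_def)
qed

lemma geo_field_eq:
  assumes "\<bar>x\<bar> \<le> M" "1/M \<le> r" "r \<le> M"
  shows "geo_field c M (x, r, \<theta>) = (cos \<theta>, sin \<theta>, curv c x r \<theta>)"
proof -
  have "clamp_to (-M) M x = x" "clamp_to (1/M) M r = r" using assms by (auto simp: clamp_to_def)
  then show ?thesis by (simp add: geo_field_def curv_def)
qed

section \<open>Existence, uniqueness, maximal curves and their symmetries\<close>

context
  fixes n :: nat
begin

abbreviation (input) "cc \<equiv> real n - 1"

lemma geo_solD:
  assumes "geo_sol n J x r th"
  shows "open J" "is_interval J" "t \<in> J \<Longrightarrow> r t > 0"
    "t \<in> J \<Longrightarrow> (x has_real_derivative cos (th t)) (at t)"
    "t \<in> J \<Longrightarrow> (r has_real_derivative sin (th t)) (at t)"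
    "t \<in> J \<Longrightarrow> (th has_real_derivative curv cc (x t) (r t) (th t)) (at t)"
  using assms unfolding geo_sol_def curv_def by auto

lemma geo_sol_cont:
  assumes "geo_sol n J x r th" "S \<subseteq> J"
  shows "continuous_on S x" "continuous_on S r" "continuous_on S th"
  using geo_solD[OF assms(1)] assms(2)
  by (meson DERIV_continuous continuous_at_imp_continuous_on subsetD)+

lemma interval_Icc: "is_interval (J::real set) \<Longrightarrow> a \<in> J \<Longrightarrow> b \<in> J \<Longrightarrow> {a..b} \<subseteq> J"
  unfolding is_interval_1 by (meson atLeastAtMost_iff subsetI)

lemma geo_sol_vec:
  assumes "geo_sol n J x r th" "t \<in> J"
  shows "((\<lambda>t. (x t, r t, th t)) has_vector_derivative (cos (th t), sin (th t), curv cc (x t) (r t) (th t))) (at t)"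
  using geo_solD(4-6)[OF assms(1) assms(2)]
  by (intro has_vector_derivative_Pair) (auto simp: has_real_derivative_iff_has_vector_derivative)

lemma vec_geo:
  assumes "(y has_vector_derivative (a, b, d)) (at t)"
  shows "((\<lambda>t. fst (y t)) has_real_derivative a) (at t)"
    "((\<lambda>t. fst (snd (y t))) has_real_derivative b) (at t)"
    "((\<lambda>t. snd (snd (y t))) has_real_derivative d) (at t)"
proof -
  have 1: "((\<lambda>t. snd (y t)) has_vector_derivative (b, d)) (at t)"
    using bounded_linear.has_vector_derivative[OF bounded_linear_snd assms] by simp
  show "((\<lambda>t. fst (y t)) has_real_derivative a) (at t)"
    using bounded_linear.has_vector_derivative[OF bounded_linear_fst assms]
    by (simp add: has_real_derivative_iff_has_vector_derivative)
  show "((\<lambda>t. fst (snd (y t))) has_real_derivative b) (at t)"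
    using bounded_linear.has_vector_derivative[OF bounded_linear_fst 1]
    by (simp add: has_real_derivative_iff_has_vector_derivative)
  show "((\<lambda>t. snd (snd (y t))) has_real_derivative d) (at t)"
    using bounded_linear.has_vector_derivative[OF bounded_linear_snd 1]
    by (simp add: has_real_derivative_iff_has_vector_derivative)
qed

lemma field_solution:
  assumes "M > 1"
  obtains y where "y t0 = y0" "\<And>t. (y has_vector_derivative geo_field cc M (y t)) (at t)"
proof -
  obtain B L where "L > 0" "\<And>z. norm (geo_field cc M z) \<le> B"
    "\<And>z z'. norm (geo_field cc M z - geo_field cc M z') \<le> L * norm (z - z')"
    using geo_field_bounds[OF assms] by metis
  then obtain y where y: "y 0 = y0" "\<And>t. (y has_vector_derivative geo_field cc M (y t)) (at t)"
    using global_picard[of "geo_field cc M" B L y0] by metis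
  have "((\<lambda>t. y (t - t0)) has_vector_derivative geo_field cc M (y (t - t0))) (at t)" for t
  proof -
    have "((\<lambda>t. t - t0) has_vector_derivative 1) (at t)" by (auto intro!: derivative_eq_intros)
    from vector_diff_chain_at[OF this y(2)] show ?thesis by (simp add: o_def)
  qed
  then show ?thesis using y(1) by (intro that[of "\<lambda>t. y (t - t0)"]) auto
qed

lemma field_unique:
  assumes M: "M > 1" and eq: "y t0 = z t0"
    and y: "\<And>s. s \<in> {a..b} \<Longrightarrow> (y has_vector_derivative geo_field cc M (y s)) (at s)"
    and z: "\<And>s. s \<in> {a..b} \<Longrightarrow> (z has_vector_derivative geo_field cc M (z s)) (at s)"
    and t0: "t0 \<in> {a..b}" and t: "t \<in> {a..b}"
  shows "y t = z t"
proof -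
  obtain B L where L: "\<And>z z'. norm (geo_field cc M z - geo_field cc M z') \<le> L * norm (z - z')"
    using geo_field_bounds[OF M] by metis
  show ?thesis
  proof (cases "t0 \<le> t")
    case True
    show ?thesis by (rule ode_unique_right[OF True y z L eq]) (use t t0 in auto)
  next
    case False
    then have "t \<le> t0" by simp
    then show ?thesis by (rule ode_unique_left[OF _ y z L eq]) (use t t0 in auto)
  qed
qed

text \<open>On a compact time interval \<open>x\<close>, \<open>r\<close> and \<open>1 / r\<close>
  are bounded by continuity, so the truncation is inactive once \<open>M\<close> is large. Every
  larger \<open>M\<close> works too, which lets two curves share one truncated field.\<close>

lemma field_of_geo:
  assumes g: "geo_sol n J x r th" and ab: "{a..b} \<subseteq> J"
  shows "\<exists>M0>1. \<forall>M\<ge>M0. \<forall>s\<in>{a..b}.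
    ((\<lambda>t. (x t, r t, th t)) has_vector_derivative geo_field cc M (x s, r s, th s)) (at s)"
proof -
  have "bounded (x ` {a..b})"
    by (intro compact_imp_bounded compact_continuous_image geo_sol_cont[OF g ab]) auto
  then obtain X where "\<forall>s\<in>{a..b}. \<bar>x s\<bar> \<le> X" by (auto simp: bounded_iff)
  then have X: "\<bar>x s\<bar> \<le> X" if "s \<in> {a..b}" for s using that by blast
  have "bounded (r ` {a..b})"
    by (intro compact_imp_bounded compact_continuous_image geo_sol_cont[OF g ab]) auto
  then obtain R where "\<forall>s\<in>{a..b}. \<bar>r s\<bar> \<le> R" by (auto simp: bounded_iff)
  then have R: "\<bar>r s\<bar> \<le> R" if "s \<in> {a..b}" for s using that by blast
  have nz: "r s > 0" if "s \<in> {a..b}" for s using geo_solD(3)[OF g] ab that by auto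
  have "bounded ((\<lambda>s. 1 / r s) ` {a..b})"
  proof (intro compact_imp_bounded compact_continuous_image continuous_intros geo_sol_cont[OF g ab] ballI)
    show "r s \<noteq> 0" if "s \<in> {a..b}" for s using nz[OF that] by simp
  qed auto
  then obtain Q where "\<forall>s\<in>{a..b}. \<bar>1 / r s\<bar> \<le> Q" by (auto simp: bounded_iff)
  then have Q: "\<bar>1 / r s\<bar> \<le> Q" if "s \<in> {a..b}" for s using that by blast
  show ?thesis
  proof (intro exI[of _ "max 2 (max X (max R Q))"] conjI allI impI ballI)
    fix M s assume M: "M \<ge> max 2 (max X (max R Q))" and s: "s \<in> {a..b}"
    have "Q \<le> M" using M by simp
    then have "1 / r s \<le> M" using Q[OF s] by (meson abs_ge_self order_trans)
    then have "1 / M \<le> r s" using nz[OF s] M by (simp add: field_simps)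
    then have "geo_field cc M (x s, r s, th s) = (cos (th s), sin (th s), curv cc (x s) (r s) (th s))"
      using X[OF s] R[OF s] M by (intro geo_field_eq) auto
    then show "((\<lambda>t. (x t, r t, th t)) has_vector_derivative geo_field cc M (x s, r s, th s)) (at s)"
      using geo_sol_vec[OF g, of s] ab s by auto
  qed auto
qed

lemma geo_unique:
  assumes g: "geo_sol n J x r th" and h: "geo_sol n K y q ph"
    and t0: "t0 \<in> J" "t0 \<in> K" and eq: "x t0 = y t0" "r t0 = q t0" "th t0 = ph t0"
    and t: "t \<in> J" "t \<in> K"
  shows "x t = y t \<and> r t = q t \<and> th t = ph t"
proof -
  define a b where "a = min t0 t" and "b = max t0 t"
  have ab: "{a..b} \<subseteq> J" "{a..b} \<subseteq> K"
    unfolding a_def b_def using geo_solD(2)[OF g] geo_solD(2)[OF h] t0 t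
    by (auto simp: min_def max_def dest: interval_Icc)
  obtain M1 where M1: "M1 > 1" "\<And>M s. M \<ge> M1 \<Longrightarrow> s \<in> {a..b} \<Longrightarrow>
    ((\<lambda>t. (x t, r t, th t)) has_vector_derivative geo_field cc M (x s, r s, th s)) (at s)"
    using field_of_geo[OF g ab(1)] by blast
  obtain M2 where M2: "M2 > 1" "\<And>M s. M \<ge> M2 \<Longrightarrow> s \<in> {a..b} \<Longrightarrow>
    ((\<lambda>t. (y t, q t, ph t)) has_vector_derivative geo_field cc M (y s, q s, ph s)) (at s)"
    using field_of_geo[OF h ab(2)] by blast
  have "(\<lambda>t. (x t, r t, th t)) t = (\<lambda>t. (y t, q t, ph t)) t"
  proof (rule field_unique[of "max M1 M2" "\<lambda>t. (x t, r t, th t)" t0 "\<lambda>t. (y t, q t, ph t)" a b])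
    show "t0 \<in> {a..b}" "t \<in> {a..b}" by (auto simp: a_def b_def)
  qed (use M1 M2 eq in auto)
  then show ?thesis by simp
qed

lemma geo_sol_of_field:
  assumes y: "\<And>t. (y has_vector_derivative geo_field cc M (y t)) (at t)" and M: "M > 0"
    and b: "\<bar>fst (y b)\<bar> < M" "1/M < fst (snd (y b))" "fst (snd (y b)) < M"
  obtains e where "e > 0" "geo_sol n {b - e<..<b + e} (\<lambda>t. fst (y t)) (\<lambda>t. fst (snd (y t))) (\<lambda>t. snd (snd (y t)))"
proof -
  let ?U = "{t. \<bar>fst (y t)\<bar> < M \<and> 1/M < fst (snd (y t)) \<and> fst (snd (y t)) < M}"
  have c: "continuous_on UNIV y"
    by (meson y continuous_at_imp_continuous_on has_vector_derivative_continuous)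
  have "open ?U"
    by (intro open_Collect_conj open_Collect_less continuous_intros c)
  then obtain e where e: "e > 0" "ball b e \<subseteq> ?U" using b by (force simp: open_contains_ball)
  show ?thesis
  proof (rule that[OF e(1)])
    show "geo_sol n {b - e<..<b + e} (\<lambda>t. fst (y t)) (\<lambda>t. fst (snd (y t))) (\<lambda>t. snd (snd (y t)))"
      unfolding geo_sol_def
    proof (intro conjI ballI)
      show "{b - e<..<b + e} \<noteq> {}" using e by simp
      fix t assume "t \<in> {b - e<..<b + e}"
      then have "t \<in> ball b e" by (auto simp: dist_real_def)
      then have t: "\<bar>fst (y t)\<bar> < M" "1/M < fst (snd (y t))" "fst (snd (y t)) < M" using e by auto
      then show "fst (snd (y t)) > 0" using M by (meson less_trans zero_less_divide_1_iff)
      have "geo_field cc M (y t) = (cos (snd (snd (y t))), sin (snd (snd (y t))),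
          curv cc (fst (y t)) (fst (snd (y t))) (snd (snd (y t))))"
        using geo_field_eq[of "fst (y t)" M "fst (snd (y t))" cc "snd (snd (y t))"] t by simp
      note v = y[of t, unfolded this]
      show "((\<lambda>t. fst (y t)) has_real_derivative cos (snd (snd (y t)))) (at t)"
        "((\<lambda>t. fst (snd (y t))) has_real_derivative sin (snd (snd (y t)))) (at t)"
        using vec_geo[OF v] by auto
      show "((\<lambda>t. snd (snd (y t))) has_real_derivative
         (fst (y t) / 2 * sin (snd (snd (y t))) + (cc / fst (snd (y t)) - fst (snd (y t)) / 2) *
           cos (snd (snd (y t))))) (at t)"
        using vec_geo(3)[OF v] unfolding curv_def by simp
    qed (auto simp: is_interval_def)
  qed
qed

lemma geo_local:
  assumes "r0 > 0"
  obtains e x r th where "e > 0" "geo_sol n {t0 - e<..<t0 + e} x r th" "x t0 = x0" "r t0 = r0" "th t0 = th0"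
proof -
  define M where "M = 2 + \<bar>x0\<bar> + r0 + 1 / r0"
  have "1 / r0 > 0" using assms by simp
  then have M: "M > 1" "\<bar>x0\<bar> < M" "r0 < M" "1 / r0 < M" using assms unfolding M_def by linarith+
  then have "1 / M < r0" using assms by (simp add: field_simps)
  obtain y where y: "y t0 = (x0, r0, th0)" "\<And>t. (y has_vector_derivative geo_field cc M (y t)) (at t)"
    using field_solution[OF M(1), of t0 "(x0, r0, th0)"] by metis
  obtain e where "e > 0" "geo_sol n {t0 - e<..<t0 + e} (\<lambda>t. fst (y t)) (\<lambda>t. fst (snd (y t))) (\<lambda>t. snd (snd (y t)))"
    by (rule geo_sol_of_field[OF y(2)]) (use y(1) M \<open>1 / M < r0\<close> in auto)
  then show ?thesis by (rule that) (use y(1) in auto)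
qed

lemma geo_glue:
  assumes g: "geo_sol n J x r th" and h: "geo_sol n K y q ph"
    and t0: "t0 \<in> J" "t0 \<in> K" and eq: "x t0 = y t0" "r t0 = q t0" "th t0 = ph t0"
  shows "geo_sol n (J \<union> K) (\<lambda>t. if t \<in> J then x t else y t) (\<lambda>t. if t \<in> J then r t else q t)
    (\<lambda>t. if t \<in> J then th t else ph t)"
proof -
  note u = geo_unique[OF g h t0 eq]
  let ?x = "\<lambda>t. if t \<in> J then x t else y t" and ?r = "\<lambda>t. if t \<in> J then r t else q t"
    and ?th = "\<lambda>t. if t \<in> J then th t else ph t"
  have d: "((\<lambda>t. if t \<in> J then a t else b t) has_real_derivative D) (at t)"
    if "(t \<in> J \<and> (a has_real_derivative D) (at t)) \<or> (t \<in> K \<and> (b has_real_derivative D) (at t))"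
      "\<And>s. s \<in> J \<Longrightarrow> s \<in> K \<Longrightarrow> a s = b s" for a b :: "real \<Rightarrow> real" and D t
    using that(1)
  proof
    assume "t \<in> J \<and> (a has_real_derivative D) (at t)"
    then have *: "t \<in> J" "(a has_real_derivative D) (at t)" by auto
    have ev: "eventually (\<lambda>s. (if s \<in> J then a s else b s) = a s) (nhds t)"
      using eventually_nhds_in_open[OF geo_solD(1)[OF g] *(1)] by (auto elim!: eventually_mono)
    show ?thesis by (rule DERIV_cong_ev[THEN iffD2, OF refl ev refl]) (use * in auto)
  next
    assume *: "t \<in> K \<and> (b has_real_derivative D) (at t)"
    have ev: "eventually (\<lambda>s. (if s \<in> J then a s else b s) = b s) (nhds t)"
      using eventually_nhds_in_open[OF geo_solD(1)[OF h], of t] * that(2)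
      by (auto elim!: eventually_mono)
    show ?thesis by (rule DERIV_cong_ev[THEN iffD2, OF refl ev refl]) (use * in auto)
  qed
  show ?thesis unfolding geo_sol_def
  proof (intro conjI ballI)
    show "open (J \<union> K)" using geo_solD(1)[OF g] geo_solD(1)[OF h] by auto
    have "connected (J \<union> K)"
      using geo_solD(2)[OF g] geo_solD(2)[OF h] t0 by (intro connected_Un) (auto simp: is_interval_connected_1)
    then show "is_interval (J \<union> K)" by (simp add: is_interval_connected_1)
    show "J \<union> K \<noteq> {}" using t0 by auto
    fix t assume t: "t \<in> J \<union> K"
    show "?r t > 0" using geo_solD(3)[OF g, of t] geo_solD(3)[OF h, of t] t by auto
    show "(?x has_real_derivative cos (?th t)) (at t)"
      using geo_solD(4)[OF g, of t] geo_solD(4)[OF h, of t] t u by (intro d) auto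
    show "(?r has_real_derivative sin (?th t)) (at t)"
      using geo_solD(5)[OF g, of t] geo_solD(5)[OF h, of t] t u by (intro d) auto
    show "(?th has_real_derivative ?x t / 2 * sin (?th t) + (cc / ?r t - ?r t / 2) * cos (?th t)) (at t)"
      using geo_solD(6)[OF g, of t] geo_solD(6)[OF h, of t] t u unfolding curv_def by (intro d) auto
  qed
qed

text \<open>Gluing would produce an extension of the maximal curve, so its domain must already
  contain \<open>K\<close>. This is the form in which maximality is used: agreement at one instant
  suffices.\<close>

lemma max_geo_contains:
  assumes g: "max_geo_sol n J x r th" and h: "geo_sol n K y q ph"
    and t0: "t0 \<in> J" "t0 \<in> K" and eq: "x t0 = y t0" "r t0 = q t0" "th t0 = ph t0"
  shows "K \<subseteq> J"
proof -
  have g': "geo_sol n J x r th" using g by (simp add: max_geo_sol_def)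
  have *: "geo_sol n J' x' r' th' \<Longrightarrow> J \<subseteq> J' \<Longrightarrow> (\<And>t. t\<in>J \<Longrightarrow> x' t = x t \<and> r' t = r t \<and> th' t = th t)
      \<Longrightarrow> J' = J" for J' x' r' th'
    using g unfolding max_geo_sol_def by blast
  have "J \<union> K = J" using geo_glue[OF g' h t0 eq] by (rule *) auto
  then show ?thesis by auto
qed

text \<open>Uniqueness makes all solutions with the same initial data compatible, so the union of
  their domains carries a solution; \<open>Y\<close> picks the common value.\<close>

lemma max_geo_exists:
  assumes "r0 > 0"
  obtains J x r th where "max_geo_sol n J x r th" "t0 \<in> J" "x t0 = x0" "r t0 = r0" "th t0 = th0"
proof -
  define P where "P K y q ph \<longleftrightarrow> geo_sol n K y q ph \<and> t0 \<in> K \<and> y t0 = x0 \<and> q t0 = r0 \<and> ph t0 = th0" for K y q ph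
  define J where "J = \<Union>{K. \<exists>y q ph. P K y q ph}"
  define Y where "Y t = (SOME z. \<exists>K y q ph. P K y q ph \<and> t \<in> K \<and> z = (y t, q t, ph t))" for t
  have Y: "Y t = (y t, q t, ph t)" if "P K y q ph" "t \<in> K" for K y q ph t
  proof -
    have "\<exists>K y q ph. P K y q ph \<and> t \<in> K \<and> Y t = (y t, q t, ph t)"
      unfolding Y_def by (rule someI_ex) (use that in blast)
    then obtain K' y' q' ph' where *: "P K' y' q' ph'" "t \<in> K'" "Y t = (y' t, q' t, ph' t)" by blast
    have "y' t = y t \<and> q' t = q t \<and> ph' t = ph t"
      using * that unfolding P_def by (intro geo_unique[where J = K' and K = K and ?t0.0 = t0]) auto
    then show ?thesis using * by simp
  qed
  let ?x = "\<lambda>t. fst (Y t)" and ?r = "\<lambda>t. fst (snd (Y t))" and ?th = "\<lambda>t. snd (snd (Y t))"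
  obtain e x r th where l: "e > 0" "geo_sol n {t0 - e<..<t0 + e} x r th" "x t0 = x0" "r t0 = r0" "th t0 = th0"
    using geo_local[OF assms] by metis
  have lP: "P {t0 - e<..<t0 + e} x r th" using l by (auto simp: P_def)
  have t0: "t0 \<in> J" unfolding J_def using lP l(1) by (intro UnionI[of "{t0 - e<..<t0 + e}"]) auto
  have g: "geo_sol n J ?x ?r ?th" unfolding geo_sol_def
  proof (intro conjI ballI)
    show "open J" unfolding J_def P_def by (auto dest: geo_solD(1))
    have "connected J" unfolding J_def
      by (rule connected_Union) (auto simp: P_def is_interval_connected_1[symmetric] dest: geo_solD(2))
    then show "is_interval J" by (simp add: is_interval_connected_1)
    show "J \<noteq> {}" using t0 by auto
    fix t assume "t \<in> J"
    then obtain K y q ph where K: "P K y q ph" "t \<in> K" unfolding J_def by blast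
    have gK: "geo_sol n K y q ph" using K by (simp add: P_def)
    have ev: "eventually (\<lambda>s. s \<in> K) (nhds t)"
      using geo_solD(1)[OF gK] K by (intro eventually_nhds_in_open)
    note Yt = Y[OF K]
    show "?r t > 0" using geo_solD(3)[OF gK K(2)] by (simp add: Yt)
    have "(?x has_real_derivative cos (ph t)) (at t)"
      using ev Y[OF K(1)] by (intro DERIV_cong_ev[THEN iffD2, OF refl _ refl geo_solD(4)[OF gK K(2)]]) (auto elim!: eventually_mono)
    then show "(?x has_real_derivative cos (?th t)) (at t)" by (simp add: Yt)
    have "(?r has_real_derivative sin (ph t)) (at t)"
      using ev Y[OF K(1)] by (intro DERIV_cong_ev[THEN iffD2, OF refl _ refl geo_solD(5)[OF gK K(2)]]) (auto elim!: eventually_mono)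
    then show "(?r has_real_derivative sin (?th t)) (at t)" by (simp add: Yt)
    have "(?th has_real_derivative curv cc (y t) (q t) (ph t)) (at t)"
      using ev Y[OF K(1)] by (intro DERIV_cong_ev[THEN iffD2, OF refl _ refl geo_solD(6)[OF gK K(2)]]) (auto elim!: eventually_mono)
    then show "(?th has_real_derivative ?x t / 2 * sin (?th t) + (cc / ?r t - ?r t / 2) * cos (?th t)) (at t)"
      by (simp add: Yt curv_def)
  qed
  have in0: "?x t0 = x0" "?r t0 = r0" "?th t0 = th0"
    using Y[OF lP, of t0] l by auto
  have "max_geo_sol n J ?x ?r ?th" unfolding max_geo_sol_def
  proof (intro conjI allI impI g)
    fix J' x' r' th'
    assume *: "geo_sol n J' x' r' th' \<and> J \<subseteq> J' \<and> (\<forall>t\<in>J. x' t = ?x t \<and> r' t = ?r t \<and> th' t = ?th t)"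
    then have "P J' x' r' th'" using t0 in0 by (auto simp: P_def)
    then have "J' \<subseteq> J" unfolding J_def by blast
    then show "J' = J" using * by auto
  qed
  then show ?thesis using t0 in0 by (rule that)
qed

text \<open>Unit speed keeps \<open>x\<close> and \<open>r\<close> bounded in finite time, and the
  angle enters the field only through \<open>sin\<close> and \<open>cos\<close>. So approaching the
  axis \<open>r = 0\<close> is the only way in which a curve can end.\<close>

lemma max_geo_forward:
  assumes m: "max_geo_sol n J x r th" and t0: "t0 \<in> J"
    and lb: "\<And>T. \<exists>e>0. \<forall>t\<in>J. t0 \<le> t \<longrightarrow> t \<le> T \<longrightarrow> r t \<ge> e"
  shows "{t0..} \<subseteq> J"
proof (rule ccontr)
  assume neg: "\<not> {t0..} \<subseteq> J"
  have g: "geo_sol n J x r th" using m by (simp add: max_geo_sol_def)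
  obtain T where T: "T \<ge> t0" "T \<notin> J" using neg by auto
  have up: "t < T" if "t \<in> J" for t
    using interval_Icc[OF geo_solD(2)[OF g] t0 that] T by (force simp: not_less)
  then have bd: "bdd_above J" by (meson bdd_aboveI less_imp_le)
  define b where "b = Sup J"
  have bJ: "b \<notin> J"
  proof
    assume "b \<in> J"
    then obtain e where "e > 0" "ball b e \<subseteq> J" using geo_solD(1)[OF g] by (meson open_contains_ball)
    then have "b + e / 2 \<in> J" by (auto simp: dist_real_def)
    then have "b + e / 2 \<le> b" unfolding b_def using bd by (rule cSup_upper)
    then show False using \<open>e > 0\<close> by simp
  qed
  have tb: "t0 < b" using cSup_upper[OF t0 bd] bJ t0 by (force simp: b_def less_le)
  have inJ: "t \<in> J" if tb': "t0 \<le> t" "t < b" for t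
  proof -
    obtain s where "s \<in> J" "t < s" using less_cSupE[of t J] tb' t0 unfolding b_def by blast
    then show ?thesis using interval_Icc[OF geo_solD(2)[OF g] t0, of s] tb' by auto
  qed
  obtain e where e: "e > 0" "\<And>t. t \<in> J \<Longrightarrow> t0 \<le> t \<Longrightarrow> t \<le> b \<Longrightarrow> r t \<ge> e" using lb[of b] by blast
  \<comment> \<open>Strictly exceeds all values of \<open>r\<close>, \<open>1 / r\<close> and the
    modulus of \<open>x\<close> before time \<open>b\<close>. So the truncated solution
    \<open>y\<close> coincides with the curve up to \<open>b\<close> and is still a genuine solution
    shortly after it.\<close>
  define M where "M = 2 + \<bar>x t0\<bar> + r t0 + (b - t0) + 1 / e"
  have rp: "r t0 > 0" using geo_solD(3)[OF g t0] .
  have e1: "1 / e > 0" using e by simp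
  have M: "M > 1" using e1 rp tb unfolding M_def by linarith
  have xb: "\<bar>x t\<bar> \<le> \<bar>x t0\<bar> + (b - t0)" and rb: "r t \<le> r t0 + (b - t0)"
    if t: "t0 \<le> t" "t < b" for t
  proof -
    have sub: "{t0..t} \<subseteq> J" using inJ t by auto
    have "norm (x t - x t0) \<le> 1 * norm (t - t0)"
    proof (rule field_differentiable_bound[of "{t0..t}" x "\<lambda>s. cos (th s)"])
      show "(x has_field_derivative cos (th s)) (at s within {t0..t})" if "s \<in> {t0..t}" for s
        using geo_solD(4)[OF g] sub that has_field_derivative_at_within by blast
    qed (use t in auto)
    then show "\<bar>x t\<bar> \<le> \<bar>x t0\<bar> + (b - t0)" using t by auto
    have "norm (r t - r t0) \<le> 1 * norm (t - t0)"
    proof (rule field_differentiable_bound[of "{t0..t}" r "\<lambda>s. sin (th s)"])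
      show "(r has_field_derivative sin (th s)) (at s within {t0..t})" if "s \<in> {t0..t}" for s
        using geo_solD(5)[OF g] sub that has_field_derivative_at_within by blast
    qed (use t in auto)
    then show "r t \<le> r t0 + (b - t0)" using t by auto
  qed
  obtain y where y: "y t0 = (x t0, r t0, th t0)" "\<And>t. (y has_vector_derivative geo_field cc M (y t)) (at t)"
    using field_solution[OF M, of t0 "(x t0, r t0, th t0)"] by metis
  have ye: "y t = (x t, r t, th t)" if t: "t0 \<le> t" "t < b" for t
  proof -
    have "y t = (\<lambda>t. (x t, r t, th t)) t"
    proof (rule field_unique[where M = M and y = y and z = "\<lambda>t. (x t, r t, th t)" and ?t0.0 = t0 and a = t0 and b = t])
      show "M > 1" by (rule M)
      show "y t0 = (x t0, r t0, th t0)" by (rule y(1))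
      show "(y has_vector_derivative geo_field cc M (y s)) (at s)" for s by (rule y(2))
      show "t0 \<in> {t0..t}" "t \<in> {t0..t}" using t by auto
      fix s assume s: "s \<in> {t0..t}"
      then have sJ: "s \<in> J" "s < b" "t0 \<le> s" using inJ t by auto
      have "1 / r s \<le> 1 / e" using e(1) e(2)[OF sJ(1)] sJ by (intro divide_left_mono) auto
      also have "\<dots> \<le> M" using rp tb unfolding M_def by linarith
      finally have "1 / M \<le> r s" using geo_solD(3)[OF g sJ(1)] M by (simp add: field_simps)
      moreover have "\<bar>x s\<bar> \<le> M" "r s \<le> M"
        using xb[OF sJ(3,2)] rb[OF sJ(3,2)] e1 rp tb unfolding M_def by linarith+
      ultimately have "geo_field cc M (x s, r s, th s) = (cos (th s), sin (th s), curv cc (x s) (r s) (th s))"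
        by (intro geo_field_eq) auto
      then show "((\<lambda>t. (x t, r t, th t)) has_vector_derivative geo_field cc M (x s, r s, th s)) (at s)"
        using geo_sol_vec[OF g sJ(1)] by simp
    qed
    then show ?thesis by simp
  qed
  have cont: "continuous (at_left b) y"
    using y(2) has_vector_derivative_continuous continuous_at_imp_continuous_at_within by blast
  have ev: "eventually (\<lambda>t. t0 \<le> t \<and> t < b) (at_left b)"
    using tb by (auto simp: eventually_at_left intro!: exI[of _ t0])
  have tx: "((\<lambda>t. \<bar>fst (y t)\<bar>) \<longlongrightarrow> \<bar>fst (y b)\<bar>) (at_left b)"
    and tr: "((\<lambda>t. fst (snd (y t))) \<longlongrightarrow> fst (snd (y b))) (at_left b)"
    using cont unfolding continuous_within by (auto intro!: tendsto_intros)
  have 1: "\<bar>fst (y b)\<bar> \<le> \<bar>x t0\<bar> + (b - t0)"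
    by (rule tendsto_upperbound[OF tx]) (use ev xb ye in \<open>auto elim!: eventually_mono\<close>)
  have 2: "fst (snd (y b)) \<le> r t0 + (b - t0)"
    by (rule tendsto_upperbound[OF tr]) (use ev rb ye in \<open>auto elim!: eventually_mono\<close>)
  have 3: "fst (snd (y b)) \<ge> e"
    by (rule tendsto_lowerbound[OF tr]) (use ev e(2) inJ ye in \<open>auto elim!: eventually_mono\<close>)
  have "1 / e < M" using rp tb unfolding M_def by linarith
  then have "1 / M < e" using e(1) M by (simp add: field_simps)
  obtain d where d: "d > 0" "geo_sol n {b - d<..<b + d} (\<lambda>t. fst (y t)) (\<lambda>t. fst (snd (y t))) (\<lambda>t. snd (snd (y t)))"
  proof (rule geo_sol_of_field[OF y(2), of b])
    show "\<bar>fst (y b)\<bar> < M" using 1 rp e1 unfolding M_def by linarith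
    show "1/M < fst (snd (y b))" using 3 \<open>1 / M < e\<close> by simp
    show "fst (snd (y b)) < M" using 2 e1 unfolding M_def by linarith
  qed (use M in auto)
  define s where "s = max t0 (b - d / 2)"
  have s: "t0 \<le> s" "s < b" "s \<in> {b - d<..<b + d}" using tb d(1) by (auto simp: s_def)
  have "{b - d<..<b + d} \<subseteq> J"
    by (rule max_geo_contains[OF m d(2), of s]) (use s inJ ye[of s] in auto)
  moreover have "b \<in> {b - d<..<b + d}" using d(1) by simp
  ultimately show False using bJ by blast
qed

text \<open>\<open>s\<close> reverses time and \<open>e\<close> reflects \<open>x\<close>. The
  offset \<open>ph\<close>, a multiple of \<open>pi\<close>, keeps the angle consistent with the
  velocity: \<open>e * s * cos (th)\<close> has to equal \<open>cos (e * th + ph)\<close>.\<close>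

lemma geo_transform:
  assumes g: "geo_sol n J x r th" and s: "s = 1 \<or> s = (-1::real)" and e: "e = 1 \<or> e = (-1::real)"
    and ph: "cos ph = e * s" "sin ph = 0"
  shows "geo_sol n {t. s * t + a \<in> J} (\<lambda>t. e * x (s * t + a)) (\<lambda>t. r (s * t + a)) (\<lambda>t. e * th (s * t + a) + ph)"
proof -
  have J: "open J" "is_interval J" "J \<noteq> {}" using g unfolding geo_sol_def by auto
  let ?K = "{t. s * t + a \<in> J}"
  have sn: "s \<noteq> 0" using s by auto
  have Keq: "?K = (\<lambda>t. s * t + a) -` J" by auto
  show ?thesis unfolding geo_sol_def
  proof (intro conjI ballI)
    show "open ?K" unfolding Keq by (intro open_vimage J continuous_intros)
    show "is_interval ?K" unfolding is_interval_1
    proof (intro allI impI ballI)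
      fix p q t assume "p \<in> ?K" "q \<in> ?K" and t: "p \<le> t \<and> t \<le> q"
      then have "s * p + a \<in> J" "s * q + a \<in> J" by auto
      then have "{min (s * p + a) (s * q + a)..max (s * p + a) (s * q + a)} \<subseteq> J"
        by (intro interval_Icc[OF J(2)]) (auto simp: min_def max_def)
      moreover have "s * t + a \<in> {min (s * p + a) (s * q + a)..max (s * p + a) (s * q + a)}"
        using s t by auto
      ultimately show "t \<in> ?K" by auto
    qed
    obtain j where "j \<in> J" using J by auto
    then have "(j - a) / s \<in> ?K" using sn by simp
    then show "?K \<noteq> {}" by blast
    fix t assume t: "t \<in> ?K"
    let ?u = "s * t + a"
    have u: "?u \<in> J" using t by simp
    have lin: "((\<lambda>t. s * t + a) has_real_derivative s) (at t)" by (auto intro!: derivative_eq_intros)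
    show "r ?u > 0" using geo_solD(3)[OF g u] .
    have cs: "cos (e * th ?u + ph) = e * s * cos (th ?u)" "sin (e * th ?u + ph) = s * sin (th ?u)"
      using e s ph by (auto simp: cos_add sin_add)
    have dx: "((\<lambda>t. e * x (s * t + a)) has_real_derivative e * (cos (th ?u) * s)) (at t)"
      by (intro DERIV_cmult DERIV_chain2[OF geo_solD(4)[OF g u] lin])
    then show "((\<lambda>t. e * x (s * t + a)) has_real_derivative cos (e * th ?u + ph)) (at t)"
      unfolding cs by (simp add: mult_ac)
    have "((\<lambda>t. r (s * t + a)) has_real_derivative (sin (th ?u) * s)) (at t)"
      by (intro DERIV_chain2[OF geo_solD(5)[OF g u] lin])
    then show "((\<lambda>t. r (s * t + a)) has_real_derivative sin (e * th ?u + ph)) (at t)"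
      unfolding cs by (simp add: mult_ac)
    have "((\<lambda>t. e * th (s * t + a) + ph) has_real_derivative e * (curv cc (x ?u) (r ?u) (th ?u) * s) + 0) (at t)"
      by (intro DERIV_add DERIV_const DERIV_cmult DERIV_chain2[OF geo_solD(6)[OF g u] lin])
    moreover have "e * (curv cc (x ?u) (r ?u) (th ?u) * s) + 0 =
       e * x ?u / 2 * sin (e * th ?u + ph) + (cc / r ?u - r ?u / 2) * cos (e * th ?u + ph)"
      unfolding cs curv_def by (simp add: algebra_simps)
    ultimately show "((\<lambda>t. e * th (s * t + a) + ph) has_real_derivative
       e * x ?u / 2 * sin (e * th ?u + ph) + (cc / r ?u - r ?u / 2) * cos (e * th ?u + ph)) (at t)" by simp
  qed
qed

lemma max_geo_transform:
  assumes m: "max_geo_sol n J x r th" and s: "s = 1 \<or> s = (-1::real)" and e: "e = 1 \<or> e = (-1::real)"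
    and ph: "cos ph = e * s" "sin ph = 0"
  shows "max_geo_sol n {t. s * t + a \<in> J} (\<lambda>t. e * x (s * t + a)) (\<lambda>t. r (s * t + a)) (\<lambda>t. e * th (s * t + a) + ph)"
  unfolding max_geo_sol_def
proof (intro conjI allI impI)
  have g: "geo_sol n J x r th" using m by (simp add: max_geo_sol_def)
  show "geo_sol n {t. s * t + a \<in> J} (\<lambda>t. e * x (s * t + a)) (\<lambda>t. r (s * t + a)) (\<lambda>t. e * th (s * t + a) + ph)"
    by (rule geo_transform[OF g s e ph])
  fix K y q p
  assume *: "geo_sol n K y q p \<and> {t. s * t + a \<in> J} \<subseteq> K \<and>
     (\<forall>t\<in>{t. s * t + a \<in> J}. y t = e * x (s * t + a) \<and> q t = r (s * t + a) \<and> p t = e * th (s * t + a) + ph)"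
  have ss: "s * s = 1" "e * e = 1" using s e by auto
  have ph': "cos (- e * ph) = e * s" "sin (- e * ph) = 0" using e ph by auto
  have inv: "s * (s * t + - s * a) + a = t" for t using ss by (simp add: algebra_simps mult.assoc[symmetric])
  \<comment> \<open>The inverse symmetry is of the same kind, with shift \<open>- s * a\<close> and
    offset \<open>- e * ph\<close>; it carries the competing extension back to the original
    curve.\<close>
  have k: "geo_sol n {t. s * t + - s * a \<in> K} (\<lambda>t. e * y (s * t + - s * a)) (\<lambda>t. q (s * t + - s * a))
     (\<lambda>t. e * p (s * t + - s * a) + - e * ph)"
    by (rule geo_transform[OF _ s e ph']) (use * in auto)
  obtain t0 where t0: "t0 \<in> J" using g unfolding geo_sol_def by auto
  then have t0': "s * t0 + - s * a \<in> {t. s * t + a \<in> J}" using inv[of t0] by simp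
  then have vals: "y (s * t0 + - s * a) = e * x t0" "q (s * t0 + - s * a) = r t0" "p (s * t0 + - s * a) = e * th t0 + ph"
    using * inv[of t0] by (metis (no_types, lifting))+
  have "{t. s * t + - s * a \<in> K} \<subseteq> J"
  proof (rule max_geo_contains[OF m k t0])
    show "t0 \<in> {t. s * t + - s * a \<in> K}" using * t0' by auto
    show "x t0 = e * y (s * t0 + - s * a)" "r t0 = q (s * t0 + - s * a)"
      "th t0 = e * p (s * t0 + - s * a) + - e * ph"
      unfolding vals using ss by (auto simp: algebra_simps mult.assoc[symmetric])
  qed
  then have "K \<subseteq> {t. s * t + a \<in> J}"
  proof -
    assume sub: "{t. s * t + - s * a \<in> K} \<subseteq> J"
    show ?thesis
    proof
      fix t assume "t \<in> K"
      moreover have "s * (s * t + a) + - s * a = t" using ss by (simp add: algebra_simps mult.assoc[symmetric])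
      ultimately show "t \<in> {t. s * t + a \<in> J}" using sub by auto
    qed
  qed
  then show "K = {t. s * t + a \<in> J}" using * by auto
qed

end

lemma deriv_lower:
  fixes f :: "real \<Rightarrow> real"
  assumes "a \<le> b" "\<And>t. a \<le> t \<Longrightarrow> t \<le> b \<Longrightarrow> (f has_real_derivative f' t) (at t)"
    "\<And>t. a \<le> t \<Longrightarrow> t \<le> b \<Longrightarrow> f' t \<ge> e"
  shows "f b \<ge> f a + e * (b - a)"
proof -
  have "f a - e * a \<le> f b - e * b"
  proof (rule DERIV_nonneg_imp_nondecreasing[OF assms(1)])
    fix t assume t: "a \<le> t" "t \<le> b"
    have "((\<lambda>t. f t - e * t) has_real_derivative f' t - e) (at t)"
      using assms(2)[OF t] by (auto intro!: derivative_eq_intros)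
    then show "\<exists>y. ((\<lambda>t. f t - e * t) has_real_derivative y) (at t) \<and> y \<ge> 0"
      using assms(3)[OF t] by (intro exI[of _ "f' t - e"]) auto
  qed
  then show ?thesis by (simp add: algebra_simps)
qed

lemma deriv_upper:
  fixes f :: "real \<Rightarrow> real"
  assumes "a \<le> b" "\<And>t. a \<le> t \<Longrightarrow> t \<le> b \<Longrightarrow> (f has_real_derivative f' t) (at t)"
    "\<And>t. a \<le> t \<Longrightarrow> t \<le> b \<Longrightarrow> f' t \<le> e"
  shows "f b \<le> f a + e * (b - a)"
proof -
  have "- f b \<ge> - f a + (- e) * (b - a)"
    by (rule deriv_lower[OF assms(1), where f' = "\<lambda>t. - f' t"]) (use assms in \<open>auto intro!: DERIV_minus\<close>)
  then show ?thesis by (simp add: algebra_simps)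
qed

lemma deriv_strict:
  fixes f :: "real \<Rightarrow> real"
  assumes "a < b" "\<And>t. a \<le> t \<Longrightarrow> t \<le> b \<Longrightarrow> (f has_real_derivative f' t) (at t)"
    "\<And>t. a \<le> t \<Longrightarrow> t \<le> b \<Longrightarrow> f' t > 0"
  shows "f a < f b"
  by (rule DERIV_pos_imp_increasing[OF assms(1)]) (use assms in blast)

lemma first_nonpos:
  fixes f :: "real \<Rightarrow> real"
  assumes "a \<le> b" "continuous_on {a..b} f" "f a > 0" "f b \<le> 0"
  obtains t where "a < t" "t \<le> b" "f t = 0" "\<And>s. a \<le> s \<Longrightarrow> s < t \<Longrightarrow> f s > 0"
proof -
  obtain t where "a < t" "t \<le> b" "- f t = 0" "\<And>s. a \<le> s \<Longrightarrow> s < t \<Longrightarrow> - f s < 0"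
    by (rule first_hit[of a b "\<lambda>t. - f t" 0]) (use assms in \<open>auto intro!: continuous_intros\<close>)
  then show ?thesis by (intro that[of t]) auto
qed

section \<open>Arcs of maximal solution curves\<close>

locale mcurve =
  fixes n :: nat and J x r th
  assumes n2: "n \<ge> 2" and mx: "max_geo_sol n J x r th"
begin

abbreviation (input) "c \<equiv> real n - 1"

lemma c1: "c \<ge> 1" using n2 by simp

lemma g: "geo_sol n J x r th" using mx by (simp add: max_geo_sol_def)

text \<open>\<open>kap\<close> is the curvature \<open>th'\<close> and \<open>hh\<close> the support function; on a graph \<open>hh = cos (th) * (u - x u')\<close>.\<close>

definition kap where "kap t = curv c (x t) (r t) (th t)"
definition hh where "hh t = r t * cos (th t) - x t * sin (th t)"
text \<open>The partial derivative of \<open>curv\<close> in the angle, hence the coefficient of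
  \<open>kap\<close> in its own equation \<open>dkap\<close>.\<close>

definition AA where "AA t = x t / 2 * cos (th t) - (c / r t - r t / 2) * sin (th t)"

lemma rpos: "t \<in> J \<Longrightarrow> r t > 0"
  and dx: "t \<in> J \<Longrightarrow> (x has_real_derivative cos (th t)) (at t)"
  and dr: "t \<in> J \<Longrightarrow> (r has_real_derivative sin (th t)) (at t)"
  and dth: "t \<in> J \<Longrightarrow> (th has_real_derivative kap t) (at t)"
  using geo_solD(3-6)[OF g] by (auto simp: kap_def)

lemma openJ: "open J" using geo_solD(1)[OF g] .

lemma Icc: "a \<in> J \<Longrightarrow> b \<in> J \<Longrightarrow> {a..b} \<subseteq> J"
  using interval_Icc[OF geo_solD(2)[OF g]] .

lemma betw: "a \<in> J \<Longrightarrow> b \<in> J \<Longrightarrow> a \<le> t \<Longrightarrow> t \<le> b \<Longrightarrow> t \<in> J"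
  using Icc[of a b] by auto

lemmas cont = geo_sol_cont[OF g]

lemma kap_eq: "kap t = x t / 2 * sin (th t) + (c / r t - r t / 2) * cos (th t)"
  by (simp add: kap_def curv_def)

lemma kap_hh: "t \<in> J \<Longrightarrow> kap t = - hh t / 2 + c * cos (th t) / r t"
  by (simp add: kap_eq hh_def algebra_simps diff_divide_distrib add_divide_distrib)

text \<open>The derivatives of \<open>x / 2\<close> and \<open>r / 2\<close> contribute opposite
  terms. What remains is a linear equation for \<open>kap\<close> with a source whose sign is
  decided by the quadrant of \<open>th\<close>.\<close>

lemma dkap: assumes t: "t \<in> J"
  shows "(kap has_real_derivative AA t * kap t - c / (r t)\<^sup>2 * (sin (th t) * cos (th t))) (at t)"
proof -
  have rp: "r t \<noteq> 0" using rpos[OF t] by simp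
  have "((\<lambda>t. x t / 2 * sin (th t) + (c / r t - r t / 2) * cos (th t)) has_real_derivative
     cos (th t) / 2 * sin (th t) + (cos (th t) * kap t) * (x t / 2) +
     ((- (c * sin (th t)) / (r t * r t) - sin (th t) / 2) * cos (th t) + (- sin (th t) * kap t) * (c / r t - r t / 2))) (at t)"
    by (rule derivative_eq_intros dx dr dth t rp refl | simp add: rp)+
  moreover have "kap = (\<lambda>t. x t / 2 * sin (th t) + (c / r t - r t / 2) * cos (th t))"
    by (auto simp: kap_eq)
  moreover have "cos (th t) / 2 * sin (th t) + (cos (th t) * kap t) * (x t / 2) +
     ((- (c * sin (th t)) / (r t * r t) - sin (th t) / 2) * cos (th t) + (- sin (th t) * kap t) * (c / r t - r t / 2))
     = AA t * kap t - c / (r t)\<^sup>2 * (sin (th t) * cos (th t))"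
    using rp by (simp add: AA_def field_simps power2_eq_square)
  ultimately show ?thesis by simp
qed

lemma contk: "S \<subseteq> J \<Longrightarrow> continuous_on S kap"
  by (meson DERIV_continuous continuous_at_imp_continuous_on dkap subsetD)

lemma contA: assumes S: "S \<subseteq> J" shows "continuous_on S AA"
proof -
  have "\<forall>t\<in>S. r t \<noteq> 0" using rpos S by force
  then show ?thesis unfolding AA_def
    by (intro continuous_intros cont[OF S]) auto
qed

lemma dhh: assumes t: "t \<in> J"
  shows "(hh has_real_derivative - kap t * (x t * cos (th t) + r t * sin (th t))) (at t)"
proof -
  have "((\<lambda>t. r t * cos (th t) - x t * sin (th t)) has_real_derivative
     (sin (th t) * cos (th t) + (- sin (th t) * kap t) * r t) - (cos (th t) * sin (th t) + (cos (th t) * kap t) * x t)) (at t)"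
    by (rule derivative_eq_intros dx dr dth t refl | simp)+
  moreover have "hh = (\<lambda>t. r t * cos (th t) - x t * sin (th t))" by (auto simp: hh_def)
  ultimately show ?thesis by (simp add: algebra_simps)
qed

lemma coef_nonneg: "a \<ge> 0 \<Longrightarrow> c / (r t)\<^sup>2 * a \<ge> 0"
  using c1 by simp

lemma coef_nonpos: "a \<le> 0 \<Longrightarrow> c / (r t)\<^sup>2 * a \<le> 0"
  using coef_nonneg[of "- a" t] by simp

text \<open>In the second and fourth quadrants the source in \<open>dkap\<close> is nonnegative, and
  \<open>linear_growth\<close> forbids the loss of positivity.\<close>

lemma kap_pos_persists:
  assumes ab: "a \<in> J" "b \<in> J" "a \<le> b" and "\<And>t. a \<le> t \<Longrightarrow> t \<le> b \<Longrightarrow> sin (th t) * cos (th t) \<le> 0"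
    and "kap a > 0"
  shows "kap b > 0"
proof -
  have "\<exists>k>0. kap b \<ge> k * kap a"
  proof (rule linear_growth[OF ab(3) contA[OF Icc[OF ab(1,2)]]])
    fix t assume t: "a \<le> t" "t \<le> b"
    show "(kap has_real_derivative AA t * kap t - c / (r t)\<^sup>2 * (sin (th t) * cos (th t))) (at t)"
      by (intro dkap betw[OF ab(1,2)] t)
    have "c / (r t)\<^sup>2 * (sin (th t) * cos (th t)) \<le> 0"
      by (rule coef_nonpos[OF assms(4)[OF t]])
    then show "AA t * kap t \<le> AA t * kap t - c / (r t)\<^sup>2 * (sin (th t) * cos (th t))" by simp
  qed
  then show ?thesis using assms(5) by (meson less_le_trans mult_pos_pos)
qed

lemma kap_neg_persists:
  assumes ab: "a \<in> J" "b \<in> J" "a \<le> b" and "\<And>t. a \<le> t \<Longrightarrow> t \<le> b \<Longrightarrow> sin (th t) * cos (th t) \<ge> 0"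
    and "kap a < 0"
  shows "kap b < 0"
proof -
  have "\<exists>k>0. - kap b \<ge> k * (- kap a)"
  proof (rule linear_growth[OF ab(3) contA[OF Icc[OF ab(1,2)]], where y = "\<lambda>t. - kap t"])
    fix t assume t: "a \<le> t" "t \<le> b"
    show "((\<lambda>t. - kap t) has_real_derivative - (AA t * kap t - c / (r t)\<^sup>2 * (sin (th t) * cos (th t)))) (at t)"
      by (intro derivative_intros dkap betw[OF ab(1,2)] t)
    have "c / (r t)\<^sup>2 * (sin (th t) * cos (th t)) \<ge> 0"
      by (rule coef_nonneg[OF assms(4)[OF t]])
    then show "AA t * - kap t \<le> - (AA t * kap t - c / (r t)\<^sup>2 * (sin (th t) * cos (th t)))" by simp
  qed
  then obtain k where "k > 0" "- kap b \<ge> k * (- kap a)" by blast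
  moreover have "k * (- kap a) > 0" using \<open>k > 0\<close> assms(5) by (simp add: mult_pos_neg)
  ultimately show ?thesis by linarith
qed

lemma sin_neg_quadrant: "- (pi/2) \<le> a \<Longrightarrow> a \<le> 0 \<Longrightarrow> sin a \<le> 0 \<and> cos a \<ge> 0"
  using sin_ge_zero[of "- a"] cos_ge_zero[of a] by auto

lemma sin_pos_quadrant: "0 \<le> a \<Longrightarrow> a \<le> pi/2 \<Longrightarrow> sin a \<ge> 0 \<and> cos a \<ge> 0"
  using sin_ge_zero[of a] cos_ge_zero[of a] by auto

lemma speed_bound:
  assumes "a \<in> J" "t \<in> J" "a \<le> t"
  shows "\<bar>x t - x a\<bar> \<le> t - a" "\<bar>r t - r a\<bar> \<le> t - a"
proof -
  have J: "s \<in> J" if "a \<le> s" "s \<le> t" for s using betw assms that by blast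
  have "x t \<le> x a + 1 * (t - a)" by (rule deriv_upper[OF assms(3) dx]) (use J in auto)
  moreover have "x t \<ge> x a + (- 1) * (t - a)" by (rule deriv_lower[OF assms(3) dx]) (use J in auto)
  ultimately show "\<bar>x t - x a\<bar> \<le> t - a" by auto
  have "r t \<le> r a + 1 * (t - a)" by (rule deriv_upper[OF assms(3) dr]) (use J in auto)
  moreover have "r t \<ge> r a + (- 1) * (t - a)" by (rule deriv_lower[OF assms(3) dr]) (use J in auto)
  ultimately show "\<bar>r t - r a\<bar> \<le> t - a" by auto
qed

text \<open>While \<open>cos (th t)\<close> stays positive the repulsive term \<open>c / r\<close> keeps the curve off the axis:
  \<open>th + k * ln r\<close> cannot drop to minus infinity in finite time.\<close>

lemma r_bounded_below:
  assumes t0: "t0 \<in> J" and e: "e > 0"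
    and th: "\<And>t. t \<in> J \<Longrightarrow> t0 \<le> t \<Longrightarrow> th t \<le> 0 \<and> cos (th t) \<ge> e"
  shows "\<exists>d>0. \<forall>t\<in>J. t0 \<le> t \<longrightarrow> t \<le> T \<longrightarrow> r t \<ge> d"
proof -
  define C where "C = \<bar>x t0\<bar> + r t0 + 2 * (T - t0)"
  \<comment> \<open>The weight of \<open>ln (r)\<close> is exactly \<open>e\<close>: since
    \<open>c >= 1\<close>, the repulsion \<open>c * cos (th) / r\<close> is at least
    \<open>e / r\<close> and absorbs \<open>e * sin (th) / r\<close>, so the singular terms together
    are nonnegative.\<close>
  define F where "F t = th t + e * ln (r t)" for t
  show ?thesis
  proof (intro exI[of _ "exp ((F t0 - \<bar>C\<bar> * \<bar>T - t0\<bar>) / e)"] conjI ballI impI)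
    fix t assume t: "t \<in> J" "t0 \<le> t" "t \<le> T"
    have J: "s \<in> J" if "t0 \<le> s" "s \<le> t" for s using betw t0 t that by blast
    have "F t \<ge> F t0 + (- \<bar>C\<bar>) * (t - t0)"
    proof (rule deriv_lower[OF t(2)])
      fix s assume s: "t0 \<le> s" "s \<le> t"
      have rs: "r s > 0" using rpos[OF J[OF s]] .
      show "(F has_real_derivative kap s + e * (sin (th s) / r s)) (at s)"
        unfolding F_def using rs
        by (auto intro!: derivative_eq_intros dth[OF J[OF s]] dr[OF J[OF s]])
      have "cos (th s) \<ge> e" using th[OF J[OF s] s(1)] by simp
      then have "c * cos (th s) \<ge> e" using c1 e mult_mono[of 1 c e "cos (th s)"] by simp
      moreover have "e * sin (th s) \<ge> - e" using e mult_left_mono[of "-1" "sin (th s)" e] by simp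
      ultimately have "(c * cos (th s) + e * sin (th s)) / r s \<ge> 0" using rs by simp
      moreover have "kap s + e * (sin (th s) / r s) =
          (c * cos (th s) + e * sin (th s)) / r s + (x s / 2 * sin (th s) - r s / 2 * cos (th s))"
        by (simp add: kap_eq algebra_simps add_divide_distrib diff_divide_distrib)
      moreover have "\<bar>x s / 2 * sin (th s)\<bar> \<le> \<bar>x s / 2\<bar> * 1" unfolding abs_mult by (intro mult_left_mono) auto
      moreover have "\<bar>r s / 2 * cos (th s)\<bar> \<le> \<bar>r s / 2\<bar> * 1" unfolding abs_mult by (intro mult_left_mono) auto
      moreover have "\<bar>x s\<bar> + r s \<le> C"
      proof -
        have "\<bar>x s\<bar> \<le> \<bar>x t0\<bar> + (s - t0)" "r s \<le> r t0 + (s - t0)"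
          using speed_bound[OF t0 J[OF s] s(1)] by linarith+
        then have "\<bar>x s\<bar> + r s \<le> \<bar>x t0\<bar> + r t0 + 2 * (s - t0)" by argo
        also have "2 * (s - t0) \<le> 2 * (T - t0)" using s t by simp
        finally show ?thesis unfolding C_def by simp
      qed
      ultimately show "- \<bar>C\<bar> \<le> kap s + e * (sin (th s) / r s)" using rs by linarith
    qed
    moreover have "\<bar>C\<bar> * (t - t0) \<le> \<bar>C\<bar> * \<bar>T - t0\<bar>" using t by (intro mult_left_mono) auto
    ultimately have "F t \<ge> F t0 - \<bar>C\<bar> * \<bar>T - t0\<bar>" by simp
    moreover have "F t \<le> e * ln (r t)" using th[OF t(1,2)] by (simp add: F_def)
    ultimately have "(F t0 - \<bar>C\<bar> * \<bar>T - t0\<bar>) / e \<le> ln (r t)" using e by (simp add: field_simps)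
    then show "exp ((F t0 - \<bar>C\<bar> * \<bar>T - t0\<bar>) / e) \<le> r t"
      using rpos[OF t(1)] by (simp add: ln_ge_iff)
  qed simp
qed

section \<open>Arcs that must reach a horizontal tangent\<close>

lemma forward_if_r_ge:
  assumes "t0 \<in> J" "d > 0" "\<And>t. t \<in> J \<Longrightarrow> t0 \<le> t \<Longrightarrow> r t \<ge> d"
  shows "{t0..} \<subseteq> J"
  by (rule max_geo_forward[OF mx assms(1)]) (use assms in blast)

lemma x_mono:
  assumes "a \<in> J" "b \<in> J" "a \<le> b" "\<And>t. a \<le> t \<Longrightarrow> t \<le> b \<Longrightarrow> cos (th t) \<ge> e"
  shows "x b \<ge> x a + e * (b - a)"
  by (rule deriv_lower[OF assms(3) dx]) (use assms betw in blast)+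

lemma th_increase:
  assumes "a \<in> J" "b \<in> J" "a \<le> b" "\<And>t. a \<le> t \<Longrightarrow> t < b \<Longrightarrow> kap t > 0"
  shows "th a \<le> th b"
proof (rule DERIV_nonneg_imp_increasing_open[OF assms(3)])
  fix t assume "a < t" "t < b"
  then show "\<exists>y. (th has_real_derivative y) (at t) \<and> 0 \<le> y"
    using dth[of t] betw[OF assms(1,2)] assms(4)[of t] by (intro exI[of _ "kap t"]) auto
qed (intro cont Icc assms)

lemma th_decrease:
  assumes "a \<in> J" "b \<in> J" "a \<le> b" "\<And>t. a \<le> t \<Longrightarrow> t < b \<Longrightarrow> kap t < 0"
  shows "th b \<le> th a"
proof -
  have "- th a \<le> - th b"
  proof (rule DERIV_nonneg_imp_increasing_open[OF assms(3)])
    fix t assume "a < t" "t < b"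
    then show "\<exists>y. ((\<lambda>t. - th t) has_real_derivative y) (at t) \<and> 0 \<le> y"
      using dth[of t] betw[OF assms(1,2)] assms(4)[of t]
      by (intro exI[of _ "- kap t"]) (auto intro!: derivative_intros)
  qed (intro continuous_intros cont Icc assms)
  then show ?thesis by simp
qed

lemma r_lower_quadrant:
  assumes "a \<in> J" "b \<in> J" "a \<le> b" "\<And>t. a \<le> t \<Longrightarrow> t \<le> b \<Longrightarrow> 0 \<le> th t \<and> th t \<le> pi"
  shows "r a \<le> r b"
proof -
  have "r b \<ge> r a + 0 * (b - a)"
  proof (rule deriv_lower[OF assms(3) dr])
    fix t assume "a \<le> t" "t \<le> b"
    then show "0 \<le> sin (th t)" using assms(4)[of t] by (simp add: sin_ge_zero)
  qed (use assms betw in blast)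
  then show ?thesis by simp
qed

text \<open>Positive curvature persists in the fourth quadrant, so \<open>th\<close> increases and
  \<open>cos (th)\<close> stays away from \<open>0\<close>. If the angle never reached
  \<open>0\<close>, the curve would run to \<open>x = \<infinity>\<close> with \<open>r\<close>
  bounded; far out \<open>AA >= 0\<close>, so \<open>kap\<close> no longer decreases and
  \<open>th\<close> would grow at a positive rate for ever.\<close>

lemma descending_reaches_valley:
  assumes t0: "t0 \<in> J" and th0: "- (pi/2) < th t0" "th t0 < 0" and k0: "kap t0 > 0"
  obtains t1 where "t0 < t1" "t1 \<in> J" "th t1 = 0" "\<And>t. t0 \<le> t \<Longrightarrow> t \<le> t1 \<Longrightarrow> kap t > 0"
    "\<And>t. t0 \<le> t \<Longrightarrow> t < t1 \<Longrightarrow> th t0 \<le> th t \<and> th t < 0"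
proof -
  have inv: "kap b > 0 \<and> th t0 \<le> th b"
    if b: "b \<in> J" "t0 \<le> b" and neg: "\<And>t. t0 \<le> t \<Longrightarrow> t < b \<Longrightarrow> th t < 0" for b
  proof -
    \<comment> \<open>The hypothesis only covers times before \<open>b\<close>; if
      \<open>th t\<close> were positive, the smaller positive value \<open>th t / 2\<close> would be
      taken before \<open>b\<close>.\<close>
    have nonp: "th t \<le> 0" if tt: "t0 \<le> t" "t \<le> b" for t
    proof (rule ccontr)
      assume a: "\<not> th t \<le> 0"
      have "th t0 < th t / 2" "th t / 2 \<le> th t" using a th0 by auto
      from first_hit[OF tt(1) cont(3)[OF Icc[OF t0 betw[OF t0 b(1) tt]]] this]
      obtain s where "t0 < s" "s \<le> t" "th s = th t / 2" by metis
      moreover from this have "s < b" using tt a by (cases "s = t") auto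
      ultimately show False using neg[of s] a by force
    qed
    have kall: "kap s > 0" if ss: "t0 \<le> s" "s \<le> b" for s
    proof (rule ccontr)
      assume "\<not> kap s > 0"
      then obtain t where t: "t0 < t" "t \<le> s" "kap t = 0" "\<And>s. t0 \<le> s \<Longrightarrow> s < t \<Longrightarrow> kap s > 0"
        using first_nonpos[of t0 s kap] ss contk[OF Icc[OF t0 betw[OF t0 b(1) ss]]] k0 by (metis not_less)
      have tJ: "t \<in> J" using betw[OF t0 b(1)] t ss by simp
      have "kap t > 0"
      proof (rule kap_pos_persists[OF t0 tJ])
        fix s assume s: "t0 \<le> s" "s \<le> t"
        have "th t0 \<le> th s"
          using th_increase[OF t0 betw[OF t0 tJ s] s(1)] t s by auto
        then show "sin (th s) * cos (th s) \<le> 0"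
          using sin_neg_quadrant[of "th s"] nonp[of s] s t th0 ss by (intro mult_nonpos_nonneg) auto
      qed (use t k0 in auto)
      then show False using t by simp
    qed
    then show ?thesis using th_increase[OF t0 b] b by auto
  qed
  have "\<exists>b\<in>J. t0 \<le> b \<and> th b \<ge> 0"
  proof (rule ccontr)
    assume "\<not> ?thesis"
    then have neg: "th b < 0" if "b \<in> J" "t0 \<le> b" for b using that by force
    have inv': "kap b > 0 \<and> th t0 \<le> th b" if "b \<in> J" "t0 \<le> b" for b
      using inv[OF that] neg betw[OF t0 that(1)] by auto
    define e where "e = cos (th t0)"
    have e: "e > 0" unfolding e_def using th0 by (intro cos_gt_zero_pi) auto
    have ce: "cos (th t) \<ge> e" if "t \<in> J" "t0 \<le> t" for t
      using inv'[OF that] neg[OF that] th0 cos_monotone_0_pi_le[of "- th t" "- th t0"]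
      unfolding e_def by simp
    have JJ: "{t0..} \<subseteq> J"
      by (rule max_geo_forward[OF mx t0], rule r_bounded_below[OF t0 e]) (use ce neg in force)
    have r0: "r t \<le> r t0" if "t0 \<le> t" for t
    proof -
      have "r t \<le> r t0 + 0 * (t - t0)"
      proof (rule deriv_upper[OF that dr])
        fix s assume s: "t0 \<le> s" "s \<le> t"
        then have "s \<in> J" using JJ by auto
        then show "sin (th s) \<le> 0" using inv'[of s] neg[of s] s th0 sin_neg_quadrant[of "th s"] by auto
      qed (use JJ in auto)
      then show ?thesis by simp
    qed
    \<comment> \<open>From \<open>t1\<close> on \<open>x >= r t0 / e\<close>, hence
      \<open>x * cos (th) >= r t0 >= - r * sin (th)\<close>, which makes \<open>AA\<close>
      nonnegative.\<close>
    define t1 where "t1 = t0 + (\<bar>x t0\<bar> + r t0 / e) / e"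
    have t1: "t0 \<le> t1" using e rpos[OF t0] by (simp add: t1_def)
    have xt: "x t \<ge> r t0 / e" if "t1 \<le> t" for t
    proof -
      have "x t \<ge> x t0 + e * (t - t0)"
        by (rule x_mono) (use that t1 JJ ce in auto)
      moreover have "e * (t - t0) \<ge> e * (t1 - t0)" using that e by (intro mult_left_mono) auto
      moreover have "e * (t1 - t0) = \<bar>x t0\<bar> + r t0 / e" using e by (simp add: t1_def)
      ultimately show ?thesis by linarith
    qed
    have Anon: "AA t \<ge> 0" if "t1 \<le> t" for t
    proof -
      have tJ: "t \<in> J" "t0 \<le> t" using JJ t1 that by auto
      have s: "sin (th t) \<le> 0" "sin (th t) \<ge> -1"
        using inv'[OF tJ] neg[OF tJ] th0 sin_neg_quadrant[of "th t"] by auto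
      have "r t0 \<le> x t * e" using xt[OF that] e by (simp add: field_simps)
      also have "\<dots> \<le> x t * cos (th t)"
        using ce[OF tJ] xt[OF that] e rpos[OF t0] by (intro mult_left_mono) (auto intro: order_trans[rotated])
      finally have 1: "x t * cos (th t) \<ge> r t0" .
      have "r t * sin (th t) \<ge> r t * (-1)" using s rpos[OF tJ(1)] by (intro mult_left_mono) auto
      then have 2: "r t * sin (th t) \<ge> - r t0" using r0[OF tJ(2)] by linarith
      have "c / r t * sin (th t) \<le> 0" using s rpos[OF tJ(1)] c1 by (intro mult_nonneg_nonpos) auto
      moreover have "AA t = (x t * cos (th t) + r t * sin (th t)) / 2 - c / r t * sin (th t)"
        by (simp add: AA_def algebra_simps add_divide_distrib)
      ultimately show ?thesis using 1 2 by argo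
    qed
    have t1J: "t1 \<in> J" using t1 JJ by auto
    have kt: "kap t \<ge> kap t1" if "t1 \<le> t" for t
    proof -
      have "kap t \<ge> kap t1 + 0 * (t - t1)"
      proof (rule deriv_lower[OF that dkap])
        fix s assume s: "t1 \<le> s" "s \<le> t"
        have sJ: "s \<in> J" "t0 \<le> s" using JJ t1 s by auto
        have "sin (th s) * cos (th s) \<le> 0"
          using inv'[OF sJ] neg[OF sJ] th0 sin_neg_quadrant[of "th s"] by (intro mult_nonpos_nonneg) auto
        then have "c / (r s)\<^sup>2 * (sin (th s) * cos (th s)) \<le> 0" by (rule coef_nonpos)
        moreover have "AA s * kap s \<ge> 0" using Anon[OF s(1)] inv'[OF sJ] by simp
        ultimately show "0 \<le> AA s * kap s - c / (r s)\<^sup>2 * (sin (th s) * cos (th s))" by linarith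
      qed (use JJ t1 in auto)
      then show ?thesis by simp
    qed
    have k1: "kap t1 > 0" using inv'[OF t1J t1] by simp
    define t2 where "t2 = t1 + (pi/2) / kap t1"
    have t2: "t1 \<le> t2" using k1 by (simp add: t2_def)
    have "th t2 \<ge> th t1 + kap t1 * (t2 - t1)"
      by (rule deriv_lower[OF t2 dth]) (use JJ t1 kt in auto)
    moreover have "kap t1 * (t2 - t1) = pi / 2" using k1 by (simp add: t2_def)
    moreover have "th t1 > - (pi/2)" using inv'[OF t1J t1] th0 by simp
    moreover have "th t2 < 0" using neg[of t2] subsetD[OF JJ, of t2] t1 t2 by simp
    ultimately show False by linarith
  qed
  then obtain b where b: "b \<in> J" "t0 \<le> b" "th b \<ge> 0" by blast
  obtain t1 where t1: "t0 < t1" "t1 \<le> b" "th t1 = 0" "\<And>s. t0 \<le> s \<Longrightarrow> s < t1 \<Longrightarrow> th s < 0"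
    using first_hit[of t0 b th 0] b th0 cont(3)[OF Icc[OF t0 b(1)]] by metis
  have t1J: "t1 \<in> J" using betw[OF t0 b(1)] t1 by simp
  have "kap t > 0 \<and> th t0 \<le> th t" if "t0 \<le> t" "t \<le> t1" for t
    by (rule inv) (use that t1 betw[OF t0 t1J] in auto)
  then show ?thesis using t1 t1J by (intro that[of t1]) auto
qed

text \<open>Here \<open>r\<close> is nondecreasing, which excludes the end of the curve and bounds
  the repulsive term by \<open>c / r t0\<close>. For large \<open>x\<close> again
  \<open>AA >= 0\<close>, which now keeps \<open>kap\<close> below a negative constant and drives
  the angle down.\<close>

lemma concave_ascent_reaches_peak:
  assumes t0: "t0 \<in> J" and th0: "0 < th t0" "th t0 < pi/2" and k0: "kap t0 < 0"
  obtains t1 where "t0 < t1" "t1 \<in> J" "th t1 = 0" "\<And>t. t0 \<le> t \<Longrightarrow> t \<le> t1 \<Longrightarrow> kap t < 0"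
    "\<And>t. t0 \<le> t \<Longrightarrow> t < t1 \<Longrightarrow> 0 < th t \<and> th t \<le> th t0"
proof -
  have inv: "kap b < 0 \<and> th b \<le> th t0"
    if b: "b \<in> J" "t0 \<le> b" and pos: "\<And>t. t0 \<le> t \<Longrightarrow> t \<le> b \<Longrightarrow> th t \<ge> 0" for b
  proof -
    have kall: "kap s < 0" if ss: "t0 \<le> s" "s \<le> b" for s
    proof (rule ccontr)
      assume "\<not> kap s < 0"
      then obtain t where t: "t0 < t" "t \<le> s" "- kap t = 0" "\<And>s. t0 \<le> s \<Longrightarrow> s < t \<Longrightarrow> - kap s > 0"
        using first_nonpos[of t0 s "\<lambda>t. - kap t"] ss k0
          continuous_on_minus[OF contk[OF Icc[OF t0 betw[OF t0 b(1) ss]]]] by (metis neg_0_less_iff_less neg_le_0_iff_le not_le)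
      have tJ: "t \<in> J" using betw[OF t0 b(1)] t ss by simp
      have "kap t < 0"
      proof (rule kap_neg_persists[OF t0 tJ])
        fix s' assume s: "t0 \<le> s'" "s' \<le> t"
        have "th s' \<le> th t0"
          using th_decrease[OF t0 betw[OF t0 tJ s] s(1)] t s by auto
        then show "0 \<le> sin (th s') * cos (th s')"
          using sin_pos_quadrant[of "th s'"] pos[of s'] s t th0 ss by auto
      qed (use t k0 in auto)
      then show False using t by simp
    qed
    then show ?thesis using th_decrease[OF t0 b] b by auto
  qed
  have "\<exists>b\<in>J. t0 \<le> b \<and> th b \<le> 0"
  proof (rule ccontr)
    assume "\<not> ?thesis"
    then have pos: "th b > 0" if "b \<in> J" "t0 \<le> b" for b using that by force
    have inv': "kap b < 0 \<and> th b \<le> th t0" if "b \<in> J" "t0 \<le> b" for b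
      using inv[OF that] pos betw[OF t0 that(1)] by (meson less_imp_le)
    define e where "e = cos (th t0)"
    have e: "e > 0" unfolding e_def using th0 by (intro cos_gt_zero_pi) auto
    have ce: "cos (th t) \<ge> e" if "t \<in> J" "t0 \<le> t" for t
      using inv'[OF that] pos[OF that] th0 cos_monotone_0_pi_le[of "th t" "th t0"]
      unfolding e_def by simp
    have r0: "r t \<ge> r t0" if "t \<in> J" "t0 \<le> t" for t
    proof (rule r_lower_quadrant[OF t0 that])
      fix s assume s: "t0 \<le> s" "s \<le> t"
      have sJ: "s \<in> J" using betw[OF t0 that(1) s] .
      show "0 \<le> th s \<and> th s \<le> pi" using inv'[OF sJ s(1)] pos[OF sJ s(1)] th0 by linarith
    qed
    have JJ: "{t0..} \<subseteq> J" by (rule forward_if_r_ge[OF t0 rpos[OF t0] r0])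
    \<comment> \<open>The threshold \<open>2 * c / (r t0 * e)\<close> gives
      \<open>x * cos (th) / 2 >= c / r t0\<close>, enough to dominate
      \<open>c / r * sin (th)\<close> in \<open>AA\<close>.\<close>
    define t1 where "t1 = t0 + (\<bar>x t0\<bar> + 2 * c / (r t0 * e)) / e"
    have rp0: "r t0 > 0" using rpos[OF t0] .
    have t1: "t0 \<le> t1" using e rp0 c1 by (simp add: t1_def)
    have xt: "x t \<ge> 2 * c / (r t0 * e)" if "t1 \<le> t" for t
    proof -
      have "x t \<ge> x t0 + e * (t - t0)"
        by (rule x_mono) (use that t1 JJ ce in auto)
      moreover have "e * (t - t0) \<ge> e * (t1 - t0)" using that e by (intro mult_left_mono) auto
      moreover have "e * (t1 - t0) = \<bar>x t0\<bar> + 2 * c / (r t0 * e)" using e by (simp add: t1_def)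
      ultimately show ?thesis by linarith
    qed
    have Anon: "AA t \<ge> 0" if "t1 \<le> t" for t
    proof -
      have tJ: "t \<in> J" "t0 \<le> t" using JJ t1 that by auto
      have s: "sin (th t) \<ge> 0" "sin (th t) \<le> 1"
        using inv'[OF tJ] pos[OF tJ] th0 sin_pos_quadrant[of "th t"] by auto
      have xp: "x t \<ge> 0" using xt[OF that] e rp0 c1 by (meson divide_nonneg_pos mult_pos_pos order_trans less_imp_le zero_le_mult_iff zero_le_numeral zero_le_one)
      have "2 * (c / r t0) = 2 * c / (r t0 * e) * e" using e by simp
      also have "\<dots> \<le> x t * cos (th t)"
        using ce[OF tJ] xt[OF that] e xp by (intro mult_mono) auto
      finally have 1: "x t * cos (th t) \<ge> 2 * (c / r t0)" .
      have "c / r t * sin (th t) \<le> c / r t0 * 1"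
        using s r0[OF tJ] rp0 c1 by (intro mult_mono divide_left_mono) auto
      moreover have "r t * sin (th t) \<ge> 0" using s rpos[OF tJ(1)] by simp
      moreover have "AA t = x t * cos (th t) / 2 + r t * sin (th t) / 2 - c / r t * sin (th t)"
        by (simp add: AA_def algebra_simps)
      ultimately show ?thesis using 1 by linarith
    qed
    have t1J: "t1 \<in> J" using t1 JJ by auto
    have kt: "kap t \<le> kap t1" if "t1 \<le> t" for t
    proof -
      have "kap t \<le> kap t1 + 0 * (t - t1)"
      proof (rule deriv_upper[OF that dkap])
        fix s assume s: "t1 \<le> s" "s \<le> t"
        have sJ: "s \<in> J" "t0 \<le> s" using JJ t1 s by auto
        have "sin (th s) * cos (th s) \<ge> 0"
          using inv'[OF sJ] pos[OF sJ] th0 sin_pos_quadrant[of "th s"] by (intro mult_nonneg_nonneg) auto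
        then have "c / (r s)\<^sup>2 * (sin (th s) * cos (th s)) \<ge> 0" by (rule coef_nonneg)
        moreover have "AA s * kap s \<le> 0"
          using Anon[OF s(1)] inv'[OF sJ] by (intro mult_nonneg_nonpos) auto
        ultimately show "AA s * kap s - c / (r s)\<^sup>2 * (sin (th s) * cos (th s)) \<le> 0" by linarith
      qed (use JJ t1 in auto)
      then show ?thesis by simp
    qed
    have k1: "kap t1 < 0" using inv'[OF t1J t1] by simp
    define t2 where "t2 = t1 + (pi/2) / (- kap t1)"
    have t2: "t1 \<le> t2" using k1 by (simp add: t2_def divide_nonneg_neg divide_nonpos_neg)
    have "th t2 \<le> th t1 + kap t1 * (t2 - t1)"
      by (rule deriv_upper[OF t2 dth]) (use JJ t1 kt in auto)
    moreover have "kap t1 * (t2 - t1) = - (pi / 2)" using k1 by (simp add: t2_def)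
    moreover have "th t1 < pi/2" using inv'[OF t1J t1] th0 by simp
    moreover have "th t2 > 0" using pos[of t2] subsetD[OF JJ, of t2] t1 t2 by simp
    ultimately show False by linarith
  qed
  then obtain b where b: "b \<in> J" "t0 \<le> b" "th b \<le> 0" by blast
  obtain t1 where t1: "t0 < t1" "t1 \<le> b" "th t1 = 0" "\<And>s. t0 \<le> s \<Longrightarrow> s < t1 \<Longrightarrow> th s > 0"
    using first_nonpos[of t0 b th] b th0 cont(3)[OF Icc[OF t0 b(1)]] by metis
  have t1J: "t1 \<in> J" using betw[OF t0 b(1)] t1 by simp
  have "kap t < 0 \<and> th t \<le> th t0" if "t0 \<le> t" "t \<le> t1" for t
  proof (rule inv)
    fix s assume "t0 \<le> s" "s \<le> t"
    then show "th s \<ge> 0" using t1(3) t1(4)[of s] that by (cases "s = t1") auto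
  qed (use that t1 betw[OF t0 t1J] in auto)
  then show ?thesis using t1 t1J by (intro that[of t1]) auto
qed

text \<open>On a graph \<open>gg\<close> is \<open>u u'' / (1 + u'^2)\<close>, and by
  \<open>kap_hh\<close> it equals \<open>c - r * hh / (2 * cos (th))\<close>, so it stays below
  \<open>c\<close> while \<open>hh\<close> and \<open>cos (th)\<close> are positive.
  \<open>QQ\<close> is \<open>2 * cos (th)\<close> times its derivative.\<close>

definition gg where "gg t = r t * kap t / cos (th t)"
definition QQ where "QQ t = x t * gg t - hh t * sin (th t)"

lemma dgg: assumes t: "t \<in> J" and C: "cos (th t) \<noteq> 0"
  shows "(gg has_real_derivative QQ t / (2 * cos (th t))) (at t)"
proof -
  have rp: "r t \<noteq> 0" using rpos[OF t] by simp
  define S C k R X h where defs: "S = sin (th t)" "C = cos (th t)" "k = kap t" "R = r t" "X = x t" "h = hh t"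
  have nz: "C \<noteq> 0" "R \<noteq> 0" using C rp by (auto simp: defs)
  have h: "h = R * C - X * S" by (simp add: hh_def defs)
  have k: "k = X / 2 * S + (c / R - R / 2) * C" by (simp add: kap_eq defs)
  have sc: "S * S = 1 - C * C" using sin_cos_squared_add[of "th t"] by (simp add: defs power2_eq_square)
  let ?k' = "AA t * k - c / R\<^sup>2 * (S * C)"
  have "((\<lambda>t. r t * kap t / cos (th t)) has_real_derivative
     ((S * k + ?k' * R) * C - (R * k) * (- S * k)) / (C * C)) (at t)"
    unfolding defs
    by (rule derivative_eq_intros dr dth dkap t C refl | simp add: C)+
  moreover have "((S * k + ?k' * R) * C - (R * k) * (- S * k)) / (C * C) = QQ t / (2 * C)"
  proof -
    have AAe: "AA t = X / 2 * C - (c / R - R / 2) * S" by (simp add: AA_def defs)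
    \<comment> \<open>\<open>AA\<close> and \<open>kap\<close> are the components of the vector
      \<open>(x / 2, c / r - r / 2)\<close> in a frame turned by \<open>th\<close>; this combination
      recovers its first component.\<close>
    have Ak: "AA t * C + k * S = X / 2"
    proof -
      have "AA t * C + k * S = X / 2 * (C * C + S * S)" unfolding AAe k by (simp add: algebra_simps)
      then show ?thesis using sc by simp
    qed
    have ck: "c * C / R = k + h / 2" unfolding k h using nz by (simp add: field_simps)
    have "(S * k + ?k' * R) * C - (R * k) * (- S * k) = R * k * (AA t * C + k * S) + S * C * (k - c * C / R)"
      using nz by (simp add: field_simps power2_eq_square)
    also have "\<dots> = R * k * X / 2 - S * C * h / 2" unfolding Ak ck by (simp add: algebra_simps)
    finally have "((S * k + ?k' * R) * C - (R * k) * (- S * k)) / (C * C) = (R * k * X / 2 - S * C * h / 2) / (C * C)"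
      by simp
    also have "\<dots> = QQ t / (2 * C)" unfolding QQ_def gg_def defs[symmetric] using nz by (simp add: field_simps)
    finally show ?thesis .
  qed
  moreover have "gg = (\<lambda>t. r t * kap t / cos (th t))" by (auto simp: gg_def)
  ultimately show ?thesis by (simp add: defs)
qed

text \<open>A linear equation for \<open>QQ\<close> whose remainder is nonnegative as soon as
  \<open>x\<close>, \<open>gg\<close>, \<open>sin (th)\<close> and \<open>cos (th)\<close> are.
  Hence \<open>QQ >= 0\<close> persists, and with it the growth of \<open>gg\<close>.\<close>

lemma dQQ: assumes t: "t \<in> J" and C: "cos (th t) \<noteq> 0"
  shows "(QQ has_real_derivative x t / (2 * cos (th t)) * QQ t +
    (2 * gg t * cos (th t) * (sin (th t))\<^sup>2 + 2 * gg t * x t * (cos (th t))\<^sup>2 * sin (th t) / r t)) (at t)"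
proof -
  have rp: "r t \<noteq> 0" using rpos[OF t] by simp
  define S C k R X h G Q where defs: "S = sin (th t)" "C = cos (th t)" "k = kap t" "R = r t" "X = x t" "h = hh t"
    "G = gg t" "Q = QQ t"
  have nz: "C \<noteq> 0" "R \<noteq> 0" using C rp by (auto simp: defs)
  have h: "h = R * C - X * S" by (simp add: hh_def defs)
  have sc: "S * S = 1 - C * C" using sin_cos_squared_add[of "th t"] by (simp add: defs power2_eq_square)
  have k: "k = G * C / R" using nz by (simp add: gg_def defs)
  have "((\<lambda>t. x t * gg t - hh t * sin (th t)) has_real_derivative
     (C * G + (Q / (2 * C)) * X) - ((- k * (X * C + R * S)) * S + (C * k) * h)) (at t)"
    unfolding defs by (rule derivative_eq_intros dx dhh dth dgg t C refl | simp add: C)+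
  moreover have "(C * G + (Q / (2 * C)) * X) - ((- k * (X * C + R * S)) * S + (C * k) * h)
      = X / (2 * C) * Q + (2 * G * C * S\<^sup>2 + 2 * G * X * C\<^sup>2 * S / R)"
  proof -
    have "k * (X * C + R * S) * S - C * k * h = k * (2 * X * C * S + R * (S * S) - R * (C * C))"
      unfolding h by (simp add: algebra_simps)
    also have "\<dots> = G * C * (S * S - C * C) + 2 * G * X * C\<^sup>2 * S / R"
      unfolding k using nz by (simp add: field_simps power2_eq_square)
    finally have "C * G + (k * (X * C + R * S) * S - C * k * h) = G * C * (1 - C * C + S * S) + 2 * G * X * C\<^sup>2 * S / R"
      by (simp add: algebra_simps)
    also have "1 - C * C + S * S = 2 * S\<^sup>2" using sc by (simp add: power2_eq_square)
    finally show ?thesis by (simp add: algebra_simps)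
  qed
  moreover have "QQ = (\<lambda>t. x t * gg t - hh t * sin (th t))" by (auto simp: QQ_def)
  ultimately show ?thesis by (simp add: defs)
qed

lemma gg_mono:
  assumes t0: "t0 \<in> J" and b: "b \<in> J" "t0 \<le> b" and x0: "x t0 \<ge> 0" and th0: "th t0 = 0"
    and k: "\<And>t. t0 \<le> t \<Longrightarrow> t \<le> b \<Longrightarrow> kap t \<ge> 0"
    and th: "\<And>t. t0 \<le> t \<Longrightarrow> t \<le> b \<Longrightarrow> 0 \<le> th t \<and> th t < pi / 2"
  shows "QQ b \<ge> 0 \<and> gg b \<ge> gg t0"
proof -
  have J: "t \<in> J" if "t0 \<le> t" "t \<le> b" for t using betw[OF t0 b(1) that] .
  have C: "cos (th t) > 0" and S: "sin (th t) \<ge> 0" if "t0 \<le> t" "t \<le> b" for t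
    using th[OF that] by (auto intro!: cos_gt_zero_pi sin_ge_zero)
  have xn: "x t \<ge> 0" if tt: "t0 \<le> t" "t \<le> b" for t
  proof -
    have "x t \<ge> x t0 + 0 * (t - t0)"
      by (rule x_mono[OF t0 J[OF tt] tt(1)]) (use C tt in \<open>auto intro: less_imp_le\<close>)
    then show ?thesis using x0 by simp
  qed
  have gn: "gg t \<ge> 0" if "t0 \<le> t" "t \<le> b" for t
    using k[OF that] C[OF that] rpos[OF J[OF that]] by (simp add: gg_def)
  have Q: "QQ s \<ge> 0" if ss: "t0 \<le> s" "s \<le> b" for s
  proof -
    have "\<exists>k>0. QQ s \<ge> k * QQ t0"
    proof (rule linear_growth[OF ss(1), where A = "\<lambda>t. x t / (2 * cos (th t))"])
      have "\<And>t. t \<in> {t0..s} \<Longrightarrow> cos (th t) \<noteq> 0" using C ss by fastforce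
      then show "continuous_on {t0..s} (\<lambda>t. x t / (2 * cos (th t)))"
        by (intro continuous_intros cont Icc t0 J[OF ss]) auto
      fix t assume t: "t0 \<le> t" "t \<le> s"
      then have t': "t0 \<le> t" "t \<le> b" using ss by auto
      show "(QQ has_real_derivative x t / (2 * cos (th t)) * QQ t +
         (2 * gg t * cos (th t) * (sin (th t))\<^sup>2 + 2 * gg t * x t * (cos (th t))\<^sup>2 * sin (th t) / r t)) (at t)"
        using dQQ[OF J[OF t']] C[OF t'] by simp
      have "2 * gg t * cos (th t) * (sin (th t))\<^sup>2 + 2 * gg t * x t * (cos (th t))\<^sup>2 * sin (th t) / r t \<ge> 0"
        using gn[OF t'] C[OF t'] S[OF t'] xn[OF t'] rpos[OF J[OF t']]
        by (intro add_nonneg_nonneg mult_nonneg_nonneg divide_nonneg_pos) auto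
      then show "x t / (2 * cos (th t)) * QQ t \<le> x t / (2 * cos (th t)) * QQ t +
         (2 * gg t * cos (th t) * (sin (th t))\<^sup>2 + 2 * gg t * x t * (cos (th t))\<^sup>2 * sin (th t) / r t)"
        by simp
    qed
    \<comment> \<open>At the horizontal tangent \<open>QQ\<close> reduces to
      \<open>x * gg\<close>.\<close>
    moreover have "QQ t0 \<ge> 0" using gn[of t0] b(2) x0 by (simp add: QQ_def th0)
    ultimately show ?thesis by (meson mult_nonneg_nonneg less_imp_le order_trans)
  qed
  have "gg b \<ge> gg t0 + 0 * (b - t0)"
  proof (rule deriv_lower[OF b(2), where f' = "\<lambda>t. QQ t / (2 * cos (th t))"])
    fix t assume t: "t0 \<le> t" "t \<le> b"
    show "(gg has_real_derivative QQ t / (2 * cos (th t))) (at t)" using dgg[OF J[OF t]] C[OF t] by simp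
    show "0 \<le> QQ t / (2 * cos (th t))" using Q[OF t] C[OF t] by simp
  qed
  then show ?thesis using Q[of b] b by simp
qed

text \<open>Along the arc leaving a valley at \<open>x \<ge> 0\<close>, \<open>gg\<close> is nondecreasing and hence bounded below;
  a graph continuing for ever would make \<open>gg\<close> exceed its upper bound \<open>c\<close>.\<close>

lemma valley_reaches_vertical:
  assumes t0: "t0 \<in> J" and th0: "th t0 = 0" and k0: "kap t0 > 0" and x0: "x t0 \<ge> 0"
  obtains t1 where "t0 < t1" "t1 \<in> J" "th t1 = pi / 2" "x t1 > 0"
    "\<And>t. t0 \<le> t \<Longrightarrow> t \<le> t1 \<Longrightarrow> kap t > 0"
    "\<And>t. t0 \<le> t \<Longrightarrow> t < t1 \<Longrightarrow> 0 \<le> th t \<and> th t < pi / 2"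
proof -
  have g0: "gg t0 > 0" using k0 rpos[OF t0] by (simp add: gg_def th0)
  have inv: "kap b > 0 \<and> 0 \<le> th b"
    if b: "b \<in> J" "t0 \<le> b" and lt: "\<And>t. t0 \<le> t \<Longrightarrow> t \<le> b \<Longrightarrow> th t < pi / 2" for b
  proof -
    have kb: "kap s > 0" if ss: "t0 \<le> s" "s \<le> b" for s
    proof (rule ccontr)
      assume "\<not> kap s > 0"
      then obtain t where t: "t0 < t" "t \<le> s" "kap t = 0" "\<And>s. t0 \<le> s \<Longrightarrow> s < t \<Longrightarrow> kap s > 0"
        using first_nonpos[of t0 s kap] ss contk[OF Icc[OF t0 betw[OF t0 b(1) ss]]] k0 by (metis not_less)
      have tJ: "t \<in> J" using betw[OF t0 b(1)] t ss by simp
      \<comment> \<open>At a first zero of \<open>kap\<close> also \<open>gg\<close> would vanish,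
        against its positive lower bound \<open>gg t0\<close>.\<close>
      have "gg t \<ge> gg t0"
      proof (rule gg_mono[OF t0 tJ _ x0 th0, THEN conjunct2])
        fix u assume u: "t0 \<le> u" "u \<le> t"
        show "kap u \<ge> 0" using t(3) t(4)[of u] u by (cases "u = t") (auto intro: less_imp_le)
        have "th t0 \<le> th u" using th_increase[OF t0 betw[OF t0 tJ u] u(1)] t u by auto
        then show "0 \<le> th u \<and> th u < pi / 2" using lt[of u] u t ss th0 by auto
      qed (use t in auto)
      then show False using g0 t(3) by (simp add: gg_def)
    qed
    then show ?thesis using th_increase[OF t0 b] th0 b by auto
  qed
  have "\<exists>b\<in>J. t0 \<le> b \<and> th b \<ge> pi / 2"
  proof (rule ccontr)
    assume "\<not> ?thesis"
    then have lt: "th b < pi / 2" if "b \<in> J" "t0 \<le> b" for b using that by force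
    have inv': "kap b > 0" "0 \<le> th b" if "b \<in> J" "t0 \<le> b" for b
      using inv[OF that] lt betw[OF t0 that(1)] by blast+
    have r0: "r t \<ge> r t0" if "t \<in> J" "t0 \<le> t" for t
    proof (rule r_lower_quadrant[OF t0 that])
      fix s assume s: "t0 \<le> s" "s \<le> t"
      have sJ: "s \<in> J" using betw[OF t0 that(1) s] .
      show "0 \<le> th s \<and> th s \<le> pi" using inv'[OF sJ s(1)] lt[OF sJ s(1)] by linarith
    qed
    have JJ: "{t0..} \<subseteq> J" by (rule forward_if_r_ge[OF t0 rpos[OF t0] r0])
    have J: "t \<in> J" if "t0 \<le> t" for t using JJ that by auto
    have kp: "kap t > 0" and thn: "0 \<le> th t" and thl: "th t < pi / 2" if "t0 \<le> t" for t
      using inv'[OF J[OF that] that] lt[OF J[OF that] that] by auto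
    have C: "cos (th t) > 0" if "t0 \<le> t" for t
      using thn[OF that] thl[OF that] by (intro cos_gt_zero_pi) auto
    have S: "sin (th t) \<ge> 0" if "t0 \<le> t" for t
      using thn[OF that] thl[OF that] by (intro sin_ge_zero) auto
    have ths: "th s < th t" if "t0 \<le> s" "s < t" for s t
      by (rule deriv_strict[OF that(2) dth]) (use that J kp in auto)
    have xs: "x s < x t" if "t0 \<le> s" "s < t" for s t
      by (rule deriv_strict[OF that(2) dx]) (use that J C in auto)
    have rm: "r s \<le> r t" if "t0 \<le> s" "s \<le> t" for s t
    proof (rule r_lower_quadrant)
      fix u assume "s \<le> u" "u \<le> t"
      then have "t0 \<le> u" using that by simp
      then show "0 \<le> th u \<and> th u \<le> pi" using thn[of u] thl[of u] pi_gt_zero by linarith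
    qed (use that J in auto)
    have xn: "x t \<ge> 0" if "t0 \<le> t" for t using xs[of t0 t] x0 that by (cases "t = t0") auto
    have hd: "kap t * (x t * cos (th t) + r t * sin (th t)) \<ge> 0" if "t0 \<le> t" for t
      using kp[OF that] xn[OF that] C[OF that] S[OF that] rpos[OF J[OF that]]
      by (intro mult_nonneg_nonneg add_nonneg_nonneg) auto
    have hm: "hh t \<le> hh s" if "t0 \<le> s" "s \<le> t" for s t
    proof -
      have "hh t \<le> hh s + 0 * (t - s)"
        by (rule deriv_upper[OF that(2) dhh]) (use that J hd in auto)
      then show ?thesis by simp
    qed
    \<comment> \<open>\<open>hh\<close> is nonincreasing, so once nonpositive it soon lies below a
      negative constant; then \<open>kap >= - hh / 2\<close> would turn the angle by
      \<open>pi\<close>, more than the quadrant allows.\<close>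
    have hp: "hh t > 0" if t: "t0 \<le> t" for t
    proof (rule ccontr)
      assume "\<not> hh t > 0"
      then have h0: "hh t \<le> 0" by simp
      have "hh t0 = r t0" by (simp add: hh_def th0)
      then have "t \<noteq> t0" using h0 rpos[OF t0] by auto
      then have t': "t0 < t" using t by simp
      have "- hh t < - hh (t + 1)"
      proof (rule deriv_strict[where f = "\<lambda>t. - hh t" and
            f' = "\<lambda>s. - (- kap s * (x s * cos (th s) + r s * sin (th s)))"])
        fix s assume s: "t \<le> s" "s \<le> t + 1"
        then have s': "t0 \<le> s" "t0 < s" using t' by auto
        show "((\<lambda>t. - hh t) has_real_derivative - (- kap s * (x s * cos (th s) + r s * sin (th s)))) (at s)"
          by (intro DERIV_minus dhh J s')
        have "sin (th s) > 0" using ths[of t0 s] th0 s' thl[of s] by (intro sin_gt_zero) auto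
        then have "x s * cos (th s) + r s * sin (th s) > 0"
          using xn[OF s'(1)] C[OF s'(1)] rpos[OF J[OF s'(1)]] by (intro add_nonneg_pos mult_nonneg_nonneg mult_pos_pos) auto
        then show "0 < - (- kap s * (x s * cos (th s) + r s * sin (th s)))" using kp[OF s'(1)] by simp
      qed simp
      then have h1: "hh (t + 1) < 0" using h0 by simp
      define e where "e = - hh (t + 1) / 2"
      have e: "e > 0" using h1 by (simp add: e_def)
      have "th (t + 1 + pi / e) \<ge> th (t + 1) + e * (t + 1 + pi / e - (t + 1))"
      proof (rule deriv_lower[OF _ dth])
        fix s assume s: "t + 1 \<le> s" "s \<le> t + 1 + pi / e"
        then have s': "t0 \<le> s" using t by simp
        show "s \<in> J" using J[OF s'] .
        have "hh s \<le> hh (t + 1)" using hm[of "t + 1" s] s t by simp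
        moreover have "c * cos (th s) / r s \<ge> 0" using C[OF s'] rpos[OF J[OF s']] c1 by simp
        ultimately show "e \<le> kap s" unfolding kap_hh[OF J[OF s']] e_def by argo
      qed (use e in simp)
      moreover have "e * (t + 1 + pi / e - (t + 1)) = pi" using e by simp
      ultimately have gr: "th (t + 1 + pi / e) \<ge> th (t + 1) + pi" by simp
      have "pi / e > 0" using e by simp
      then have p: "t0 \<le> t + 1 + pi / e" "t0 \<le> t + 1" using t by linarith+
      show False using gr thn[OF p(2)] thl[OF p(1)] pi_gt_zero by linarith
    qed
    define ta where "ta = t0 + 1"
    define K where "K = x ta * sin (th ta)"
    have ta: "t0 \<le> ta" "t0 < ta" by (auto simp: ta_def)
    have xa: "x ta > 0" using xs[of t0 ta] ta x0 by simp
    have sa: "sin (th ta) > 0" using ths[of t0 ta] th0 ta thl[of ta] by (intro sin_gt_zero) auto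
    have K: "K > 0" using xa sa by (simp add: K_def)
    have ra: "r ta > 0" using rpos[OF J[OF ta(1)]] .
    \<comment> \<open>Positivity of \<open>hh\<close> reads
      \<open>r * cos (th) > x * sin (th) >= K\<close>, and \<open>r\<close> grows at most at unit
      speed. The resulting lower bound for \<open>x' = cos (th)\<close> has a divergent logarithmic
      integral, so \<open>x\<close> exceeds every level.\<close>
    have CK: "cos (th t) \<ge> K / (r ta + (t - ta))" if t: "ta \<le> t" for t
    proof -
      have t': "t0 \<le> t" using t ta by simp
      have "th ta \<le> th t" using ths[of ta t] ta t by (cases "t = ta") auto
      then have "sin (th ta) \<le> sin (th t)"
        using thn[of ta] thl[OF t'] ta by (intro sin_monotone_2pi_le) auto
      moreover have "x ta \<le> x t" using xs[of ta t] ta t by (cases "t = ta") auto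
      ultimately have "K \<le> x t * sin (th t)" unfolding K_def using xa sa by (intro mult_mono) auto
      also have "\<dots> \<le> r t * cos (th t)" using hp[OF t'] by (simp add: hh_def)
      also have "\<dots> \<le> (r ta + (t - ta)) * cos (th t)"
        using speed_bound(2)[OF J[OF ta(1)] J[OF t'] t] C[OF t'] by (intro mult_right_mono) auto
      finally show ?thesis using ra t by (simp add: field_simps)
    qed
    \<comment> \<open>Beyond this level \<open>x * gg >= 1 + 2 * c / r ta\<close>, while
      \<open>kap > 0\<close> gives \<open>hh * sin (th) <= 2 * c / r ta\<close>; hence
      \<open>QQ >= 1\<close>. The next two constants invert the logarithm to ensure
      \<open>x tb >= X\<close>.\<close>
    define X where "X = (1 + 2 * c / r ta) / gg t0"
    have X: "X > 0" using ra g0 c1 by (simp add: X_def add_pos_nonneg)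
    define y where "y = (X + K * ln (r ta)) / K"
    define tb where "tb = ta + exp y"
    have tb: "ta \<le> tb" "t0 \<le> tb" using ta by (auto simp: tb_def add_increasing2)
    have xb: "x tb \<ge> X"
    proof -
      have "x tb - K * ln (r ta + (tb - ta)) \<ge> x ta - K * ln (r ta + (ta - ta)) + 0 * (tb - ta)"
      proof (rule deriv_lower[OF tb(1), where f' = "\<lambda>t. cos (th t) - K * (1 / (r ta + (t - ta)))"])
        fix s assume s: "ta \<le> s" "s \<le> tb"
        have p: "r ta + (s - ta) > 0" using ra s by simp
        show "((\<lambda>t. x t - K * ln (r ta + (t - ta))) has_real_derivative cos (th s) - K * (1 / (r ta + (s - ta)))) (at s)"
          using p s ta by (auto intro!: derivative_eq_intros dx J)
        show "0 \<le> cos (th s) - K * (1 / (r ta + (s - ta)))" using CK[OF s(1)] by simp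
      qed
      moreover have "ln (r ta + (tb - ta)) \<ge> y"
      proof -
        have "ln (exp y) \<le> ln (r ta + (tb - ta))" unfolding tb_def using ra
          by (subst ln_le_cancel_iff) (auto simp: add_pos_pos)
        then show ?thesis by simp
      qed
      then have "K * ln (r ta + (tb - ta)) \<ge> K * y" using K by simp
      moreover have "K * y = X + K * ln (r ta)" using K by (simp add: y_def)
      ultimately show ?thesis using xa by simp
    qed
    have ggm: "gg t \<ge> gg t0" if "t0 \<le> t" for t
      by (rule gg_mono[OF t0 J[OF that] that x0 th0, THEN conjunct2]) (use kp thn thl in \<open>auto intro: less_imp_le\<close>)
    \<comment> \<open>At rate \<open>1/2\<close> or more, \<open>gg\<close> gains \<open>c\<close>
      within time \<open>2 * c\<close> and so passes its upper bound.\<close>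
    have "gg (tb + 2 * c) \<ge> gg tb + 1/2 * (tb + 2 * c - tb)"
    proof (rule deriv_lower[where f' = "\<lambda>t. QQ t / (2 * cos (th t))"])
      fix t assume t: "tb \<le> t" "t \<le> tb + 2 * c"
      then have t': "t0 \<le> t" "ta \<le> t" using tb by auto
      have Ct: "cos (th t) > 0" using C[OF t'(1)] .
      show "(gg has_real_derivative QQ t / (2 * cos (th t))) (at t)" using dgg[OF J[OF t'(1)]] Ct by simp
      have "x tb \<le> x t" using xs[of tb t] tb t by (cases "t = tb") auto
      then have "x t \<ge> X" using xb by simp
      then have "x t * gg t \<ge> X * gg t0" using X g0 ggm[OF t'(1)] by (intro mult_mono) auto
      moreover have "X * gg t0 = 1 + 2 * c / r ta" using g0 by (simp add: X_def)
      moreover have "hh t * sin (th t) \<le> 2 * c / r ta"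
      proof -
        have "hh t \<le> 2 * (c * cos (th t) / r t)" using kap_hh[OF J[OF t'(1)]] kp[OF t'(1)] by argo
        also have "\<dots> \<le> 2 * (c * 1 / r ta)"
          using c1 Ct ra rm[OF ta(1) t'(2)] by (intro frac_le mult_left_mono) auto
        finally have "hh t \<le> 2 * c / r ta" by simp
        moreover have "hh t * sin (th t) \<le> hh t * 1" using hp[OF t'(1)] by (intro mult_left_mono) auto
        ultimately show ?thesis by simp
      qed
      ultimately have "QQ t \<ge> 1" unfolding QQ_def by linarith
      then have "QQ t / (2 * cos (th t)) \<ge> 1 / (2 * cos (th t))" using Ct by (intro divide_right_mono) auto
      moreover have "1 / (2 * cos (th t)) \<ge> 1 / 2" using Ct by (simp add: field_simps)
      ultimately show "1/2 \<le> QQ t / (2 * cos (th t))" by linarith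
    qed (use c1 in simp)
    then have gbig: "gg (tb + 2 * c) > c" using ggm[OF tb(2)] g0 by argo
    define t where "t = tb + 2 * c"
    have t': "t0 \<le> t" using tb c1 by (simp add: t_def)
    have "gg t = c - r t * hh t / (2 * cos (th t))"
      unfolding gg_def kap_hh[OF J[OF t']] using C[OF t'] rpos[OF J[OF t']] by (simp add: field_simps)
    moreover have "r t * hh t / (2 * cos (th t)) > 0" using hp[OF t'] C[OF t'] rpos[OF J[OF t']] by simp
    ultimately show False using gbig by (simp add: t_def)
  qed
  then obtain b where b: "b \<in> J" "t0 \<le> b" "th b \<ge> pi / 2" by blast
  obtain t1 where t1: "t0 < t1" "t1 \<le> b" "th t1 = pi / 2" "\<And>s. t0 \<le> s \<Longrightarrow> s < t1 \<Longrightarrow> th s < pi / 2"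
    using first_hit[of t0 b th "pi / 2"] b th0 cont(3)[OF Icc[OF t0 b(1)]] pi_half_gt_zero by metis
  have t1J: "t1 \<in> J" using betw[OF t0 b(1)] t1 by simp
  have i: "kap t > 0 \<and> 0 \<le> th t" if "t0 \<le> t" "t < t1" for t
    by (rule inv) (use that t1 betw[OF t0 t1J] in auto)
  have "x t0 < x t1"
  proof (rule DERIV_pos_imp_increasing_open[OF t1(1)])
    fix t assume "t0 < t" "t < t1"
    then show "\<exists>y. (x has_real_derivative y) (at t) \<and> 0 < y"
      using dx[of t] betw[OF t0 t1J, of t] i[of t] t1(4)[of t]
      by (intro exI[of _ "cos (th t)"]) (auto intro!: cos_gt_zero_pi)
  qed (intro cont Icc t0 t1J)
  then have "x t1 > 0" using x0 by simp
  moreover from this have "kap t1 > 0" by (simp add: kap_eq t1)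
  ultimately show ?thesis using t1 t1J i by (intro that[of t1]) (auto simp: le_less)
qed

text \<open>\<open>sin (th) = 0\<close> and \<open>kap = 0\<close> force
  \<open>c / r = r / 2\<close>. The horizontal line at this height is a solution, and by uniqueness
  it is the curve.\<close>

lemma horizontal_stationary:
  assumes t0: "t0 \<in> J" and s0: "sin (th t0) = 0" and k0: "kap t0 = 0" and t: "t \<in> J"
  shows "th t = th t0 \<and> r t = r t0 \<and> (r t0)\<^sup>2 = 2 * c"
proof -
  have rp: "r t0 > 0" using rpos[OF t0] .
  have c0: "cos (th t0) \<noteq> 0" using s0 sin_cos_squared_add[of "th t0"] by auto
  have e: "c / r t0 - r t0 / 2 = 0" using k0 c0 s0 by (simp add: kap_eq)
  have "geo_sol n UNIV (\<lambda>t. x t0 + cos (th t0) * (t - t0)) (\<lambda>_. r t0) (\<lambda>_. th t0)"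
    unfolding geo_sol_def using rp e s0 by (auto intro!: derivative_eq_intros)
  from geo_unique[OF g this t0 UNIV_I _ _ _ t UNIV_I]
  have "r t = r t0" "th t = th t0" by auto
  moreover have "(r t0)\<^sup>2 = 2 * c" using e rp by (simp add: field_simps power2_eq_square)
  ultimately show ?thesis by simp
qed

text \<open>The line \<open>x = 0\<close> traversed at unit speed is a solution while
  \<open>r > 0\<close>; the comparison is confined to times less than \<open>r t0\<close> away,
  before it could meet the axis.\<close>

lemma vertical_stationary:
  assumes t0: "t0 \<in> J" and c0: "cos (th t0) = 0" and x0: "x t0 = 0"
  obtains e where "e > 0" "\<And>t. \<bar>t - t0\<bar> < e \<Longrightarrow> t \<in> J \<and> th t = th t0"
proof -
  obtain e1 where e1: "e1 > 0" "ball t0 e1 \<subseteq> J" using openJ t0 by (meson open_contains_ball)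
  define e where "e = min e1 (r t0)"
  have rp: "r t0 > 0" using rpos[OF t0] .
  have e: "e > 0" using e1 rp by (simp add: e_def)
  let ?K = "{t0 - e<..<t0 + e}"
  have h: "geo_sol n ?K (\<lambda>_. 0) (\<lambda>t. r t0 + sin (th t0) * (t - t0)) (\<lambda>_. th t0)"
    unfolding geo_sol_def
  proof (intro conjI ballI)
    fix t assume t: "t \<in> ?K"
    have "\<bar>sin (th t0) * (t - t0)\<bar> \<le> 1 * \<bar>t - t0\<bar>" unfolding abs_mult by (intro mult_right_mono) auto
    moreover have "\<bar>t - t0\<bar> < r t0" using t by (auto simp: e_def)
    ultimately show "r t0 + sin (th t0) * (t - t0) > 0" by argo
  qed (use e c0 in \<open>auto intro!: derivative_eq_intros simp: is_interval_def\<close>)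
  show ?thesis
  proof (rule that[OF e])
    fix t assume t: "\<bar>t - t0\<bar> < e"
    then have "t \<in> ball t0 e1" "t \<in> ?K" by (auto simp: dist_real_def e_def)
    moreover have "t0 \<in> ?K" using e by simp
    ultimately show "t \<in> J \<and> th t = th t0"
      using geo_unique[OF g h t0, of t] e1 x0 by auto
  qed
qed

text \<open>All other sign patterns of \<open>th\<close> and \<open>kap\<close> are eliminated by
  following the curve: a concave ascent leads to a peak, a peak to a descent, a descent to the axis
  or to positive curvature and thereby to a valley, and a valley at \<open>x >= 0\<close> to a
  vertical tangent, which the bounds on \<open>th\<close> exclude. The pattern
  \<open>th = 0\<close>, \<open>kap = 0\<close> belongs to the constant solution.\<close>

lemma graph_trichotomy:
  assumes JJ: "{t0..} \<subseteq> J" and x0: "x t0 \<ge> 0"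
    and th: "\<And>t. t \<ge> t0 \<Longrightarrow> - (pi/2) < th t \<and> th t < pi/2"
    and nc: "\<not> (\<forall>t\<in>J. th t = 0 \<and> (r t)\<^sup>2 = 2 * c)" and t: "t0 \<le> t"
  shows "th t > 0 \<and> kap t > 0"
proof -
  have J: "t \<in> J" if "t0 \<le> t" for t using JJ that by auto
  have C: "cos (th t) > 0" if "t0 \<le> t" for t using th[OF that] by (intro cos_gt_zero_pi) auto
  have xn: "x t \<ge> 0" if "t0 \<le> t" for t
  proof -
    have "x t \<ge> x t0 + 0 * (t - t0)"
      by (rule x_mono) (use that J C in \<open>auto intro: less_imp_le\<close>)
    then show ?thesis using x0 by simp
  qed
  have valley: False if a: "t0 \<le> a" "th a = 0" "kap a > 0" for a
  proof -
    obtain t1 where "a < t1" "th t1 = pi/2" using valley_reaches_vertical[OF J[OF a(1)] a(2,3) xn[OF a(1)]] by metis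
    then show False using th[of t1] a by auto
  qed
  have q4: False if a: "t0 \<le> a" "th a < 0" "kap a > 0" for a
  proof -
    have "- (pi/2) < th a" using th[OF a(1)] by simp
    from descending_reaches_valley[OF J[OF a(1)] this a(2,3)]
    obtain t1 where "a < t1" "th t1 = 0" "kap t1 > 0" by (metis less_imp_le order_refl)
    then show False using valley[of t1] a by auto
  qed
  \<comment> \<open>At such a point the source in \<open>dkap\<close> is strictly positive, so
    \<open>kap > 0\<close> just afterwards while \<open>th\<close> is still negative, and
    \<open>q4\<close> applies.\<close>
  have q3z: False if a: "t0 \<le> a" "th a < 0" "kap a = 0" for a
  proof -
    have "sin (th a) < 0" using a th[OF a(1)] sin_gt_zero[of "- th a"] by simp
    then have "sin (th a) * cos (th a) < 0" using C[OF a(1)] by (simp add: mult_neg_pos)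
    then have "- (c / (r a)\<^sup>2 * (sin (th a) * cos (th a))) > 0"
      using c1 rpos[OF J[OF a(1)]] by (simp add: mult_pos_neg divide_less_0_iff)
    then have "0 < AA a * kap a - c / (r a)\<^sup>2 * (sin (th a) * cos (th a))" using a(3) by simp
    from DERIV_pos_inc_right[OF dkap[OF J[OF a(1)]] this] a(3)
    obtain d where d: "d > 0" "\<And>h. 0 < h \<Longrightarrow> h < d \<Longrightarrow> 0 < kap (a + h)" by auto
    have "isCont th a" using dth[OF J[OF a(1)]] DERIV_isCont by blast
    then have "eventually (\<lambda>s. th s < 0) (at a)" using a(2) unfolding isCont_def by (rule order_tendstoD)
    then obtain d' where d': "d' > 0" "\<And>s. s \<noteq> a \<Longrightarrow> dist s a < d' \<Longrightarrow> th s < 0" unfolding eventually_at by auto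
    define h where "h = min d d' / 2"
    have h: "0 < h" "h < d" "h < d'" using d(1) d'(1) by (auto simp: h_def)
    show False using q4[of "a + h"] d(2)[of h] d'(2)[of "a + h"] h a by (auto simp: dist_real_def)
  qed
  have q3: False if a: "t0 \<le> a" "th a < 0" for a
  proof (cases "kap a < 0")
    case True
    show ?thesis
    proof (cases "\<exists>b\<ge>a. kap b \<ge> 0")
      case True
      then obtain b where b: "b \<ge> a" "kap b \<ge> 0" by blast
      obtain s where s: "a < s" "s \<le> b" "kap s = 0" "\<And>u. a \<le> u \<Longrightarrow> u < s \<Longrightarrow> kap u < 0"
        using first_hit[of a b kap 0] b \<open>kap a < 0\<close> contk[of "{a..b}"] JJ a
        by (metis (no_types, opaque_lifting) Icc J order_trans)
      have "th s \<le> th a" by (rule th_decrease) (use s a J in auto)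
      then show False using q3z[of s] s a by auto
    next
      case False
      then have kn: "kap b < 0" if "b \<ge> a" for b using that by force
      have ra: "r a > 0" using rpos[OF J[OF a(1)]] .
      define e where "e = - sin (th a)"
      have e: "e > 0" using a th[OF a(1)] sin_lt_zero by (simp add: e_def sin_gt_zero flip: sin_minus)
      \<comment> \<open>With \<open>kap\<close> negative for ever the descent stays at least as
        steep as at \<open>a\<close>, so \<open>r\<close> would be exhausted after time
        \<open>r a / e\<close>.\<close>
      have "r (a + r a / e) \<le> r a + (- e) * (a + r a / e - a)"
      proof (rule deriv_upper[OF _ dr])
        fix s assume s: "a \<le> s" "s \<le> a + r a / e"
        have "th s \<le> th a" by (rule th_decrease) (use s a J kn in auto)
        then show "sin (th s) \<le> - e" unfolding e_def
          using th[of s] s a th[OF a(1)] sin_monotone_2pi_le[of "th s" "th a"] by auto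
      qed (use e ra J a in auto)
      then have "r (a + r a / e) \<le> 0" using e by simp
      moreover have "t0 \<le> a + r a / e" using a e ra by (meson add_increasing2 divide_nonneg_pos less_imp_le order_trans le_add_same_cancel1)
      ultimately show False using rpos[OF J] by (metis not_less)
    qed
  next
    case False
    then show ?thesis using q3z[of a] q4[of a] a by force
  qed
  have peak: False if a: "t0 \<le> a" "th a = 0" "kap a < 0" for a
  proof -
    from DERIV_neg_dec_right[OF dth[OF J[OF a(1)]] a(3)] a(2)
    obtain d where d: "d > 0" "\<And>h. 0 < h \<Longrightarrow> h < d \<Longrightarrow> th (a + h) < 0" by auto
    show False using q3[of "a + d/2"] d(2)[of "d/2"] d(1) a by auto
  qed
  have zero: False if a: "t0 \<le> a" "th a = 0" "kap a = 0" for a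
  proof -
    have "\<forall>t\<in>J. th t = 0 \<and> (r t)\<^sup>2 = 2 * c"
      using horizontal_stationary[OF J[OF a(1)] _ a(3)] a by auto
    then show False using nc by blast
  qed
  have q2: False if a: "t0 \<le> a" "th a > 0" "kap a < 0" for a
  proof -
    have "th a < pi/2" using th[OF a(1)] by simp
    from concave_ascent_reaches_peak[OF J[OF a(1)] a(2) this a(3)]
    obtain t1 where "a < t1" "th t1 = 0" "kap t1 < 0" by (metis less_imp_le order_refl)
    then show False using peak[of t1] a by auto
  qed
  have q2z: False if a: "t0 \<le> a" "th a > 0" "kap a = 0" for a
  proof -
    have "sin (th a) > 0" using a th[OF a(1)] by (intro sin_gt_zero) auto
    then have "c / (r a)\<^sup>2 * (sin (th a) * cos (th a)) > 0"
      using c1 rpos[OF J[OF a(1)]] C[OF a(1)] by (intro mult_pos_pos divide_pos_pos) auto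
    then have "AA a * kap a - c / (r a)\<^sup>2 * (sin (th a) * cos (th a)) < 0" using a(3) by simp
    from DERIV_neg_dec_right[OF dkap[OF J[OF a(1)]] this] a(3)
    obtain d where d: "d > 0" "\<And>h. 0 < h \<Longrightarrow> h < d \<Longrightarrow> kap (a + h) < 0" by auto
    have "isCont th a" using dth[OF J[OF a(1)]] DERIV_isCont by blast
    then have "eventually (\<lambda>s. th s > 0) (at a)" using a(2) unfolding isCont_def by (rule order_tendstoD)
    then obtain d' where d': "d' > 0" "\<And>s. s \<noteq> a \<Longrightarrow> dist s a < d' \<Longrightarrow> th s > 0" unfolding eventually_at by auto
    define h where "h = min d d' / 2"
    have h: "0 < h" "h < d" "h < d'" using d(1) d'(1) by (auto simp: h_def)
    show False using q2[of "a + h"] d(2)[of h] d'(2)[of "a + h"] h a by (auto simp: dist_real_def)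
  qed
  show ?thesis
    using q3[OF t] valley[OF t] zero[OF t] peak[OF t] q2[OF t] q2z[OF t] by (meson linorder_neqE)
qed

end

section \<open>Solution graphs\<close>

lemma DERIV_inverse_strong:
  fixes f :: "real \<Rightarrow> real"
  assumes "open S" "x \<in> S" "continuous_on S f" "\<And>z. z \<in> S \<Longrightarrow> g (f z) = z"
    "(f has_real_derivative D) (at x)" "D \<noteq> 0"
  shows "(g has_real_derivative inverse D) (at (f x))"
  unfolding has_field_derivative_def
  by (rule has_derivative_inverse_strong[OF assms(1-4) assms(5)[unfolded has_field_derivative_def]])
    (use assms(6) in \<open>auto simp: fun_eq_iff\<close>)

lemma increasing_bijection_inverse:
  fixes S :: "real \<Rightarrow> real"
  assumes d: "\<And>\<xi>. (S has_real_derivative w \<xi>) (at \<xi>)" and w: "\<And>\<xi>. w \<xi> \<ge> 1"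
  obtains X where "\<And>t. S (X t) = t" "\<And>\<xi>. X (S \<xi>) = \<xi>" "\<And>t. (X has_real_derivative 1 / w (X t)) (at t)"
proof -
  have wp: "w \<xi> > 0" for \<xi> using w[of \<xi>] by linarith
  have sm: "S a < S b" if "a < b" for a b by (rule deriv_strict[OF that d wp])
  have inj: "inj S" by (rule injI) (metis sm linorder_neqE less_irrefl)
  have cont: "continuous_on A S" for A by (meson DERIV_isCont continuous_at_imp_continuous_on d)
  have surj: "\<exists>\<xi>. S \<xi> = t" for t
  proof -
    define K where "K = \<bar>t - S 0\<bar>"
    have up: "S K \<ge> S 0 + 1 * (K - 0)" by (rule deriv_lower[OF _ d w]) (simp add: K_def)
    have lo: "S 0 \<ge> S (- K) + 1 * (0 - - K)" by (rule deriv_lower[OF _ d w]) (simp add: K_def)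
    have "S (- K) \<le> t" "t \<le> S K" using up lo by (auto simp: K_def)
    then show ?thesis using IVT'[of S "-K" t K, OF _ _ _ cont] by (auto simp: K_def)
  qed
  define X where "X = inv S"
  have SX: "S (X t) = t" for t unfolding X_def using surj by (metis f_inv_into_f rangeI)
  have XS: "X (S \<xi>) = \<xi>" for \<xi> unfolding X_def using inj by simp
  have "(X has_real_derivative inverse (w (X t))) (at (S (X t)))" for t
    by (rule DERIV_inverse_strong[of UNIV _ S]) (use d wp[of "X t"] XS cont in auto)
  then show ?thesis using SX XS by (intro that) (auto simp: divide_inverse)
qed

lemma ode_solD:
  assumes "ode_sol n {d<..} u u' u''" "\<xi> > d"
  shows "u \<xi> > 0" "(u has_real_derivative u' \<xi>) (at \<xi>)" "(u' has_real_derivative u'' \<xi>) (at \<xi>)"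
    "u'' \<xi> = ((\<xi> * u' \<xi> - u \<xi>) / 2 + (real n - 1) / u \<xi>) * (1 + (u' \<xi>)\<^sup>2)"
proof -
  have at: "at \<xi> within {d<..} = at \<xi>" by (rule at_within_open) (use assms(2) in auto)
  have "\<forall>\<xi>\<in>{d<..}. u \<xi> > 0 \<and> (u has_real_derivative u' \<xi>) (at \<xi> within {d<..}) \<and>
      (u' has_real_derivative u'' \<xi>) (at \<xi> within {d<..}) \<and>
      u'' \<xi> = ((\<xi> * u' \<xi> - u \<xi>) / 2 + (real n - 1) / u \<xi>) * (1 + (u' \<xi>)\<^sup>2)"
    using assms(1) by (simp only: ode_sol_def)
  then have H: "u \<xi> > 0 \<and> (u has_real_derivative u' \<xi>) (at \<xi> within {d<..}) \<and>
      (u' has_real_derivative u'' \<xi>) (at \<xi> within {d<..}) \<and>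
      u'' \<xi> = ((\<xi> * u' \<xi> - u \<xi>) / 2 + (real n - 1) / u \<xi>) * (1 + (u' \<xi>)\<^sup>2)"
    by (rule bspec) (simp add: assms(2))
  show "u \<xi> > 0" by (rule H[THEN conjunct1])
  show "(u has_real_derivative u' \<xi>) (at \<xi>)"
    using H[THEN conjunct2, THEN conjunct1] at by simp
  show "(u' has_real_derivative u'' \<xi>) (at \<xi>)"
    using H[THEN conjunct2, THEN conjunct2, THEN conjunct1] by (simp only: at)
  show "u'' \<xi> = ((\<xi> * u' \<xi> - u \<xi>) / 2 + (real n - 1) / u \<xi>) * (1 + (u' \<xi>)\<^sup>2)"
    by (rule H[THEN conjunct2, THEN conjunct2, THEN conjunct2])
qed

lemma curv_arctan:
  "curv c \<xi> v (arctan p) = ((\<xi> * p - v) / 2 + c / v) / sqrt (1 + p\<^sup>2)"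
  by (simp add: curv_def sin_arctan cos_arctan add_divide_distrib diff_divide_distrib algebra_simps)

lemma graph_to_curve:
  assumes o: "ode_sol n {d<..} u u' u''" and a: "d < a"
  obtains T X where "geo_sol n {T<..} X (\<lambda>t. u (X t)) (\<lambda>t. arctan (u' (X t)))"
    "\<And>t. T < t \<Longrightarrow> a < X t" "\<And>\<xi>. a < \<xi> \<Longrightarrow> \<exists>t>T. X t = \<xi>"
proof -
  \<comment> \<open>The arc-length density is frozen to the left of \<open>a\<close>, so that its
    primitive is a bijection of the whole line; only parameters beyond \<open>S a\<close> are
    used.\<close>
  define w where "w \<xi> = sqrt (1 + (u' (max a \<xi>))\<^sup>2)" for \<xi>
  note D = ode_solD[OF o]
  have cu: "continuous_on {d<..} u'"
    by (meson D(3) DERIV_isCont continuous_at_imp_continuous_on greaterThan_iff)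
  have "continuous_on UNIV (\<lambda>\<xi>. u' (max a \<xi>))"
    by (rule continuous_on_compose2[OF cu]) (use a in \<open>auto intro!: continuous_intros\<close>)
  then have cw: "continuous_on UNIV w" unfolding w_def by (intro continuous_intros)
  obtain S where S: "\<And>\<xi>. (S has_vector_derivative w \<xi>) (at \<xi>)"
    using antiderivative_UNIV[OF cw] by metis
  have w1: "w \<xi> \<ge> 1" for \<xi> unfolding w_def by (simp add: real_le_rsqrt)
  obtain X where X: "\<And>t. S (X t) = t" "\<And>\<xi>. X (S \<xi>) = \<xi>" "\<And>t. (X has_real_derivative 1 / w (X t)) (at t)"
    using increasing_bijection_inverse[of S w] S w1 by (metis has_real_derivative_iff_has_vector_derivative)
  have Sm: "S p < S q" if "p < q" for p q
  proof (rule deriv_strict[OF that])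
    show "(S has_real_derivative w \<xi>) (at \<xi>)" for \<xi> using S by (simp add: has_real_derivative_iff_has_vector_derivative)
    show "w \<xi> > 0" for \<xi> using w1[of \<xi>] by linarith
  qed
  have gt: "a < X t" if "S a < t" for t
  proof (rule ccontr)
    assume "\<not> a < X t"
    then have "S (X t) \<le> S a" using Sm[of "X t" a] by (cases "X t = a") auto
    then show False using that X by simp
  qed
  show ?thesis
  proof (rule that[of "S a" X])
    show "geo_sol n {S a<..} X (\<lambda>t. u (X t)) (\<lambda>t. arctan (u' (X t)))" unfolding geo_sol_def
    proof (intro conjI ballI)
      fix t assume "t \<in> {S a<..}"
      then have aX: "a < X t" using gt by auto
      then have dX: "d < X t" using a by simp
      let ?p = "u' (X t)"
      have wt: "w (X t) = sqrt (1 + ?p\<^sup>2)" using aX by (simp add: w_def max_def)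
      have sp: "sqrt (1 + ?p\<^sup>2) > 0" by (simp add: add_pos_nonneg)
      have ss: "sqrt (1 + ?p\<^sup>2) * sqrt (1 + ?p\<^sup>2) = 1 + ?p\<^sup>2" by (simp add: add_nonneg_nonneg)
      show "u (X t) > 0" using D(1)[OF dX] .
      have dXt: "(X has_real_derivative cos (arctan ?p)) (at t)" using X(3)[of t] unfolding wt cos_arctan .
      then show "(X has_real_derivative cos (arctan ?p)) (at t)" .
      have "((\<lambda>t. u (X t)) has_real_derivative ?p * cos (arctan ?p)) (at t)"
        by (rule DERIV_chain2[OF D(2)[OF dX] dXt])
      then show "((\<lambda>t. u (X t)) has_real_derivative sin (arctan ?p)) (at t)"
        by (simp add: sin_arctan cos_arctan)
      have "((\<lambda>t. arctan (u' (X t))) has_real_derivative inverse (1 + ?p\<^sup>2) * (u'' (X t) * cos (arctan ?p))) (at t)"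
        by (rule DERIV_chain2[OF DERIV_arctan DERIV_chain2[OF D(3)[OF dX] dXt]])
      moreover have "inverse (1 + ?p\<^sup>2) * (u'' (X t) * cos (arctan ?p)) = curv (real n - 1) (X t) (u (X t)) (arctan ?p)"
      proof -
        have "1 + ?p\<^sup>2 \<noteq> 0" by (metis add_pos_nonneg less_irrefl zero_le_power2 zero_less_one)
        then have *: "inverse (1 + ?p\<^sup>2) * (E * (1 + ?p\<^sup>2) * (1 / q)) = E / q" for E q :: real
          by simp
        show ?thesis unfolding curv_arctan D(4)[OF dX] cos_arctan by (rule *)
      qed
      ultimately show "((\<lambda>t. arctan (u' (X t))) has_real_derivative
        X t / 2 * sin (arctan ?p) + ((real n - 1) / u (X t) - u (X t) / 2) * cos (arctan ?p)) (at t)"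
        by (simp add: curv_def)
    qed (auto simp: is_interval_def)
    show "a < X t" if "S a < t" for t using gt[OF that] .
    show "\<exists>t>S a. X t = \<xi>" if "a < \<xi>" for \<xi> using Sm[OF that] X(2) by blast
  qed
qed

lemma graph_in_max_curve:
  assumes o: "ode_sol n {d<..} u u' u''" and a: "d < a" and n: "n \<ge> 2"
  obtains J x r th T where "mcurve n J x r th" "{T<..} \<subseteq> J"
    "\<And>t. T < t \<Longrightarrow> a < x t \<and> r t = u (x t) \<and> th t = arctan (u' (x t))"
    "\<And>\<xi>. a < \<xi> \<Longrightarrow> \<exists>t>T. x t = \<xi>"
proof -
  obtain T X where X: "geo_sol n {T<..} X (\<lambda>t. u (X t)) (\<lambda>t. arctan (u' (X t)))"
    "\<And>t. T < t \<Longrightarrow> a < X t" "\<And>\<xi>. a < \<xi> \<Longrightarrow> \<exists>t>T. X t = \<xi>"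
    using graph_to_curve[OF o a] by metis
  have "u (X (T + 1)) > 0" using geo_solD(3)[OF X(1), of "T + 1"] by simp
  then obtain J x r th where m: "max_geo_sol n J x r th" "T + 1 \<in> J" "x (T + 1) = X (T + 1)"
    "r (T + 1) = u (X (T + 1))" "th (T + 1) = arctan (u' (X (T + 1)))"
    using max_geo_exists by metis
  have sub: "{T<..} \<subseteq> J" by (rule max_geo_contains[OF m(1) X(1) m(2)]) (use m in auto)
  have g: "geo_sol n J x r th" using m by (simp add: max_geo_sol_def)
  have "x t = X t \<and> r t = u (X t) \<and> th t = arctan (u' (X t))" if "T < t" for t
    by (rule geo_unique[OF g X(1) m(2)]) (use m that sub in auto)
  then show ?thesis
    using m(1) n sub X(2,3) by (intro that[of J x r th T]) (auto simp: mcurve_def, metis)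
qed

text \<open>One bad point \<open>x1\<close> suffices: by \<open>graph_trichotomy\<close> started
  there, the maximal curve carrying the graph is the horizontal line, so \<open>u\<close> takes the
  constant value at every other point as well.\<close>

lemma graph_signs:
  assumes o: "ode_sol n {d<..} u u' u''" and d: "d \<ge> 0" and n: "n \<ge> 2"
  shows "(\<forall>\<xi>>d. u \<xi> = sqrt (2 * (real n - 1))) \<or> (\<forall>\<xi>>d. u' \<xi> > 0 \<and> u'' \<xi> > 0)"
proof (rule ccontr)
  assume neg: "\<not> ?thesis"
  then obtain x1 where x1: "x1 > d" "\<not> (u' x1 > 0 \<and> u'' x1 > 0)" by blast
  have "u \<xi> = sqrt (2 * (real n - 1))" if xi: "\<xi> > d" for \<xi>
  proof -
    define a where "a = (d + min \<xi> x1) / 2"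
    have a: "d < a" "a < \<xi>" "a < x1" using xi x1 by (auto simp: a_def)
    obtain J x r th T where m: "mcurve n J x r th" "{T<..} \<subseteq> J"
      "\<And>t. T < t \<Longrightarrow> a < x t \<and> r t = u (x t) \<and> th t = arctan (u' (x t))"
      "\<And>\<xi>. a < \<xi> \<Longrightarrow> \<exists>t>T. x t = \<xi>"
      using graph_in_max_curve[OF o a(1) n] by metis
    interpret mcurve n J x r th by (rule m(1))
    obtain t1 where t1: "t1 > T" "x t1 = x1" using m(4)[OF a(3)] by blast
    have "\<forall>t\<in>J. th t = 0 \<and> (r t)\<^sup>2 = 2 * c"
    proof (rule ccontr)
      assume nc: "\<not> ?thesis"
      have "th t1 > 0 \<and> kap t1 > 0"
      proof (rule graph_trichotomy[OF _ _ _ nc])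
        show "{t1..} \<subseteq> J" using m(2) t1 by (auto intro: order.strict_trans2)
        show "x t1 \<ge> 0" using t1 x1 d by simp
        show "- (pi/2) < th t \<and> th t < pi/2" if "t \<ge> t1" for t
        proof -
          have "T < t" using t1(1) that by simp
          then have "th t = arctan (u' (x t))" using m(3) by blast
          then show ?thesis using arctan_lbound[of "u' (x t)"] arctan_ubound[of "u' (x t)"] by simp
        qed
      qed simp
      moreover have "th t1 = arctan (u' x1)" "kap t1 = curv c x1 (u x1) (arctan (u' x1))"
        using m(3)[OF t1(1)] t1(2) by (simp_all add: kap_def)
      ultimately have "arctan (u' x1) > 0" "((x1 * u' x1 - u x1) / 2 + c / u x1) / sqrt (1 + (u' x1)\<^sup>2) > 0"
        unfolding curv_arctan by simp_all
      then have "u' x1 > 0" "((x1 * u' x1 - u x1) / 2 + c / u x1) / sqrt (1 + (u' x1)\<^sup>2) > 0"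
        by simp_all
      moreover have "sqrt (1 + (u' x1)\<^sup>2) > 0" by (simp add: add_pos_nonneg)
      ultimately have "(x1 * u' x1 - u x1) / 2 + c / u x1 > 0" by (simp only: zero_less_divide_iff) auto
      then have "u'' x1 > 0" unfolding ode_solD(4)[OF o x1(1)] by (intro mult_pos_pos) (auto intro: add_pos_nonneg)
      then show False using x1 \<open>u' x1 > 0\<close> by simp
    qed
    moreover obtain t where t: "t > T" "x t = \<xi>" using m(4)[OF a(2)] by blast
    moreover have "t \<in> J" using m(2) t by auto
    ultimately have "(r t)\<^sup>2 = 2 * c" by blast
    then have "(u \<xi>)\<^sup>2 = 2 * c" using m(3)[OF t(1)] t(2) by simp
    then show ?thesis using ode_solD(1)[OF o xi] by (metis real_sqrt_unique less_imp_le)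
  qed
  then show False using neg by blast
qed

text \<open>Convexity forces \<open>w < 2 * c / u\<close> for \<open>w = u - \<xi> * u'\<close>. The
  bounds then follow from \<open>w = (u - \<sigma> * \<xi>) + \<xi> * (\<sigma> - u')\<close>, a sum
  of two positive terms, so that each of them is smaller than \<open>w\<close>.\<close>

lemma graph_classification:
  assumes o: "ode_sol n {d<..} u u' u''" and d: "d \<ge> 0" and n: "n \<ge> 2"
  obtains "\<forall>\<xi>>d. u \<xi> = sqrt (2 * (real n - 1))"
  | \<sigma> where "\<sigma> > 0" "\<And>\<xi>. \<xi> > d \<Longrightarrow> u' \<xi> > 0 \<and> u'' \<xi> > 0 \<and> u' \<xi> < \<sigma> \<and> u \<xi> > \<sigma> * \<xi> \<and>
      0 < u \<xi> - \<xi> * u' \<xi> \<and> u \<xi> - \<xi> * u' \<xi> < 2 * (real n - 1) / (\<sigma> * \<xi>) \<and>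
      u \<xi> - \<sigma> * \<xi> < 2 * (real n - 1) / (\<sigma> * \<xi>) \<and> \<sigma> - u' \<xi> < 2 * (real n - 1) / (\<sigma> * \<xi>\<^sup>2)"
proof (cases "\<forall>\<xi>>d. u \<xi> = sqrt (2 * (real n - 1))")
  case True then show ?thesis using that by blast
next
  case False
  let ?c = "real n - 1"
  have c: "?c > 0" using n by simp
  have s: "u' \<xi> > 0" "u'' \<xi> > 0" if "\<xi> > d" for \<xi> using graph_signs[OF o d n] False that by blast+
  note D = ode_solD[OF o]
  define w where "w \<xi> = u \<xi> - \<xi> * u' \<xi>" for \<xi>
  have dw: "(w has_real_derivative - (\<xi> * u'' \<xi>)) (at \<xi>)" if "\<xi> > d" for \<xi>
    unfolding w_def by (auto intro!: derivative_eq_intros D that)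
  have wdec: "w b < w a" if "d < a" "a < b" for a b
  proof -
    have "- w a < - w b"
    proof (rule deriv_strict[OF that(2), where f = "\<lambda>t. - w t" and f' = "\<lambda>t. - (- (t * u'' t))"])
      fix t assume "a \<le> t" "t \<le> b"
      then have td: "t > d" "t > 0" using that d by auto
      show "((\<lambda>t. - w t) has_real_derivative - (- (t * u'' t))) (at t)" by (rule DERIV_minus[OF dw[OF td(1)]])
      show "- (- (t * u'' t)) > 0" using td s(2)[OF td(1)] by simp
    qed
    then show ?thesis by simp
  qed
  \<comment> \<open>Otherwise \<open>w\<close> is eventually below a negative constant, and the
    derivative \<open>u'' / (1 + u'^2)\<close> of \<open>arctan u'\<close> is at least
    \<open>e\<close>; over a length \<open>pi / e\<close> this exceeds the range of
    \<open>arctan\<close>.\<close>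
  have wpos: "w x1 > 0" if x1: "x1 > d" for x1
  proof (rule ccontr)
    assume "\<not> w x1 > 0"
    then have "w (x1 + 1) < 0" using wdec[OF x1, of "x1 + 1"] by simp
    define e where "e = - w (x1 + 1) / 2"
    have e: "e > 0" using \<open>w (x1 + 1) < 0\<close> by (simp add: e_def)
    have "arctan (u' (x1 + 1 + pi / e)) \<ge> arctan (u' (x1 + 1)) + e * (x1 + 1 + pi / e - (x1 + 1))"
    proof (rule deriv_lower[where f = "\<lambda>t. arctan (u' t)" and f' = "\<lambda>t. inverse (1 + (u' t)\<^sup>2) * u'' t"])
      fix t assume t: "x1 + 1 \<le> t" "t \<le> x1 + 1 + pi / e"
      then have td: "t > d" using x1 by simp
      show "((\<lambda>t. arctan (u' t)) has_real_derivative inverse (1 + (u' t)\<^sup>2) * u'' t) (at t)"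
        by (rule DERIV_chain2[OF DERIV_arctan D(3)[OF td]])
      have "w t \<le> w (x1 + 1)" using wdec[of "x1 + 1" t] x1 t by (cases "t = x1 + 1") auto
      moreover have "?c / u t > 0" using c D(1)[OF td] by simp
      ultimately have "e \<le> (t * u' t - u t) / 2 + ?c / u t" unfolding e_def w_def by argo
      moreover have "1 + (u' t)\<^sup>2 \<noteq> 0" by (metis add_pos_nonneg less_irrefl zero_le_power2 zero_less_one)
      then have "inverse (1 + (u' t)\<^sup>2) * (E * (1 + (u' t)\<^sup>2)) = E" for E by simp
      ultimately show "e \<le> inverse (1 + (u' t)\<^sup>2) * u'' t" unfolding D(4)[OF td] by metis
    qed (use e in simp)
    moreover have "e * (x1 + 1 + pi / e - (x1 + 1)) = pi" using e by simp
    ultimately have "arctan (u' (x1 + 1 + pi / e)) \<ge> arctan (u' (x1 + 1)) + pi" by simp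
    then show False using arctan_lbound[of "u' (x1 + 1)"] arctan_ubound[of "u' (x1 + 1 + pi / e)"] by linarith
  qed
  have wub: "w \<xi> < 2 * (?c / u \<xi>)" if xi: "\<xi> > d" for \<xi>
  proof -
    have "0 < ((\<xi> * u' \<xi> - u \<xi>) / 2 + ?c / u \<xi>) * (1 + (u' \<xi>)\<^sup>2)"
      using s(2)[OF xi] unfolding D(4)[OF xi] .
    then have "0 < (\<xi> * u' \<xi> - u \<xi>) / 2 + ?c / u \<xi>"
      by (rule zero_less_mult_pos2) (rule add_pos_nonneg, simp_all)
    then show ?thesis unfolding w_def by argo
  qed
  have pinc: "u' a < u' b" if "d < a" "a < b" for a b
    by (rule deriv_strict[OF that(2) D(3)]) (use that s in auto)
  have qdec: "u b / b < u a / a" if "d < a" "a < b" for a b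
  proof -
    have "- (u a / a) < - (u b / b)"
    proof (rule deriv_strict[OF that(2), where f = "\<lambda>t. - (u t / t)" and f' = "\<lambda>t. w t / (t * t)"])
      fix t assume t: "a \<le> t" "t \<le> b"
      then have td: "t > d" "t > 0" using that d by auto
      show "((\<lambda>t. - (u t / t)) has_real_derivative w t / (t * t)) (at t)"
        using td unfolding w_def
        by (auto intro!: derivative_eq_intros D simp: field_simps)
      show "w t / (t * t) > 0" using wpos[OF td(1)] td by simp
    qed
    then show ?thesis by simp
  qed
  have pq: "u' \<xi> < u \<xi> / \<xi>" if "\<xi> > d" for \<xi>
    using wpos[OF that] that d by (simp add: w_def field_simps)
  have pqall: "u' y < u \<xi> / \<xi>" if "\<xi> > d" "y > d" for \<xi> y
  proof (cases "y \<le> \<xi>")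
    case True
    then have "u' y \<le> u' \<xi>" using pinc[of y \<xi>] that by (cases "y = \<xi>") auto
    then show ?thesis using pq[OF that(1)] by simp
  next
    case False
    then show ?thesis using qdec[of \<xi> y] pq[of y] that by auto
  qed
  \<comment> \<open>Every slope lies below every quotient \<open>u / \<xi>\<close>, so this supremum
    is finite and at the same time a lower bound of all the quotients.\<close>
  define \<sigma> where "\<sigma> = Sup (u' ` {d<..})"
  have bdd: "bdd_above (u' ` {d<..})"
    by (rule bdd_aboveI[of _ "u (d + 1) / (d + 1)"]) (use pqall[of "d + 1"] in \<open>auto intro: less_imp_le\<close>)
  have ps: "u' \<xi> < \<sigma>" if "\<xi> > d" for \<xi>
  proof -
    have "u' (\<xi> + 1) \<le> \<sigma>" unfolding \<sigma>_def by (rule cSup_upper[OF _ bdd]) (use that in auto)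
    then show ?thesis using pinc[OF that, of "\<xi> + 1"] by simp
  qed
  have us: "\<sigma> * \<xi> < u \<xi>" if xi: "\<xi> > d" for \<xi>
  proof -
    have "\<sigma> \<le> u (\<xi> + 1) / (\<xi> + 1)" unfolding \<sigma>_def
      by (rule cSup_least) (use pqall[of "\<xi> + 1"] xi in \<open>auto intro!: less_imp_le\<close>)
    also have "\<dots> < u \<xi> / \<xi>" using qdec[OF xi, of "\<xi> + 1"] by simp
    finally show ?thesis using xi d by (simp add: field_simps)
  qed
  have sp: "\<sigma> > 0" using ps[of "d + 1"] s(1)[of "d + 1"] by simp
  show ?thesis
  proof (rule that(2)[OF sp])
    fix \<xi> assume xi: "\<xi> > d"
    then have xp: "\<xi> > 0" using d by simp
    have "2 * (?c / u \<xi>) < 2 * (?c / (\<sigma> * \<xi>))"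
      using us[OF xi] sp xp c D(1)[OF xi] by (intro mult_strict_left_mono divide_strict_left_mono) auto
    then have W: "w \<xi> < 2 * ?c / (\<sigma> * \<xi>)" using wub[OF xi] by simp
    have a: "u \<xi> - \<sigma> * \<xi> = w \<xi> - \<xi> * (\<sigma> - u' \<xi>)" by (simp add: w_def algebra_simps)
    have "\<xi> * (\<sigma> - u' \<xi>) > 0" using ps[OF xi] xp by simp
    then have A: "u \<xi> - \<sigma> * \<xi> < 2 * ?c / (\<sigma> * \<xi>)" using a W by linarith
    have "\<xi> * (\<sigma> - u' \<xi>) < 2 * ?c / (\<sigma> * \<xi>)" using a W us[OF xi] by linarith
    moreover have "y < K / \<xi>" if "\<xi> * y < K" for y K using that xp by (simp add: pos_less_divide_eq mult.commute)
    ultimately have "\<sigma> - u' \<xi> < 2 * ?c / (\<sigma> * \<xi>) / \<xi>" by blast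
    then have B: "\<sigma> - u' \<xi> < 2 * ?c / (\<sigma> * \<xi>\<^sup>2)" by (simp add: power2_eq_square mult.assoc)
    show "u' \<xi> > 0 \<and> u'' \<xi> > 0 \<and> u' \<xi> < \<sigma> \<and> u \<xi> > \<sigma> * \<xi> \<and>
      0 < u \<xi> - \<xi> * u' \<xi> \<and> u \<xi> - \<xi> * u' \<xi> < 2 * ?c / (\<sigma> * \<xi>) \<and>
      u \<xi> - \<sigma> * \<xi> < 2 * ?c / (\<sigma> * \<xi>) \<and> \<sigma> - u' \<xi> < 2 * ?c / (\<sigma> * \<xi>\<^sup>2)"
      using s[OF xi] ps[OF xi] us[OF xi] wpos[OF xi] W A B unfolding w_def by blast
  qed
qed

text \<open>Since \<open>x' = cos (th) > 0\<close>, the abscissa serves as parameter. The cube in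
  \<open>u''\<close> consists of \<open>1 / cos ^ 2\<close> from the derivative of
  \<open>tan\<close> and one more factor from the change of parameter.\<close>

lemma (in mcurve) curve_to_graph:
  assumes I: "open I" "is_interval I" "I \<subseteq> J" and C: "\<And>t. t \<in> I \<Longrightarrow> cos (th t) > 0"
  obtains u u' u'' where "\<And>t. t \<in> I \<Longrightarrow> u (x t) = r t \<and> u' (x t) = tan (th t) \<and> u'' (x t) = kap t / cos (th t) ^ 3"
    "ode_sol n (x ` I) u u' u''" "\<And>\<xi>. \<xi> \<in> x ` I \<Longrightarrow> (u has_real_derivative u' \<xi>) (at \<xi>) \<and> (u' has_real_derivative u'' \<xi>) (at \<xi>)"
proof -
  have sm: "x s < x t" if "s \<in> I" "t \<in> I" "s < t" for s t
    by (rule deriv_strict[OF that(3) dx]) (use interval_Icc[OF I(2) that(1,2)] I(3) C in auto)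
  then have inj: "inj_on x I" by (metis inj_onI linorder_neqE less_irrefl)
  define \<tau> where "\<tau> = inv_into I x"
  have tx: "\<tau> (x t) = t" if "t \<in> I" for t unfolding \<tau>_def using inj that by simp
  define u where "u \<xi> = r (\<tau> \<xi>)" for \<xi>
  define u' where "u' \<xi> = tan (th (\<tau> \<xi>))" for \<xi>
  define u'' where "u'' \<xi> = kap (\<tau> \<xi>) / cos (th (\<tau> \<xi>)) ^ 3" for \<xi>
  have dt: "(\<tau> has_real_derivative inverse (cos (th t))) (at (x t))" if t: "t \<in> I" for t
    by (rule DERIV_inverse_strong[of I _ x])
      (use t I C[OF t] tx dx cont(1)[OF I(3)] in auto)
  have d: "(u has_real_derivative u' (x t)) (at (x t))" "(u' has_real_derivative u'' (x t)) (at (x t))"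
    "u'' (x t) = ((x t * u' (x t) - u (x t)) / 2 + c / u (x t)) * (1 + (u' (x t))\<^sup>2)" if t: "t \<in> I" for t
  proof -
    have tJ: "t \<in> J" using t I by auto
    have Ct: "cos (th t) \<noteq> 0" using C[OF t] by simp
    have "(r has_real_derivative sin (th t)) (at (\<tau> (x t)))" unfolding tx[OF t] by (rule dr[OF tJ])
    from DERIV_chain2[OF this dt[OF t]] show "(u has_real_derivative u' (x t)) (at (x t))"
      unfolding u_def u'_def tx[OF t] by (simp add: tan_def divide_inverse)
    have "(th has_real_derivative kap t) (at (\<tau> (x t)))" unfolding tx[OF t] by (rule dth[OF tJ])
    note 1 = DERIV_chain2[OF this dt[OF t]]
    have "(tan has_real_derivative inverse ((cos (th t))\<^sup>2)) (at (th (\<tau> (x t))))"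
      unfolding tx[OF t] by (rule DERIV_tan[OF Ct])
    from DERIV_chain2[OF this 1]
    have "(u' has_real_derivative inverse ((cos (th t))\<^sup>2) * (kap t * inverse (cos (th t)))) (at (x t))"
      unfolding u'_def[abs_def] .
    moreover have "inverse (C\<^sup>2) * (k * inverse C) = k / C ^ 3" for C k :: real
      by (simp add: divide_inverse power2_eq_square power3_eq_cube)
    ultimately show "(u' has_real_derivative u'' (x t)) (at (x t))"
      unfolding u''_def tx[OF t] by simp
    have "X / 2 * S + (q - R / 2) * C = ((X * (S / C) - R) / 2 + q) * C" if "C \<noteq> 0" for X S q R C :: real
      using that by (simp add: field_simps)
    from this[OF Ct] have k: "kap t = ((x t * tan (th t) - r t) / 2 + c / r t) * cos (th t)"
      unfolding kap_eq tan_def .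
    have "E * C / C ^ 3 = E * (inverse C)\<^sup>2" if "C \<noteq> 0" for E C :: real
      using that by (simp add: field_simps power2_eq_square power3_eq_cube)
    from this[OF Ct] show "u'' (x t) = ((x t * u' (x t) - u (x t)) / 2 + c / u (x t)) * (1 + (u' (x t))\<^sup>2)"
      unfolding u_def u'_def u''_def tx[OF t] k tan_sec[OF Ct] .
  qed
  show ?thesis
  proof (rule that[of u u' u''])
    show "u (x t) = r t \<and> u' (x t) = tan (th t) \<and> u'' (x t) = kap t / cos (th t) ^ 3" if "t \<in> I" for t
      using tx[OF that] by (simp add: u_def u'_def u''_def)
    show "ode_sol n (x ` I) u u' u''" unfolding ode_sol_def
    proof (intro ballI, elim imageE, intro conjI)
      fix \<xi> t assume \<xi>: "\<xi> = x t" and t: "t \<in> I"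
      show "u \<xi> > 0" unfolding \<xi> u_def tx[OF t] using rpos t I(3) by blast
      show "(u has_real_derivative u' \<xi>) (at \<xi> within x ` I)"
        "(u' has_real_derivative u'' \<xi>) (at \<xi> within x ` I)"
        unfolding \<xi> by (rule has_field_derivative_at_within[OF d(1)[OF t]] has_field_derivative_at_within[OF d(2)[OF t]])+
      show "u'' \<xi> = ((\<xi> * u' \<xi> - u \<xi>) / 2 + c / u \<xi>) * (1 + (u' \<xi>)\<^sup>2)"
        unfolding \<xi> by (rule d(3)[OF t])
    qed
    show "(u has_real_derivative u' \<xi>) (at \<xi>) \<and> (u' has_real_derivative u'' \<xi>) (at \<xi>)" if "\<xi> \<in> x ` I" for \<xi>
      using d(1,2) that by blast
  qed
qed

lemma at_within_atLeast: "R < x \<Longrightarrow> at x within {R..} = at (x::real)"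
  by (rule at_within_interior) simp

lemma deriv_within_nondecreasing:
  fixes f :: "real \<Rightarrow> real"
  assumes "R \<le> a" "a \<le> b" "\<And>x. R \<le> x \<Longrightarrow> (f has_real_derivative f' x) (at x within {R..})"
    "\<And>x. a < x \<Longrightarrow> x < b \<Longrightarrow> f' x \<ge> 0"
  shows "f a \<le> f b"
proof (rule DERIV_nonneg_imp_increasing_open[OF assms(2)])
  have "continuous_on {R..} f" by (rule DERIV_continuous_on[OF assms(3)]) simp
  then show "continuous_on {a..b} f" by (rule continuous_on_subset) (use assms in auto)
  fix x assume x: "a < x" "x < b"
  then have "(f has_real_derivative f' x) (at x)" using assms(3)[of x] assms(1) at_within_atLeast[of R x] by simp
  then show "\<exists>y. (f has_real_derivative y) (at x) \<and> y \<ge> 0" using assms(4)[OF x] by blast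
qed

section \<open>Solutions asymptotic to a line\<close>

text \<open>Variation of constants, integrated from infinity. The homogeneous solution
  \<open>exp A\<close> blows up, so the free constant has to be \<open>- L\<close> with
  \<open>L\<close> the limit of \<open>H\<close>. Since \<open>f\<close> is dominated by
  \<open>M * a\<close>, the tail of the integral is dominated by \<open>M * exp (- A)\<close>, which
  gives both convergence and the bound \<open>M\<close>.\<close>

lemma bounded_linear_ode_solution:
  fixes a A f :: "real \<Rightarrow> real"
  assumes A: "\<And>x. R \<le> x \<Longrightarrow> (A has_real_derivative a x) (at x within {R..})"
    and lim: "filterlim A at_top at_top"
    and f: "continuous_on {R..} f" and fM: "\<And>x. R \<le> x \<Longrightarrow> \<bar>f x\<bar> \<le> M * a x"
  shows "\<exists>y. (\<forall>x\<ge>R. (y has_real_derivative a x * y x + f x) (at x within {R..})) \<and> (\<forall>x\<ge>R. \<bar>y x\<bar> \<le> M)"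
proof -
  have cA: "continuous_on {R..} A" by (rule DERIV_continuous_on[OF A]) simp
  define g where "g x = exp (- A x) * f x" for x
  have cg: "continuous_on {R..} g" unfolding g_def by (intro continuous_intros cA f)
  define H where "H x = integral {R..x} g" for x
  have dH: "(H has_real_derivative g x) (at x within {R..})" if x: "R \<le> x" for x
  proof -
    have "(H has_real_derivative g x) (at x within {R..x + 1})" unfolding H_def
      by (rule integral_has_real_derivative[OF continuous_on_subset[OF cg]]) (use x in auto)
    moreover have "at x within {R..x + 1} = at x within {R..}"
      by (rule at_within_nhd[of _ "{..<x + 1}"]) auto
    ultimately show ?thesis by simp
  qed
  have cH: "continuous_on {R..} H" by (rule DERIV_continuous_on[OF dH]) simp
  have bd: "\<bar>H z - H x\<bar> \<le> M * exp (- A x) - M * exp (- A z)" if xz: "R \<le> x" "x \<le> z" for x z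
  proof -
    have E: "((\<lambda>x. - (M * exp (- A x)) + s * H x) has_real_derivative M * a x * exp (- A x) + s * g x) (at x within {R..})"
      if "R \<le> x" for x s
      using that by (auto intro!: derivative_eq_intros A dH)
    have G: "\<bar>g x\<bar> \<le> M * a x * exp (- A x)" if "R \<le> x" for x
      using mult_right_mono[OF fM[OF that], of "exp (- A x)"] by (simp add: g_def abs_mult mult.commute)
    have "- (M * exp (- A x)) + 1 * H x \<le> - (M * exp (- A z)) + 1 * H z"
    proof (rule deriv_within_nondecreasing[OF xz, where f = "\<lambda>x. - (M * exp (- A x)) + 1 * H x" and
          f' = "\<lambda>x. M * a x * exp (- A x) + 1 * g x"])
      show "((\<lambda>x. - (M * exp (- A x)) + 1 * H x) has_real_derivative M * a x * exp (- A x) + 1 * g x) (at x within {R..})"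
        if "R \<le> x" for x by (rule E[OF that])
    next
      fix t assume "x < t" "t < z"
      then show "0 \<le> M * a t * exp (- A t) + 1 * g t" using G[of t] xz by (auto simp: abs_le_iff)
    qed
    moreover have "- (M * exp (- A x)) + (-1) * H x \<le> - (M * exp (- A z)) + (-1) * H z"
    proof (rule deriv_within_nondecreasing[OF xz, where f = "\<lambda>x. - (M * exp (- A x)) + (-1) * H x" and
          f' = "\<lambda>x. M * a x * exp (- A x) + (-1) * g x"])
      show "((\<lambda>x. - (M * exp (- A x)) + (-1) * H x) has_real_derivative M * a x * exp (- A x) + (-1) * g x) (at x within {R..})"
        if "R \<le> x" for x by (rule E[OF that])
    next
      fix t assume "x < t" "t < z"
      then show "0 \<le> M * a t * exp (- A t) + (-1) * g t" using G[of t] xz by (auto simp: abs_le_iff)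
    qed
    ultimately show ?thesis by (simp add: abs_le_iff)
  qed
  have E0: "((\<lambda>x. M * exp (- A x)) \<longlongrightarrow> 0) at_top"
  proof -
    have "((\<lambda>x. exp (- A x)) \<longlongrightarrow> 0) at_top"
      by (rule filterlim_compose[OF exp_at_bot]) (rule filterlim_compose[OF filterlim_uminus_at_bot_at_top lim])
    from tendsto_mult_right_zero[OF this] show ?thesis .
  qed
  have nat_top: "filterlim (\<lambda>n. R + real n) at_top sequentially"
    by (rule filterlim_tendsto_add_at_top[OF tendsto_const filterlim_real_sequentially])
  have E1: "(\<lambda>n. M * exp (- A (R + real n))) \<longlonglongrightarrow> 0"
    by (rule filterlim_compose[OF E0 nat_top])
  have "Cauchy (\<lambda>n. H (R + real n))"
  proof (rule CauchyI')
    fix e :: real assume "e > 0"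
    then have "e / 2 > 0" by simp
    from tendstoD[OF E1 this]
    have "eventually (\<lambda>n. \<bar>M * exp (- A (R + real n))\<bar> < e / 2) sequentially"
      by (simp add: dist_real_def)
    then obtain N where N: "\<And>n. n \<ge> N \<Longrightarrow> \<bar>M * exp (- A (R + real n))\<bar> < e / 2"
      unfolding eventually_sequentially by blast
    show "\<exists>N. \<forall>m\<ge>N. \<forall>n>m. dist (H (R + real m)) (H (R + real n)) < e"
    proof (intro exI[of _ N] allI impI)
      fix m n assume "N \<le> m" "m < n"
      then have "\<bar>H (R + real n) - H (R + real m)\<bar> \<le> M * exp (- A (R + real m)) - M * exp (- A (R + real n))"
        "\<bar>M * exp (- A (R + real m))\<bar> < e / 2" "\<bar>M * exp (- A (R + real n))\<bar> < e / 2"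
        using bd[of "R + real m" "R + real n"] N[of m] N[of n] by simp_all
      then show "dist (H (R + real m)) (H (R + real n)) < e" unfolding dist_real_def by argo
    qed
  qed
  then obtain L where L: "(\<lambda>n. H (R + real n)) \<longlonglongrightarrow> L" using Cauchy_convergent convergent_def by blast
  have Lb: "\<bar>L - H x\<bar> \<le> M * exp (- A x)" if x: "R \<le> x" for x
  proof -
    have "(\<lambda>n. \<bar>H (R + real n) - H x\<bar>) \<longlonglongrightarrow> \<bar>L - H x\<bar>" by (intro tendsto_intros L)
    moreover have "(\<lambda>n. M * exp (- A x) - M * exp (- A (R + real n))) \<longlonglongrightarrow> M * exp (- A x) - 0"
      by (intro tendsto_intros E1)
    moreover have "eventually (\<lambda>n. \<bar>H (R + real n) - H x\<bar> \<le> M * exp (- A x) - M * exp (- A (R + real n))) sequentially"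
    proof -
      have "eventually (\<lambda>n. x \<le> R + real n) sequentially" using nat_top by (simp add: filterlim_at_top)
      then show ?thesis by eventually_elim (rule bd[OF x])
    qed
    ultimately show ?thesis using tendsto_le[OF trivial_limit_sequentially] by fastforce
  qed
  show ?thesis
  proof (intro exI[of _ "\<lambda>x. exp (A x) * (H x - L)"] conjI allI impI)
    fix x assume x: "R \<le> x"
    have "((\<lambda>x. exp (A x) * (H x - L)) has_real_derivative exp (A x) * a x * (H x - L) + g x * exp (A x)) (at x within {R..})"
      using x by (auto intro!: derivative_eq_intros A dH)
    moreover have "exp (A x) * a x * (H x - L) + g x * exp (A x) = a x * (exp (A x) * (H x - L)) + f x"
      by (simp add: g_def exp_minus field_simps)
    ultimately show "((\<lambda>x. exp (A x) * (H x - L)) has_real_derivative a x * (exp (A x) * (H x - L)) + f x) (at x within {R..})"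
      by metis
  next
    fix x assume x: "R \<le> x"
    have "\<bar>exp (A x) * (H x - L)\<bar> = exp (A x) * \<bar>L - H x\<bar>" by (simp add: abs_mult abs_minus_commute)
    also have "\<dots> \<le> exp (A x) * (M * exp (- A x))" by (intro mult_left_mono Lb[OF x]) simp
    also have "\<dots> = M" by (simp add: exp_minus)
    finally show "\<bar>exp (A x) * (H x - L)\<bar> \<le> M" .
  qed
qed

text \<open>If \<open>s * y\<close> exceeded \<open>M\<close> somewhere, the excess would grow at
  least like \<open>exp A\<close>, against the bound \<open>K\<close>. So any a priori bound
  improves to \<open>M\<close>; applied to differences this gives the contraction estimate.\<close>

lemma bounded_linear_ode_bound:
  fixes a A f y :: "real \<Rightarrow> real"
  assumes A: "\<And>x. R \<le> x \<Longrightarrow> (A has_real_derivative a x) (at x within {R..})"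
    and lim: "filterlim A at_top at_top"
    and fM: "\<And>x. R \<le> x \<Longrightarrow> \<bar>f x\<bar> \<le> M * a x"
    and y: "\<And>x. R \<le> x \<Longrightarrow> (y has_real_derivative a x * y x + f x) (at x within {R..})"
    and K: "\<And>x. R \<le> x \<Longrightarrow> \<bar>y x\<bar> \<le> K" and x0: "R \<le> x0"
  shows "\<bar>y x0\<bar> \<le> M"
proof -
  have main: "s * y x0 \<le> M" if s: "s = 1 \<or> s = -1" for s :: real
  proof (rule ccontr)
    assume neg: "\<not> s * y x0 \<le> M"
    define e where "e = (s * y x0 - M) * exp (- A x0)"
    have e: "e > 0" using neg by (simp add: e_def)
    have ge: "(s * y x - M) * exp (- A x) \<ge> e" if x: "x0 \<le> x" for x
      unfolding e_def
    proof (rule deriv_within_nondecreasing[OF x0 x])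
      fix t assume "R \<le> t"
      then show "((\<lambda>x. (s * y x - M) * exp (- A x)) has_real_derivative (M * a t + s * f t) * exp (- A t)) (at t within {R..})"
        by (auto intro!: derivative_eq_intros A y simp: algebra_simps)
    next
      fix t assume "x0 < t" "t < x"
      then have "\<bar>f t\<bar> \<le> M * a t" using fM[of t] x0 by simp
      then have "M * a t + s * f t \<ge> 0" using s by auto
      then show "0 \<le> (M * a t + s * f t) * exp (- A t)" by simp
    qed
    have "eventually (\<lambda>x. A x > ln ((\<bar>K\<bar> + \<bar>M\<bar> + 1) / e) \<and> x \<ge> x0) at_top"
      using lim by (intro eventually_conj eventually_ge_at_top) (simp add: filterlim_at_top_dense)
    then obtain x where x: "A x > ln ((\<bar>K\<bar> + \<bar>M\<bar> + 1) / e)" "x \<ge> x0"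
      using eventually_happens'[OF trivial_limit_at_top_linorder] by blast
    have "(\<bar>K\<bar> + \<bar>M\<bar> + 1) / e > 0" using e by (simp add: add_nonneg_pos)
    then have "(\<bar>K\<bar> + \<bar>M\<bar> + 1) / e < exp (A x)" using x(1) by (metis exp_less_cancel_iff exp_ln)
    then have "\<bar>K\<bar> + \<bar>M\<bar> + 1 < e * exp (A x)" using e by (simp add: field_simps)
    also have "\<dots> \<le> (s * y x - M) * exp (- A x) * exp (A x)" by (intro mult_right_mono ge x) simp
    also have "\<dots> = s * y x - M" by (simp add: exp_minus)
    finally have "\<bar>K\<bar> + 1 < s * y x" by argo
    moreover have "\<bar>y x\<bar> \<le> K" using K[of x] x x0 by simp
    ultimately show False using s by auto
  qed
  show ?thesis using main[of 1] main[of "-1"] by (simp add: abs_le_iff)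
qed

section \<open>The system at infinity and its contraction\<close>

lemma bdd_lip_inverse:
  assumes "bdd_lip f" "e > 0" "\<And>z. f z \<ge> e"
  shows "bdd_lip (\<lambda>z. 1 / f z)"
proof -
  obtain B L where f: "\<And>z. \<bar>f z\<bar> \<le> B" "\<And>z z'. \<bar>f z - f z'\<bar> \<le> L * norm (z - z')"
    using bdd_lipE[OF assms(1)] by metis
  have fp: "f z > 0" for z using assms(2) assms(3)[of z] by linarith
  have inv: "0 < 1 / f z \<and> 1 / f z \<le> 1 / e" for z
    using fp[of z] assms(2) assms(3)[of z] by (simp add: frac_le)
  show ?thesis
  proof (rule bdd_lipI[of _ "1 / e" "1 / e * (1 / e) * L"])
    fix z z'
    show "\<bar>1 / f z\<bar> \<le> 1 / e" using inv[of z] by linarith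
    have "1 / f z - 1 / f z' = (1 / f z) * (1 / f z') * (f z' - f z)" using fp[of z] fp[of z'] by (simp add: field_simps)
    also have "\<bar>\<dots>\<bar> = (1 / f z) * (1 / f z') * \<bar>f z' - f z\<bar>" using fp[of z] fp[of z'] by (simp add: abs_mult)
    also have "\<dots> \<le> (1 / e) * (1 / e) * (L * norm (z - z'))"
    proof (rule mult_mono)
      show "1 / f z * (1 / f z') \<le> 1 / e * (1 / e)"
        using inv[of z] inv[of z'] assms(2) by (intro mult_mono) auto
      show "\<bar>f z' - f z\<bar> \<le> L * norm (z - z')" using f(2)[of z z'] by (simp add: abs_minus_commute)
    qed (use assms(2) in auto)
    finally show "\<bar>1 / f z - 1 / f z'\<bar> \<le> 1 / e * (1 / e) * L * norm (z - z')" by (simp only: mult.assoc)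
  qed
qed

text \<open>With \<open>\<zeta> = u - \<sigma> x\<close>, \<open>w = u - x u'\<close> and \<open>y = 1 / x\<close>, the graph equation becomes the system
  \<open>\<zeta>' = (\<zeta> - w) / x\<close>, \<open>w' = (1 + \<sigma>\<^sup>2) / 2 * x * w + end_field c \<sigma> y \<zeta> w\<close>.\<close>

definition end_field :: "real \<Rightarrow> real \<Rightarrow> real \<Rightarrow> real \<Rightarrow> real \<Rightarrow> real" where
  "end_field c \<sigma> y \<zeta> w = (\<zeta> + (-1) * w) * (2 * \<sigma> + (\<zeta> + (-1) * w) * y) * w * (1/2) +
     (- c) * (1 + (\<sigma> + (\<zeta> + (-1) * w) * y) * (\<sigma> + (\<zeta> + (-1) * w) * y)) * (1 / (\<sigma> + \<zeta> * y))"

text \<open>In the variable \<open>y = 1 / x\<close> the nonlinearity is regular up to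
  \<open>y = 0\<close>: it is polynomial apart from \<open>1 / (\<sigma> + \<zeta> * y)\<close>,
  whose denominator is at least \<open>\<sigma> / 2\<close> in the stated range. Clamping extends it
  to the whole space, where the \<open>bdd_lip\<close> rules apply.\<close>

lemma end_field_bounds:
  assumes s: "\<sigma> > 0"
  obtains B L where "B > 0" "L > 0"
    "\<And>y \<zeta> w. 0 \<le> y \<Longrightarrow> y \<le> \<sigma> / 2 \<Longrightarrow> \<bar>\<zeta>\<bar> \<le> 1 \<Longrightarrow> \<bar>w\<bar> \<le> 1 \<Longrightarrow> \<bar>end_field c \<sigma> y \<zeta> w\<bar> \<le> B"
    "\<And>y \<zeta> w \<zeta>' w'. 0 \<le> y \<Longrightarrow> y \<le> \<sigma> / 2 \<Longrightarrow> \<bar>\<zeta>\<bar> \<le> 1 \<Longrightarrow> \<bar>w\<bar> \<le> 1 \<Longrightarrow> \<bar>\<zeta>'\<bar> \<le> 1 \<Longrightarrow> \<bar>w'\<bar> \<le> 1 \<Longrightarrow>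
       \<bar>end_field c \<sigma> y \<zeta> w - end_field c \<sigma> y \<zeta>' w'\<bar> \<le> L * (\<bar>\<zeta> - \<zeta>'\<bar> + \<bar>w - w'\<bar>)"
proof -
  have cl: "\<bar>clamp_to a b v - clamp_to a b w\<bar> \<le> \<bar>v - w\<bar>" for a b v w
    unfolding clamp_to_def by linarith
  have atom: "bdd_lip (\<lambda>z::real \<times> real \<times> real. clamp_to a b (p z))"
    if p: "\<And>z z'. \<bar>p z - p z'\<bar> \<le> norm (z - z')" for p a b
  proof (rule bdd_lipI[of _ "\<bar>a\<bar> + \<bar>b\<bar>" 1])
    fix z z'
    show "\<bar>clamp_to a b (p z)\<bar> \<le> \<bar>a\<bar> + \<bar>b\<bar>" unfolding clamp_to_def by linarith
    show "\<bar>clamp_to a b (p z) - clamp_to a b (p z')\<bar> \<le> 1 * norm (z - z')"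
      using order_trans[OF cl p[of z z']] by simp
  qed
  define Y where "Y z = clamp_to 0 (\<sigma> / 2) (fst z)" for z :: "real \<times> real \<times> real"
  define Z where "Z z = clamp_to (-1) 1 (fst (snd z))" for z :: "real \<times> real \<times> real"
  define W where "W z = clamp_to (-1) 1 (snd (snd z))" for z :: "real \<times> real \<times> real"
  have n1: "\<bar>fst z - fst z'\<bar> \<le> norm (z - z')" for z z' :: "real \<times> real \<times> real"
    using abs_fst_le[of "z - z'"] by simp
  have n2: "\<bar>fst (snd z) - fst (snd z')\<bar> \<le> norm (z - z')" for z z' :: "real \<times> real \<times> real"
    using abs_fst_le[of "snd (z - z')"] norm_snd_le'[of "z - z'"] by simp
  have n3: "\<bar>snd (snd z) - snd (snd z')\<bar> \<le> norm (z - z')" for z z' :: "real \<times> real \<times> real"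
    using norm_snd_le'[of "snd (z - z')"] norm_snd_le'[of "z - z'"] by simp
  have YL: "bdd_lip Y" unfolding Y_def by (rule atom[OF n1])
  have ZL: "bdd_lip Z" unfolding Z_def by (rule atom[OF n2])
  have WL: "bdd_lip W" unfolding W_def by (rule atom[OF n3])
  have den: "\<sigma> + Z z * Y z \<ge> \<sigma> / 2" for z
  proof -
    have "\<bar>Z z * Y z\<bar> \<le> 1 * (\<sigma> / 2)" unfolding abs_mult
      using s by (intro mult_mono) (auto simp: Z_def Y_def clamp_to_def)
    then show ?thesis by (simp add: abs_le_iff)
  qed
  have I: "bdd_lip (\<lambda>z. 1 / (\<sigma> + Z z * Y z))"
    by (rule bdd_lip_inverse[of _ "\<sigma> / 2"]) (use s den in \<open>auto intro!: bdd_lip_add bdd_lip_mult bdd_lip_const YL ZL\<close>)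
  have "bdd_lip (\<lambda>z. end_field c \<sigma> (Y z) (Z z) (W z))"
    unfolding end_field_def by (intro bdd_lip_add bdd_lip_mult bdd_lip_const YL ZL WL I)
  then obtain B L where BL: "B > 0" "L > 0" "\<And>z. \<bar>end_field c \<sigma> (Y z) (Z z) (W z)\<bar> \<le> B"
    "\<And>z z'. \<bar>end_field c \<sigma> (Y z) (Z z) (W z) - end_field c \<sigma> (Y z') (Z z') (W z')\<bar> \<le> L * norm (z - z')"
    by (rule bdd_lipE) blast
  have eqs: "Y (y, \<zeta>, w) = y" "Z (y, \<zeta>, w) = \<zeta>" "W (y, \<zeta>, w) = w"
    if "0 \<le> y" "y \<le> \<sigma> / 2" "\<bar>\<zeta>\<bar> \<le> 1" "\<bar>w\<bar> \<le> 1" for y \<zeta> w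
    using that by (auto simp: Y_def Z_def W_def clamp_to_def)
  show ?thesis
  proof (rule that[OF BL(1,2)])
    fix y \<zeta> w :: real assume a: "0 \<le> y" "y \<le> \<sigma> / 2" "\<bar>\<zeta>\<bar> \<le> 1" "\<bar>w\<bar> \<le> 1"
    show "\<bar>end_field c \<sigma> y \<zeta> w\<bar> \<le> B" using BL(3)[of "(y, \<zeta>, w)"] eqs[OF a] by simp
    fix \<zeta>' w' :: real assume b: "\<bar>\<zeta>'\<bar> \<le> 1" "\<bar>w'\<bar> \<le> 1"
    have "\<bar>end_field c \<sigma> y \<zeta> w - end_field c \<sigma> y \<zeta>' w'\<bar> \<le> L * norm ((y, \<zeta>, w) - (y, \<zeta>', w'))"
      using BL(4)[of "(y, \<zeta>, w)" "(y, \<zeta>', w')"] eqs[OF a] eqs[OF a(1,2) b] by simp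
    also have "norm ((y, \<zeta>, w) - (y, \<zeta>', w')) \<le> \<bar>\<zeta> - \<zeta>'\<bar> + \<bar>w - w'\<bar>"
      using norm_Pair_le[of "\<zeta> - \<zeta>'" "w - w'"] by (simp add: norm_Pair)
    finally show "\<bar>end_field c \<sigma> y \<zeta> w - end_field c \<sigma> y \<zeta>' w'\<bar> \<le> L * (\<bar>\<zeta> - \<zeta>'\<bar> + \<bar>w - w'\<bar>)"
      using BL(2) by simp
  qed
qed

text \<open>One step of a fixed-point iteration, written as a relation: with \<open>w\<close> frozen
  in the inhomogeneities, \<open>\<zeta>\<close> and \<open>W\<close> are bounded solutions of two
  linear equations. A fixed point \<open>W = w\<close> solves the nonlinear system.\<close>

definition end_step :: "real \<Rightarrow> real \<Rightarrow> real \<Rightarrow> real \<Rightarrow> (real \<Rightarrow> real) \<Rightarrow> (real \<Rightarrow> real) \<Rightarrow> (real \<Rightarrow> real) \<Rightarrow> bool" where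
  "end_step c \<sigma> k R w \<zeta> W \<longleftrightarrow> continuous_on {R..} w \<and> (\<forall>x\<ge>R. \<bar>w x\<bar> \<le> 1 \<and> \<bar>\<zeta> x\<bar> \<le> 1 \<and> \<bar>W x\<bar> \<le> 1 \<and>
     (\<zeta> has_real_derivative 1 / x * \<zeta> x + - w x / x) (at x within {R..}) \<and>
     (W has_real_derivative k * x * W x + end_field c \<sigma> (1 / x) (\<zeta> x) (w x)) (at x within {R..}))"

context
  fixes c \<sigma> k B L R :: real
  assumes s: "\<sigma> > 0" and k: "k = (1 + \<sigma>\<^sup>2) / 2"
    and Bb: "\<And>y \<zeta> w. 0 \<le> y \<Longrightarrow> y \<le> \<sigma> / 2 \<Longrightarrow> \<bar>\<zeta>\<bar> \<le> 1 \<Longrightarrow> \<bar>w\<bar> \<le> 1 \<Longrightarrow> \<bar>end_field c \<sigma> y \<zeta> w\<bar> \<le> B"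
    and Lb: "\<And>y \<zeta> w \<zeta>' w'. 0 \<le> y \<Longrightarrow> y \<le> \<sigma> / 2 \<Longrightarrow> \<bar>\<zeta>\<bar> \<le> 1 \<Longrightarrow> \<bar>w\<bar> \<le> 1 \<Longrightarrow> \<bar>\<zeta>'\<bar> \<le> 1 \<Longrightarrow> \<bar>w'\<bar> \<le> 1 \<Longrightarrow>
       \<bar>end_field c \<sigma> y \<zeta> w - end_field c \<sigma> y \<zeta>' w'\<bar> \<le> L * (\<bar>\<zeta> - \<zeta>'\<bar> + \<bar>w - w'\<bar>)"
    and L0: "L > 0" and R: "R \<ge> 1" "1 / R \<le> \<sigma> / 2" "B \<le> k * R" "4 * L \<le> k * R"
begin

lemma k_pos: "k > 0"
proof -
  have "0 < (1 + \<sigma>\<^sup>2) / 2" by (intro divide_pos_pos add_pos_nonneg) auto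
  then show ?thesis using k by metis
qed

lemma inv_le: assumes "R \<le> x" shows "0 \<le> 1 / x \<and> 1 / x \<le> \<sigma> / 2"
proof -
  have "1 / x \<le> 1 / R" using R(1) assms by (intro frac_le) auto
  then have "1 / x \<le> \<sigma> / 2" using R(2) by (rule order_trans)
  moreover have "x > 0" using R(1) assms by linarith
  ultimately show ?thesis by simp
qed

lemma ln_deriv: "R \<le> x \<Longrightarrow> (ln has_real_derivative 1 / x) (at x within {R..})"
  using R(1) by (intro has_field_derivative_at_within[OF DERIV_ln_divide]) simp

lemma sq_deriv: "((\<lambda>x. k * x\<^sup>2 / 2) has_real_derivative k * x) (at x within {R..})"
  by (auto intro!: derivative_eq_intros)

lemma sq_top: "filterlim (\<lambda>x. k * x\<^sup>2 / 2) at_top at_top"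
proof -
  have "filterlim (\<lambda>x::real. (k / 2) * x\<^sup>2) at_top at_top"
    by (intro filterlim_tendsto_pos_mult_at_top[OF tendsto_const] filterlim_pow_at_top filterlim_ident)
      (use k_pos in auto)
  then show ?thesis by simp
qed

text \<open>Both equations fall under \<open>bounded_linear_ode_solution\<close>, with
  \<open>A\<close> equal to \<open>ln\<close> and to \<open>k * x^2 / 2\<close>. The condition
  \<open>B <= k * R\<close> keeps \<open>W\<close> in the unit ball.\<close>

lemma end_step_exists:
  assumes w: "continuous_on {R..} w" "\<And>x. R \<le> x \<Longrightarrow> \<bar>w x\<bar> \<le> 1"
  shows "\<exists>\<zeta> W. end_step c \<sigma> k R w \<zeta> W"
proof -
  have nz: "\<And>x. x \<in> {R..} \<Longrightarrow> x \<noteq> 0" using R by auto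
  have "\<exists>\<zeta>. (\<forall>x\<ge>R. (\<zeta> has_real_derivative 1 / x * \<zeta> x + - w x / x) (at x within {R..})) \<and>
    (\<forall>x\<ge>R. \<bar>\<zeta> x\<bar> \<le> 1)"
  proof (rule bounded_linear_ode_solution[OF ln_deriv ln_at_top])
    show "continuous_on {R..} (\<lambda>x. - w x / x)" by (intro continuous_intros w) (use nz in auto)
    show "\<bar>- w x / x\<bar> \<le> 1 * (1 / x)" if "R \<le> x" for x
      using w(2)[OF that] that R(1) by (simp add: divide_right_mono)
  qed
  then obtain \<zeta> where z': "\<forall>x\<ge>R. (\<zeta> has_real_derivative 1 / x * \<zeta> x + - w x / x) (at x within {R..})"
    "\<forall>x\<ge>R. \<bar>\<zeta> x\<bar> \<le> 1" by (elim exE conjE)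
  note z = z'(1)[rule_format] z'(2)[rule_format]
  have cz: "continuous_on {R..} \<zeta>" by (rule DERIV_continuous_on[OF z(1)]) simp
  have den: "\<sigma> + \<zeta> x * (1 / x) \<noteq> 0" if x: "R \<le> x" for x
  proof -
    have "\<bar>\<zeta> x * (1 / x)\<bar> \<le> 1 * (\<sigma> / 2)" unfolding abs_mult
      using z(2)[OF x] inv_le[OF x] by (intro mult_mono) auto
    then have "- (\<zeta> x * (1 / x)) \<le> \<sigma> / 2" unfolding abs_le_iff mult_1 by blast
    then show ?thesis using s by argo
  qed
  have "\<exists>W. (\<forall>x\<ge>R. (W has_real_derivative k * x * W x + end_field c \<sigma> (1 / x) (\<zeta> x) (w x)) (at x within {R..})) \<and>
    (\<forall>x\<ge>R. \<bar>W x\<bar> \<le> 1)"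
  proof (rule bounded_linear_ode_solution[OF sq_deriv sq_top])
    show "continuous_on {R..} (\<lambda>x. end_field c \<sigma> (1 / x) (\<zeta> x) (w x))"
      unfolding end_field_def by (intro continuous_intros w cz) (use nz den in auto)
    show "\<bar>end_field c \<sigma> (1 / x) (\<zeta> x) (w x)\<bar> \<le> 1 * (k * x)" if x: "R \<le> x" for x
    proof -
      have "\<bar>end_field c \<sigma> (1 / x) (\<zeta> x) (w x)\<bar> \<le> B" using inv_le[OF x] z(2)[OF x] w(2)[OF x] by (intro Bb) auto
      also have "\<dots> \<le> k * R" by (rule R(3))
      also have "\<dots> \<le> k * x" using k_pos by (intro mult_left_mono x) simp
      finally show ?thesis by simp
    qed
  qed
  then obtain W where W: "\<forall>x\<ge>R. (W has_real_derivative k * x * W x + end_field c \<sigma> (1 / x) (\<zeta> x) (w x)) (at x within {R..})"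
    "\<forall>x\<ge>R. \<bar>W x\<bar> \<le> 1" by (elim exE conjE)
  have "end_step c \<sigma> k R w \<zeta> W" unfolding end_step_def
    by (intro conjI allI impI w z W(1)[rule_format] W(2)[rule_format])
  then show ?thesis by blast
qed

text \<open>The equation for \<open>\<zeta>\<close> passes the distance \<open>D\<close> on without
  gain. The gain comes from the rate \<open>k * x\<close> in the equation for \<open>W\<close>: by
  \<open>4 * L <= k * R\<close>, the inhomogeneity \<open>2 * L * D\<close> is at most
  \<open>D / 2\<close> times that rate.\<close>

lemma end_step_contracts:
  assumes 1: "end_step c \<sigma> k R w1 \<zeta>1 W1" and 2: "end_step c \<sigma> k R w2 \<zeta>2 W2"
    and D: "\<And>x. R \<le> x \<Longrightarrow> \<bar>w1 x - w2 x\<bar> \<le> D" and x: "R \<le> x"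
  shows "\<bar>\<zeta>1 x - \<zeta>2 x\<bar> \<le> D" "\<bar>W1 x - W2 x\<bar> \<le> D / 2"
proof -
  have D0: "D \<ge> 0" using D[OF x] by linarith
  have zd: "\<bar>\<zeta>1 x - \<zeta>2 x\<bar> \<le> D" if x: "R \<le> x" for x
  proof (rule bounded_linear_ode_bound[OF ln_deriv ln_at_top, where f = "\<lambda>x. - (w1 x - w2 x) / x" and
        y = "\<lambda>x. \<zeta>1 x - \<zeta>2 x" and K = 2])
    fix x assume x: "R \<le> x"
    show "\<bar>- (w1 x - w2 x) / x\<bar> \<le> D * (1 / x)" using D[OF x] x R by (simp add: divide_right_mono abs_minus_commute)
    have d: "(\<zeta>1 has_real_derivative 1 / x * \<zeta>1 x + - w1 x / x) (at x within {R..})"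
      "(\<zeta>2 has_real_derivative 1 / x * \<zeta>2 x + - w2 x / x) (at x within {R..})"
      using 1 2 x unfolding end_step_def by blast+
    have e: "1 / x * \<zeta>1 x + - w1 x / x - (1 / x * \<zeta>2 x + - w2 x / x) = 1 / x * (\<zeta>1 x - \<zeta>2 x) + - (w1 x - w2 x) / x"
      by (simp add: diff_divide_distrib)
    show "((\<lambda>x. \<zeta>1 x - \<zeta>2 x) has_real_derivative 1 / x * (\<zeta>1 x - \<zeta>2 x) + - (w1 x - w2 x) / x) (at x within {R..})"
      using DERIV_diff[OF d] unfolding e .
    have "\<bar>\<zeta>1 x\<bar> \<le> 1" "\<bar>\<zeta>2 x\<bar> \<le> 1" using 1 2 x unfolding end_step_def by blast+
    then show "\<bar>\<zeta>1 x - \<zeta>2 x\<bar> \<le> 2" by linarith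
  qed (assumption | rule x)+
  then show "\<bar>\<zeta>1 x - \<zeta>2 x\<bar> \<le> D" using x by blast
  show "\<bar>W1 x - W2 x\<bar> \<le> D / 2"
  proof (rule bounded_linear_ode_bound[OF sq_deriv sq_top, where y = "\<lambda>x. W1 x - W2 x" and K = 2 and
        f = "\<lambda>x. end_field c \<sigma> (1 / x) (\<zeta>1 x) (w1 x) - end_field c \<sigma> (1 / x) (\<zeta>2 x) (w2 x)"])
    fix x assume x: "R \<le> x"
    have b: "\<bar>\<zeta>1 x\<bar> \<le> 1" "\<bar>\<zeta>2 x\<bar> \<le> 1" "\<bar>w1 x\<bar> \<le> 1" "\<bar>w2 x\<bar> \<le> 1" "\<bar>W1 x\<bar> \<le> 1" "\<bar>W2 x\<bar> \<le> 1"
      using 1 2 x unfolding end_step_def by blast+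
    have "\<bar>end_field c \<sigma> (1 / x) (\<zeta>1 x) (w1 x) - end_field c \<sigma> (1 / x) (\<zeta>2 x) (w2 x)\<bar>
        \<le> L * (\<bar>\<zeta>1 x - \<zeta>2 x\<bar> + \<bar>w1 x - w2 x\<bar>)"
      using inv_le[OF x] b by (intro Lb) auto
    also have "\<dots> \<le> L * (D + D)" using L0 zd[OF x] D[OF x] by (intro mult_left_mono add_mono) auto
    also have "\<dots> = (4 * L) * (D / 2)" by simp
    also have "\<dots> \<le> (k * R) * (D / 2)" using R(4) D0 by (intro mult_right_mono) auto
    also have "\<dots> \<le> (k * x) * (D / 2)" using x k_pos D0 by (intro mult_right_mono mult_left_mono) auto
    finally show "\<bar>end_field c \<sigma> (1 / x) (\<zeta>1 x) (w1 x) - end_field c \<sigma> (1 / x) (\<zeta>2 x) (w2 x)\<bar> \<le> D / 2 * (k * x)"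
      by (simp only: mult.commute)
    have d: "(W1 has_real_derivative k * x * W1 x + end_field c \<sigma> (1 / x) (\<zeta>1 x) (w1 x)) (at x within {R..})"
      "(W2 has_real_derivative k * x * W2 x + end_field c \<sigma> (1 / x) (\<zeta>2 x) (w2 x)) (at x within {R..})"
      using 1 2 x unfolding end_step_def by blast+
    have e: "k * x * W1 x + E1 - (k * x * W2 x + E2) = k * x * (W1 x - W2 x) + (E1 - E2)" for E1 E2
      by (simp add: algebra_simps)
    show "((\<lambda>x. W1 x - W2 x) has_real_derivative k * x * (W1 x - W2 x) +
      (end_field c \<sigma> (1 / x) (\<zeta>1 x) (w1 x) - end_field c \<sigma> (1 / x) (\<zeta>2 x) (w2 x))) (at x within {R..})"
      using DERIV_diff[OF d] unfolding e .
    show "\<bar>W1 x - W2 x\<bar> \<le> 2" using b by linarith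
  qed (assumption | rule x)+
qed

lemma end_fixed_point: "\<exists>\<zeta> w. end_step c \<sigma> k R w \<zeta> w"
proof -
  let ?S = "cball (0 :: real \<Rightarrow>\<^sub>C real) 1"
  have S1: "\<bar>apply_bcontfun v x\<bar> \<le> 1" if "v \<in> ?S" for v x
    using norm_bounded[of v x] that by simp
  have "\<forall>v\<in>?S. \<exists>\<zeta> W. end_step c \<sigma> k R (apply_bcontfun v) \<zeta> W"
    using end_step_exists S1 by (metis continuous_on_apply_bcontfun)
  then obtain Z W where ZW: "\<And>v. v \<in> ?S \<Longrightarrow> end_step c \<sigma> k R (apply_bcontfun v) (Z v) (W v)" by metis
  have cW: "continuous_on {R..} (W v)" if "v \<in> ?S" for v
  proof (rule DERIV_continuous_on)
    show "(W v has_real_derivative k * x * W v x + end_field c \<sigma> (1 / x) (Z v x) (apply_bcontfun v x)) (at x within {R..})"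
      if "x \<in> {R..}" for x using ZW[OF \<open>v \<in> ?S\<close>] that unfolding end_step_def by blast
  qed
  have W1: "\<bar>W v x\<bar> \<le> 1" if "v \<in> ?S" "R \<le> x" for v x
    using ZW[OF that(1)] that(2) unfolding end_step_def by blast
  \<comment> \<open>The functions on the half-line are extended to the left by their value at
    \<open>R\<close>, so that the complete space of bounded continuous functions on the whole line
    can be used.\<close>
  define T where "T v = Bcontfun (\<lambda>x. W v (max R x))" for v
  have Tin: "(\<lambda>x. W v (max R x)) \<in> bcontfun" if v: "v \<in> ?S" for v
  proof (rule bcontfun_normI)
    show "continuous_on UNIV (\<lambda>x. W v (max R x))"
      by (rule continuous_on_compose2[OF cW[OF v]]) (auto intro!: continuous_intros)
    show "norm (W v (max R x)) \<le> 1" for x using W1[OF v, of "max R x"] by simp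
  qed
  have T: "apply_bcontfun (T v) x = W v (max R x)" if "v \<in> ?S" for v x
    unfolding T_def using Bcontfun_inverse[OF Tin[OF that]] by simp
  have "\<exists>!v\<in>?S. T v = v"
  proof (rule Banach_fix[where c = "1/2"])
    show "complete ?S" by (simp add: complete_eq_closed)
    show "?S \<noteq> {}" by simp
    show "T ` ?S \<subseteq> ?S"
    proof
      fix v' assume "v' \<in> T ` ?S"
      then obtain v where v: "v \<in> ?S" "v' = T v" by blast
      have "norm (T v) \<le> 1" by (rule norm_bound) (use T[OF v(1)] W1[OF v(1)] in simp)
      then show "v' \<in> ?S" using v by simp
    qed
    fix v v' assume v: "v \<in> ?S" "v' \<in> ?S"
    show "dist (T v) (T v') \<le> 1/2 * dist v v'"
    proof (rule dist_bound)
      fix x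
      have "\<bar>W v (max R x) - W v' (max R x)\<bar> \<le> dist v v' / 2"
      proof (rule end_step_contracts(2)[OF ZW[OF v(1)] ZW[OF v(2)]])
        show "\<bar>apply_bcontfun v x - apply_bcontfun v' x\<bar> \<le> dist v v'" for x
          using dist_bounded[of v x v'] by (simp add: dist_real_def)
      qed simp
      then show "dist (apply_bcontfun (T v) x) (apply_bcontfun (T v') x) \<le> 1/2 * dist v v'"
        by (simp add: T[OF v(1)] T[OF v(2)] dist_real_def)
    qed
  qed auto
  then obtain v where v: "v \<in> ?S" "T v = v" by blast
  have eq: "W v x = apply_bcontfun v x" if "R \<le> x" for x
    using T[OF v(1), of x] v(2) that by (simp add: max_def)
  have "end_step c \<sigma> k R (apply_bcontfun v) (Z v) (apply_bcontfun v)"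
    unfolding end_step_def
  proof (intro conjI allI impI)
    note Z = ZW[OF v(1), unfolded end_step_def]
    show "continuous_on {R..} (apply_bcontfun v)" by simp
    fix x assume x: "R \<le> x"
    show "\<bar>apply_bcontfun v x\<bar> \<le> 1" "\<bar>apply_bcontfun v x\<bar> \<le> 1" using S1[OF v(1)] by auto
    show "\<bar>Z v x\<bar> \<le> 1" "(Z v has_real_derivative 1 / x * Z v x + - apply_bcontfun v x / x) (at x within {R..})"
      using Z x by blast+
    have "(W v has_real_derivative k * x * W v x + end_field c \<sigma> (1 / x) (Z v x) (apply_bcontfun v x)) (at x within {R..})"
      using Z x by blast
    then show "(apply_bcontfun v has_real_derivative k * x * apply_bcontfun v x + end_field c \<sigma> (1 / x) (Z v x) (apply_bcontfun v x)) (at x within {R..})"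
      unfolding eq[OF x] by (rule has_field_derivative_transform_within[of _ _ _ _ 1]) (use x eq in auto)
  qed
  then show ?thesis by blast
qed

text \<open>Two fixed points differ by at most \<open>2\<close>, and each use of the contraction
  halves the bound.\<close>

lemma end_step_unique:
  assumes 1: "end_step c \<sigma> k R w1 \<zeta>1 w1" and 2: "end_step c \<sigma> k R w2 \<zeta>2 w2" and x: "R \<le> x"
  shows "w1 x = w2 x \<and> \<zeta>1 x = \<zeta>2 x"
proof -
  have iter: "\<forall>x\<ge>R. \<bar>w1 x - w2 x\<bar> \<le> 2 * (1/2) ^ j" for j
  proof (induction j)
    case 0
    have "\<bar>w1 x\<bar> \<le> 1" "\<bar>w2 x\<bar> \<le> 1" if "R \<le> x" for x using 1 2 that unfolding end_step_def by blast+
    then show ?case by (smt (verit) power_0)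
  next
    case (Suc j)
    show ?case using end_step_contracts(2)[OF 1 2, of "2 * (1/2) ^ j"] Suc by simp
  qed
  have w: "w1 x = w2 x" if x: "R \<le> x" for x
  proof -
    have "(\<lambda>j. 2 * (1/2) ^ j) \<longlonglongrightarrow> (2 * 0 :: real)" by (intro tendsto_intros LIMSEQ_power_zero) auto
    then have "\<bar>w1 x - w2 x\<bar> \<le> 2 * 0"
      by (rule tendsto_lowerbound) (use iter x in auto)
    then show ?thesis by simp
  qed
  have "\<bar>\<zeta>1 x - \<zeta>2 x\<bar> \<le> 0" by (rule end_step_contracts(1)[OF 1 2 _ x]) (use w in simp)
  then show ?thesis using w[OF x] by simp
qed

end

section \<open>From the end system back to the graph equation\<close>

lemma ode_sol_unique_left:
  assumes o1: "ode_sol n {d<..} u1 u1' u1''" and o2: "ode_sol n {d<..} u2 u2' u2''"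
    and ad: "d < a" "a \<le> b" and eq: "u1 b = u2 b" "u1' b = u2' b"
  shows "u1 a = u2 a"
proof -
  let ?c = "real n - 1"
  note D1 = ode_solD[OF o1] and D2 = ode_solD[OF o2]
  define \<psi> where "\<psi> x = (x * u2' x - u2 x) / 2 + ?c / u2 x" for x
  \<comment> \<open>\<open>\<alpha>\<close> and \<open>\<beta>\<close> are the exact coefficients in
    \<open>u1'' - u2'' = \<alpha> * (u1' - u2') - \<beta> * (u1 - u2)\<close>; being bounded on
    \<open>{a..b}\<close>, they supply the Lipschitz constant along the two solutions.\<close>
  define \<alpha> where "\<alpha> x = (1 + (u1' x)\<^sup>2) * x / 2 + \<psi> x * (u1' x + u2' x)" for x
  define \<beta> where "\<beta> x = (1 + (u1' x)\<^sup>2) * (1/2 + ?c / (u1 x * u2 x))" for x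
  have dd: "d < x" if "x \<in> {a..b}" for x using that ad by simp
  have c: "continuous_on {a..b} u1" "continuous_on {a..b} u2" "continuous_on {a..b} u1'" "continuous_on {a..b} u2'"
    using D1(2,3) D2(2,3) dd by (meson DERIV_isCont continuous_at_imp_continuous_on)+
  have nz: "\<forall>x\<in>{a..b}. u1 x * u2 x \<noteq> 0" "\<forall>x\<in>{a..b}. u2 x \<noteq> 0"
    using D1(1) D2(1) dd by (metis less_irrefl mult_pos_pos)+
  have "bounded (\<alpha> ` {a..b})" unfolding \<alpha>_def \<psi>_def
    by (intro compact_imp_bounded compact_continuous_image continuous_intros c nz) auto
  then obtain K1 where K1: "\<forall>x\<in>{a..b}. \<bar>\<alpha> x\<bar> \<le> K1" by (auto simp: bounded_iff)
  have "bounded (\<beta> ` {a..b})" unfolding \<beta>_def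
    by (intro compact_imp_bounded compact_continuous_image continuous_intros c nz) auto
  then obtain K2 where K2: "\<forall>x\<in>{a..b}. \<bar>\<beta> x\<bar> \<le> K2" by (auto simp: bounded_iff)
  have "(\<lambda>x. (u1 x, u1' x)) a = (\<lambda>x. (u2 x, u2' x)) a"
  proof (rule ode_unique_left[where b = b and y = "\<lambda>x. (u1 x, u1' x)" and z = "\<lambda>x. (u2 x, u2' x)" and y' = "\<lambda>x. (u1' x, u1'' x)" and z' = "\<lambda>x. (u2' x, u2'' x)" and L = "1 + K1 + K2"])
    fix x assume x: "a \<le> x" "x \<le> b"
    then have xd: "d < x" "x \<in> {a..b}" using ad by auto
    show "((\<lambda>x. (u1 x, u1' x)) has_vector_derivative (u1' x, u1'' x)) (at x)"
      using D1(2,3)[OF xd(1)] by (intro has_vector_derivative_Pair) (simp_all add: has_real_derivative_iff_has_vector_derivative)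
    show "((\<lambda>x. (u2 x, u2' x)) has_vector_derivative (u2' x, u2'' x)) (at x)"
      using D2(2,3)[OF xd(1)] by (intro has_vector_derivative_Pair) (simp_all add: has_real_derivative_iff_has_vector_derivative)
    let ?N = "norm ((u1 x, u1' x) - (u2 x, u2' x))"
    have n1: "\<bar>u1 x - u2 x\<bar> \<le> ?N" and n2: "\<bar>u1' x - u2' x\<bar> \<le> ?N"
      using norm_fst_le[of "u1 x - u2 x" "u1' x - u2' x"] norm_snd_le[of "u1' x - u2' x" "u1 x - u2 x"] by auto
    have "A * (1 + p\<^sup>2) - B * (1 + q\<^sup>2) = (A - B) * (1 + p\<^sup>2) + B * ((p + q) * (p - q))" for A B p q :: real
      by (simp add: algebra_simps power2_eq_square)
    then have "u1'' x - u2'' x = ((x * u1' x - u1 x) / 2 + ?c / u1 x - \<psi> x) * (1 + (u1' x)\<^sup>2) +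
        \<psi> x * ((u1' x + u2' x) * (u1' x - u2' x))"
      unfolding D1(4)[OF xd(1)] D2(4)[OF xd(1)] \<psi>_def by blast
    also have "(x * u1' x - u1 x) / 2 + ?c / u1 x - \<psi> x =
        x / 2 * (u1' x - u2' x) - (1/2 + ?c / (u1 x * u2 x)) * (u1 x - u2 x)"
      using D1(1)[OF xd(1)] D2(1)[OF xd(1)] unfolding \<psi>_def by (simp add: field_simps)
    finally have e: "u1'' x - u2'' x = \<alpha> x * (u1' x - u2' x) - \<beta> x * (u1 x - u2 x)"
    proof -
      have "(x / 2 * \<Delta> - q * \<delta>) * P + \<psi> x * (S * \<Delta>) = (P * x / 2 + \<psi> x * S) * \<Delta> - (P * q) * \<delta>" for \<Delta> \<delta> q P S
        by (simp add: algebra_simps)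
      then show "u1'' x - u2'' x = (x / 2 * (u1' x - u2' x) - (1/2 + ?c / (u1 x * u2 x)) * (u1 x - u2 x)) * (1 + (u1' x)\<^sup>2) +
        \<psi> x * ((u1' x + u2' x) * (u1' x - u2' x)) \<Longrightarrow> ?thesis"
        unfolding \<alpha>_def \<beta>_def by metis
    qed
    have "\<bar>u1'' x - u2'' x\<bar> \<le> \<bar>\<alpha> x\<bar> * \<bar>u1' x - u2' x\<bar> + \<bar>\<beta> x\<bar> * \<bar>u1 x - u2 x\<bar>"
      unfolding e using abs_triangle_ineq4[of "\<alpha> x * (u1' x - u2' x)" "\<beta> x * (u1 x - u2 x)"] by (simp add: abs_mult)
    also have "\<dots> \<le> K1 * ?N + K2 * ?N"
      using K1 K2 xd n1 n2 by (intro add_mono mult_mono) (auto intro: order_trans[OF abs_ge_zero])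
    finally have "\<bar>u1'' x - u2'' x\<bar> \<le> K1 * ?N + K2 * ?N" .
    moreover have "norm ((u1' x, u1'' x) - (u2' x, u2'' x)) \<le> \<bar>u1' x - u2' x\<bar> + \<bar>u1'' x - u2'' x\<bar>"
      using norm_Pair_le[of "u1' x - u2' x" "u1'' x - u2'' x"] by simp
    ultimately show "norm ((u1' x, u1'' x) - (u2' x, u2'' x)) \<le> (1 + K1 + K2) * ?N"
      using n2 unfolding distrib_right by linarith
  qed (use ad eq in auto)
  then show ?thesis by simp
qed

lemma end_radius:
  fixes k \<sigma> B L :: real
  assumes "k > 0" "\<sigma> > 0" "B > 0" "L > 0" and M: "M > 0"
  obtains R where "R \<ge> 1" "1 / R \<le> \<sigma> / 2" "B \<le> k * R" "4 * L \<le> k * R" "R \<ge> M"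
proof -
  define R where "R = 1 + 2 / \<sigma> + B / k + 4 * L / k + M"
  have p: "2 / \<sigma> > 0" "B / k > 0" "4 * L / k > 0" using assms by auto
  have "R \<ge> 1" "R \<ge> 2 / \<sigma>" "R \<ge> B / k" "R \<ge> 4 * L / k" "R \<ge> M"
    using p M unfolding R_def by linarith+
  then show ?thesis using assms by (intro that[of R]) (simp_all add: field_simps)
qed

lemma asymptotic_solution_exists:
  assumes s: "\<sigma> > 0" and n: "n \<ge> 2"
  obtains R u u' u'' where "R \<ge> 1" "ode_sol n {R<..} u u' u''" "\<And>x. x > R \<Longrightarrow> \<bar>u x - \<sigma> * x\<bar> \<le> 1"
proof -
  define k where "k = (1 + \<sigma>\<^sup>2) / 2"
  have kp: "k > 0" unfolding k_def by (intro divide_pos_pos add_pos_nonneg) auto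
  let ?c = "real n - 1"
  obtain B L where BL: "B > 0" "L > 0"
    "\<And>y \<zeta> w. 0 \<le> y \<Longrightarrow> y \<le> \<sigma> / 2 \<Longrightarrow> \<bar>\<zeta>\<bar> \<le> 1 \<Longrightarrow> \<bar>w\<bar> \<le> 1 \<Longrightarrow> \<bar>end_field ?c \<sigma> y \<zeta> w\<bar> \<le> B"
    "\<And>y \<zeta> w \<zeta>' w'. 0 \<le> y \<Longrightarrow> y \<le> \<sigma> / 2 \<Longrightarrow> \<bar>\<zeta>\<bar> \<le> 1 \<Longrightarrow> \<bar>w\<bar> \<le> 1 \<Longrightarrow> \<bar>\<zeta>'\<bar> \<le> 1 \<Longrightarrow> \<bar>w'\<bar> \<le> 1 \<Longrightarrow>
       \<bar>end_field ?c \<sigma> y \<zeta> w - end_field ?c \<sigma> y \<zeta>' w'\<bar> \<le> L * (\<bar>\<zeta> - \<zeta>'\<bar> + \<bar>w - w'\<bar>)"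
    using end_field_bounds[OF s, of ?c] by metis
  \<comment> \<open>The last condition gives \<open>\<sigma> * x > 2\<close> beyond
    \<open>R\<close>, which keeps \<open>u\<close> positive although \<open>\<zeta>\<close> may be
    as low as \<open>-1\<close>.\<close>
  obtain R where R: "R \<ge> 1" "1 / R \<le> \<sigma> / 2" "B \<le> k * R" "4 * L \<le> k * R" "R \<ge> 2 / \<sigma>"
    using end_radius[OF kp s BL(1,2), of "2 / \<sigma>"] s by auto
  note ctx = s k_def BL(3,4) BL(2) R(1-4)
  obtain \<zeta> w where st: "end_step ?c \<sigma> k R w \<zeta> w"
    using end_fixed_point[OF ctx] by blast
  have d: "(\<zeta> has_real_derivative 1 / x * \<zeta> x + - w x / x) (at x)"
    "(w has_real_derivative k * x * w x + end_field ?c \<sigma> (1 / x) (\<zeta> x) (w x)) (at x)"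
    "\<bar>\<zeta> x\<bar> \<le> 1" if x: "x > R" for x
  proof -
    have "R \<le> x" using x by simp
    then show "(\<zeta> has_real_derivative 1 / x * \<zeta> x + - w x / x) (at x)"
      "(w has_real_derivative k * x * w x + end_field ?c \<sigma> (1 / x) (\<zeta> x) (w x)) (at x)" "\<bar>\<zeta> x\<bar> \<le> 1"
      using st unfolding end_step_def at_within_atLeast[OF x, symmetric] by simp_all
  qed
  define u where "u x = \<sigma> * x + \<zeta> x" for x
  define u' where "u' x = \<sigma> + (\<zeta> x - w x) / x" for x
  define u'' where "u'' x = ((x * u' x - u x) / 2 + ?c / u x) * (1 + (u' x)\<^sup>2)" for x
  have "ode_sol n {R<..} u u' u''" unfolding ode_sol_def
  proof (intro ballI conjI)
    fix x assume "x \<in> {R<..}"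
    then have x: "x > R" and xp: "x > 0" using R(1) by auto
    have "\<sigma> * x > \<sigma> * R" using x s by simp
    moreover have "\<sigma> * R \<ge> 2" using R(5) s by (simp add: field_simps)
    ultimately have "\<sigma> * x > 2" by linarith
    then show up: "u x > 0" using d(3)[OF x] unfolding u_def by linarith
    have "(u has_real_derivative \<sigma> + (1 / x * \<zeta> x + - w x / x)) (at x)"
      unfolding u_def by (auto intro!: derivative_eq_intros d(1)[OF x])
    moreover have "\<sigma> + (1 / x * \<zeta> x + - w x / x) = u' x" by (simp add: u'_def diff_divide_distrib)
    ultimately show "(u has_real_derivative u' x) (at x within {R<..})"
      using has_field_derivative_at_within by metis
    have xu: "x * u' x - u x = - w x" using xp by (simp add: u_def u'_def field_simps)
    let ?E = "end_field ?c \<sigma> (1 / x) (\<zeta> x) (w x)"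
    have E: "?E = (x * (u' x - \<sigma>)) * (2 * \<sigma> + (u' x - \<sigma>)) * w x / 2 - ?c * (1 + (u' x)\<^sup>2) * (x / u x)"
    proof -
      have 1: "(\<zeta> x + (-1) * w x) * (1 / x) = u' x - \<sigma>" by (simp add: u'_def)
      have 2: "\<zeta> x + (-1) * w x = x * (u' x - \<sigma>)" using xp by (simp add: u'_def)
      have 3: "1 / (\<sigma> + \<zeta> x * (1 / x)) = x / u x" using xp up by (simp add: u_def field_simps)
      have "a * (1/2) + (- C) * q * z = a / 2 - C * q * z" for a C q z :: real by simp
      moreover have "\<sigma> + (u' x - \<sigma>) = u' x" by simp
      ultimately show ?thesis unfolding end_field_def 1 3 unfolding 2 power2_eq_square by metis
    qed
    have "(u' has_real_derivative ((1 / x * \<zeta> x + - w x / x - (k * x * w x + ?E)) * x - (\<zeta> x - w x)) / (x * x)) (at x)"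
      unfolding u'_def using xp by (auto intro!: derivative_eq_intros d(1,2)[OF x])
    moreover have "((1 / x * \<zeta> x + - w x / x - (k * x * w x + ?E)) * x - (\<zeta> x - w x)) / (x * x) = - (k * w x) - ?E / x"
      using xp by (simp add: field_simps)
    moreover have "- (k * w x) - ?E / x = u'' x"
    proof -
      have "?E / x = (u' x - \<sigma>) * (u' x + \<sigma>) * w x / 2 - ?c / u x * (1 + (u' x)\<^sup>2)"
        unfolding E using xp up by (simp add: field_simps)
      then show ?thesis unfolding u''_def xu k_def by (simp add: algebra_simps power2_eq_square add_divide_distrib)
    qed
    ultimately show "(u' has_real_derivative u'' x) (at x within {R<..})"
      using has_field_derivative_at_within by metis
    show "u'' x = ((x * u' x - u x) / 2 + ?c / u x) * (1 + (u' x)\<^sup>2)" by (simp add: u''_def)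
  qed
  then show ?thesis using R(1) d(3) by (intro that[of R u u' u'']) (auto simp: u_def)
qed

text \<open>Both solutions give fixed points of the contraction beyond a common \<open>R\<close> and
  hence agree there; uniqueness for the graph equation carries the equality back to
  \<open>x\<close>.\<close>

lemma asymptotic_solution_unique:
  assumes s: "\<sigma> > 0" and n: "n \<ge> 2" and d: "d \<ge> 0"
    and o1: "ode_sol n {d<..} u1 u1' u1''" and o2: "ode_sol n {d<..} u2 u2' u2''"
    and b1: "\<And>x. x > d \<Longrightarrow> \<bar>u1 x - \<sigma> * x\<bar> \<le> K / x \<and> \<bar>u1 x - x * u1' x\<bar> \<le> K / x"
    and b2: "\<And>x. x > d \<Longrightarrow> \<bar>u2 x - \<sigma> * x\<bar> \<le> K / x \<and> \<bar>u2 x - x * u2' x\<bar> \<le> K / x"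
    and x: "d < x"
  shows "u1 x = u2 x"
proof -
  define k where "k = (1 + \<sigma>\<^sup>2) / 2"
  have kp: "k > 0" unfolding k_def by (intro divide_pos_pos add_pos_nonneg) auto
  let ?c = "real n - 1"
  obtain B L where BL: "B > 0" "L > 0"
    "\<And>y \<zeta> w. 0 \<le> y \<Longrightarrow> y \<le> \<sigma> / 2 \<Longrightarrow> \<bar>\<zeta>\<bar> \<le> 1 \<Longrightarrow> \<bar>w\<bar> \<le> 1 \<Longrightarrow> \<bar>end_field ?c \<sigma> y \<zeta> w\<bar> \<le> B"
    "\<And>y \<zeta> w \<zeta>' w'. 0 \<le> y \<Longrightarrow> y \<le> \<sigma> / 2 \<Longrightarrow> \<bar>\<zeta>\<bar> \<le> 1 \<Longrightarrow> \<bar>w\<bar> \<le> 1 \<Longrightarrow> \<bar>\<zeta>'\<bar> \<le> 1 \<Longrightarrow> \<bar>w'\<bar> \<le> 1 \<Longrightarrow>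
       \<bar>end_field ?c \<sigma> y \<zeta> w - end_field ?c \<sigma> y \<zeta>' w'\<bar> \<le> L * (\<bar>\<zeta> - \<zeta>'\<bar> + \<bar>w - w'\<bar>)"
    using end_field_bounds[OF s, of ?c] by metis
  \<comment> \<open>Large enough for \<open>K / x <= 1\<close> beyond \<open>R\<close>, and to the
    right of the point at which equality is claimed.\<close>
  obtain R where R: "R \<ge> 1" "1 / R \<le> \<sigma> / 2" "B \<le> k * R" "4 * L \<le> k * R" "R \<ge> 1 + x + \<bar>K\<bar>"
  proof (rule end_radius[OF kp s BL(1,2)])
    show "0 < 1 + x + \<bar>K\<bar>" using x d by linarith
  qed
  note ctx = s k_def BL(3,4) BL(2) R(1-4)
  have Rx: "x < R" "\<bar>K\<bar> < R" "d < R" using R(5) x d by auto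
  have step: "end_step ?c \<sigma> k R (\<lambda>x. u x - x * u' x) (\<lambda>x. u x - \<sigma> * x) (\<lambda>x. u x - x * u' x)"
    if o: "ode_sol n {d<..} u u' u''"
      and b: "\<And>x. x > d \<Longrightarrow> \<bar>u x - \<sigma> * x\<bar> \<le> K / x \<and> \<bar>u x - x * u' x\<bar> \<le> K / x" for u u' u''
  proof -
    note D = ode_solD[OF o]
    have dz: "((\<lambda>x. u x - \<sigma> * x) has_real_derivative 1 / x * (u x - \<sigma> * x) + - (u x - x * u' x) / x) (at x)"
      and dw: "((\<lambda>x. u x - x * u' x) has_real_derivative
        k * x * (u x - x * u' x) + end_field ?c \<sigma> (1 / x) (u x - \<sigma> * x) (u x - x * u' x)) (at x)"
      if x: "R \<le> x" for x
    proof -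
      have xd: "d < x" and xp: "x > 0" using x Rx R(1) by auto
      note up = D(1)[OF xd]
      have "((\<lambda>x. u x - \<sigma> * x) has_real_derivative u' x - \<sigma>) (at x)"
        by (auto intro!: derivative_eq_intros D(2)[OF xd])
      moreover have "u' x - \<sigma> = 1 / x * (u x - \<sigma> * x) + - (u x - x * u' x) / x" using xp by (simp add: field_simps)
      ultimately show "((\<lambda>x. u x - \<sigma> * x) has_real_derivative 1 / x * (u x - \<sigma> * x) + - (u x - x * u' x) / x) (at x)"
        by metis
      have "((\<lambda>x. u x - x * u' x) has_real_derivative - (x * u'' x)) (at x)"
        by (auto intro!: derivative_eq_intros D(2,3)[OF xd])
      moreover have "- (x * u'' x) = k * x * (u x - x * u' x) + end_field ?c \<sigma> (1 / x) (u x - \<sigma> * x) (u x - x * u' x)"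
      proof -
        have 2: "(u x - \<sigma> * x) + (-1) * (u x - x * u' x) = x * (u' x - \<sigma>)" by (simp add: algebra_simps)
        have 1: "x * (u' x - \<sigma>) * (1 / x) = u' x - \<sigma>" using xp by simp
        have 3: "1 / (\<sigma> + (u x - \<sigma> * x) * (1 / x)) = x / u x" using xp up by (simp add: field_simps)
        have E: "end_field ?c \<sigma> (1 / x) (u x - \<sigma> * x) (u x - x * u' x) =
          (x * (u' x - \<sigma>)) * (2 * \<sigma> + (u' x - \<sigma>)) * (u x - x * u' x) / 2 - ?c * (1 + (u' x)\<^sup>2) * (x / u x)"
        proof -
          have "a * (1/2) + (- C) * q * z = a / 2 - C * q * z" for a C q z :: real by simp
          moreover have "\<sigma> + (u' x - \<sigma>) = u' x" by simp
          ultimately show ?thesis unfolding end_field_def 2 3 1 power2_eq_square by metis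
        qed
        \<comment> \<open>Writing \<open>1 + p^2 = (1 + \<sigma>^2) + (p - \<sigma>) * (2 * \<sigma>
          + (p - \<sigma>))\<close> splits off the linear term with rate
          \<open>k * x\<close>.\<close>
        have "- (x * (((x * p - v) / 2 + ?c / v) * (1 + p\<^sup>2))) = (1 + \<sigma>\<^sup>2) / 2 * x * (v - x * p) +
          ((x * (p - \<sigma>)) * (2 * \<sigma> + (p - \<sigma>)) * (v - x * p) / 2 - ?c * (1 + p\<^sup>2) * (x / v))" for p v
        proof -
          have "?c * (1 + p\<^sup>2) * (x / v) = (1 + p\<^sup>2) * (?c / v * x)" by simp
          moreover have "- (x * (((x * p - v) / 2 + C) * (1 + p\<^sup>2))) = (1 + \<sigma>\<^sup>2) / 2 * x * (v - x * p) +
            ((x * (p - \<sigma>)) * (2 * \<sigma> + (p - \<sigma>)) * (v - x * p) / 2 - (1 + p\<^sup>2) * (C * x))" for C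
            by (simp add: field_simps power2_eq_square)
          ultimately show ?thesis by metis
        qed
        then show ?thesis unfolding E D(4)[OF xd] k_def by blast
      qed
      ultimately show "((\<lambda>x. u x - x * u' x) has_real_derivative
        k * x * (u x - x * u' x) + end_field ?c \<sigma> (1 / x) (u x - \<sigma> * x) (u x - x * u' x)) (at x)" by metis
    qed
    have le1: "\<bar>u x - \<sigma> * x\<bar> \<le> 1" "\<bar>u x - x * u' x\<bar> \<le> 1" if x: "R \<le> x" for x
    proof -
      have "K / x \<le> 1" using x Rx R(1) by (simp add: divide_le_eq_1)
      moreover have "d < x" using x Rx by simp
      ultimately show "\<bar>u x - \<sigma> * x\<bar> \<le> 1" "\<bar>u x - x * u' x\<bar> \<le> 1" using b[of x] by auto
    qed
    show ?thesis unfolding end_step_def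
    proof (intro conjI allI impI)
      show "continuous_on {R..} (\<lambda>x. u x - x * u' x)"
        by (rule continuous_at_imp_continuous_on) (use DERIV_isCont[OF dw] in auto)
    qed (rule le1 has_field_derivative_at_within[OF dz] has_field_derivative_at_within[OF dw]; assumption)+
  qed
  have *: "u1 y - y * u1' y = u2 y - y * u2' y \<and> u1 y - \<sigma> * y = u2 y - \<sigma> * y" if y: "R \<le> y" for y
    using end_step_unique[OF ctx step[OF o1 b1] step[OF o2 b2] y] by blast
  have "u1 R = u2 R" "R * u1' R = R * u2' R" using *[of R] by auto
  then have eq: "u1 R = u2 R" "u1' R = u2' R" using R(1) by auto
  show ?thesis by (rule ode_sol_unique_left[OF o1 o2 x _ eq]) (use Rx in simp)
qed

section \<open>Self-intersection\<close>

lemma curv_transform: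
  assumes "s = 1 \<or> s = (-1::real)" "e = 1 \<or> e = (-1::real)" "cos ph = e * s" "sin ph = 0"
  shows "curv c (e * x) r (e * \<theta> + ph) = e * s * curv c x r \<theta>"
  using assms by (auto simp: curv_def cos_add sin_add algebra_simps)

section \<open>The arc lemmas transported to the other quadrants\<close>

context mcurve
begin

lemma transform:
  assumes "s = 1 \<or> s = (-1::real)" "e = 1 \<or> e = (-1::real)" "cos ph = e * s" "sin ph = 0"
  shows "mcurve n {t. s * t + a \<in> J} (\<lambda>t. e * x (s * t + a)) (\<lambda>t. r (s * t + a)) (\<lambda>t. e * th (s * t + a) + ph)"
  using max_geo_transform[OF mx assms] n2 by unfold_locales

text \<open>Reversing time together with reflecting \<open>x\<close> negates the angle and keeps the
  curvature, so this is \<open>valley_reaches_vertical\<close> run backwards.\<close>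

lemma valley_backward:
  assumes t0: "t0 \<in> J" and a: "th t0 = 0" "kap t0 > 0" "x t0 \<le> 0"
  obtains t1 where "t1 < t0" "t1 \<in> J" "th t1 = - (pi/2)"
proof -
  interpret m: mcurve n "{t. -1 * t + 0 \<in> J}" "\<lambda>t. -1 * x (-1 * t + 0)" "\<lambda>t. r (-1 * t + 0)" "\<lambda>t. -1 * th (-1 * t + 0) + 0"
    by (rule transform) auto
  have "m.kap (- t0) = kap t0" unfolding m.kap_def kap_def
    using curv_transform[of "-1" "-1" 0 c "x t0" "r t0" "th t0"] by simp
  then have pre: "- t0 \<in> {t. -1 * t + 0 \<in> J}" "-1 * th (-1 * - t0 + 0) + 0 = 0" "m.kap (- t0) > 0" "0 \<le> -1 * x (-1 * - t0 + 0)"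
    using a t0 by simp_all
  show ?thesis
  proof (rule m.valley_reaches_vertical[OF pre])
    fix t1 assume t1: "- t0 < t1" "t1 \<in> {t. -1 * t + 0 \<in> J}" "-1 * th (-1 * t1 + 0) + 0 = pi / 2"
    show thesis
    proof (rule that[of "- t1"])
      show "- t1 < t0" "- t1 \<in> J" using t1 by simp_all
      show "th (- t1) = - (pi/2)" using t1(3) by simp
    qed
  qed
qed

text \<open>Reflection in \<open>x\<close> with offset \<open>pi\<close> turns a leftward ascent
  with positive curvature into a concave ascent in the first quadrant.\<close>

lemma left_ascent_reaches_peak:
  assumes t0: "t0 \<in> J" and a: "pi/2 < th t0" "th t0 < pi" "kap t0 > 0"
  obtains t1 where "t0 < t1" "t1 \<in> J" "th t1 = pi" "kap t1 > 0" "\<And>t. t0 \<le> t \<Longrightarrow> t < t1 \<Longrightarrow> th t0 \<le> th t \<and> th t < pi"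
proof -
  interpret m: mcurve n "{t. 1 * t + 0 \<in> J}" "\<lambda>t. -1 * x (1 * t + 0)" "\<lambda>t. r (1 * t + 0)" "\<lambda>t. -1 * th (1 * t + 0) + pi"
    by (rule transform) auto
  have k: "m.kap t = - kap t" for t unfolding m.kap_def kap_def
    using curv_transform[of 1 "-1" pi c "x t" "r t" "th t"] by simp
  obtain t1 where "t0 < t1" "t1 \<in> J" "-1 * th t1 + pi = 0" "\<And>t. t0 \<le> t \<Longrightarrow> t \<le> t1 \<Longrightarrow> - kap t < 0"
    "\<And>t. t0 \<le> t \<Longrightarrow> t < t1 \<Longrightarrow> 0 < -1 * th t + pi \<and> -1 * th t + pi \<le> -1 * th t0 + pi"
    using m.concave_ascent_reaches_peak[of t0] a t0 unfolding k by auto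
  then show ?thesis by (intro that[of t1]) auto
qed

text \<open>Time reversal with offset \<open>- pi\<close> negates the curvature and turns the
  leftward horizontal point into a valley traversed to the right.\<close>

lemma left_valley_backward:
  assumes t0: "t0 \<in> J" and a: "th t0 = pi" "kap t0 < 0" "x t0 \<ge> 0"
  obtains t1 where "t1 < t0" "t1 \<in> J" "th t1 = 3 * pi / 2" "\<And>t. t1 \<le> t \<Longrightarrow> t \<le> t0 \<Longrightarrow> kap t < 0"
proof -
  interpret m: mcurve n "{t. -1 * t + 0 \<in> J}" "\<lambda>t. 1 * x (-1 * t + 0)" "\<lambda>t. r (-1 * t + 0)" "\<lambda>t. 1 * th (-1 * t + 0) + - pi"
    by (rule transform) auto
  have k: "m.kap t = - kap (- t)" for t unfolding m.kap_def kap_def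
    using curv_transform[of "-1" 1 "- pi" c "x (- t)" "r (- t)" "th (- t)"] by simp
  show ?thesis
  proof (rule m.valley_reaches_vertical[of "- t0"])
    show "- t0 \<in> {t. -1 * t + 0 \<in> J}" "1 * th (-1 * - t0 + 0) + - pi = 0" "m.kap (- t0) > 0" "0 \<le> 1 * x (-1 * - t0 + 0)"
      using a t0 unfolding k by simp_all
    fix t1 assume t1: "- t0 < t1" "t1 \<in> {t. -1 * t + 0 \<in> J}" "1 * th (-1 * t1 + 0) + - pi = pi / 2"
      "\<And>t. - t0 \<le> t \<Longrightarrow> t \<le> t1 \<Longrightarrow> m.kap t > 0"
    show thesis
    proof (rule that[of "- t1"])
      show "- t1 < t0" "- t1 \<in> J" using t1 by simp_all
      show "th (- t1) = 3 * pi / 2" using t1(3) by simp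
      show "kap t < 0" if "- t1 \<le> t" "t \<le> t0" for t using t1(4)[of "- t"] that unfolding k by simp
    qed
  qed
qed

text \<open>The reflected curve moves right for ever, so \<open>graph_trichotomy\<close> makes its
  angle \<open>pi - th\<close> positive.\<close>

lemma left_graph_trichotomy:
  assumes JJ: "{t0..} \<subseteq> J" and x0: "x t0 \<le> 0"
    and th: "\<And>t. t \<ge> t0 \<Longrightarrow> pi/2 < th t \<and> th t < 3 * pi/2"
    and nc: "\<exists>t\<in>J. th t \<noteq> pi"
  shows "th t0 < pi"
proof -
  interpret m: mcurve n "{t. 1 * t + 0 \<in> J}" "\<lambda>t. -1 * x (1 * t + 0)" "\<lambda>t. r (1 * t + 0)" "\<lambda>t. -1 * th (1 * t + 0) + pi"
    by (rule transform) auto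
  have "-1 * th (1 * t0 + 0) + pi > 0 \<and> m.kap t0 > 0"
  proof (rule m.graph_trichotomy[of t0])
    show "- (pi/2) < -1 * th (1 * t + 0) + pi \<and> -1 * th (1 * t + 0) + pi < pi/2" if "t \<ge> t0" for t
      using th[OF that] by auto
    show "\<not> (\<forall>t\<in>{t. 1 * t + 0 \<in> J}. -1 * th (1 * t + 0) + pi = 0 \<and> (r (1 * t + 0))\<^sup>2 = 2 * c)"
    proof
      assume all: "\<forall>t\<in>{t. 1 * t + 0 \<in> J}. -1 * th (1 * t + 0) + pi = 0 \<and> (r (1 * t + 0))\<^sup>2 = 2 * c"
      obtain t where t: "t \<in> J" "th t \<noteq> pi" using nc by blast
      then show False using bspec[OF all, of t] by simp
    qed
  qed (use JJ x0 in auto)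
  then show ?thesis by simp
qed

lemma shifted_descent:
  assumes t0: "t0 \<in> J" and a: "3 * pi/2 < th t0" "th t0 < 2 * pi" "kap t0 > 0"
  obtains t1 where "t0 < t1" "t1 \<in> J" "th t1 = 2 * pi" "kap t1 > 0" "\<And>t. t0 \<le> t \<Longrightarrow> t < t1 \<Longrightarrow> th t0 \<le> th t \<and> th t < 2 * pi"
proof -
  interpret m: mcurve n "{t. 1 * t + 0 \<in> J}" "\<lambda>t. 1 * x (1 * t + 0)" "\<lambda>t. r (1 * t + 0)" "\<lambda>t. 1 * th (1 * t + 0) + - (2 * pi)"
    by (rule transform) auto
  have k: "m.kap t = kap t" for t unfolding m.kap_def kap_def
    using curv_transform[of 1 1 "- (2 * pi)" c "x t" "r t" "th t"] by simp
  obtain t1 where "t0 < t1" "t1 \<in> J" "th t1 - 2 * pi = 0" "\<And>t. t0 \<le> t \<Longrightarrow> t \<le> t1 \<Longrightarrow> kap t > 0"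
    "\<And>t. t0 \<le> t \<Longrightarrow> t < t1 \<Longrightarrow> th t0 - 2 * pi \<le> th t - 2 * pi \<and> th t - 2 * pi < 0"
    using m.descending_reaches_valley[of t0] a t0 unfolding k by auto
  then show ?thesis by (intro that[of t1]) auto
qed

lemma shifted_valley:
  assumes t0: "t0 \<in> J" and a: "th t0 = 2 * pi" "kap t0 > 0" "x t0 \<ge> 0"
  obtains t1 where "t0 < t1" "t1 \<in> J" "th t1 = 5 * pi / 2" "\<And>t. t0 \<le> t \<Longrightarrow> t < t1 \<Longrightarrow> 2 * pi \<le> th t \<and> th t < 5 * pi / 2"
proof -
  interpret m: mcurve n "{t. 1 * t + 0 \<in> J}" "\<lambda>t. 1 * x (1 * t + 0)" "\<lambda>t. r (1 * t + 0)" "\<lambda>t. 1 * th (1 * t + 0) + - (2 * pi)"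
    by (rule transform) auto
  have k: "m.kap t = kap t" for t unfolding m.kap_def kap_def
    using curv_transform[of 1 1 "- (2 * pi)" c "x t" "r t" "th t"] by simp
  show ?thesis
  proof (rule m.valley_reaches_vertical[of t0])
    show "t0 \<in> {t. 1 * t + 0 \<in> J}" "1 * th (1 * t0 + 0) + - (2 * pi) = 0" "m.kap t0 > 0" "0 \<le> 1 * x (1 * t0 + 0)"
      using a t0 unfolding k by simp_all
    fix t1 assume t1: "t0 < t1" "t1 \<in> {t. 1 * t + 0 \<in> J}" "1 * th (1 * t1 + 0) + - (2 * pi) = pi / 2"
      "\<And>t. t0 \<le> t \<Longrightarrow> t < t1 \<Longrightarrow> 0 \<le> 1 * th (1 * t + 0) + - (2 * pi) \<and> 1 * th (1 * t + 0) + - (2 * pi) < pi / 2"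
    show thesis
    proof (rule that[OF t1(1)])
      show "t1 \<in> J" using t1(2) by simp
      show "th t1 = 5 * pi / 2" using t1(3) by simp
      show "2 * pi \<le> th t \<and> th t < 5 * pi / 2" if "t0 \<le> t" "t < t1" for t using t1(4)[OF that] by simp
    qed
  qed
qed

lemma x_strict_mono:
  assumes "a \<in> J" "b \<in> J" "a < b" "\<And>t. a < t \<Longrightarrow> t < b \<Longrightarrow> cos (th t) > 0"
  shows "x a < x b"
proof (rule DERIV_pos_imp_increasing_open[OF assms(3)])
  fix t assume "a < t" "t < b"
  then show "\<exists>y. (x has_real_derivative y) (at t) \<and> 0 < y"
    using dx[OF betw[OF assms(1,2)]] assms(4)[of t] by (intro exI[of _ "cos (th t)"]) auto
qed (intro cont Icc assms)

lemma x_strict_anti: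
  assumes "a \<in> J" "b \<in> J" "a < b" "\<And>t. a < t \<Longrightarrow> t < b \<Longrightarrow> cos (th t) < 0"
  shows "x b < x a"
proof -
  have "- x a < - x b"
  proof (rule DERIV_pos_imp_increasing_open[OF assms(3)])
    fix t assume "a < t" "t < b"
    then show "\<exists>y. ((\<lambda>t. - x t) has_real_derivative y) (at t) \<and> 0 < y"
      using DERIV_minus[OF dx[OF betw[OF assms(1,2)]]] assms(4)[of t] by (intro exI[of _ "- cos (th t)"]) auto
  qed (intro continuous_on_minus cont Icc assms)
  then show ?thesis by simp
qed

lemma kap_nonneg_if_th_first_hit:
  assumes t: "t \<in> J" and a: "a < t" "\<And>s. a \<le> s \<Longrightarrow> s < t \<Longrightarrow> th s \<le> th t"
  shows "kap t \<ge> 0"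
proof (rule ccontr)
  assume "\<not> kap t \<ge> 0"
  then have "kap t < 0" by simp
  from DERIV_neg_dec_left[OF dth[OF t] this]
  obtain d where d: "d > 0" "\<And>h. h > 0 \<Longrightarrow> h < d \<Longrightarrow> th t < th (t - h)" by blast
  define h where "h = min (d / 2) (t - a)"
  have "h > 0" "h < d" "a \<le> t - h" using d(1) a by (auto simp: h_def)
  then show False using d(2)[of h] a(2)[of "t - h"] by simp
qed

lemma th_after:
  assumes t: "t \<in> J" and k: "kap t > 0" and v: "th t < v"
  obtains e where "e > 0" "\<And>s. t \<le> s \<Longrightarrow> s \<le> t + e \<Longrightarrow> s \<in> J \<and> kap s > 0 \<and> th s < v"
    "\<And>s. t < s \<Longrightarrow> s \<le> t + e \<Longrightarrow> th t < th s"
proof -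
  obtain e1 where e1: "e1 > 0" "ball t e1 \<subseteq> J" using openJ t by (meson open_contains_ball)
  have "isCont kap t" "isCont th t" using dkap[OF t] dth[OF t] DERIV_isCont by blast+
  from tendsto_within_open[of t UNIV kap "kap t"]
  have "\<forall>\<^sub>F s in nhds t. kap s > 0" using \<open>isCont kap t\<close> k
    by (simp add: isCont_def tendsto_at_iff_tendsto_nhds order_tendstoD)
  moreover have "\<forall>\<^sub>F s in nhds t. th s < v" using \<open>isCont th t\<close> v
    by (simp add: isCont_def tendsto_at_iff_tendsto_nhds order_tendstoD)
  ultimately have "\<forall>\<^sub>F s in nhds t. kap s > 0 \<and> th s < v" by eventually_elim blast
  then obtain e2 where e2: "e2 > 0" "\<And>s. dist s t < e2 \<Longrightarrow> kap s > 0 \<and> th s < v"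
    unfolding eventually_nhds_metric by blast
  define e where "e = min e1 e2 / 2"
  have e: "e > 0" "e < e1" "e < e2" using e1(1) e2(1) by (auto simp: e_def)
  have J: "s \<in> J" if "t \<le> s" "s \<le> t + e" for s using e1(2) e that by (auto simp: dist_real_def)
  have K: "kap s > 0 \<and> th s < v" if "t \<le> s" "s \<le> t + e" for s using e2(2)[of s] e that by (auto simp: dist_real_def)
  show ?thesis
  proof (rule that[OF e(1)])
    show "s \<in> J \<and> kap s > 0 \<and> th s < v" if "t \<le> s" "s \<le> t + e" for s using J[OF that] K[OF that] by blast
    show "th t < th s" if "t < s" "s \<le> t + e" for s
    proof (rule deriv_strict[OF that(1)])
      fix u assume u: "t \<le> u" "u \<le> s"
      then have "u \<le> t + e" using that by simp
      then show "(th has_real_derivative kap u) (at u)" "kap u > 0" using dth[OF J] K u by auto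
    qed
  qed
qed

end

text \<open>The mirror image of the curve carrying the graph, traversed so that the asymptotic end
  lies in the past: it comes from \<open>x = - \<infinity>\<close>, descending and convex. Every
  continuation then runs forward in time.\<close>

locale trumpet_curve = mcurve +
  fixes t0
  assumes past: "{..t0} \<subseteq> J" "\<And>t. t \<le> t0 \<Longrightarrow> - (pi/2) < th t \<and> th t < 0 \<and> kap t > 0"
    and x_unbounded: "\<And>\<xi>. \<exists>t\<le>t0. x t < \<xi>"
begin

lemma arcs:
  obtains tv tb where "tv < tb" "tb \<in> J" "{..tb} \<subseteq> J" "th tv = 0" "th tb = pi/2" "x tv > 0" "t0 < tv"
    "\<And>t. t \<le> tb \<Longrightarrow> kap t > 0" "\<And>t. t < tv \<Longrightarrow> - (pi/2) < th t \<and> th t < 0"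
    "\<And>t. tv \<le> t \<Longrightarrow> t < tb \<Longrightarrow> 0 \<le> th t \<and> th t < pi/2"
proof -
  have t0: "t0 \<in> J" using past(1) by auto
  obtain tv where tv: "t0 < tv" "tv \<in> J" "th tv = 0" "\<And>t. t0 \<le> t \<Longrightarrow> t \<le> tv \<Longrightarrow> kap t > 0"
    "\<And>t. t0 \<le> t \<Longrightarrow> t < tv \<Longrightarrow> th t0 \<le> th t \<and> th t < 0"
    using descending_reaches_valley[OF t0, of thesis] past(2)[of t0] by blast
  have before: "- (pi/2) < th t \<and> th t < 0" if "t < tv" for t
    using past(2)[of t] past(2)[of t0] tv(5)[of t] that by (cases "t \<le> t0") auto
  \<comment> \<open>A valley at \<open>x <= 0\<close>, followed backwards, would have a vertical
    tangent in the past, where the curve is a graph.\<close>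
  have xv: "x tv > 0"
  proof (rule ccontr)
    assume "\<not> x tv > 0"
    then have "x tv \<le> 0" by simp
    moreover have "kap tv > 0" using tv by simp
    ultimately obtain t1 where "t1 < tv" "th t1 = - (pi/2)" using valley_backward[OF tv(2,3)] by metis
    then show False using before[of t1] by auto
  qed
  have "kap tv > 0" "x tv \<ge> 0" using tv xv by auto
  then obtain tb where tb: "tv < tb" "tb \<in> J" "th tb = pi / 2" "\<And>t. tv \<le> t \<Longrightarrow> t \<le> tb \<Longrightarrow> kap t > 0"
    "\<And>t. tv \<le> t \<Longrightarrow> t < tb \<Longrightarrow> 0 \<le> th t \<and> th t < pi / 2"
    using valley_reaches_vertical[OF tv(2,3), of thesis] by blast
  show ?thesis
  proof (rule that[OF tb(1,2) _ tv(3) tb(3) xv tv(1)])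
    show "{..tb} \<subseteq> J"
    proof
      fix t assume "t \<in> {..tb}"
      then show "t \<in> J" using past(1) betw[OF t0 tb(2), of t] by (cases "t \<le> t0") auto
    qed
    show "kap t > 0" if "t \<le> tb" for t
      using past(2)[of t] tv(4)[of t] tb(4)[of t] that by (meson linear)
  qed (use before tb(5) in auto)
qed

lemma graph:
  assumes tb: "{..tb} \<subseteq> J" "\<And>t. t < tb \<Longrightarrow> - (pi/2) < th t \<and> th t < pi/2" "t0 < tb"
  obtains u u' u'' where "\<And>t. t < tb \<Longrightarrow> u (x t) = r t \<and> u' (x t) = tan (th t) \<and> u'' (x t) = kap t / cos (th t) ^ 3"
    "ode_sol n {..<x tb} u u' u''" "x ` {..<tb} = {..<x tb}"
    "\<And>\<xi>. \<xi> < x tb \<Longrightarrow> (u has_real_derivative u' \<xi>) (at \<xi>) \<and> (u' has_real_derivative u'' \<xi>) (at \<xi>)"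
proof -
  have J: "t \<in> J" if "t \<le> tb" for t using tb(1) that by auto
  have C: "cos (th t) > 0" if "t < tb" for t using tb(2)[OF that] by (intro cos_gt_zero_pi) auto
  have xs: "x s < x t" if "s < t" "t \<le> tb" for s t
    by (rule x_strict_mono) (use that J C in auto)
  have im: "x ` {..<tb} = {..<x tb}"
  proof (intro equalityI subsetI)
    fix \<xi> assume "\<xi> \<in> x ` {..<tb}"
    then show "\<xi> \<in> {..<x tb}" using xs by auto
  next
    fix \<xi> assume \<xi>: "\<xi> \<in> {..<x tb}"
    obtain a where a: "a \<le> t0" "x a < \<xi>" using x_unbounded by blast
    have "continuous_on {a..tb} x" by (rule cont) (use J in auto)
    then obtain t where "a \<le> t" "t \<le> tb" "x t = \<xi>"
      using IVT'[of x a \<xi> tb] a \<xi> tb(3) by auto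
    then show "\<xi> \<in> x ` {..<tb}" using \<xi> by (auto simp: image_iff le_less intro!: bexI[of _ t])
  qed
  have "\<exists>u u' u''. (\<forall>t\<in>{..<tb}. u (x t) = r t \<and> u' (x t) = tan (th t) \<and> u'' (x t) = kap t / cos (th t) ^ 3) \<and>
    ode_sol n (x ` {..<tb}) u u' u'' \<and>
    (\<forall>\<xi>\<in>x ` {..<tb}. (u has_real_derivative u' \<xi>) (at \<xi>) \<and> (u' has_real_derivative u'' \<xi>) (at \<xi>))"
  proof (rule curve_to_graph[of "{..<tb}"])
    show "is_interval {..<tb}" by (simp add: is_interval_def)
    fix u u' u'' assume
      "\<And>t. t \<in> {..<tb} \<Longrightarrow> u (x t) = r t \<and> u' (x t) = tan (th t) \<and> u'' (x t) = kap t / cos (th t) ^ 3"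
      "ode_sol n (x ` {..<tb}) u u' u''"
      "\<And>\<xi>. \<xi> \<in> x ` {..<tb} \<Longrightarrow> (u has_real_derivative u' \<xi>) (at \<xi>) \<and> (u' has_real_derivative u'' \<xi>) (at \<xi>)"
    then show "\<exists>u u' u''. (\<forall>t\<in>{..<tb}. u (x t) = r t \<and> u' (x t) = tan (th t) \<and> u'' (x t) = kap t / cos (th t) ^ 3) \<and>
      ode_sol n (x ` {..<tb}) u u' u'' \<and>
      (\<forall>\<xi>\<in>x ` {..<tb}. (u has_real_derivative u' \<xi>) (at \<xi>) \<and> (u' has_real_derivative u'' \<xi>) (at \<xi>))"
      by (intro exI[of _ u] exI[of _ u'] exI[of _ u''] conjI ballI) auto
  qed (use J C in auto)
  then obtain u u' u'' where P: "\<forall>t\<in>{..<tb}. u (x t) = r t \<and> u' (x t) = tan (th t) \<and> u'' (x t) = kap t / cos (th t) ^ 3"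
    "ode_sol n {..<x tb} u u' u''"
    "\<forall>\<xi>\<in>{..<x tb}. (u has_real_derivative u' \<xi>) (at \<xi>) \<and> (u' has_real_derivative u'' \<xi>) (at \<xi>)"
    unfolding im by (elim exE conjE)
  show ?thesis by (rule that[OF _ P(2) im]) (use P(1,3) in \<open>simp_all only: Ball_def lessThan_iff\<close>)
qed

text \<open>Let \<open>u\<close> be the graph traced before the vertical tangent at \<open>tb\<close>. Injectivity keeps \<open>r - u (x)\<close>
  positive after \<open>tb\<close>, and its derivative \<open>sg\<close> can vanish only decreasingly; this rules out, one quadrant
  of \<open>th\<close> after the other, every continuation but a return to \<open>x = b\<close> below the returning arc.\<close>

lemma not_embedded: "\<not> inj_on (\<lambda>t. (x t, r t)) J"
proof
  assume inj: "inj_on (\<lambda>t. (x t, r t)) J"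
  obtain tv tb where a: "tv < tb" "tb \<in> J" "{..tb} \<subseteq> J" "th tv = 0" "th tb = pi/2" "x tv > 0" "t0 < tv"
    "\<And>t. t \<le> tb \<Longrightarrow> kap t > 0" "\<And>t. t < tv \<Longrightarrow> - (pi/2) < th t \<and> th t < 0"
    "\<And>t. tv \<le> t \<Longrightarrow> t < tb \<Longrightarrow> 0 \<le> th t \<and> th t < pi/2"
    using arcs by metis
  define b where "b = x tb"
  define m where "m = x tv"
  have J: "t \<in> J" if "t \<le> tb" for t using a(3) that by auto
  have J': "t \<in> J" if "tb \<le> t" "t \<le> s" "s \<in> J" for t s using betw[OF a(2) that(3)] that by blast
  have thb: "- (pi/2) < th t \<and> th t < pi/2" if "t < tb" for t
    using a(9)[of t] a(10)[of t] that pi_gt_zero by (cases "t < tv") auto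
  have "t0 < tb" using a by simp
  from graph[OF a(3) thb this] obtain u u' u'' where
    u: "\<And>t. t < tb \<Longrightarrow> u (x t) = r t \<and> u' (x t) = tan (th t) \<and> u'' (x t) = kap t / cos (th t) ^ 3"
    and o: "ode_sol n {..<b} u u' u''" and im: "x ` {..<tb} = {..<b}"
    and du: "\<And>\<xi>. \<xi> < b \<Longrightarrow> (u has_real_derivative u' \<xi>) (at \<xi>) \<and> (u' has_real_derivative u'' \<xi>) (at \<xi>)"
    unfolding b_def by metis
  have Cb: "cos (th t) > 0" if "t < tb" for t using thb[OF that] by (intro cos_gt_zero_pi) auto
  have xs: "x s < x t" if "s < t" "t \<le> tb" for s t
    by (rule x_strict_mono) (use that J Cb in auto)
  have mb: "m < b" "m > 0" using xs[OF a(1)] a(6) by (auto simp: m_def b_def)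
  have preim: "\<exists>t<tb. x t = \<xi>" if "\<xi> < b" for \<xi> using im that by (metis imageE lessThan_iff)
  have r_up: "r s \<le> r t" if "tv \<le> s" "s \<le> t" "t \<le> tb" for s t
  proof (rule r_lower_quadrant)
    fix q assume "s \<le> q" "q \<le> t"
    then have "th q = pi/2 \<or> (0 \<le> th q \<and> th q < pi/2)"
      using a(10)[of q] a(5) that by (cases "q = tb") auto
    then show "0 \<le> th q \<and> th q \<le> pi" using pi_gt_zero by linarith
  qed (use that J in auto)
  \<comment> \<open>The valley is the lowest point of the graph. Later, staying above the graph
    therefore keeps the curve away from the axis.\<close>
  have r_min: "r tv \<le> r t" if "t \<le> tb" for t
  proof (cases "t < tv")
    case True
    have "r tv \<le> r t + 0 * (tv - t)"
    proof (rule deriv_upper[of t tv r "\<lambda>t. sin (th t)"])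
      fix q assume q: "t \<le> q" "q \<le> tv"
      show "(r has_real_derivative sin (th q)) (at q)" by (rule dr[OF J]) (use q a in auto)
      show "sin (th q) \<le> 0"
        using sin_neg_quadrant[of "th q"] a(9)[of q] a(4) q by (cases "q = tv") auto
    qed (use True in auto)
    then show ?thesis by simp
  next
    case False then show ?thesis using r_up[of tv t] that by simp
  qed
  have umin: "r tv \<le> u \<xi>" if \<xi>: "\<xi> < b" for \<xi>
  proof -
    obtain t where "t < tb" "x t = \<xi>" using preim[OF \<xi>] by blast
    then show ?thesis using u[of t] r_min[of t] by simp
  qed
  have u'neg: "u' \<xi> < 0" if \<xi>: "\<xi> < m" for \<xi>
  proof -
    obtain t where t: "t < tb" "x t = \<xi>" using preim[of \<xi>] \<xi> mb by auto
    have "t < tv"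
    proof (rule ccontr)
      assume "\<not> t < tv"
      then have "m \<le> x t" using xs[of tv t] t by (cases "t = tv") (auto simp: m_def)
      then show False using \<xi> t by simp
    qed
    then have "tan (th t) < 0" using a(9)[of t] tan_gt_zero[of "- th t"] by simp
    then show ?thesis using u[OF t(1)] t by simp
  qed
  have rv: "r tv > 0" using rpos[OF J] a(1) by simp
  note D = o[unfolded ode_sol_def]
  have upos: "u \<xi> > 0" if "\<xi> < b" for \<xi> using umin[OF that] rv by simp
  have ueq: "u'' \<xi> = ((\<xi> * u' \<xi> - u \<xi>) / 2 + c / u \<xi>) * (1 + (u' \<xi>)\<^sup>2)" if "\<xi> < b" for \<xi>
    using D that by auto
  \<comment> \<open>\<open>dl\<close> is the height of the curve above the graph at the same
    abscissa, and \<open>sg\<close> is its time derivative.\<close>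
  define dl where "dl t = r t - u (x t)" for t
  define sg where "sg t = sin (th t) - u' (x t) * cos (th t)" for t
  have ddl: "(dl has_real_derivative sg t) (at t)" if t: "t \<in> J" "x t < b" for t
    unfolding dl_def sg_def
    by (intro DERIV_diff dr[OF t(1)] DERIV_chain2[OF conjunct1[OF du[OF t(2)]] dx[OF t(1)]])
  have dsg: "(sg has_real_derivative (cos (th t) * kap t - (u'' (x t) * cos (th t) * cos (th t) + - sin (th t) * kap t * u' (x t)))) (at t)"
    if t: "t \<in> J" "x t < b" for t
  proof -
    have 1: "((\<lambda>t. sin (th t)) has_real_derivative cos (th t) * kap t) (at t)"
      by (rule DERIV_chain2[OF DERIV_sin dth[OF t(1)]])
    have 2: "((\<lambda>t. cos (th t)) has_real_derivative - sin (th t) * kap t) (at t)"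
      by (rule DERIV_chain2[OF DERIV_cos dth[OF t(1)]])
    have 3: "((\<lambda>t. u' (x t)) has_real_derivative u'' (x t) * cos (th t)) (at t)"
      by (rule DERIV_chain2[OF conjunct2[OF du[OF t(2)]] dx[OF t(1)]])
    show ?thesis unfolding sg_def[abs_def] by (rule DERIV_diff[OF 1 DERIV_mult[OF 3 2]])
  qed
  \<comment> \<open>Where \<open>sg\<close> vanishes, the curve is parallel to the graph at the same
    \<open>x\<close>. The two curvatures then differ only through \<open>c / r - r / 2\<close>,
    which is strictly decreasing in \<open>r\<close>, and the curve lies higher.\<close>
  have dsg0: "cos (th t) * kap t - (u'' (x t) * cos (th t) * cos (th t) + - sin (th t) * kap t * u' (x t)) < 0"
    if t: "t \<in> J" "x t < b" "sg t = 0" "dl t > 0" for t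
  proof -
    define C p R v where d: "C = cos (th t)" "p = u' (x t)" "R = r t" "v = u (x t)"
    have S: "sin (th t) = p * C" using t(3) by (simp add: sg_def d)
    have C0: "C \<noteq> 0" using S sin_cos_squared_add[of "th t"] by (auto simp: d)
    have v0: "v > 0" using upos[OF t(2)] by (simp add: d)
    have vR: "v < R" using t(4) by (simp add: dl_def d)
    have k: "kap t = C * (x t / 2 * p + (c / R - R / 2))" unfolding kap_eq S d(1)[symmetric] d(3)[symmetric] by (simp add: algebra_simps)
    have "C * kap t - (u'' (x t) * C * C + - sin (th t) * kap t * p)
        = C * C * (1 + p\<^sup>2) * ((c / R - R / 2) - (c / v - v / 2))"
      unfolding ueq[OF t(2)] k S d(2)[symmetric] d(4)[symmetric]
      by (simp add: algebra_simps power2_eq_square diff_divide_distrib add_divide_distrib)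
    also have "\<dots> < 0"
    proof (rule mult_pos_neg)
      have "C * C > 0" using C0 by (metis not_real_square_gt_zero)
      moreover have "1 + p\<^sup>2 > 0" by (intro add_pos_nonneg) auto
      ultimately show "C * C * (1 + p\<^sup>2) > 0" by (rule mult_pos_pos)
      have "c / R < c / v" using v0 vR c1 by (intro divide_strict_left_mono) auto
      then show "(c / R - R / 2) - (c / v - v / 2) < 0" using vR by argo
    qed
    finally show ?thesis by (simp only: d)
  qed
  have noncross: "dl t \<noteq> 0" if t: "t \<in> J" "tb < t" "x t < b" for t
  proof
    assume "dl t = 0"
    obtain s where s: "s < tb" "x s = x t" using preim[OF t(3)] by blast
    then have "r s = r t" using u[OF s(1)] \<open>dl t = 0\<close> by (simp add: dl_def)
    then have "s = t" using inj s t J[of s] unfolding inj_on_def by auto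
    then show False using s t by simp
  qed
  \<comment> \<open>Just after \<open>tb\<close> the curve is higher than \<open>r tb\<close>, which
    bounds the ascending part of the graph; afterwards \<open>noncross\<close> preserves the
    sign.\<close>
  have dlpos: "dl t > 0" if t: "t \<in> J" "tb < t" and xt: "\<And>s. tb < s \<Longrightarrow> s \<le> t \<Longrightarrow> x s < b" for t
  proof (rule ccontr)
    assume "\<not> dl t > 0"
    have "isCont x tb" using dx[OF a(2)] DERIV_isCont by blast
    then have "\<forall>\<^sub>F s in at tb. x s > m" using mb(1) unfolding isCont_def b_def by (rule order_tendstoD)
    then obtain e1 where e1: "e1 > 0" "\<And>s. s \<noteq> tb \<Longrightarrow> dist s tb < e1 \<Longrightarrow> x s > m" unfolding eventually_at by auto
    have "sin (th tb) > 0" unfolding a(5) by simp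
    from DERIV_pos_inc_right[OF dr[OF a(2)] this]
    obtain e2 where e2: "e2 > 0" "\<And>h. h > 0 \<Longrightarrow> h < e2 \<Longrightarrow> r tb < r (tb + h)" by blast
    define h where "h = min (min (e1/2) (e2/2)) (t - tb)"
    have h: "h > 0" "h < e1" "h < e2" "tb + h \<le> t" using e1(1) e2(1) t by (auto simp: h_def)
    have xh: "x (tb + h) < b" "x (tb + h) > m" using xt[of "tb + h"] h e1(2)[of "tb + h"] by (auto simp: dist_real_def)
    obtain s where s: "s < tb" "x s = x (tb + h)" using preim[OF xh(1)] by blast
    have "tv \<le> s"
    proof (rule ccontr)
      assume "\<not> tv \<le> s"
      then have "x s < m" unfolding m_def using xs[of s tv] a(1) by simp
      then show False using s xh by simp
    qed
    then have "r s \<le> r tb" using r_up[of s tb] s by simp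
    then have pos: "dl (tb + h) > 0" using e2(2)[OF h(1,3)] u[OF s(1)] s(2) by (simp add: dl_def)
    have J2: "q \<in> J" if "tb + h \<le> q" "q \<le> t" for q using J'[of q t] that h t by auto
    have "continuous_on {tb + h..t} dl"
    proof (rule continuous_at_imp_continuous_on, intro ballI)
      fix q assume "q \<in> {tb + h..t}"
      then show "isCont dl q" using DERIV_isCont[OF ddl[OF J2 xt]] h by auto
    qed
    from first_nonpos[OF h(4) this pos] \<open>\<not> dl t > 0\<close>
    obtain q where "tb + h < q" "q \<le> t" "dl q = 0" by (metis not_less)
    then show False using noncross[of q] J2[of q] xt[of q] h by auto
  qed
  \<comment> \<open>A return of \<open>sg\<close> to \<open>0\<close> from below would contradict
    the strict decrease in \<open>dsg0\<close>.\<close>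
  have sgneg: "sg t < 0" if t3: "tb < t3" "t3 \<le> t" "t \<in> J" "sg t3 < 0" and xt: "\<And>s. tb < s \<Longrightarrow> s \<le> t \<Longrightarrow> x s < b" for t3 t
  proof (rule ccontr)
    assume neg: "\<not> sg t < 0"
    have J2: "q \<in> J" if "t3 \<le> q" "q \<le> t" for q using J'[of q t] that t3 by auto
    have "continuous_on {t3..t} sg"
    proof (rule continuous_at_imp_continuous_on, intro ballI)
      fix q assume "q \<in> {t3..t}"
      then show "isCont sg q" using DERIV_isCont[OF dsg[OF J2 xt]] t3 by auto
    qed
    from first_hit[OF t3(2) this t3(4)] neg
    obtain q where q: "t3 < q" "q \<le> t" "sg q = 0" "\<And>s. t3 \<le> s \<Longrightarrow> s < q \<Longrightarrow> sg s < 0" by (metis not_less)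
    have qJ: "q \<in> J" "x q < b" "tb < q" using J2[of q] xt[of q] q t3 by auto
    have "dl q > 0" by (rule dlpos[OF qJ(1,3)]) (use xt q in auto)
    from DERIV_neg_dec_left[OF dsg[OF qJ(1,2)] dsg0[OF qJ(1,2) q(3) this]]
    obtain d where d: "d > 0" "\<And>h. h > 0 \<Longrightarrow> h < d \<Longrightarrow> sg q < sg (q - h)" by blast
    define h where "h = min (d/2) (q - t3)"
    have "h > 0" "h < d" "t3 \<le> q - h" using d(1) q(1) by (auto simp: h_def)
    then show False using d(2)[of h] q(3) q(4)[of "q - h"] by simp
  qed
  \<comment> \<open>Beyond the vertical tangent the curve turns left and rises to a peak at
    \<open>tp\<close>, where \<open>th = pi\<close>.\<close>
  have kb: "kap tb > 0" using a(8) by simp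
  have "th tb < pi" using a(5) pi_gt_zero by linarith
  from th_after[OF a(2) kb this] obtain e where e: "e > 0"
    "\<And>s. tb \<le> s \<Longrightarrow> s \<le> tb + e \<Longrightarrow> s \<in> J \<and> kap s > 0 \<and> th s < pi" "\<And>s. tb < s \<Longrightarrow> s \<le> tb + e \<Longrightarrow> pi/2 < th s"
    unfolding a(5) by metis
  have "tb + e \<in> J" "pi/2 < th (tb + e)" "th (tb + e) < pi" "kap (tb + e) > 0" using e(1) e(2)[of "tb + e"] e(3)[of "tb + e"] by auto
  from left_ascent_reaches_peak[OF this] obtain tp where tp: "tb + e < tp" "tp \<in> J" "th tp = pi" "kap tp > 0"
    "\<And>t. tb + e \<le> t \<Longrightarrow> t < tp \<Longrightarrow> th (tb + e) \<le> th t \<and> th t < pi" by metis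
  have th2a: "pi/2 < th t \<and> th t \<le> pi" if "tb < t" "t \<le> tp" for t
  proof (cases "t \<le> tb + e")
    case True then show ?thesis using e(2)[of t] e(3)[of t] that by auto
  next
    case False
    show ?thesis
    proof (cases "t = tp")
      case True then show ?thesis unfolding True using tp(3) pi_gt_zero by linarith
    next
      case f2: False
      then have "th (tb + e) \<le> th t \<and> th t < pi" using tp(5)[of t] False that by simp
      moreover have "pi/2 < th (tb + e)" using e(3)[of "tb + e"] e(1) by simp
      ultimately show ?thesis by linarith
    qed
  qed
  have ctp: "tb < tp" using tp e by simp
  have cosneg: "cos \<theta> < 0" if "pi/2 < \<theta>" "\<theta> < 3 * pi/2" for \<theta>
    using cos_gt_zero_pi[of "\<theta> - pi"] that by (simp add: cos_diff)
  have xbelow: "x t < b" if t: "tb < t" "t \<in> J" and r3: "\<And>s. tb < s \<Longrightarrow> s < t \<Longrightarrow> pi/2 < th s \<and> th s < 3 * pi/2" for t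
    unfolding b_def by (rule x_strict_anti[OF a(2) t(2,1)]) (use r3 cosneg in blast)
  have rge: "r t \<ge> r tv" if t: "tb < t" "t \<in> J" and xt: "\<And>s. tb < s \<Longrightarrow> s \<le> t \<Longrightarrow> x s < b" for t
    using dlpos[OF t(2,1) xt] umin[OF xt[of t]] t by (simp add: dl_def)
  \<comment> \<open>If the peak still lies at \<open>x > 0\<close>, the leftward descent must reach
    \<open>x = 0\<close> before the tangent becomes horizontal again or vertical.\<close>
  have "\<exists>t3\<in>J. tp \<le> t3 \<and> x t3 \<le> 0 \<and> (\<forall>s. tp \<le> s \<longrightarrow> s \<le> t3 \<longrightarrow> pi \<le> th s \<and> th s < 3 * pi/2)"
  proof (cases "x tp \<le> 0")
    case True
    then show ?thesis using tp pi_gt_zero by (intro bexI[of _ tp]) auto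
  next
    case False
    then have xtp: "x tp > 0" by simp
    \<comment> \<open>A return to \<open>th = pi\<close> from above has negative curvature. Followed
      backwards, such a valley at \<open>x >= 0\<close> keeps negative curvature until
      \<open>th = 3 * pi / 2\<close>; this contradicts the bound on \<open>th\<close> after
      \<open>tp\<close>, or the positive curvature at \<open>tp\<close> itself.\<close>
    have gepi: "pi < th t" if t: "t \<in> J" "tp < t" and pr: "\<And>s. tp \<le> s \<Longrightarrow> s \<le> t \<Longrightarrow> x s > 0 \<and> th s < 3 * pi/2" for t
    proof (rule ccontr)
      assume neg: "\<not> pi < th t"
      have "th tp < 3 * pi/2" using tp(3) pi_gt_zero by linarith
      from th_after[OF tp(2,4) this] obtain e' where e': "e' > 0" "\<And>s. tp < s \<Longrightarrow> s \<le> tp + e' \<Longrightarrow> pi < th s"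
        unfolding tp(3) by metis
      define q where "q = min (tp + e') t"
      have q: "tp < q" "q \<le> t" "th q - pi > 0" using e' t by (auto simp: q_def)
      have Jq: "s \<in> J" if "tp \<le> s" "s \<le> t" for s using betw[OF tp(2) t(1) that] .
      have "continuous_on {q..t} (\<lambda>s. th s - pi)"
        by (intro continuous_intros cont) (use Jq q in auto)
      from first_nonpos[OF q(2) this q(3)] neg
      obtain tr where tr: "q < tr" "tr \<le> t" "th tr - pi = 0" "\<And>s. q \<le> s \<Longrightarrow> s < tr \<Longrightarrow> th s - pi > 0" by (metis diff_gt_0_iff_gt not_less)
      have trJ: "tr \<in> J" using Jq q tr by auto
      have tr1: "th tr = pi" using tr by simp
      have "kap tr \<noteq> 0"
      proof
        assume "kap tr = 0"
        then have "th tb = th tr" using horizontal_stationary[OF trJ _ _ a(2)] tr1 by simp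
        then show False using a(5) tr1 pi_gt_zero by linarith
      qed
      moreover have "\<not> kap tr > 0"
      proof
        assume "kap tr > 0"
        from DERIV_pos_inc_left[OF dth[OF trJ] this]
        obtain d where d: "d > 0" "\<And>h. h > 0 \<Longrightarrow> h < d \<Longrightarrow> th (tr - h) < th tr" by blast
        define h where "h = min (d/2) (tr - q)"
        have "h > 0" "h < d" "q \<le> tr - h" using d(1) tr(1) by (auto simp: h_def)
        then show False using d(2)[of h] tr1 tr(4)[of "tr - h"] by simp
      qed
      ultimately have kr: "kap tr < 0" by simp
      have "x tr \<ge> 0" using pr[of tr] tr q by simp
      from left_valley_backward[OF trJ tr1 kr this]
      obtain t1 where t1: "t1 < tr" "t1 \<in> J" "th t1 = 3 * pi / 2" "\<And>s. t1 \<le> s \<Longrightarrow> s \<le> tr \<Longrightarrow> kap s < 0" by metis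
      show False
      proof (cases "tp \<le> t1")
        case True
        then show False using pr[of t1] t1 tr by simp
      next
        case False
        then show False using t1(4)[of tp] tp(4) q tr by simp
      qed
    qed
    show ?thesis
    proof (rule ccontr)
      assume none: "\<not> ?thesis"
      have good: "x t > 0 \<and> th t < 3 * pi/2" if t: "t \<in> J" "tp \<le> t" for t
      proof (rule ccontr)
        assume bad: "\<not> (x t > 0 \<and> th t < 3 * pi/2)"
        \<comment> \<open>The first zero of \<open>f\<close> is the first failure of one of the two
          conditions. A downward vertical tangent there needs \<open>kap >= 0\<close>, hence
          \<open>x = 0\<close>, and the curve would coincide with the line \<open>x = 0\<close>
          nearby; so \<open>x\<close> reaches \<open>0\<close> with an admissible angle.\<close>
        define f where "f s = min (x s) (3 * pi/2 - th s)" for s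
        have "continuous_on {tp..t} f" unfolding f_def
          by (intro continuous_intros cont Icc[OF tp(2) t(1)])
        moreover have "3 * pi/2 - th tp > 0" using tp(3) pi_gt_zero by linarith
        then have "f tp > 0" using xtp unfolding f_def by simp
        moreover have "f t \<le> 0" using bad by (auto simp: f_def min_def)
        ultimately obtain q where q: "tp < q" "q \<le> t" "f q = 0" "\<And>s. tp \<le> s \<Longrightarrow> s < q \<Longrightarrow> f s > 0"
          using first_nonpos[of tp t f] t(2) by metis
        have qJ: "q \<in> J" using betw[OF tp(2) t(1)] q by simp
        have fq: "x q \<ge> 0" "th q \<le> 3 * pi/2" "x q = 0 \<or> th q = 3 * pi/2" using q(3) by (auto simp: f_def min_def split: if_splits)
        have bq: "x s > 0 \<and> th s < 3 * pi/2" if "tp \<le> s" "s < q" for s using q(4)[OF that] by (simp add: f_def)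
        have gs: "pi \<le> th s \<and> th s < 3 * pi/2" if "tp \<le> s" "s < q" for s
        proof (cases "s = tp")
          case True then show ?thesis unfolding True using tp(3) pi_gt_zero by linarith
        next
          case False
          then have "pi < th s" using gepi[of s] bq betw[OF tp(2) qJ, of s] that by simp
          then show ?thesis using bq[OF that] by simp
        qed
        show False
        proof (cases "th q = 3 * pi/2")
          case True
          have "kap q \<ge> 0" by (rule kap_nonneg_if_th_first_hit[OF qJ q(1)]) (use gs True in force)
          moreover have S: "sin (3 * pi/2) = -1" "cos (3 * pi/2) = 0"
            using sin_add[of pi "pi/2"] cos_add[of pi "pi/2"] by (simp_all add: field_simps)
          ultimately have "x q \<le> 0" unfolding kap_eq True by simp
          then have x0: "x q = 0" using fq by simp
          have "cos (th q) = 0" unfolding True by (rule S)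
          from vertical_stationary[OF qJ this x0] obtain d where d: "d > 0" "\<And>t. \<bar>t - q\<bar> < d \<Longrightarrow> t \<in> J \<and> th t = th q" by metis
          define s where "s = max tp (q - d/2)"
          have "tp \<le> s" "s < q" "\<bar>s - q\<bar> < d" using d(1) q(1) by (auto simp: s_def)
          then show False using d(2)[of s] gs[of s] True by simp
        next
          case False
          then have xq: "x q = 0" "th q < 3 * pi/2" using fq by auto
          have "pi \<le> th q"
          proof (rule ccontr)
            assume n: "\<not> pi \<le> th q"
            have "th s \<ge> pi" if "s \<in> {tp..<q}" for s using gs that by auto
            moreover have "(th \<longlongrightarrow> th q) (at_left q)"
              using DERIV_isCont[OF dth[OF qJ]] by (simp add: isCont_def filterlim_at_split)
            moreover have "\<forall>\<^sub>F s in at_left q. s \<in> {tp..<q}" using q(1) by (auto simp: eventually_at_left intro!: exI[of _ tp])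
            ultimately have "pi \<le> th q" by (intro tendsto_lowerbound[of th "th q" "at_left q"]) (auto elim: eventually_mono)
            then show False using n by simp
          qed
          then have "\<forall>s. tp \<le> s \<longrightarrow> s \<le> q \<longrightarrow> pi \<le> th s \<and> th s < 3 * pi/2"
            using gs xq(2) by (metis le_less)
          then show False using none qJ q(1) xq(1) by (metis less_imp_le order_refl)
        qed
      qed
      have gp: "pi \<le> th t" if "t \<in> J" "tp \<le> t" for t
      proof (cases "t = tp")
        case False
        then have "pi < th t" using gepi[of t] good betw[OF tp(2) that(1)] that by auto
        then show ?thesis by simp
      qed (use tp in simp)
      have rl: "r t \<ge> r tv" if t: "t \<in> J" "tp \<le> t" for t
      proof (rule rge)
        fix s assume s: "tb < s" "s \<le> t"
        have sJ: "s \<in> J" using J'[of s t] s t by simp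
        show "x s < b"
        proof (rule xbelow[OF s(1) sJ])
          fix q assume q: "tb < q" "q < s"
          have "q \<in> J" using J'[of q t] q s t by simp
          then show "pi/2 < th q \<and> th q < 3 * pi/2"
            using th2a[of q] good[of q] gp[of q] q pi_gt_zero by (cases "q \<le> tp") auto
        qed
      qed (use t ctp in auto)
      have JJ: "{tp..} \<subseteq> J" by (rule forward_if_r_ge[OF tp(2) rv rl])
      \<comment> \<open>In the third quadrant \<open>- cos (th) - sin (th) >= 1\<close>, so
        \<open>x + r\<close> drops at least at unit speed and is used up at time
        \<open>T\<close>.\<close>
      define T where "T = tp + x tp + r tp"
      have T: "tp \<le> T" using xtp rpos[OF tp(2)] by (simp add: T_def)
      have "- x T - r T \<ge> - x tp - r tp + 1 * (T - tp)"
      proof (rule deriv_lower[OF T, where f' = "\<lambda>t. - cos (th t) - sin (th t)"])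
        fix s assume s: "tp \<le> s" "s \<le> T"
        then have sJ: "s \<in> J" using JJ by auto
        show "((\<lambda>t. - x t - r t) has_real_derivative - cos (th s) - sin (th s)) (at s)"
          by (intro DERIV_diff DERIV_minus dx[OF sJ] dr[OF sJ])
        have "pi \<le> th s" "th s < 3 * pi/2" using gp[OF sJ s(1)] good[OF sJ s(1)] by auto
        then have "0 \<le> th s - pi" "th s - pi \<le> pi/2" by auto
        from sin_pos_quadrant[OF this] have p: "- sin (th s) \<ge> 0" "- cos (th s) \<ge> 0" by (simp_all add: sin_diff cos_diff)
        have "(- sin (th s) + - cos (th s))\<^sup>2 = 1 + 2 * (- sin (th s)) * (- cos (th s))"
          using sin_cos_squared_add[of "th s"] by (simp add: power2_eq_square algebra_simps)
        moreover have "0 \<le> 2 * (- sin (th s)) * (- cos (th s))"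
          by (intro mult_nonneg_nonneg p) simp
        ultimately have "1\<^sup>2 \<le> (- sin (th s) + - cos (th s))\<^sup>2" by simp
        then have "1 \<le> - sin (th s) + - cos (th s)" by (rule power2_le_imp_le) (intro add_nonneg_nonneg p)
        then show "1 \<le> - cos (th s) - sin (th s)" by linarith
      qed
      moreover have "1 * (T - tp) = x tp + r tp" by (simp add: T_def)
      ultimately have "- x T - r T \<ge> 0" by linarith
      moreover have "T \<in> J" using JJ T by auto
      ultimately show False using good[of T] rpos[of T] T by linarith
    qed
  qed
  then obtain t3 where t3: "t3 \<in> J" "tp \<le> t3" "x t3 \<le> 0" "\<And>s. tp \<le> s \<Longrightarrow> s \<le> t3 \<Longrightarrow> pi \<le> th s \<and> th s < 3 * pi/2"
    by blast
  have tb3: "tb < t3" using ctp t3 by simp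
  have th3: "pi/2 < th s \<and> th s < 3 * pi/2" if "tb < s" "s \<le> t3" for s
    using th2a[of s] t3(4)[of s] that pi_gt_zero by (cases "s \<le> tp") auto
  have x3b: "x s < b" if "tb < s" "s \<le> t3" for s
    by (rule xbelow[OF that(1)]) (use that J'[of s t3] t3 th3 in auto)
  \<comment> \<open>At \<open>x <= 0\<close> the graph is strictly decreasing, since its valley lies
    at \<open>m > 0\<close>, whereas the curve moves left without rising.\<close>
  have sg3: "sg t3 < 0"
  proof -
    have p: "pi \<le> th t3" "th t3 < 3 * pi/2" using t3(4)[of t3] t3(2) by auto
    have "sin (th t3) \<le> 0" using sin_ge_zero[of "th t3 - pi"] p by (simp add: sin_diff)
    moreover have "u' (x t3) * cos (th t3) > 0"
      using u'neg[of "x t3"] mb t3(3) cosneg[of "th t3"] p pi_gt_zero by (intro mult_neg_neg) auto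
    ultimately show ?thesis by (simp add: sg_def)
  qed
  text \<open>From here on the curve moves below the tangent direction of the graph, which rules out \<open>th = pi/2\<close>.\<close>
  have lower: "pi/2 < th t" if t: "t \<in> J" "t3 \<le> t" and up: "\<And>s. t3 \<le> s \<Longrightarrow> s < t \<Longrightarrow> th s < 3 * pi/2" for t
  proof (rule ccontr)
    assume neg: "\<not> pi/2 < th t"
    have "continuous_on {t3..t} (\<lambda>s. th s - pi/2)" by (intro continuous_intros cont Icc[OF t3(1) t(1)])
    moreover have "th t3 - pi/2 > 0" using th3[of t3] tb3 by simp
    ultimately obtain q where q: "t3 < q" "q \<le> t" "th q - pi/2 = 0" "\<And>s. t3 \<le> s \<Longrightarrow> s < q \<Longrightarrow> th s - pi/2 > 0"
      using first_nonpos[of t3 t "\<lambda>s. th s - pi/2"] t(2) neg by (metis diff_gt_0_iff_gt not_less)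
    have qJ: "q \<in> J" using betw[OF t3(1) t(1)] q by simp
    have "sg q < 0"
    proof (rule sgneg[OF tb3 less_imp_le[OF q(1)] qJ sg3])
      fix s assume s: "tb < s" "s \<le> q"
      show "x s < b"
      proof (rule xbelow[OF s(1)])
        show "s \<in> J" using J'[of s q] s qJ by simp
        fix w assume w: "tb < w" "w < s"
        show "pi/2 < th w \<and> th w < 3 * pi/2"
          using th3[of w] q(4)[of w] up[of w] w s q by (cases "w \<le> t3") auto
      qed
    qed
    moreover have thq: "th q = pi/2" using q(3) by linarith
    ultimately show False unfolding sg_def thq by simp
  qed
  \<comment> \<open>Otherwise the curve would move left for ever above the graph, and
    \<open>left_graph_trichotomy\<close> would give \<open>th t3 < pi\<close>.\<close>
  have "\<exists>t\<in>J. t3 \<le> t \<and> th t \<ge> 3 * pi/2"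
  proof (rule ccontr)
    assume "\<not> ?thesis"
    then have up: "th t < 3 * pi/2" if "t \<in> J" "t3 \<le> t" for t using that by force
    have lo: "pi/2 < th t" if "t \<in> J" "t3 \<le> t" for t
      by (rule lower[OF that]) (use up betw[OF t3(1) that(1)] in auto)
    have all: "pi/2 < th s \<and> th s < 3 * pi/2" if "tb < s" "s \<in> J" for s
      using th3[of s] up[of s] lo[of s] that by (cases "s \<le> t3") auto
    have "r t \<ge> r tv" if t: "t \<in> J" "t3 \<le> t" for t
    proof (rule rge)
      fix s assume s: "tb < s" "s \<le> t"
      show "x s < b" by (rule xbelow[OF s(1)]) (use J'[of _ t] s t all in auto)
    qed (use t tb3 in auto)
    then have JJ: "{t3..} \<subseteq> J" by (rule forward_if_r_ge[OF t3(1) rv])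
    have "th t3 < pi"
    proof (rule left_graph_trichotomy[OF JJ t3(3)])
      show "pi/2 < th t \<and> th t < 3 * pi/2" if "t3 \<le> t" for t using up[of t] lo[of t] JJ that by auto
      show "\<exists>t\<in>J. th t \<noteq> pi" using a(2,5) pi_gt_zero by (intro bexI[of _ tb]) auto
    qed
    then show False using t3(4)[of t3] t3(2) by simp
  qed
  then obtain t4 where t4: "t4 \<in> J" "t3 \<le> t4" "th t4 \<ge> 3 * pi/2" by blast
  have "th t3 < 3 * pi/2" using th3[of t3] tb3 by simp
  from first_hit[OF t4(2) cont(3)[OF Icc[OF t3(1) t4(1)]] this t4(3)]
  obtain tB where tB: "t3 < tB" "tB \<le> t4" "th tB = 3 * pi/2" "\<And>s. t3 \<le> s \<Longrightarrow> s < tB \<Longrightarrow> th s < 3 * pi/2" by metis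
  have tBJ: "tB \<in> J" using betw[OF t3(1) t4(1)] tB by simp
  have thB: "pi/2 < th s \<and> th s < 3 * pi/2" if "tb < s" "s < tB" for s
  proof (cases "s \<le> t3")
    case True then show ?thesis using th3 that by simp
  next
    case False
    then have "s \<in> J" using J'[of s tB] tBJ that by simp
    then show ?thesis using lower[of s] tB(4) False that by auto
  qed
  have tbB: "tb < tB" using tb3 tB by simp
  have xBlt: "x s < b" if "tb < s" "s \<le> tB" for s
    by (rule xbelow[OF that(1)]) (use J'[of s tB] tBJ that thB in auto)
  have xanti: "x t < x s" if "tb \<le> s" "s < t" "t \<le> tB" for s t
    by (rule x_strict_anti) (use J'[of _ tB] tBJ that thB cosneg in auto)
  have xB: "x tB < 0" using xanti[of t3 tB] tb3 tB(1) t3(3) by simp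
  have S32: "sin (3 * pi/2) = -1" "cos (3 * pi/2) = 0"
    using sin_add[of pi "pi/2"] cos_add[of pi "pi/2"] by (simp_all add: field_simps)
  \<comment> \<open>The tangent points straight down, so the curvature is \<open>- x / 2\<close>;
    being positive, it turns the curve back to the right.\<close>
  have kB: "kap tB > 0" unfolding kap_eq tB(3) S32 using xB by simp
  have "th tB < 2 * pi" using tB(3) pi_gt_zero by linarith
  from th_after[OF tBJ kB this] obtain e where e: "e > 0"
    "\<And>s. tB \<le> s \<Longrightarrow> s \<le> tB + e \<Longrightarrow> s \<in> J \<and> kap s > 0 \<and> th s < 2 * pi" "\<And>s. tB < s \<Longrightarrow> s \<le> tB + e \<Longrightarrow> 3 * pi/2 < th s"
    unfolding tB(3) by metis
  have "tB + e \<in> J" "3 * pi/2 < th (tB + e)" "th (tB + e) < 2 * pi" "kap (tB + e) > 0"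
    using e(1) e(2)[of "tB + e"] e(3)[of "tB + e"] by auto
  from shifted_descent[OF this] obtain t5 where t5: "tB + e < t5" "t5 \<in> J" "th t5 = 2 * pi" "kap t5 > 0"
    "\<And>t. tB + e \<le> t \<Longrightarrow> t < t5 \<Longrightarrow> th (tB + e) \<le> th t \<and> th t < 2 * pi" by metis
  have th5: "3 * pi/2 \<le> th t \<and> th t \<le> 2 * pi" if tt: "tB \<le> t" "t \<le> t5" for t
  proof -
    consider "t = tB" | "tB < t" "t \<le> tB + e" | "tB + e < t" "t < t5" | "t = t5" using tt by linarith
    then show ?thesis
    proof cases
      case 1 then show ?thesis unfolding 1 using tB(3) pi_gt_zero by linarith
    next
      case 2 then show ?thesis using e(2)[of t] e(3)[of t] by auto
    next
      case 3 then show ?thesis using t5(5)[of t] e(1) e(3)[of "tB + e"] by auto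
    next
      case 4 then show ?thesis unfolding 4 using t5(3) pi_gt_zero by linarith
    qed
  qed
  have cos4: "cos \<theta> \<ge> 0" if "3 * pi/2 \<le> \<theta>" "\<theta> \<le> 5 * pi/2" for \<theta>
    using cos_ge_zero[of "\<theta> - 2 * pi"] that by (simp add: cos_diff)
  \<comment> \<open>The curve must come back to \<open>x = b\<close>. Before that
    \<open>sg < 0\<close>, which at \<open>th = 2 * pi\<close> means \<open>u' > 0\<close> and hence
    \<open>x >= 0\<close>, so the valley lemma applies; but at the vertical tangent it yields,
    \<open>th = 5 * pi / 2\<close>, one has \<open>sg = 1\<close>.\<close>
  have "\<exists>t6\<in>J. tB \<le> t6 \<and> b \<le> x t6 \<and> (\<forall>t. tB \<le> t \<longrightarrow> t \<le> t6 \<longrightarrow> cos (th t) \<ge> 0)"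
  proof (cases "\<exists>t. tB \<le> t \<and> t \<le> t5 \<and> b \<le> x t")
    case True
    then obtain t where t: "tB \<le> t" "t \<le> t5" "b \<le> x t" by blast
    show ?thesis
    proof (intro bexI[of _ t] conjI allI impI)
      show "t \<in> J" using betw[OF tBJ t5(2) t(1,2)] .
      show "0 \<le> cos (th s)" if "tB \<le> s" "s \<le> t" for s using th5[of s] that t pi_gt_zero by (intro cos4) auto
    qed (use t in auto)
  next
    case False
    have x5: "x s < b" if "tb < s" "s \<le> t5" for s
      using xBlt[of s] False that by (meson linear not_le)
    have t35: "t3 \<le> t5" using tB t5 e by simp
    have "sg t5 < 0" by (rule sgneg[OF tb3 t35 t5(2) sg3 x5])
    then have u5: "u' (x t5) > 0" unfolding sg_def t5(3) by simp
    have "x t5 \<ge> 0"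
    proof (rule ccontr)
      assume "\<not> x t5 \<ge> 0"
      then show False using u'neg[of "x t5"] u5 mb by simp
    qed
    from shifted_valley[OF t5(2,3,4) this] obtain t6 where t6: "t5 < t6" "t6 \<in> J" "th t6 = 5 * pi / 2"
      "\<And>t. t5 \<le> t \<Longrightarrow> t < t6 \<Longrightarrow> 2 * pi \<le> th t \<and> th t < 5 * pi / 2" by metis
    have th6: "3 * pi/2 \<le> th s \<and> th s \<le> 5 * pi/2" if tt: "tB \<le> s" "s \<le> t6" for s
    proof -
      consider "s \<le> t5" | "t5 < s" "s < t6" | "s = t6" using tt by linarith
      then show ?thesis
      proof cases
        case 1 then show ?thesis using th5[OF tt(1) 1] pi_gt_zero by linarith
      next
        case 2 then show ?thesis using t6(4)[OF less_imp_le[OF 2(1)] 2(2)] pi_gt_zero by linarith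
      next
        case 3 then show ?thesis unfolding 3 using t6(3) pi_gt_zero by linarith
      qed
    qed
    have "\<exists>t. t5 < t \<and> t \<le> t6 \<and> b \<le> x t"
    proof (rule ccontr)
      assume none: "\<not> ?thesis"
      have x6: "x s < b" if "tb < s" "s \<le> t6" for s
        using x5[of s] none that by (meson linear not_le)
      have t36: "t3 \<le> t6" using t35 t6 by simp
      have "sg t6 < 0" by (rule sgneg[OF tb3 t36 t6(2) sg3 x6])
      moreover have "5 * pi / 2 = pi/2 + 2 * pi" by simp
      ultimately show False unfolding sg_def t6(3) by (simp only: sin_periodic cos_periodic sin_pi_half cos_pi_half)
    qed
    then obtain t where t: "t5 < t" "t \<le> t6" "b \<le> x t" by blast
    show ?thesis
    proof (intro bexI[of _ t] conjI allI impI)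
      show "t \<in> J" using betw[OF t5(2) t6(2)] t by simp
      show "tB \<le> t" using t t5 e by simp
      show "b \<le> x t" by (rule t)
      show "0 \<le> cos (th s)" if "tB \<le> s" "s \<le> t" for s using th6[of s] that t by (intro cos4) auto
    qed
  qed
  then obtain t6 where t6: "t6 \<in> J" "tB \<le> t6" "b \<le> x t6" "\<And>t. tB \<le> t \<Longrightarrow> t \<le> t6 \<Longrightarrow> cos (th t) \<ge> 0" by blast
  have "x tB < b" using xB mb by simp
  from first_hit[OF t6(2) cont(1)[OF Icc[OF tBJ t6(1)]] this t6(3)]
  obtain te where te: "tB < te" "te \<le> t6" "x te = b" "\<And>s. tB \<le> s \<Longrightarrow> s < te \<Longrightarrow> x s < b" by metis
  have teJ: "te \<in> J" using betw[OF tBJ t6(1)] te by simp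
  have xe: "x s < b" if "tb < s" "s < te" for s using xBlt[of s] te(4)[of s] that by (cases "s \<le> tB") auto
  have xge: "x tB \<le> x s" if "tB \<le> s" "s \<le> te" for s
  proof -
    have "x s \<ge> x tB + 0 * (s - tB)"
      by (rule x_mono[OF tBJ]) (use betw[OF tBJ teJ] that te t6(4) in auto)
    then show ?thesis by simp
  qed
  \<comment> \<open>The comparison with the graph is available only for \<open>x < b\<close>, so it
    is carried to \<open>x = b\<close> by two limits, one along the final arc and one along the
    graph towards \<open>tb\<close>.\<close>
  have r1: "r tb \<le> r te"
  proof -
    have "r t' \<le> r te" if t': "tv \<le> t'" "t' < tb" for t'
    proof (rule tendsto_lowerbound[of r "r te" "at_left te"])
      show "(r \<longlongrightarrow> r te) (at_left te)"
        using DERIV_isCont[OF dr[OF teJ]] by (simp add: isCont_def filterlim_at_split)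
      have "(x \<longlongrightarrow> x te) (at_left te)"
        using DERIV_isCont[OF dx[OF teJ]] by (simp add: isCont_def filterlim_at_split)
      moreover have "x t' < x te" using xs[of t' tb] t' te(3) by (simp add: b_def)
      ultimately have "\<forall>\<^sub>F s in at_left te. x t' < x s" by (rule order_tendstoD)
      moreover have "\<forall>\<^sub>F s in at_left te. tB < s \<and> s < te" using te(1) by (auto simp: eventually_at_left intro!: exI[of _ tB])
      ultimately show "\<forall>\<^sub>F s in at_left te. r t' \<le> r s"
      proof eventually_elim
        case (elim s)
        have s: "tb < s" "s \<in> J" "x s < b" using elim tbB J'[of s te] teJ xe[of s] by auto
        have "dl s > 0" by (rule dlpos[OF s(2,1)]) (use xe elim in auto)
        moreover obtain q where q: "q < tb" "x q = x s" using preim[OF s(3)] by blast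
        moreover have "t' \<le> q"
        proof (rule ccontr)
          assume "\<not> t' \<le> q"
          then have "x q < x t'" using xs[of q t'] t' by simp
          then show False using q elim by simp
        qed
        then have "r t' \<le> r q" using r_up[of t' q] q t' by simp
        ultimately show "r t' \<le> r s" using u[of q] by (simp add: dl_def)
      qed
    qed simp
    then have ev: "\<forall>\<^sub>F t in at_left tb. r t \<le> r te"
      using a(1) by (auto simp: eventually_at_left intro!: exI[of _ tv])
    have "(r \<longlongrightarrow> r tb) (at_left tb)"
      using DERIV_isCont[OF dr[OF a(2)]] by (simp add: isCont_def filterlim_at_split)
    then show ?thesis by (rule tendsto_upperbound) (use ev in auto)
  qed
  \<comment> \<open>From \<open>tb\<close> to \<open>tB\<close> the curve moves left monotonically,
    so this arc can be parametrised by \<open>x\<close>.\<close>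
  define \<rho> where "\<rho> = inv_into {tb..tB} x"
  have injx: "inj_on x {tb..tB}"
  proof (rule inj_onI)
    fix s t assume st: "s \<in> {tb..tB}" "t \<in> {tb..tB}" "x s = x t"
    then show "s = t" using xanti[of s t] xanti[of t s] by (cases s t rule: linorder_cases) auto
  qed
  have \<rho>x: "\<rho> (x t) = t" if "t \<in> {tb..tB}" for t unfolding \<rho>_def using injx that by simp
  have cx: "continuous_on {tb..tB} x" by (rule cont) (use J'[of _ tB] tBJ in auto)
  have xim: "{x tB..b} \<subseteq> x ` {tb..tB}"
  proof
    fix \<xi> assume "\<xi> \<in> {x tB..b}"
    then show "\<xi> \<in> x ` {tb..tB}" using IVT2'[of x tB \<xi> tb] cx tbB by (force simp: b_def)
  qed
  have "continuous_on (x ` {tb..tB}) \<rho>"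
    by (rule continuous_on_inv[OF cx]) (use \<rho>x in auto)
  then have c\<rho>: "continuous_on {x tB..b} \<rho>" using xim continuous_on_subset by blast
  have \<rho>in: "\<rho> \<xi> \<in> {tb..tB} \<and> x (\<rho> \<xi>) = \<xi>" if "\<xi> \<in> {x tB..b}" for \<xi>
    using xim that unfolding \<rho>_def by (meson f_inv_into_f inv_into_into subsetD)
  \<comment> \<open>Height of the returning arc above the final one. Injectivity keeps
    \<open>G\<close> from vanishing, so its sign just after \<open>tB\<close> persists.\<close>
  define G where "G t = r (\<rho> (x t)) - r t" for t
  have xrange: "x t \<in> {x tB..b}" if "tB \<le> t" "t \<le> te" for t
    using xge[OF that] xe[of t] te(3) tbB that by (cases "t = te") auto
  have cG: "continuous_on {tB..te} G" unfolding G_def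
  proof (intro continuous_intros)
    have ctB: "continuous_on {tB..te} x" "continuous_on {tB..te} r" by (intro cont Icc tBJ teJ)+
    have cr: "continuous_on {tb..tB} r" by (rule cont) (use J'[of _ tB] tBJ in auto)
    have "continuous_on {tB..te} (\<lambda>t. \<rho> (x t))"
      by (rule continuous_on_compose2[OF c\<rho> ctB(1)]) (use xrange in auto)
    then show "continuous_on {tB..te} (\<lambda>t. r (\<rho> (x t)))"
      by (rule continuous_on_compose2[OF cr]) (use \<rho>in xrange in auto)
    show "continuous_on {tB..te} r" by (rule ctB)
  qed
  have Gnz: "G t \<noteq> 0" if t: "tB < t" "t \<le> te" for t
  proof
    assume "G t = 0"
    have q: "\<rho> (x t) \<in> {tb..tB}" "x (\<rho> (x t)) = x t" using \<rho>in[OF xrange[of t]] t by auto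
    have tJ: "t \<in> J" "\<rho> (x t) \<in> J" using betw[OF tBJ teJ, of t] J'[of "\<rho> (x t)" tB] tBJ q(1) t by auto
    have "\<rho> (x t) = t" using inj q(2) tJ \<open>G t = 0\<close> unfolding inj_on_def G_def by auto
    then show False using q(1) t by simp
  qed
  \<comment> \<open>Through the downward vertical tangent \<open>r\<close> is decreasing in time, so
    at equal \<open>x\<close> the part just before \<open>tB\<close> lies above the part just after
    it.\<close>
  have Gpos: "\<exists>t. tB < t \<and> t < te \<and> G t > 0"
  proof -
    have sB: "sin (th tB) < 0" unfolding tB(3) S32 by simp
    from DERIV_neg_dec_right[OF dr[OF tBJ] sB] obtain e1 where e1: "e1 > 0" "\<And>h. h > 0 \<Longrightarrow> h < e1 \<Longrightarrow> r (tB + h) < r tB" by blast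
    from DERIV_neg_dec_left[OF dr[OF tBJ] sB] obtain e2 where e2: "e2 > 0" "\<And>h. h > 0 \<Longrightarrow> h < e2 \<Longrightarrow> r tB < r (tB - h)" by blast
    have "continuous_on {tB..te} (\<lambda>t. \<rho> (x t))"
      by (rule continuous_on_compose2[OF c\<rho>]) (use xrange Icc[OF tBJ teJ] cont(1) in auto)
    then have "((\<lambda>t. \<rho> (x t)) \<longlongrightarrow> \<rho> (x tB)) (at tB within {tB..te})" using te(1) by (auto simp: continuous_on_def)
    moreover have "\<rho> (x tB) > tB - e2" using \<rho>x[of tB] tbB e2(1) by simp
    ultimately have "\<forall>\<^sub>F t in at tB within {tB..te}. \<rho> (x t) > tB - e2" by (rule order_tendstoD)
    then obtain e3 where e3: "e3 > 0" "\<And>t. t \<in> {tB..te} \<Longrightarrow> t \<noteq> tB \<Longrightarrow> dist t tB < e3 \<Longrightarrow> \<rho> (x t) > tB - e2"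
      unfolding eventually_at by auto
    define h where "h = min (min (e1/2) (e3/2)) ((te - tB)/2)"
    have hle: "h \<le> e1/2" "h \<le> e3/2" "h \<le> (te - tB)/2" unfolding h_def
      by (rule min.coboundedI1[OF min.cobounded1], rule min.coboundedI1[OF min.cobounded2], rule min.cobounded2)
    have "h > 0" using e1(1) e3(1) te(1) by (simp add: h_def)
    have h: "h > 0" "h < e1" "h < e3" "tB + h < te" using hle \<open>h > 0\<close> e1(1) e3(1) te(1) by argo+
    have q: "\<rho> (x (tB + h)) > tB - e2" using e3(2)[of "tB + h"] h by (auto simp: dist_real_def)
    have q': "\<rho> (x (tB + h)) \<in> {tb..tB}" using \<rho>in[OF xrange[of "tB + h"]] h by auto
    have "r tB \<le> r (\<rho> (x (tB + h)))"
    proof (cases "\<rho> (x (tB + h)) = tB")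
      case False
      then show ?thesis using e2(2)[of "tB - \<rho> (x (tB + h))"] q q' by auto
    qed simp
    then have "G (tB + h) > 0" using e1(2)[OF h(1,2)] by (simp add: G_def)
    then show ?thesis using h by (intro exI[of _ "tB + h"]) auto
  qed
  then obtain t7 where t7: "tB < t7" "t7 < te" "G t7 > 0" by blast
  \<comment> \<open>At \<open>x = b\<close> this puts the final arc at or below the point at
    \<open>tb\<close>, while \<open>r1\<close> puts it at or above: the two points coincide, against
    injectivity.\<close>
  have "G te \<ge> 0"
  proof (rule ccontr)
    assume "\<not> G te \<ge> 0"
    moreover have "continuous_on {t7..te} G" by (rule continuous_on_subset[OF cG]) (use t7 in auto)
    ultimately obtain q where "t7 < q" "q \<le> te" "G q = 0"
      using first_nonpos[of t7 te G] t7 by (metis less_imp_le not_le)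
    then show False using Gnz[of q] t7 by simp
  qed
  moreover have "\<rho> (x te) = tb" using \<rho>x[of tb] tbB te(3) by (simp add: b_def)
  ultimately have "r te \<le> r tb" by (simp add: G_def)
  then have "r te = r tb" using r1 by simp
  moreover have "x te = x tb" using te(3) by (simp add: b_def)
  ultimately have "te = tb" using inj teJ a(2) unfolding inj_on_def by auto
  then show False using te tbB by simp
qed

end

section \<open>Trumpets\<close>

lemma ode_sol_within:
  assumes "ode_sol n I u u' u''" "K \<subseteq> I"
  shows "ode_sol n K u u' u''"
  using assms unfolding ode_sol_def by (meson DERIV_subset subsetD)

text \<open>An algebra of functions containing \<open>u\<close>, \<open>u'\<close> and
  \<open>1 / u\<close> that is closed under differentiation, because the equation expresses
  \<open>u''\<close> inside it. Iterating the derivative within it gives smoothness.\<close>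

inductive_set sol_exprs :: "(real \<Rightarrow> real) \<Rightarrow> (real \<Rightarrow> real) \<Rightarrow> (real \<Rightarrow> real) set" for u p where
  var: "(\<lambda>x. x) \<in> sol_exprs u p"
| const: "(\<lambda>x. k) \<in> sol_exprs u p"
| sol: "u \<in> sol_exprs u p"
| slope: "p \<in> sol_exprs u p"
| recip: "(\<lambda>x. 1 / u x) \<in> sol_exprs u p"
| add: "f \<in> sol_exprs u p \<Longrightarrow> g \<in> sol_exprs u p \<Longrightarrow> (\<lambda>x. f x + g x) \<in> sol_exprs u p"
| mult: "f \<in> sol_exprs u p \<Longrightarrow> g \<in> sol_exprs u p \<Longrightarrow> (\<lambda>x. f x * g x) \<in> sol_exprs u p"

lemma sol_exprs_derivative:
  assumes o: "ode_sol n I u p q" and f: "f \<in> sol_exprs u p"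
  shows "\<exists>g\<in>sol_exprs u p. \<forall>x\<in>I. (f has_real_derivative g x) (at x within I)"
  using f
proof induction
  case var
  show ?case by (rule bexI[OF _ const[of 1]]) (auto intro!: derivative_eq_intros)
next
  case (const k)
  show ?case by (rule bexI[OF _ sol_exprs.const[of 0]]) (auto intro!: derivative_eq_intros)
next
  case sol
  show ?case by (rule bexI[OF _ slope]) (use o in \<open>simp add: ode_sol_def\<close>)
next
  case slope
  show ?case
  proof (rule bexI[of _ "\<lambda>x. ((x * p x + (-1) * u x) * (1/2) + (real n - 1) * (1 / u x)) * (1 + p x * p x)"])
    have "((x * p x + (-1) * u x) * (1/2) + (real n - 1) * (1 / u x)) * (1 + p x * p x) = q x" if "x \<in> I" for x
      using o that unfolding ode_sol_def by (simp add: power2_eq_square)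
    then show "\<forall>x\<in>I. (p has_real_derivative ((x * p x + (-1) * u x) * (1/2) + (real n - 1) * (1 / u x)) * (1 + p x * p x)) (at x within I)"
      using o unfolding ode_sol_def by metis
  qed (intro sol_exprs.intros)
next
  case recip
  show ?case
  proof (rule bexI[of _ "\<lambda>x. (-1) * (p x * ((1 / u x) * (1 / u x)))"], intro ballI)
    fix x assume "x \<in> I"
    then have x: "u x > 0" "(u has_real_derivative p x) (at x within I)" using o unfolding ode_sol_def by blast+
    show "((\<lambda>x. 1 / u x) has_real_derivative (-1) * (p x * ((1 / u x) * (1 / u x)))) (at x within I)"
    proof -
      have "((\<lambda>x. 1 / u x) has_real_derivative (0 * u x - 1 * p x) / (u x * u x)) (at x within I)"
        by (rule DERIV_divide[OF DERIV_const x(2)]) (use x(1) in simp)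
      then show ?thesis by simp
    qed
  qed (intro sol_exprs.intros)
next
  case (add f g)
  then obtain f' g' where "f' \<in> sol_exprs u p" "g' \<in> sol_exprs u p"
    "\<forall>x\<in>I. (f has_real_derivative f' x) (at x within I)" "\<forall>x\<in>I. (g has_real_derivative g' x) (at x within I)" by blast
  then show ?case
    by (intro bexI[of _ "\<lambda>x. f' x + g' x"] ballI DERIV_add sol_exprs.add) (simp_all only: Ball_def)
next
  case (mult f g)
  from mult.IH obtain f' g' where d: "f' \<in> sol_exprs u p" "g' \<in> sol_exprs u p"
    "\<forall>x\<in>I. (f has_real_derivative f' x) (at x within I)" "\<forall>x\<in>I. (g has_real_derivative g' x) (at x within I)" by blast
  have E: "(\<lambda>x. f' x * g x + g' x * f x) \<in> sol_exprs u p"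
    by (rule sol_exprs.add[OF sol_exprs.mult[OF d(1) mult.hyps(2)] sol_exprs.mult[OF d(2) mult.hyps(1)]])
  show ?case
  proof (rule bexI[OF _ E], rule ballI)
    fix x assume x: "x \<in> I"
    show "((\<lambda>x. f x * g x) has_real_derivative f' x * g x + g' x * f x) (at x within I)"
      by (rule DERIV_mult[OF bspec[OF d(3) x] bspec[OF d(4) x]])
  qed
qed

lemma ode_sol_smooth:
  assumes o: "ode_sol n I u p q"
  shows "smooth_on I u"
proof -
  obtain nx where nx: "\<And>f. f \<in> sol_exprs u p \<Longrightarrow> nx f \<in> sol_exprs u p \<and> (\<forall>x\<in>I. (f has_real_derivative nx f x) (at x within I))"
    using sol_exprs_derivative[OF o] by metis
  define D where "D k = (nx ^^ k) u" for k :: nat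
  have E: "D k \<in> sol_exprs u p" for k by (induction k) (auto simp: D_def sol_exprs.sol nx)
  show ?thesis unfolding smooth_on_def
  proof (intro exI[of _ D] conjI allI ballI)
    show "D 0 = u" by (simp add: D_def)
    fix k x assume "x \<in> I"
    moreover have "D (Suc k) = nx (D k)" by (simp add: D_def)
    ultimately show "(D k has_real_derivative D (Suc k) x) (at x within I)" using nx[OF E[of k]] by simp
  qed
qed

lemma slopes_equal:
  fixes \<sigma> \<sigma>' :: real
  assumes "\<And>s. s \<ge> S \<Longrightarrow> \<bar>\<sigma> * s - \<sigma>' * s\<bar> \<le> K"
  shows "\<sigma> = \<sigma>'"
proof (rule ccontr)
  assume ne: "\<sigma> \<noteq> \<sigma>'"
  define e where "e = \<bar>\<sigma> - \<sigma>'\<bar>"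
  have e: "e > 0" using ne by (simp add: e_def)
  define s where "s = \<bar>S\<bar> + (\<bar>K\<bar> + 1) / e"
  have "(\<bar>K\<bar> + 1) / e > 0" using e by simp
  then have s: "s \<ge> S" "s \<ge> 0" "s \<ge> (\<bar>K\<bar> + 1) / e" unfolding s_def by linarith+
  have "\<bar>\<sigma> * s - \<sigma>' * s\<bar> = e * s" using s(2) by (simp add: e_def abs_mult flip: left_diff_distrib)
  also have "\<dots> \<ge> \<bar>K\<bar> + 1" using s(3) e by (simp add: field_simps)
  finally show False using assms[OF s(1)] by linarith
qed

text \<open>Lines at bounded distance from each other have equal slope. So the slope found by
  \<open>graph_classification\<close> is the prescribed one, and the constant solution is excluded
  because \<sigma> is positive.\<close>

lemma classification_with_slope:
  assumes o: "ode_sol n {d<..} u u' u''" and d: "d \<ge> 0" and n: "n \<ge> 2" and s: "\<sigma> > 0"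
    and bd: "\<And>x. x > S \<Longrightarrow> \<bar>u x - \<sigma> * x\<bar> \<le> 1" and x: "x > d"
  shows "u' x > 0 \<and> u'' x > 0 \<and> u' x < \<sigma> \<and> u x > \<sigma> * x \<and>
      0 < u x - x * u' x \<and> u x - x * u' x < 2 * (real n - 1) / (\<sigma> * x) \<and>
      u x - \<sigma> * x < 2 * (real n - 1) / (\<sigma> * x) \<and> \<sigma> - u' x < 2 * (real n - 1) / (\<sigma> * x\<^sup>2)"
proof -
  define B where "B = \<bar>S\<bar> + d + 1"
  show ?thesis
  proof (rule graph_classification[OF o d n])
    assume c: "\<forall>\<xi>>d. u \<xi> = sqrt (2 * (real n - 1))"
    have "\<sigma> = 0"
    proof (rule slopes_equal[of B _ _ "\<bar>sqrt (2 * (real n - 1))\<bar> + 1"])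
      fix s assume "s \<ge> B"
      then have "u s = sqrt (2 * (real n - 1))" "\<bar>u s - \<sigma> * s\<bar> \<le> 1" using c bd[of s] d by (auto simp: B_def)
      then show "\<bar>\<sigma> * s - 0 * s\<bar> \<le> \<bar>sqrt (2 * (real n - 1))\<bar> + 1" by argo
    qed
    then show ?thesis using s by simp
  next
    fix \<sigma>' assume s': "\<sigma>' > 0" and p: "\<And>\<xi>. \<xi> > d \<Longrightarrow> u' \<xi> > 0 \<and> u'' \<xi> > 0 \<and> u' \<xi> < \<sigma>' \<and> u \<xi> > \<sigma>' * \<xi> \<and>
      0 < u \<xi> - \<xi> * u' \<xi> \<and> u \<xi> - \<xi> * u' \<xi> < 2 * (real n - 1) / (\<sigma>' * \<xi>) \<and>
      u \<xi> - \<sigma>' * \<xi> < 2 * (real n - 1) / (\<sigma>' * \<xi>) \<and> \<sigma>' - u' \<xi> < 2 * (real n - 1) / (\<sigma>' * \<xi>\<^sup>2)"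
    have "\<sigma> = \<sigma>'"
    proof (rule slopes_equal[of B _ _ "2 * (real n - 1) / \<sigma>' + 1"])
      fix t assume t: "t \<ge> B"
      then have td: "t > d" "t > S" "t \<ge> 1" using d by (auto simp: B_def)
      have "2 * (real n - 1) / (\<sigma>' * t) \<le> 2 * (real n - 1) / (\<sigma>' * 1)"
        using td n s' by (intro divide_left_mono mult_left_mono) auto
      then have "0 < u t - \<sigma>' * t" "u t - \<sigma>' * t < 2 * (real n - 1) / \<sigma>'" "\<bar>u t - \<sigma> * t\<bar> \<le> 1"
        using p[OF td(1)] bd[OF td(2)] by auto
      then show "\<bar>\<sigma> * t - \<sigma>' * t\<bar> \<le> 2 * (real n - 1) / \<sigma>' + 1" by argo
    qed
    then show ?thesis using p[OF x] by simp
  qed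
qed

text \<open>Bundles the graph with a curve that carries it. The domain reaches to some
  \<open>- b < 0\<close>, so that derivatives at \<open>0\<close> are two-sided; the curve is the
  mirror image, whence \<open>- s\<close> and \<open>- arctan\<close>.\<close>

definition is_trumpet :: "nat \<Rightarrow> real \<Rightarrow> (real \<Rightarrow> real) \<Rightarrow> (real \<Rightarrow> real) \<Rightarrow> bool" where
  "is_trumpet n \<sigma> U U' \<longleftrightarrow> (\<exists>b>0. \<exists>U''. ode_sol n {- b<..} U U' U'' \<and> (\<forall>s>- b. U'' s > 0) \<and> (\<forall>s\<ge>0. U' s > 0) \<and>
     (\<exists>S. \<forall>s>S. \<bar>U s - \<sigma> * s\<bar> \<le> 1) \<and>
     (\<exists>J x r th t0. trumpet_curve n J x r th t0 \<and>
        (\<forall>s\<ge>0. \<exists>t\<in>J. x t = - s \<and> r t = U s \<and> th t = - arctan (U' s))))"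

lemma (in trumpet_curve) reflected_graph:
  obtains b U U' U'' where "b > 0" "ode_sol n {- b<..} U U' U''" "\<And>s. s > - b \<Longrightarrow> U'' s > 0" "\<And>s. s \<ge> 0 \<Longrightarrow> U' s > 0"
    "\<And>s. s > - b \<Longrightarrow> \<exists>t\<in>J. x t = - s \<and> r t = U s \<and> th t = - arctan (U' s)" "\<And>t. t \<le> t0 \<Longrightarrow> U (- x t) = r t"
proof -
  obtain tv tb where a: "tv < tb" "tb \<in> J" "{..tb} \<subseteq> J" "th tv = 0" "th tb = pi/2" "x tv > 0" "t0 < tv"
    "\<And>t. t \<le> tb \<Longrightarrow> kap t > 0" "\<And>t. t < tv \<Longrightarrow> - (pi/2) < th t \<and> th t < 0"
    "\<And>t. tv \<le> t \<Longrightarrow> t < tb \<Longrightarrow> 0 \<le> th t \<and> th t < pi/2"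
    using arcs by metis
  have thb: "- (pi/2) < th t \<and> th t < pi/2" if "t < tb" for t
    using a(9)[of t] a(10)[of t] that pi_gt_zero by (cases "t < tv") auto
  have "t0 < tb" using a by simp
  from graph[OF a(3) thb this] obtain v v' v'' where
    v: "\<And>t. t < tb \<Longrightarrow> v (x t) = r t \<and> v' (x t) = tan (th t) \<and> v'' (x t) = kap t / cos (th t) ^ 3"
    and o: "ode_sol n {..<x tb} v v' v''" and im: "x ` {..<tb} = {..<x tb}"
    and dv: "\<And>\<xi>. \<xi> < x tb \<Longrightarrow> (v has_real_derivative v' \<xi>) (at \<xi>) \<and> (v' has_real_derivative v'' \<xi>) (at \<xi>)"
    by metis
  have Cb: "cos (th t) > 0" if "t < tb" for t using thb[OF that] by (intro cos_gt_zero_pi) auto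
  have xs: "x s < x t" if "s < t" "t \<le> tb" for s t
    by (rule x_strict_mono) (use that a(3) Cb in auto)
  have preim: "\<exists>t<tb. x t = \<xi>" if "\<xi> < x tb" for \<xi> using im that by (metis imageE lessThan_iff)
  show ?thesis
  proof (rule that[of "x tb" "\<lambda>s. v (- s)" "\<lambda>s. - v' (- s)" "\<lambda>s. v'' (- s)"])
    show "x tb > 0" using xs[OF a(1)] a(6) by simp
    show "ode_sol n {- x tb<..} (\<lambda>s. v (- s)) (\<lambda>s. - v' (- s)) (\<lambda>s. v'' (- s))" unfolding ode_sol_def
    proof (intro ballI conjI)
      fix s assume "s \<in> {- x tb<..}"
      then have s: "- s < x tb" by auto
      have d: "(uminus has_real_derivative -1) (at s)" by (auto intro!: derivative_eq_intros)
      show "v (- s) > 0" using o s unfolding ode_sol_def by auto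
      have "((\<lambda>s. v (- s)) has_real_derivative v' (- s) * -1) (at s)"
        by (rule DERIV_chain2[OF conjunct1[OF dv[OF s]] d])
      then have "((\<lambda>s. v (- s)) has_real_derivative - v' (- s)) (at s)" by simp
      then show "((\<lambda>s. v (- s)) has_real_derivative - v' (- s)) (at s within {- x tb<..})"
        by (rule has_field_derivative_at_within)
      have "((\<lambda>s. - v' (- s)) has_real_derivative - (v'' (- s) * -1)) (at s)"
        by (rule DERIV_minus[OF DERIV_chain2[OF conjunct2[OF dv[OF s]] d]])
      then have "((\<lambda>s. - v' (- s)) has_real_derivative v'' (- s)) (at s)" by simp
      then show "((\<lambda>s. - v' (- s)) has_real_derivative v'' (- s)) (at s within {- x tb<..})"
        by (rule has_field_derivative_at_within)
      have "v'' (- s) = ((- s * v' (- s) - v (- s)) / 2 + c / v (- s)) * (1 + (v' (- s))\<^sup>2)"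
        using o s unfolding ode_sol_def by auto
      then show "v'' (- s) = ((s * - v' (- s) - v (- s)) / 2 + c / v (- s)) * (1 + (- v' (- s))\<^sup>2)" by simp
    qed
    fix s
    show "v'' (- s) > 0" if s: "s > - x tb"
    proof -
      obtain t where t: "t < tb" "x t = - s" using preim[of "- s"] s by auto
      have "kap t / cos (th t) ^ 3 > 0" using a(8)[of t] Cb[OF t(1)] t by simp
      then show ?thesis using v[OF t(1)] t(2) by simp
    qed
    show "- v' (- s) > 0" if s: "s \<ge> 0"
    proof -
      have "- s < x tv" using s a(6) by simp
      moreover have "x tv < x tb" using xs[OF a(1)] by simp
      ultimately obtain t where t: "t < tb" "x t = - s" using preim[of "- s"] by auto
      have "t < tv"
      proof (rule ccontr)
        assume "\<not> t < tv"
        then have "x tv \<le> x t" using xs[of tv t] t(1) by (cases "t = tv") auto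
        then show False using \<open>- s < x tv\<close> t by simp
      qed
      then have "tan (th t) < 0" using a(9)[of t] tan_gt_zero[of "- th t"] by simp
      then show ?thesis using v[OF t(1)] t(2) by simp
    qed
    show "\<exists>t\<in>J. x t = - s \<and> r t = v (- s) \<and> th t = - arctan (- v' (- s))" if s: "s > - x tb"
    proof -
      obtain t where t: "t < tb" "x t = - s" using preim[of "- s"] s by auto
      have "arctan (tan (th t)) = th t" using thb[OF t(1)] by (intro arctan_tan) auto
      moreover have "t \<in> J" using a(3) t(1) by auto
      ultimately show ?thesis using v[OF t(1)] t(2) by (intro bexI[of _ t]) (auto simp: arctan_minus)
    qed
    show "v (- (- x t)) = r t" if "t \<le> t0" for t using v[of t] that a by simp
  qed
qed

text \<open>The contraction gives the solution only far out. Continuing the maximal curve and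
  reading it as a graph up to its vertical tangent extends the solution past
  \<open>x = 0\<close>.\<close>

lemma trumpet_exists:
  assumes s: "\<sigma> > 0" and n: "n \<ge> 2"
  shows "\<exists>U U'. is_trumpet n \<sigma> U U'"
proof -
  obtain R u u' u'' where R: "R \<ge> 1" and o: "ode_sol n {R<..} u u' u''" and bd: "\<And>x. x > R \<Longrightarrow> \<bar>u x - \<sigma> * x\<bar> \<le> 1"
    using asymptotic_solution_exists[OF s n] by metis
  have R0: "R \<ge> 0" using R by simp
  note cl = classification_with_slope[OF o R0 n s bd]
  have Rl: "R < R + 1" by simp
  obtain J x r th T where m: "mcurve n J x r th" "{T<..} \<subseteq> J"
    "\<And>t. T < t \<Longrightarrow> R + 1 < x t \<and> r t = u (x t) \<and> th t = arctan (u' (x t))"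
    "\<And>\<xi>. R + 1 < \<xi> \<Longrightarrow> \<exists>t>T. x t = \<xi>"
    by (rule graph_in_max_curve[OF o Rl n], rule that)
  interpret mcurve n J x r th by (rule m(1))
  have JT: "t \<in> J" if "T < t" for t by (rule subsetD[OF m(2)]) (simp add: that)
  have th: "0 < th t \<and> th t < pi/2 \<and> kap t > 0" if t: "T < t" for t
  proof -
    have X: "R + 1 < x t \<and> r t = u (x t) \<and> th t = arctan (u' (x t))" by (rule m(3)[OF t])
    then have xt: "x t > R" "r t = u (x t)" "th t = arctan (u' (x t))" by linarith+
    have p: "u' (x t) > 0" "u'' (x t) > 0" using cl[OF _ xt(1)] bd by blast+
    have "0 < ((x t * u' (x t) - u (x t)) / 2 + c / u (x t)) * (1 + (u' (x t))\<^sup>2)"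
      using p(2) unfolding ode_solD(4)[OF o xt(1)] .
    then have "0 < (x t * u' (x t) - u (x t)) / 2 + c / u (x t)"
      by (rule zero_less_mult_pos2) (rule add_pos_nonneg, simp_all)
    moreover have "sqrt (1 + (u' (x t))\<^sup>2) > 0" by (simp add: add_pos_nonneg)
    ultimately have "kap t > 0" unfolding kap_def xt(2,3) curv_arctan by (rule divide_pos_pos)
    then show ?thesis using p(1) xt(3) arctan_ubound[of "u' (x t)"] by simp
  qed
  \<comment> \<open>Time is reversed, and the margin \<open>1\<close> places the closed half-line up
    to \<open>t0\<close> inside the domain of the original arc.\<close>
  define t0 where "t0 = - (T + 1)"
  have m': "mcurve n {t. - t \<in> J} (\<lambda>t. - x (- t)) (\<lambda>t. r (- t)) (\<lambda>t. - th (- t))"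
    using transform[of "-1" "-1" 0 0] by simp
  interpret m: mcurve n "{t. - t \<in> J}" "\<lambda>t. - x (- t)" "\<lambda>t. r (- t)" "\<lambda>t. - th (- t)" by (rule m')
  have k: "m.kap t = kap (- t)" for t unfolding m.kap_def kap_def
    using curv_transform[of "-1" "-1" 0 c "x (- t)" "r (- t)" "th (- t)"] by simp
  interpret tc: trumpet_curve n "{t. - t \<in> J}" "\<lambda>t. - x (- t)" "\<lambda>t. r (- t)" "\<lambda>t. - th (- t)" t0
  proof unfold_locales
    show "{..t0} \<subseteq> {t. - t \<in> J}" using JT by (auto simp: t0_def)
    show "- (pi / 2) < - th (- t) \<and> - th (- t) < 0 \<and> 0 < m.kap t" if "t \<le> t0" for t
      using th[of "- t"] that unfolding k by (auto simp: t0_def)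
    show "\<exists>t\<le>t0. - x (- t) < \<xi>" for \<xi>
    proof -
      define \<eta> where "\<eta> = \<bar>\<xi>\<bar> + \<bar>x (T + 1)\<bar> + R + 2"
      have "R + 1 < \<eta>" by (simp add: \<eta>_def)
      then obtain t where t: "T < t" "x t = \<eta>" using m(4) by blast
      have "T + 1 \<le> t"
      proof (rule ccontr)
        assume n: "\<not> T + 1 \<le> t"
        have "x t < x (T + 1)"
        proof (rule x_strict_mono)
          show "0 < cos (th q)" if "t < q" for q using th[of q] that t by (intro cos_gt_zero_pi) auto
        qed (use n t JT in auto)
        then show False using t(2) R unfolding \<eta>_def by linarith
      qed
      moreover have "- \<eta> < \<xi>" unfolding \<eta>_def using R by linarith
      ultimately show ?thesis using t by (intro exI[of _ "- t"]) (auto simp: t0_def)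
    qed
  qed
  obtain b U U' U'' where U: "b > 0" "ode_sol n {- b<..} U U' U''" "\<And>s. s > - b \<Longrightarrow> U'' s > 0" "\<And>s. s \<ge> 0 \<Longrightarrow> U' s > 0"
    "\<And>s. s > - b \<Longrightarrow> \<exists>t\<in>{t. - t \<in> J}. - x (- t) = - s \<and> r (- t) = U s \<and> - th (- t) = - arctan (U' s)"
    "\<And>t. t \<le> t0 \<Longrightarrow> U (- (- x (- t))) = r (- t)"
    by (rule tc.reflected_graph, rule that)
  have "is_trumpet n \<sigma> U U'" unfolding is_trumpet_def
  proof (rule exI[of _ b], rule conjI[OF U(1)], rule exI[of _ U''], intro conjI)
    show "ode_sol n {- b<..} U U' U''" by (rule U(2))
    show "\<forall>s>- b. U'' s > 0" using U(3) by simp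
    show "\<forall>s\<ge>0. U' s > 0" using U(4) by simp
    show "\<exists>S. \<forall>s>S. \<bar>U s - \<sigma> * s\<bar> \<le> 1"
    proof (intro exI[of _ "\<bar>x (T + 1)\<bar> + R + 1"] allI impI)
      fix s assume s: "\<bar>x (T + 1)\<bar> + R + 1 < s"
      then have "R + 1 < s" by linarith
      then obtain t where t: "T < t" "x t = s" using m(4) by blast
      have "T + 1 \<le> t"
      proof (rule ccontr)
        assume n: "\<not> T + 1 \<le> t"
        have "x t < x (T + 1)"
        proof (rule x_strict_mono)
          show "0 < cos (th q)" if "t < q" for q using th[of q] that t by (intro cos_gt_zero_pi) auto
        qed (use n t JT in auto)
        then show False using t(2) R s by linarith
      qed
      then have "U (x t) = r t" using U(6)[of "- t"] by (simp add: t0_def)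
      then have "U s = u s" using m(3)[OF t(1)] t(2) by simp
      then show "\<bar>U s - \<sigma> * s\<bar> \<le> 1" using bd[of s] \<open>R + 1 < s\<close> by simp
    qed
    have "\<forall>s\<ge>0. \<exists>t\<in>{t. - t \<in> J}. - x (- t) = - s \<and> r (- t) = U s \<and> - th (- t) = - arctan (U' s)"
      using U(1,5) by auto
    then show "\<exists>J x r th t0. trumpet_curve n J x r th t0 \<and>
        (\<forall>s\<ge>0. \<exists>t\<in>J. x t = - s \<and> r t = U s \<and> th t = - arctan (U' s))"
      using tc.trumpet_curve_axioms by blast
  qed
  then show ?thesis by blast
qed

text \<open>\<open>J\<close> is a countable union of compact sets, so one of them contains
  infinitely many of the uncountably many parameters \<open>\<tau> s\<close>, and these accumulate
  at some \<open>t\<close>. Along them \<open>r - U (x)\<close> vanishes, so its derivative at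
  \<open>t\<close> is \<open>0\<close>: the curve is tangent to the graph there.\<close>

lemma tangent_contact:
  assumes g: "geo_sol n J x r th" and dU: "\<And>s. s > 0 \<Longrightarrow> (U has_real_derivative U' s) (at s)"
    and sub: "{(s, U s) | s. s \<ge> 0} \<subseteq> (\<lambda>t. (x t, r t)) ` J"
  obtains t where "t \<in> J" "x t > 0" "r t = U (x t)" "sin (th t) = U' (x t) * cos (th t)"
proof -
  have "\<forall>s\<in>{1..2}. \<exists>t\<in>J. x t = s \<and> r t = U s"
  proof
    fix s :: real assume "s \<in> {1..2}"
    then have "(s, U s) \<in> (\<lambda>t. (x t, r t)) ` J" using sub by auto
    then show "\<exists>t\<in>J. x t = s \<and> r t = U s" by auto
  qed
  then obtain \<tau> where \<tau>: "\<And>s. s \<in> {1..2} \<Longrightarrow> \<tau> s \<in> J \<and> x (\<tau> s) = s \<and> r (\<tau> s) = U s" by metis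
  obtain C :: "nat \<Rightarrow> real set" where C: "\<And>n. compact (C n)" "\<And>n. C n \<subseteq> J" "\<Union>(range C) = J"
    using open_Union_compact_subsets[OF geo_solD(1)[OF g]] by metis
  have "\<exists>k. infinite {s\<in>{1..2}. \<tau> s \<in> C k}"
  proof (rule ccontr)
    assume "\<not> ?thesis"
    then have fin: "finite {s\<in>{1..2}. \<tau> s \<in> C k}" for k by blast
    have "{1..2::real} = (\<Union>k. {s\<in>{1..2}. \<tau> s \<in> C k})"
    proof (intro equalityI subsetI)
      fix s :: real assume s: "s \<in> {1..2}"
      then have "\<tau> s \<in> \<Union>(range C)" using \<tau> C(3) by simp
      then obtain k where "\<tau> s \<in> C k" by (elim UN_E)
      then show "s \<in> (\<Union>k. {s\<in>{1..2}. \<tau> s \<in> C k})" using s by (intro UN_I[of k]) simp_all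
    qed auto
    moreover have "countable (\<Union>k. {s\<in>{1..2}. \<tau> s \<in> C k})"
      by (rule countable_UN[OF countableI_type countable_finite[OF fin]])
    ultimately have "countable {1..2::real}" by (rule ssubst[of _ _ countable])
    then show False using uncountable_closed_interval[of 1 2] by simp
  qed
  then obtain k where k: "infinite {s\<in>{1..2}. \<tau> s \<in> C k}" by blast
  define A where "A = \<tau> ` {s\<in>{1..2}. \<tau> s \<in> C k}"
  have "inj_on \<tau> {s\<in>{1..2}. \<tau> s \<in> C k}"
  proof (rule inj_onI)
    fix p q assume pq: "p \<in> {s\<in>{1..2}. \<tau> s \<in> C k}" "q \<in> {s\<in>{1..2}. \<tau> s \<in> C k}" "\<tau> p = \<tau> q"
    have px: "x (\<tau> p) = p" by (rule \<tau>[THEN conjunct2, THEN conjunct1]) (use pq in simp)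
    have qx: "x (\<tau> q) = q" by (rule \<tau>[THEN conjunct2, THEN conjunct1]) (use pq in simp)
    show "p = q" by (rule trans[OF trans[OF px[symmetric] arg_cong[OF pq(3), of x]] qx])
  qed
  then have "infinite A" unfolding A_def using k finite_imageD[of \<tau> "{s\<in>{1..2}. \<tau> s \<in> C k}"] by argo
  moreover have "A \<subseteq> C k" unfolding A_def by (intro image_subsetI) simp
  ultimately have "\<exists>t\<in>C k. t islimpt A"
    using C(1)[of k, unfolded compact_eq_Bolzano_Weierstrass, rule_format, of A] by simp
  then obtain t where t: "t \<in> C k" "t islimpt A" by (elim bexE)
  have tJ: "t \<in> J" using t(1) C(2) by blast
  obtain f where f: "\<And>i::nat. f i \<in> A - {t}" "f \<longlonglongrightarrow> t" using t(2) unfolding islimpt_sequential by blast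
  have fA: "x (f i) \<in> {1..2} \<and> r (f i) = U (x (f i))" for i
  proof -
    obtain s where "s \<in> {1..2}" "f i = \<tau> s" using f(1)[of i] by (auto simp: A_def)
    then show ?thesis using \<tau>[of s] by simp
  qed
  have cx: "isCont x t" "isCont r t" using geo_solD(4,5)[OF g tJ] DERIV_isCont by blast+
  have xl: "(\<lambda>i. x (f i)) \<longlonglongrightarrow> x t" by (rule isCont_tendsto_compose[OF cx(1) f(2)])
  have rl: "(\<lambda>i. r (f i)) \<longlonglongrightarrow> r t" by (rule isCont_tendsto_compose[OF cx(2) f(2)])
  have "x t \<ge> 1" by (rule tendsto_lowerbound[OF xl]) (use fA in auto)
  then have xp: "x t > 0" by simp
  have "(\<lambda>i. U (x (f i))) \<longlonglongrightarrow> U (x t)"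
    by (rule isCont_tendsto_compose[OF DERIV_isCont[OF dU[OF xp]] xl])
  moreover have "(\<lambda>i. U (x (f i))) = (\<lambda>i. r (f i))" using fA by auto
  ultimately have req: "r t = U (x t)" using rl LIMSEQ_unique by metis
  define \<phi> where "\<phi> s = r s - U (x s)" for s
  have "(\<phi> has_real_derivative sin (th t) - U' (x t) * cos (th t)) (at t)"
    unfolding \<phi>_def by (rule DERIV_diff[OF geo_solD(5)[OF g tJ] DERIV_chain2[OF dU[OF xp] geo_solD(4)[OF g tJ]]])
  then have lim: "((\<lambda>y. (\<phi> y - \<phi> t) / (y - t)) \<longlongrightarrow> sin (th t) - U' (x t) * cos (th t)) (at t)"
    unfolding has_field_derivative_iff .
  have "filterlim f (at t) sequentially"
    unfolding filterlim_at using f by (auto intro!: always_eventually)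
  from filterlim_compose[OF lim this]
  have "(\<lambda>i. (\<phi> (f i) - \<phi> t) / (f i - t)) \<longlonglongrightarrow> sin (th t) - U' (x t) * cos (th t)" .
  moreover have "(\<lambda>i. (\<phi> (f i) - \<phi> t) / (f i - t)) = (\<lambda>i. 0)" using fA req by (auto simp: \<phi>_def)
  ultimately have "sin (th t) - U' (x t) * cos (th t) = 0" using LIMSEQ_unique[OF _ tendsto_const] by metis
  then show ?thesis using that[OF tJ xp req] by simp
qed

text \<open>A point with its tangent line determines the curve up to direction. So after a symmetry
  the given maximal curve contains a copy of the trumpet curve and inherits its
  self-intersection.\<close>

lemma trumpet_curve_self_intersects:
  assumes tc: "trumpet_curve n J0 x0 r0 th0 t0"
    and pts: "\<And>s. s \<ge> 0 \<Longrightarrow> \<exists>t\<in>J0. x0 t = - s \<and> r0 t = U s \<and> th0 t = - arctan (U' s)"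
    and dU: "\<And>s. s > 0 \<Longrightarrow> (U has_real_derivative U' s) (at s)"
    and m: "max_geo_sol n J x r th" and sub: "{(s, U s) | s. s \<ge> 0} \<subseteq> (\<lambda>t. (x t, r t)) ` J"
  shows "\<not> embedded_curve J x r"
proof
  assume emb: "embedded_curve J x r"
  interpret trumpet_curve n J0 x0 r0 th0 t0 by (rule tc)
  have gJ: "geo_sol n J x r th" using m by (simp add: max_geo_sol_def)
  obtain t where t: "t \<in> J" "x t > 0" "r t = U (x t)" "sin (th t) = U' (x t) * cos (th t)"
  proof (rule tangent_contact[OF gJ _ sub])
    show "(U has_real_derivative U' s) (at s)" if "s > 0" for s using that by (rule dU)
  qed (rule that)
  have "x t \<ge> 0" using t(2) by simp
  from pts[OF this] obtain t1 where t1: "t1 \<in> J0" "x0 t1 = - x t" "r0 t1 = U (x t)" "th0 t1 = - arctan (U' (x t))" by blast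
  \<comment> \<open>Equal tangent lines make \<open>ph\<close> a multiple of \<open>pi\<close>. Its
    cosine records the relative direction of the two curves and fixes \<open>s\<close> through
    \<open>cos ph = e * s\<close> with \<open>e = -1\<close>.\<close>
  define ph where "ph = th t - arctan (U' (x t))"
  have sph: "sin ph = 0" unfolding ph_def sin_diff t(4) sin_arctan cos_arctan by simp
  have cph: "cos ph = 1 \<or> cos ph = -1"
    using sin_cos_squared_add[of ph] sph by (simp add: power2_eq_1_iff)
  define s where "s = - cos ph"
  have s: "s = 1 \<or> s = -1" using cph by (auto simp: s_def)
  have ss: "s * s = 1" using s by auto
  define a where "a = t1 - s * t"
  have at: "s * t + a = t1" by (simp add: a_def)
  let ?K = "{q. s * q + a \<in> J0}"
  have h: "max_geo_sol n ?K (\<lambda>q. -1 * x0 (s * q + a)) (\<lambda>q. r0 (s * q + a)) (\<lambda>q. -1 * th0 (s * q + a) + ph)"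
    by (rule max_geo_transform[OF mx s]) (simp_all add: s_def sph)
  then have gK: "geo_sol n ?K (\<lambda>q. -1 * x0 (s * q + a)) (\<lambda>q. r0 (s * q + a)) (\<lambda>q. -1 * th0 (s * q + a) + ph)"
    by (simp add: max_geo_sol_def)
  have tK: "t \<in> ?K" using at t1(1) by simp
  have eq: "x t = -1 * x0 (s * t + a)" "r t = r0 (s * t + a)" "th t = -1 * th0 (s * t + a) + ph"
    unfolding at using t1 t(3) by (simp_all add: ph_def)
  have KJ: "?K \<subseteq> J" by (rule max_geo_contains[OF m gK t(1) tK eq])
  have same: "x q = -1 * x0 (s * q + a) \<and> r q = r0 (s * q + a)" if "q \<in> ?K" for q
    using geo_unique[OF gJ gK t(1) tK eq _ that] KJ that by blast
  have "inj_on (\<lambda>t. (x0 t, r0 t)) J0"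
  proof (rule inj_onI)
    fix p q assume pq: "p \<in> J0" "q \<in> J0" "(x0 p, r0 p) = (x0 q, r0 q)"
    have inv: "s * (s * (v - a)) + a = v" for v using ss by (simp flip: mult.assoc)
    have K: "s * (p - a) \<in> ?K" "s * (q - a) \<in> ?K" using pq inv by auto
    have "(x (s * (p - a)), r (s * (p - a))) = (x (s * (q - a)), r (s * (q - a)))"
      using same[OF K(1)] same[OF K(2)] pq(3) unfolding inv by simp
    then have "s * (p - a) = s * (q - a)"
      using emb K KJ unfolding embedded_curve_def inj_on_def by blast
    then show "p = q" using s by auto
  qed
  then show False using not_embedded by blast
qed

lemma strictly_convex_onI_deriv:
  assumes d: "\<And>x. x > a \<Longrightarrow> (u has_real_derivative u' x) (at x)"
    and inc: "\<And>x y. a < x \<Longrightarrow> x < y \<Longrightarrow> u' x < u' y" and S: "S \<subseteq> {a<..}"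
  shows "strictly_convex_on S u"
proof -
  have main: "u ((1 - t) * x + t * y) < (1 - t) * u x + t * u y"
    if "a < x" "x < y" "0 < t" "t < 1" for x y t
  proof -
    define z where "z = (1 - t) * x + t * y"
    have zx: "z - x = t * (y - x)" and yz: "y - z = (1 - t) * (y - x)" by (simp_all add: z_def algebra_simps)
    have p: "t * (y - x) > 0" "(1 - t) * (y - x) > 0" using that by auto
    have z: "x < z" "z < y" using p unfolding zx[symmetric] yz[symmetric] by simp_all
    have "\<exists>v>x. v < z \<and> u z - u x = (z - x) * u' v"
      by (rule MVT2[OF z(1)], rule d) (use that in simp)
    then obtain v where v: "x < v" "v < z" "u z - u x = (z - x) * u' v" by (elim exE conjE)
    have "\<exists>w>z. w < y \<and> u y - u z = (y - z) * u' w"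
      by (rule MVT2[OF z(2)], rule d) (use that z in simp)
    then obtain w where w: "z < w" "w < y" "u y - u z = (y - z) * u' w" by (elim exE conjE)
    have "u' v < u' w" using inc[of v w] v w that by simp
    moreover have "t * (1 - t) * (y - x) > 0" using that by simp
    ultimately have "t * (1 - t) * (y - x) * u' v < t * (1 - t) * (y - x) * u' w" by (rule mult_strict_left_mono)
    moreover have "(1 - t) * (u z - u x) = t * (1 - t) * (y - x) * u' v" unfolding v(3) zx by (simp only: mult_ac)
    moreover have "t * (u y - u z) = t * (1 - t) * (y - x) * u' w" unfolding w(3) yz by (simp only: mult_ac)
    ultimately have "(1 - t) * (u z - u x) < t * (u y - u z)" by (simp only:)
    then have "u z < (1 - t) * u x + t * u y" by (simp add: algebra_simps)
    then show ?thesis by (simp add: z_def)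
  qed
  show ?thesis unfolding strictly_convex_on_def
  proof (intro ballI allI impI, elim conjE)
    fix x y t :: real assume xy: "x \<in> S" "y \<in> S" "x \<noteq> y" and t: "0 < t" "t < 1"
    have ax: "a < x" "a < y" using xy S by auto
    show "u ((1 - t) * x + t * y) < (1 - t) * u x + t * u y"
    proof (cases "x < y")
      case True then show ?thesis using main[OF ax(1) _ t] by simp
    next
      case False
      then have "y < x" using xy by simp
      from main[OF ax(2) this, of "1 - t"] t show ?thesis by (simp add: add.commute)
    qed
  qed
qed

lemma asymptotic_bounded:
  fixes v :: "real \<Rightarrow> real"
  assumes "((\<lambda>x. v x - \<sigma> * x) \<longlongrightarrow> 0) at_top"
  obtains S where "\<And>x. x > S \<Longrightarrow> \<bar>v x - \<sigma> * x\<bar> \<le> 1"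
proof -
  have "\<forall>\<^sub>F x in at_top. dist (v x - \<sigma> * x) 0 < 1" using tendstoD[OF assms, of 1] by simp
  then obtain S where S: "\<And>x. x \<ge> S \<Longrightarrow> \<bar>v x - \<sigma> * x\<bar> < 1" unfolding eventually_at_top_linorder by auto
  show ?thesis by (rule that[of S]) (use S less_imp_le in auto)
qed

lemma trumpet_facts:
  assumes T: "is_trumpet n \<sigma> U U'" and s: "\<sigma> > 0" and n: "n \<ge> 2"
  obtains b U'' where "b > 0" "ode_sol n {- b<..} U U' U''" "\<And>x. x > - b \<Longrightarrow> U'' x > 0" "\<And>x. x \<ge> 0 \<Longrightarrow> U' x > 0"
    "\<And>x. x > 0 \<Longrightarrow> U' x < \<sigma> \<and> U x > \<sigma> * x \<and> 0 < U x - x * U' x \<and> U x - x * U' x < 2 * (real n - 1) / (\<sigma> * x) \<and>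
      U x - \<sigma> * x < 2 * (real n - 1) / (\<sigma> * x) \<and> \<sigma> - U' x < 2 * (real n - 1) / (\<sigma> * x\<^sup>2)"
proof -
  obtain b U'' S where b: "b > 0" and o: "ode_sol n {- b<..} U U' U''" and p: "\<forall>s>- b. U'' s > 0" "\<forall>s\<ge>0. U' s > 0"
    and S: "\<forall>s>S. \<bar>U s - \<sigma> * s\<bar> \<le> 1"
    using T unfolding is_trumpet_def by (elim exE conjE)
  have "{0<..} \<subseteq> {- b<..}" using b by auto
  note o0 = ode_sol_within[OF o this]
  have "U' x < \<sigma> \<and> U x > \<sigma> * x \<and> 0 < U x - x * U' x \<and> U x - x * U' x < 2 * (real n - 1) / (\<sigma> * x) \<and>
      U x - \<sigma> * x < 2 * (real n - 1) / (\<sigma> * x) \<and> \<sigma> - U' x < 2 * (real n - 1) / (\<sigma> * x\<^sup>2)" if "x > 0" for x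
    using classification_with_slope[OF o0 order_refl n s S[rule_format] that] by simp
  then show ?thesis by (intro that[OF b o p(1)[rule_format] p(2)[rule_format]])
qed

lemma trumpet_unique_end:
  assumes T: "is_trumpet n \<sigma> U U'" and s: "\<sigma> > 0" and n: "n \<ge> 2" and d: "d \<ge> 0"
    and o: "ode_sol n {d<..} v v' v''"
    and b: "\<And>x. x > d \<Longrightarrow> v x > \<sigma> * x \<and> 0 < v x - x * v' x \<and> v x - x * v' x < 2 * (real n - 1) / (\<sigma> * x) \<and>
      v x - \<sigma> * x < 2 * (real n - 1) / (\<sigma> * x)" and x: "x > d"
  shows "v x = U x"
proof -
  obtain e U'' where U: "e > 0" "ode_sol n {- e<..} U U' U''"
    "\<And>x. x > 0 \<Longrightarrow> U' x < \<sigma> \<and> U x > \<sigma> * x \<and> 0 < U x - x * U' x \<and> U x - x * U' x < 2 * (real n - 1) / (\<sigma> * x) \<and>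
      U x - \<sigma> * x < 2 * (real n - 1) / (\<sigma> * x) \<and> \<sigma> - U' x < 2 * (real n - 1) / (\<sigma> * x\<^sup>2)"
    by (rule trumpet_facts[OF T s n], rule that)
  have "{d<..} \<subseteq> {- e<..}" using U(1) d by auto
  note oU = ode_sol_within[OF U(2) this]
  have split: "2 * (real n - 1) / (\<sigma> * y) = 2 * (real n - 1) / \<sigma> / y" for y by simp
  show ?thesis
  proof (rule asymptotic_solution_unique[OF s n d o oU, where K = "2 * (real n - 1) / \<sigma>"])
    fix y assume y: "y > d"
    then have y0: "y > 0" using d by simp
    show "\<bar>v y - \<sigma> * y\<bar> \<le> 2 * (real n - 1) / \<sigma> / y \<and> \<bar>v y - y * v' y\<bar> \<le> 2 * (real n - 1) / \<sigma> / y"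
      using b[OF y] unfolding split by linarith
    show "\<bar>U y - \<sigma> * y\<bar> \<le> 2 * (real n - 1) / \<sigma> / y \<and> \<bar>U y - y * U' y\<bar> \<le> 2 * (real n - 1) / \<sigma> / y"
      using U(3)[OF y0] unfolding split by linarith
  qed (rule x)
qed

lemma trumpet_properties:
  assumes T: "is_trumpet n \<sigma> U U'" and s: "\<sigma> > 0" and n: "n \<ge> 2"
  shows "smooth_on {0..} U" "is_sol n {0..} U"
    "((\<lambda>x. U x - \<sigma> * x) \<longlongrightarrow> 0) at_top"
    "\<And>x. x \<ge> 0 \<Longrightarrow> (U has_real_derivative U' x) (at x within {0..})"
    "\<And>x. x > 0 \<Longrightarrow> U x > \<sigma> * x" "U 0 < sqrt (2 * (real n - 1))"
    "(\<lambda>x. \<bar>U x - \<sigma> * x\<bar>) \<in> O[at_top](\<lambda>x. 1 / x)" "(\<lambda>x. \<bar>U' x - \<sigma>\<bar>) \<in> O[at_top](\<lambda>x. 1 / x\<^sup>2)"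
    "\<And>x. x \<ge> 0 \<Longrightarrow> rot_mean_curv x (U x) (U' x) > 0"
    "strictly_convex_on {0..} U" "\<And>x. x \<ge> 0 \<Longrightarrow> 0 < U' x \<and> U' x < \<sigma>"
proof -
  obtain b U'' where b: "b > 0" and o: "ode_sol n {- b<..} U U' U''" and p: "\<And>x. x > - b \<Longrightarrow> U'' x > 0"
    and q: "\<And>x. x \<ge> 0 \<Longrightarrow> U' x > 0"
    and f: "\<And>x. x > 0 \<Longrightarrow> U' x < \<sigma> \<and> U x > \<sigma> * x \<and> 0 < U x - x * U' x \<and> U x - x * U' x < 2 * (real n - 1) / (\<sigma> * x) \<and>
      U x - \<sigma> * x < 2 * (real n - 1) / (\<sigma> * x) \<and> \<sigma> - U' x < 2 * (real n - 1) / (\<sigma> * x\<^sup>2)"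
    by (rule trumpet_facts[OF T s n], rule that)
  let ?c = "real n - 1"
  have c: "?c > 0" using n by simp
  have sub: "{0..} \<subseteq> {- b<..}" using b by auto
  note o0 = ode_sol_within[OF o sub] and D = ode_solD[OF o]
  show "smooth_on {0..} U" by (rule ode_sol_smooth[OF o0])
  show "is_sol n {0..} U" using o0 unfolding is_sol_def by blast
  show "(U has_real_derivative U' x) (at x within {0..})" if "x \<ge> 0" for x
    using has_field_derivative_at_within[OF D(2)] that b by simp
  show "U x > \<sigma> * x" if "x > 0" for x using f[OF that] by simp
  have U0: "U 0 > 0" "U'' 0 > 0" using D(1)[of 0] p[of 0] b by simp_all
  \<comment> \<open>At \<open>x = 0\<close> convexity reads \<open>- U 0 / 2 + ?c / U 0 > 0\<close>,
    which is the bound on \<open>U 0\<close>.\<close>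
  have "0 < ((0 * U' 0 - U 0) / 2 + ?c / U 0) * (1 + (U' 0)\<^sup>2)" using U0(2) D(4)[of 0] b by simp
  then have "0 < (0 * U' 0 - U 0) / 2 + ?c / U 0"
    by (rule zero_less_mult_pos2) (rule add_pos_nonneg, simp_all)
  then have "(U 0)\<^sup>2 < 2 * ?c" using U0(1) by (simp add: field_simps power2_eq_square)
  then show "U 0 < sqrt (2 * ?c)" using U0(1) real_less_rsqrt by blast
  have bnd: "\<bar>U x - \<sigma> * x\<bar> \<le> 2 * ?c / \<sigma> * (1 / x)" "\<bar>U' x - \<sigma>\<bar> \<le> 2 * ?c / \<sigma> * (1 / x\<^sup>2)" if "x > 0" for x
    using f[OF that] by auto
  show "(\<lambda>x. \<bar>U x - \<sigma> * x\<bar>) \<in> O[at_top](\<lambda>x. 1 / x)"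
  proof (rule bigoI[of _ "2 * ?c / \<sigma>"])
    show "\<forall>\<^sub>F x in at_top. norm \<bar>U x - \<sigma> * x\<bar> \<le> 2 * ?c / \<sigma> * norm (1 / x)"
      using eventually_gt_at_top[of 0] by eventually_elim (use bnd in auto)
  qed
  show "(\<lambda>x. \<bar>U' x - \<sigma>\<bar>) \<in> O[at_top](\<lambda>x. 1 / x\<^sup>2)"
  proof (rule bigoI[of _ "2 * ?c / \<sigma>"])
    show "\<forall>\<^sub>F x in at_top. norm \<bar>U' x - \<sigma>\<bar> \<le> 2 * ?c / \<sigma> * norm (1 / x\<^sup>2)"
      using eventually_gt_at_top[of 0] by eventually_elim (use bnd in auto)
  qed
  show "((\<lambda>x. U x - \<sigma> * x) \<longlongrightarrow> 0) at_top"
  proof (rule Lim_null_comparison)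
    show "\<forall>\<^sub>F x in at_top. norm (U x - \<sigma> * x) \<le> 2 * ?c / \<sigma> * (1 / x)"
      using eventually_gt_at_top[of 0] by eventually_elim (use bnd in auto)
    show "((\<lambda>x. 2 * ?c / \<sigma> * (1 / x)) \<longlongrightarrow> 0) at_top"
      by (intro tendsto_mult_right_zero tendsto_divide_0[OF tendsto_const] filterlim_at_top_imp_at_infinity filterlim_ident)
  qed
  show "rot_mean_curv x (U x) (U' x) > 0" if "x \<ge> 0" for x
  proof -
    have "U x - x * U' x > 0" using f[of x] that U0(1) by (cases "x = 0") auto
    moreover have "sqrt (1 + (U' x)\<^sup>2) > 0" by (simp add: add_pos_nonneg)
    ultimately show ?thesis unfolding rot_mean_curv_def by simp
  qed
  have inc: "U' x < U' y" if "- b < x" "x < y" for x y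
    by (rule deriv_strict[OF that(2) D(3)]) (use that p in auto)
  show "strictly_convex_on {0..} U" by (rule strictly_convex_onI_deriv[OF D(2) inc sub])
  show "0 < U' x \<and> U' x < \<sigma>" if "x \<ge> 0" for x
  proof -
    \<comment> \<open>The upper bound on the slope in \<open>f\<close> is for positive arguments
      only; comparing with \<open>x + 1\<close> includes \<open>x = 0\<close>.\<close>
    have "U' x < U' (x + 1)" using inc[of x "x + 1"] that b by simp
    then show ?thesis using q[OF that] f[of "x + 1"] that by simp
  qed
qed

lemma trumpet_unique:
  assumes T: "is_trumpet n \<sigma> U U'" and s: "\<sigma> > 0" and n: "n \<ge> 2"
    and v: "is_sol n {0..} v" "((\<lambda>x. v x - \<sigma> * x) \<longlongrightarrow> 0) at_top" and x: "x \<ge> 0"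
  shows "v x = U x"
proof -
  obtain v' v'' where o: "ode_sol n {0..} v v' v''" using v(1) unfolding is_sol_def by blast
  have "{0<..} \<subseteq> {0::real..}" by auto
  note o0 = ode_sol_within[OF o this]
  obtain S where S: "\<And>x. x > S \<Longrightarrow> \<bar>v x - \<sigma> * x\<bar> \<le> 1" by (rule asymptotic_bounded[OF v(2)], rule that)
  have pos: "v y = U y" if y: "y > 0" for y
  proof (rule trumpet_unique_end[OF T s n order_refl o0 _ y])
    fix z :: real assume "z > 0"
    from classification_with_slope[OF o0 order_refl n s S this]
    show "v z > \<sigma> * z \<and> 0 < v z - z * v' z \<and> v z - z * v' z < 2 * (real n - 1) / (\<sigma> * z) \<and>
      v z - \<sigma> * z < 2 * (real n - 1) / (\<sigma> * z)" by simp
  qed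
  show ?thesis
  proof (cases "x = 0")
    case True
    have dv: "(v has_real_derivative v' 0) (at 0 within {0..})" using o unfolding ode_sol_def by simp
    have dU: "(U has_real_derivative U' 0) (at 0 within {0..})" using trumpet_properties(4)[OF T s n, of 0] by simp
    have lv: "(v \<longlongrightarrow> v 0) (at 0 within {0..})" and lU: "(U \<longlongrightarrow> U 0) (at 0 within {0..})"
      using DERIV_continuous[OF dv] DERIV_continuous[OF dU] by (simp_all add: continuous_within)
    have "{0<..} \<subseteq> {0::real..}" by auto
    note l = tendsto_within_subset[OF lv this] tendsto_within_subset[OF lU this]
    have "\<forall>\<^sub>F y in at_right 0. v y = U y"
      unfolding eventually_at_filter by (intro always_eventually allI impI, rule pos) simp
    from tendsto_cong[OF this] have "(U \<longlongrightarrow> v 0) (at_right 0)" using l(1) by simp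
    from tendsto_unique[OF _ this l(2)] have "v 0 = U 0" by simp
    then show ?thesis using True by simp
  qed (use pos x in simp)
qed

lemma trumpet_curves:
  assumes T: "is_trumpet n \<sigma> U U'" and s: "\<sigma> > 0" and n: "n \<ge> 2"
  shows "\<exists>J x r th. max_geo_sol n J x r th \<and> {(s, U s) | s. s \<ge> 0} \<subseteq> (\<lambda>t. (x t, r t)) ` J"
    "\<And>J x r th. max_geo_sol n J x r th \<Longrightarrow> {(s, U s) | s. s \<ge> 0} \<subseteq> (\<lambda>t. (x t, r t)) ` J \<Longrightarrow> \<not> embedded_curve J x r"
proof -
  obtain J x r th t0 where tc: "trumpet_curve n J x r th t0"
    and pts: "\<forall>s\<ge>0. \<exists>t\<in>J. x t = - s \<and> r t = U s \<and> th t = - arctan (U' s)"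
    using T unfolding is_trumpet_def by (elim exE conjE)
  interpret trumpet_curve n J x r th t0 by (rule tc)
  have m: "max_geo_sol n {t. -1 * t + 0 \<in> J} (\<lambda>t. -1 * x (-1 * t + 0)) (\<lambda>t. r (-1 * t + 0)) (\<lambda>t. -1 * th (-1 * t + 0) + 0)"
    by (rule max_geo_transform[OF mx]) auto
  show "\<exists>J x r th. max_geo_sol n J x r th \<and> {(s, U s) | s. s \<ge> 0} \<subseteq> (\<lambda>t. (x t, r t)) ` J"
  proof (intro exI conjI)
    show "{(s, U s) | s. s \<ge> 0} \<subseteq> (\<lambda>t. (-1 * x (-1 * t + 0), r (-1 * t + 0))) ` {t. -1 * t + 0 \<in> J}"
    proof
      fix z assume "z \<in> {(s, U s) | s. s \<ge> 0}"
      then obtain q where q: "q \<ge> 0" "z = (q, U q)" by blast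
      then obtain t where "t \<in> J" "x t = - q" "r t = U q" using pts by blast
      then show "z \<in> (\<lambda>t. (-1 * x (-1 * t + 0), r (-1 * t + 0))) ` {t. -1 * t + 0 \<in> J}"
        using q(2) by (intro image_eqI[of _ _ "- t"]) auto
    qed
  qed (rule m)
  fix J' x' r' th'
  assume m': "max_geo_sol n J' x' r' th'" and sub: "{(s, U s) | s. s \<ge> 0} \<subseteq> (\<lambda>t. (x' t, r' t)) ` J'"
  show "\<not> embedded_curve J' x' r'"
  proof (rule trumpet_curve_self_intersects[OF tc _ _ m' sub])
    show "\<exists>t\<in>J. x t = - s \<and> r t = U s \<and> th t = - arctan (U' s)" if "s \<ge> 0" for s using pts that by blast
    show "(U has_real_derivative U' s) (at s)" if "s > 0" for s
      using trumpet_properties(4)[OF T _ n, of s] at_within_atLeast[OF that] \<open>\<sigma> > 0\<close> that by simp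
  qed
qed

theorem theorem1:
  fixes n :: nat
  assumes "n \<ge> 2"
  shows "\<exists>(U :: real \<Rightarrow> real \<Rightarrow> real) (U' :: real \<Rightarrow> real \<Rightarrow> real).
    (\<forall>\<sigma>>0.
       \<comment> \<open>existence: smooth solution on [0,oo), asymptotic to sigma x\<close>
       smooth_on {0..} (U \<sigma>) \<and> is_sol n {0..} (U \<sigma>) \<and>
       ((\<lambda>x. U \<sigma> x - \<sigma> * x) \<longlongrightarrow> 0) at_top \<and>
       \<comment> \<open>uniqueness\<close>
       (\<forall>v. smooth_on {0..} v \<and> is_sol n {0..} v \<and> ((\<lambda>x. v x - \<sigma> * x) \<longlongrightarrow> 0) at_top
            \<longrightarrow> (\<forall>x\<ge>0. v x = U \<sigma> x)) \<and>
       \<comment> \<open>U' sigma is the derivative of U sigma on [0,oo)\<close>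
       (\<forall>x\<ge>0. (U \<sigma> has_real_derivative U' \<sigma> x) (at x within {0..})) \<and>
       \<comment> \<open>(i)\<close>
       (\<forall>x>0. U \<sigma> x > \<sigma> * x) \<and> U \<sigma> 0 < sqrt (2 * (real n - 1)) \<and>
       \<comment> \<open>(ii)\<close>
       (\<lambda>x. \<bar>U \<sigma> x - \<sigma> * x\<bar>) \<in> O[at_top](\<lambda>x. 1 / x) \<and>
       (\<lambda>x. \<bar>U' \<sigma> x - \<sigma>\<bar>) \<in> O[at_top](\<lambda>x. 1 / x\<^sup>2) \<and>
       \<comment> \<open>(iii)\<close>
       (\<forall>x\<ge>0. rot_mean_curv x (U \<sigma> x) (U' \<sigma> x) > 0) \<and>
       \<comment> \<open>(iv)\<close>
       strictly_convex_on {0..} (U \<sigma>) \<and>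
       (\<forall>x\<ge>0. 0 < U' \<sigma> x \<and> U' \<sigma> x < \<sigma>) \<and>
       \<comment> \<open>(v)\<close>
       (\<exists>J x r th. max_geo_sol n J x r th \<and>
            {(s, U \<sigma> s) | s. s \<ge> 0} \<subseteq> (\<lambda>t. (x t, r t)) ` J) \<and>
       (\<forall>J x r th. max_geo_sol n J x r th \<and>
            {(s, U \<sigma> s) | s. s \<ge> 0} \<subseteq> (\<lambda>t. (x t, r t)) ` J
            \<longrightarrow> \<not> embedded_curve J x r))
    \<and>
    \<comment> \<open>classification of solutions on (d,oo)\<close>
    (\<forall>d>0. \<forall>u. is_sol n {d<..} u \<longrightarrow>
       (\<forall>x>d. u x = sqrt (2 * (real n - 1))) \<or>
       (\<exists>\<sigma>>0. \<forall>x>d. u x = U \<sigma> x))"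
proof -
  have "\<forall>\<sigma>. \<exists>U U'. \<sigma> > 0 \<longrightarrow> is_trumpet n \<sigma> U U'" using trumpet_exists[OF _ assms] by blast
  then obtain U U' where T: "\<And>\<sigma>. \<sigma> > 0 \<Longrightarrow> is_trumpet n \<sigma> (U \<sigma>) (U' \<sigma>)" by metis
  show ?thesis
  proof (rule exI[of _ U], rule exI[of _ U'], rule conjI; intro allI impI)
    fix \<sigma> :: real assume s: "\<sigma> > 0"
    note P = trumpet_properties[OF T[OF s] s assms] and Q = trumpet_curves[OF T[OF s] s assms]
    show "smooth_on {0..} (U \<sigma>) \<and> is_sol n {0..} (U \<sigma>) \<and>
       ((\<lambda>x. U \<sigma> x - \<sigma> * x) \<longlongrightarrow> 0) at_top \<and>
       (\<forall>v. smooth_on {0..} v \<and> is_sol n {0..} v \<and> ((\<lambda>x. v x - \<sigma> * x) \<longlongrightarrow> 0) at_top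
            \<longrightarrow> (\<forall>x\<ge>0. v x = U \<sigma> x)) \<and>
       (\<forall>x\<ge>0. (U \<sigma> has_real_derivative U' \<sigma> x) (at x within {0..})) \<and>
       (\<forall>x>0. U \<sigma> x > \<sigma> * x) \<and> U \<sigma> 0 < sqrt (2 * (real n - 1)) \<and>
       (\<lambda>x. \<bar>U \<sigma> x - \<sigma> * x\<bar>) \<in> O[at_top](\<lambda>x. 1 / x) \<and>
       (\<lambda>x. \<bar>U' \<sigma> x - \<sigma>\<bar>) \<in> O[at_top](\<lambda>x. 1 / x\<^sup>2) \<and>
       (\<forall>x\<ge>0. rot_mean_curv x (U \<sigma> x) (U' \<sigma> x) > 0) \<and>
       strictly_convex_on {0..} (U \<sigma>) \<and>
       (\<forall>x\<ge>0. 0 < U' \<sigma> x \<and> U' \<sigma> x < \<sigma>) \<and>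
       (\<exists>J x r th. max_geo_sol n J x r th \<and>
            {(s, U \<sigma> s) | s. s \<ge> 0} \<subseteq> (\<lambda>t. (x t, r t)) ` J) \<and>
       (\<forall>J x r th. max_geo_sol n J x r th \<and>
            {(s, U \<sigma> s) | s. s \<ge> 0} \<subseteq> (\<lambda>t. (x t, r t)) ` J
            \<longrightarrow> \<not> embedded_curve J x r)"
    proof (rule conjI, rule P(1), rule conjI, rule P(2), rule conjI, rule P(3), rule conjI)
      show "\<forall>v. smooth_on {0..} v \<and> is_sol n {0..} v \<and> ((\<lambda>x. v x - \<sigma> * x) \<longlongrightarrow> 0) at_top
            \<longrightarrow> (\<forall>x\<ge>0. v x = U \<sigma> x)"
        using trumpet_unique[OF T[OF s] s assms] by (intro allI impI, elim conjE)
    qed (intro conjI allI impI P(4-) Q(1); (assumption | (elim conjE, rule Q(2)); assumption))+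
  next
    fix d :: real and u assume d: "d > 0" and "is_sol n {d<..} u"
    then obtain u' u'' where o: "ode_sol n {d<..} u u' u''" unfolding is_sol_def by blast
    have d0: "d \<ge> 0" using d by simp
    show "(\<forall>x>d. u x = sqrt (2 * (real n - 1))) \<or> (\<exists>\<sigma>>0. \<forall>x>d. u x = U \<sigma> x)"
    proof (rule graph_classification[OF o d0 assms])
      fix \<sigma> assume s: "\<sigma> > 0" and p: "\<And>\<xi>. \<xi> > d \<Longrightarrow> u' \<xi> > 0 \<and> u'' \<xi> > 0 \<and> u' \<xi> < \<sigma> \<and> u \<xi> > \<sigma> * \<xi> \<and>
        0 < u \<xi> - \<xi> * u' \<xi> \<and> u \<xi> - \<xi> * u' \<xi> < 2 * (real n - 1) / (\<sigma> * \<xi>) \<and>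
        u \<xi> - \<sigma> * \<xi> < 2 * (real n - 1) / (\<sigma> * \<xi>) \<and> \<sigma> - u' \<xi> < 2 * (real n - 1) / (\<sigma> * \<xi>\<^sup>2)"
      have "u x = U \<sigma> x" if x: "x > d" for x
        by (rule trumpet_unique_end[OF T[OF s] s assms d0 o _ x]) (use p in simp)
      then show ?thesis using s by blast
    qed simp
  qed
qed

end
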